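(* Let $\mathfrak g$ be of nonexceptional affine type, i.e. one of $A^{(1)}_n$ $(n\ge1)$, $B^{(1)}_n$ $(n\ge3)$, $C^{(1)}_n$ $(n\ge2)$, $D^{(1)}_n$ $(n\ge4)$, $A^{(2)}_{2n}$ $(n\ge1)$, $A^{(2)\dagger}_{2n}$ $(n\ge1)$, $A^{(2)}_{2n-1}$ $(n\ge2)$, $D^{(2)}_{n+1}$ $(n\ge2)$. Let $L\ge0$ be an integer and $\lambda$ a dominant weight. Let $\overline X(\lambda,L;q)=\sum_{b\in\mathcal P(\lambda,L)}q^{\overline D(b)}$ be the one-dimensional sum over classically restricted paths of weight $\lambda$ in $(B^{1,1})^{\otimes L}$, and let $\overline M(\lambda,L;q)$ be the corresponding fermionic formula (both defined in the context). Then $$\overline X(\lambda,L;q)=\overline M(\lambda,L;q).$$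
   Context: **Weights.** Weights are vectors in $\mathbb Z^n$ (in $\mathbb Z^{n+1}$ for $A^{(1)}_n$) with standard basis $\epsilon_i$. $\lambda$ is dominant if: type $A^{(1)}_n$: $\lambda_1\ge\dots\ge\lambda_{n+1}\ge0$; type $D^{(1)}_n$: $\lambda_1\ge\dots\ge\lambda_n$ and $\lambda_{n-1}+\lambda_n\ge0$; all other types: $\lambda_1\ge\dots\ge\lambda_n\ge0$. **Crystals $B=B^{1,1}$.** A coloured graph with colours $0,1,\dots,n$; $x\xrightarrow{i}y$ means $\tilde f_i x=y$, $\tilde e_i y=x$; otherwise $\tilde e_i,\tilde f_i$ are undefined. - $A^{(1)}_n$: elements $1,\dots,n+1$; $k\xrightarrow{k}k+1$ $(1\le k\le n)$, $n+1\xrightarrow{0}1$. - All other types contain the elements $k,\overline k$ $(1\le k\le n)$ and arrows $k\xrightarrow{k}k+1$, $\overline{k+1}\xrightarrow{k}\overline k$ $(1\le k\le n-1)$, and additionally: - colour $n$: for $C^{(1)}_n,A^{(2)}_{2n},A^{(2)}_{2n-1}$: $n\xrightarrow{n}\overline n$; for $B^{(1)}_n,A^{(2)\dagger}_{2n},D^{(2)}_{n+1}$: an extra element $0$ and $n\xrightarrow{n}0\xrightarrow{n}\overline n$; for $D^{(1)}_n$: $n-1\xrightarrow{n}\overline n$, $n\xrightarrow{n}\overline{n-1}$. - colour $0$: for $B^{(1)}_n,D^{(1)}_n,A^{(2)}_{2n-1}$: $\overline2\xrightarrow{0}1$, $\overline1\xrightarrow{0}2$; for $C^{(1)}_n,A^{(2)\dagger}_{2n}$: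 $\overline1\xrightarrow{0}1$; for $A^{(2)}_{2n},D^{(2)}_{n+1}$: an extra element $\phi$ and $\overline1\xrightarrow{0}\phi\xrightarrow{0}1$. $\mathrm{wt}(k)=\epsilon_k$, $\mathrm{wt}(\overline k)=-\epsilon_k$, $\mathrm{wt}(0)=\mathrm{wt}(\phi)=0$, additive on tensor products. $\varepsilon_i(b)=\max\{k:\tilde e_i^kb\text{ defined}\}$, $\varphi_i(b)=\max\{k:\tilde f_i^kb\text{ defined}\}$. On tensor products: $\tilde e_i(b_1\otimes b_2)=\tilde e_ib_1\otimes b_2$ if $\varepsilon_i(b_1)>\varphi_i(b_2)$, else $b_1\otimes\tilde e_ib_2$; $\tilde f_i(b_1\otimes b_2)=\tilde f_ib_1\otimes b_2$ if $\varepsilon_i(b_1)\ge\varphi_i(b_2)$, else $b_1\otimes\tilde f_ib_2$ (undefined if the factor is undefined). $\mathcal P(\lambda,L)$ is the set of $b=b_L\otimes\cdots\otimes b_1\in B^{\otimes L}$ with $\mathrm{wt}(b)=\lambda$ and $\tilde e_ib$ undefined for all $i\in\{1,\dots,n\}$. **Energy.** $H:B\otimes B\to\mathbb Z$ is the unique function with $H(1\otimes1)=0$ such that, whenever $\tilde e_i(b\otimes b')$ is defined, $H(\tilde e_i(b\otimes b'))=H(b\otimes b')$ if $i\ne0$, $=H(b\otimes b')-1$ if $i=0$ and $\tilde e_0$ acts on the left factor $b$, and $=H(b\otimes b')+1$ if $i=0$ and $\tilde e_0$ acts on the right factor $b'$. Let $b^\natural\in B$ be the unique element with $\varphi_0(b^\natural)=1$,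 $\varphi_i(b^\natural)=0$ for $i\neq0$. Put $E(b_L\otimes\cdots\otimes b_1)=L\,H(b_1\otimes b^\natural)+\sum_{j=1}^{L-1}(L-j)H(b_{j+1}\otimes b_j)$ ($E=0$ if $L=0$), $D(b)=E(b)-E(1\otimes\cdots\otimes1)$, and $\overline D=-D$. **Configurations.** Let $\upsilon_n=2$ for $C^{(1)}_n$, $\upsilon_n=\frac12$ for $B^{(1)}_n$, and $\upsilon_a=1$ in all other cases. $\nu^\bullet=(\nu^{(1)},\dots,\nu^{(n)})$, where $\nu^{(a)}$ is a finite multiset of "parts" from $\upsilon_a\mathbb Z_{>0}$; $m_i^{(a)}$ is the multiplicity of $i$ in $\nu^{(a)}$; $|\nu^{(a)}|$ is the sum of the parts; $Q_i(\tau)=\sum_j\min(\tau_j,i)$. Put $\nu^{(0)}=(1^L)$ ($L$ parts equal to 1). $\nu^\bullet$ is a $\lambda$-configuration if, with $S_a=\lambda_1+\cdots+\lambda_a$: - $A^{(1)}_n,C^{(1)}_n,A^{(2)}_{2n},A^{(2)\dagger}_{2n},D^{(2)}_{n+1}$: $|\nu^{(a)}|=L-S_a$ for $1\le a\le n$ (and $|\lambda|=L$ in type $A^{(1)}_n$); - $B^{(1)}_n,A^{(2)}_{2n-1}$: $|\nu^{(a)}|=L-S_a$ for $a<n$, $|\nu^{(n)}|=\frac12(L-S_n)$; - $D^{(1)}_n$: $|\nu^{(a)}|=L-S_a$ for $a\le n-2$, $|\nu^{(n-1)}|=\frac12(L-S_{n-1}+\lambda_n)$, $|\nu^{(n)}|=\frac12(L-S_n)$.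 Vacancy numbers $P_i^{(a)}$, $i\in\upsilon_a\mathbb Z_{>0}$: $P_i^{(a)}=Q_i(\nu^{(a-1)})-2Q_i(\nu^{(a)})+Q_i(\nu^{(a+1)})$ except in the following cases: - $A^{(1)}_n$: $P^{(n)}_i=Q_i(\nu^{(n-1)})-2Q_i(\nu^{(n)})$; - $D^{(1)}_n$: $P^{(n-2)}_i=Q_i(\nu^{(n-3)})-2Q_i(\nu^{(n-2)})+Q_i(\nu^{(n-1)})+Q_i(\nu^{(n)})$, $P^{(a)}_i=Q_i(\nu^{(n-2)})-2Q_i(\nu^{(a)})$ for $a=n-1,n$; - $B^{(1)}_n$: $P^{(n-1)}_i=Q_i(\nu^{(n-2)})-2Q_i(\nu^{(n-1)})+2Q_i(\nu^{(n)})$, $P^{(n)}_i=2Q_i(\nu^{(n-1)})-4Q_i(\nu^{(n)})$; - $C^{(1)}_n,A^{(2)}_{2n},A^{(2)\dagger}_{2n}$: $P^{(n)}_i=Q_i(\nu^{(n-1)})-Q_i(\nu^{(n)})$; - $A^{(2)}_{2n-1}$: $P^{(n-1)}_i=Q_i(\nu^{(n-2)})-2Q_i(\nu^{(n-1)})+2Q_i(\nu^{(n)})$, $P^{(n)}_i=Q_i(\nu^{(n-1)})-2Q_i(\nu^{(n)})$; - $D^{(2)}_{n+1}$: $P^{(n)}_i=2Q_i(\nu^{(n-1)})-2Q_i(\nu^{(n)})$. Let $$cc(\nu)=\tfrac12\sum_{a,b=1}^n\sum_{j,k\ge1}(\alpha_a|\alpha_b)\min(t_bj,t_ak)\,m^{(a)}_{\upsilon_aj}\,m^{(b)}_{\upsilon_bk}.$$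 Here $\alpha_a=\epsilon_a-\epsilon_{a+1}$ for $a<n$ (also $a=n$ for $A^{(1)}_n$); $\alpha_n=\epsilon_n$ for $B^{(1)}_n,A^{(2)}_{2n},A^{(2)\dagger}_{2n},D^{(2)}_{n+1}$; $\alpha_n=2\epsilon_n$ for $C^{(1)}_n,A^{(2)}_{2n-1}$; $\alpha_n=\epsilon_{n-1}+\epsilon_n$ for $D^{(1)}_n$; $(\epsilon_i|\epsilon_j)=c\,\delta_{ij}$ with $c=\frac12$ for $C^{(1)}_n$, $c=2$ for $A^{(2)}_{2n},D^{(2)}_{n+1}$, $c=1$ otherwise. $t_a=1$ except $t_n=2$ for $B^{(1)}_n$ and $t_a=2$ $(a<n)$ for $C^{(1)}_n$. $t_a^\vee=1$ except: $t_a^\vee=2$ for all $a$ for $A^{(2)}_{2n}$; $t_n^\vee=2$ for $A^{(2)}_{2n-1}$; $t_a^\vee=2$ for $a<n$ for $D^{(2)}_{n+1}$. **Fermionic formula.** For $\mathfrak g\ne A^{(2)\dagger}_{2n}$, let $C(\lambda,L)$ be the set of $\lambda$-configurations with $P_i^{(a)}\ge0$ for all $1\le a\le n$, $i\in\upsilon_a\mathbb Z_{>0}$, and $$\overline M(\lambda,L;q)=\sum_{\nu^\bullet\in C(\lambda,L)}q^{cc(\nu)}\prod_{a=1}^n\prod_{i\in\upsilon_a\mathbb Z_{>0}}\begin{bmatrix} P_i^{(a)}+m_i^{(a)} \\ m_i^{(a)} \end{bmatrix}_{q^{t_a^\vee}},$$ where $\begin{bmatrix} p+m \\ m \end{bmatrix}_q=\frac{(q)_{p+m}}{(q)_p(q)_m}$,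 $(q)_m=\prod_{k=1}^m(1-q^k)$. For $\mathfrak g=A^{(2)\dagger}_{2n}$, $\overline M(\lambda,L;q)=\sum_{(\nu^\bullet,J^\bullet)}q^{cc(\nu)+\sum_{a,i}|J^{(a,i)}|}$, the sum over pairs in which $\nu^\bullet$ is a $\lambda$-configuration with all $P_i^{(a)}\ge0$ and with $P_i^{(n)}\ge1$ whenever $i$ is odd and $m_i^{(n)}>0$, and $J^{(a,i)}$ is a multiset of exactly $m_i^{(a)}$ numbers in $[0,P_i^{(a)}]$ which are integers if $a\ne n$ or $i$ is even, and elements of $\frac12+\mathbb Z$ if $a=n$ and $i$ is odd; $|J^{(a,i)}|$ is the sum of its elements. *)

theory Defs
  imports Complex_Main "HOL-Library.FuncSet" "HOL-Library.Multiset" "HOL-Library.Poly_Mapping"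
begin

text \<open>
  The type \<open>A1\<close> with rank \<open>n\<close> stands for \<open>A\<^sup>(\<^sup>1\<^sup>)\<^sub>n\<close>, and likewise \<open>B1\<close>, \<open>C1\<close>, \<open>D1\<close>;
  \<open>A2_even\<close> is \<open>A\<^sup>(\<^sup>2\<^sup>)\<close> with index \<open>2n\<close>, \<open>A2_dagger\<close> its dagger version,
  \<open>A2_odd\<close> is \<open>A\<^sup>(\<^sup>2\<^sup>)\<close> with index \<open>2n - 1\<close>, and \<open>D2\<close> is \<open>D\<^sup>(\<^sup>2\<^sup>)\<close> with index \<open>n + 1\<close>.
\<close>
datatype aff_type = A1 | B1 | C1 | D1 | A2_even | A2_dagger | A2_odd | D2

definition nonexceptional :: "aff_type \<Rightarrow> nat \<Rightarrow> bool" where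
  "nonexceptional ty n \<longleftrightarrow>
     (case ty of A1 \<Rightarrow> n \<ge> 1 | B1 \<Rightarrow> n \<ge> 3 | C1 \<Rightarrow> n \<ge> 2 | D1 \<Rightarrow> n \<ge> 4
       | A2_even \<Rightarrow> n \<ge> 1 | A2_dagger \<Rightarrow> n \<ge> 1 | A2_odd \<Rightarrow> n \<ge> 2 | D2 \<Rightarrow> n \<ge> 2)"


section \<open>Weights\<close>

text \<open>
  A vector of \<open>\<int>\<^sup>N\<close>, with \<open>N = wt_dim ty n\<close>, is a function on \<open>nat\<close> that vanishes outside \<open>{1..N}\<close>.
\<close>
definition wt_dim :: "aff_type \<Rightarrow> nat \<Rightarrow> nat" where
  "wt_dim ty n = (if ty = A1 then n + 1 else n)"

definition weights :: "aff_type \<Rightarrow> nat \<Rightarrow> (nat \<Rightarrow> int) set" where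
  "weights ty n = {lam. \<forall>i. i \<notin> {1..wt_dim ty n} \<longrightarrow> lam i = 0}"

definition eps :: "nat \<Rightarrow> nat \<Rightarrow> 'a::zero_neq_one" where
  "eps k = (\<lambda>i. if i = k then 1 else 0)"

definition dominant :: "aff_type \<Rightarrow> nat \<Rightarrow> (nat \<Rightarrow> int) \<Rightarrow> bool" where
  "dominant ty n lam \<longleftrightarrow> lam \<in> weights ty n \<and>
     (\<forall>i\<in>{1..<wt_dim ty n}. lam i \<ge> lam (i + 1)) \<and>
     (if ty = D1 then lam (n - 1) + lam n \<ge> 0 else lam (wt_dim ty n) \<ge> 0)"


section \<open>Crystals\<close>

text \<open>The value \<open>None\<close> of a crystal operator means ``undefined''.\<close>
record 'b crystal =
  elts :: "'b set"
  eop :: "nat \<Rightarrow> 'b \<Rightarrow> 'b option"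
  fop :: "nat \<Rightarrow> 'b \<Rightarrow> 'b option"
  wt :: "'b \<Rightarrow> nat \<Rightarrow> int"

definition string_length :: "('b \<Rightarrow> 'b option) \<Rightarrow> 'b \<Rightarrow> nat" where
  "string_length g b = Max {k. ((\<lambda>x. Option.bind x g) ^^ k) (Some b) \<noteq> None}"

definition varepsilon :: "'b crystal \<Rightarrow> nat \<Rightarrow> 'b \<Rightarrow> nat" where
  "varepsilon C i = string_length (eop C i)"

definition varphi :: "'b crystal \<Rightarrow> nat \<Rightarrow> 'b \<Rightarrow> nat" where
  "varphi C i = string_length (fop C i)"

definition tensor :: "'a crystal \<Rightarrow> 'b crystal \<Rightarrow> ('a \<times> 'b) crystal" where
  "tensor C D =
    \<lparr> elts = elts C \<times> elts D,
      eop = (\<lambda>i (x, y). if varepsilon C i x > varphi D i y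
                        then map_option (\<lambda>x'. (x', y)) (eop C i x)
                        else map_option (\<lambda>y'. (x, y')) (eop D i y)),
      fop = (\<lambda>i (x, y). if varepsilon C i x \<ge> varphi D i y
                        then map_option (\<lambda>x'. (x', y)) (fop C i x)
                        else map_option (\<lambda>y'. (x, y')) (fop D i y)),
      wt = (\<lambda>(x, y) k. wt C x k + wt D y k) \<rparr>"

text \<open>
  The element \<open>b\<^sub>L \<otimes> \<dots> \<otimes> b\<^sub>1\<close> of the \<open>L\<close>-th tensor power is the list \<open>[b\<^sub>L, \<dots>, b\<^sub>1]\<close>;
  it is bracketed to the right, which is immaterial as the tensor product is associative.
\<close>
primrec tensor_power :: "'b crystal \<Rightarrow> nat \<Rightarrow> 'b list crystal" where
  "tensor_power C 0 =
    \<lparr> elts = {[]}, eop = (\<lambda>i b. None), fop = (\<lambda>i b. None), wt = (\<lambda>b k. 0) \<rparr>"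
| "tensor_power C (Suc L) =
    (let T = tensor C (tensor_power C L); cons = (\<lambda>(x, xs). x # xs) in
     \<lparr> elts = cons ` elts T,
       eop = (\<lambda>i b. case b of [] \<Rightarrow> None | x # xs \<Rightarrow> map_option cons (eop T i (x, xs))),
       fop = (\<lambda>i b. case b of [] \<Rightarrow> None | x # xs \<Rightarrow> map_option cons (fop T i (x, xs))),
       wt = (\<lambda>b. case b of [] \<Rightarrow> (\<lambda>k. 0) | x # xs \<Rightarrow> wt T (x, xs)) \<rparr>)"


subsection \<open>The crystal \<open>B\<^sup>1\<^sup>,\<^sup>1\<close>\<close>

text \<open>\<open>Bar k\<close> is the barred letter, \<open>Zero\<close> and \<open>Phi\<close> are the extra elements \<open>0\<close> and \<open>\<phi>\<close>.\<close>
datatype letter = Ltr nat | Bar nat | Zero | Phi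

definition letters :: "aff_type \<Rightarrow> nat \<Rightarrow> letter set" where
  "letters ty n =
    (if ty = A1 then Ltr ` {1..n + 1}
     else Ltr ` {1..n} \<union> Bar ` {1..n}
       \<union> (if ty \<in> {B1, A2_dagger, D2} then {Zero} else {})
       \<union> (if ty \<in> {A2_even, D2} then {Phi} else {}))"

definition colour_n_arrows :: "aff_type \<Rightarrow> nat \<Rightarrow> (letter \<times> nat \<times> letter) set" where
  "colour_n_arrows ty n =
    (if ty \<in> {C1, A2_even, A2_odd} then {(Ltr n, n, Bar n)}
     else if ty \<in> {B1, A2_dagger, D2} then {(Ltr n, n, Zero), (Zero, n, Bar n)}
     else {(Ltr (n - 1), n, Bar n), (Ltr n, n, Bar (n - 1))})"

definition colour_0_arrows :: "aff_type \<Rightarrow> (letter \<times> nat \<times> letter) set" where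
  "colour_0_arrows ty =
    (if ty \<in> {B1, D1, A2_odd} then {(Bar 2, 0, Ltr 1), (Bar 1, 0, Ltr 2)}
     else if ty \<in> {C1, A2_dagger} then {(Bar 1, 0, Ltr 1)}
     else {(Bar 1, 0, Phi), (Phi, 0, Ltr 1)})"

text \<open>\<open>(x, i, y)\<close> is an arrow of colour \<open>i\<close> from \<open>x\<close> to \<open>y\<close>.\<close>
definition arrows :: "aff_type \<Rightarrow> nat \<Rightarrow> (letter \<times> nat \<times> letter) set" where
  "arrows ty n =
    (if ty = A1
     then {(Ltr k, k, Ltr (k + 1)) | k. 1 \<le> k \<and> k \<le> n} \<union> {(Ltr (n + 1), 0, Ltr 1)}
     else {(Ltr k, k, Ltr (k + 1)) | k. 1 \<le> k \<and> k < n}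
       \<union> {(Bar (k + 1), k, Bar k) | k. 1 \<le> k \<and> k < n}
       \<union> colour_n_arrows ty n \<union> colour_0_arrows ty)"

primrec letter_wt :: "letter \<Rightarrow> nat \<Rightarrow> int" where
  "letter_wt (Ltr k) = eps k"
| "letter_wt (Bar k) = (\<lambda>i. - eps k i)"
| "letter_wt Zero = (\<lambda>i. 0)"
| "letter_wt Phi = (\<lambda>i. 0)"

definition B11 :: "aff_type \<Rightarrow> nat \<Rightarrow> letter crystal" where
  "B11 ty n =
    \<lparr> elts = letters ty n,
      eop = (\<lambda>i y. if \<exists>x. (x, i, y) \<in> arrows ty n
                   then Some (THE x. (x, i, y) \<in> arrows ty n) else None),
      fop = (\<lambda>i x. if \<exists>y. (x, i, y) \<in> arrows ty n
                   then Some (THE y. (x, i, y) \<in> arrows ty n) else None),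
      wt = letter_wt \<rparr>"

definition paths :: "aff_type \<Rightarrow> nat \<Rightarrow> (nat \<Rightarrow> int) \<Rightarrow> nat \<Rightarrow> letter list set" where
  "paths ty n lam L =
    {b \<in> elts (tensor_power (B11 ty n) L).
       wt (tensor_power (B11 ty n) L) b = lam \<and>
       (\<forall>i\<in>{1..n}. eop (tensor_power (B11 ty n) L) i b = None)}"


section \<open>Energy\<close>

text \<open>
  The condition \<open>H \<in> extensional \<dots>\<close> fixes the values of \<open>H\<close> outside of \<open>B \<otimes> B\<close>, so that \<open>H\<close> is unique
  as a function on the whole type.
\<close>
definition is_local_energy :: "aff_type \<Rightarrow> nat \<Rightarrow> (letter \<times> letter \<Rightarrow> int) \<Rightarrow> bool" where
  "is_local_energy ty n H \<longleftrightarrow>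
    (let B = B11 ty n in
      H \<in> extensional (elts (tensor B B)) \<and>
      H (Ltr 1, Ltr 1) = 0 \<and>
      (\<forall>i\<in>{0..n}. \<forall>(b, b') \<in> elts (tensor B B). \<forall>c.
         eop (tensor B B) i (b, b') = Some c \<longrightarrow>
         H c = (if i \<noteq> 0 then H (b, b')
                else if varepsilon B 0 b > varphi B 0 b' then H (b, b') - 1
                else H (b, b') + 1)))"

definition local_energy :: "aff_type \<Rightarrow> nat \<Rightarrow> letter \<times> letter \<Rightarrow> int" where
  "local_energy ty n = (THE H. is_local_energy ty n H)"

definition b_natural :: "aff_type \<Rightarrow> nat \<Rightarrow> letter" where
  "b_natural ty n =
    (THE b. b \<in> elts (B11 ty n) \<and>
       (\<forall>i\<in>{0..n}. varphi (B11 ty n) i b = (if i = 0 then 1 else 0)))"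

text \<open>Since \<open>b = [b\<^sub>L, \<dots>, b\<^sub>1]\<close>, the factor \<open>b\<^sub>j\<close> is the list entry with index \<open>L - j\<close>.\<close>
definition energy :: "aff_type \<Rightarrow> nat \<Rightarrow> letter list \<Rightarrow> int" where
  "energy ty n b =
    (let L = length b; H = local_energy ty n; fac = (\<lambda>j. b ! (L - j)) in
     if L = 0 then 0
     else int L * H (fac 1, b_natural ty n)
          + (\<Sum>j = 1..L - 1. int (L - j) * H (fac (j + 1), fac j)))"

definition D_energy :: "aff_type \<Rightarrow> nat \<Rightarrow> letter list \<Rightarrow> int" where
  "D_energy ty n b = energy ty n b - energy ty n (replicate (length b) (Ltr 1))"

definition D_bar :: "aff_type \<Rightarrow> nat \<Rightarrow> letter list \<Rightarrow> int" where
  "D_bar ty n b = - D_energy ty n b"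


section \<open>Laurent polynomials with rational exponents\<close>

text \<open>
  Both sides of the identity live in the ring of formal integer combinations of the powers \<open>q\<^sup>r\<close>,
  \<open>r\<close> rational: the exponents on the fermionic side are a priori only half-integers.
\<close>
type_synonym qpoly = "rat \<Rightarrow>\<^sub>0 int"

definition qpow :: "rat \<Rightarrow> qpoly" where
  "qpow r = Poly_Mapping.single r 1"

definition qpoch :: "qpoly \<Rightarrow> nat \<Rightarrow> qpoly" where
  "qpoch q m = (\<Prod>k = 1..m. (1 - q ^ k))"

text \<open>The exact quotient of \<open>(q)\<^bsub>p+m\<^esub>\<close> by \<open>(q)\<^bsub>p\<^esub> (q)\<^bsub>m\<^esub>\<close>, with \<open>q\<close> replaced by the first argument.\<close>
definition qbinom :: "qpoly \<Rightarrow> nat \<Rightarrow> nat \<Rightarrow> qpoly" where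
  "qbinom q p m = (THE x. x * (qpoch q p * qpoch q m) = qpoch q (p + m))"

definition Xbar :: "aff_type \<Rightarrow> nat \<Rightarrow> (nat \<Rightarrow> int) \<Rightarrow> nat \<Rightarrow> qpoly" where
  "Xbar ty n lam L = (\<Sum>b\<in>paths ty n lam L. qpow (of_int (D_bar ty n b)))"


section \<open>Configurations\<close>

definition upsilon :: "aff_type \<Rightarrow> nat \<Rightarrow> nat \<Rightarrow> rat" where
  "upsilon ty n a = (if ty = C1 \<and> a = n then 2 else if ty = B1 \<and> a = n then 1/2 else 1)"

definition part_sizes :: "aff_type \<Rightarrow> nat \<Rightarrow> nat \<Rightarrow> rat set" where
  "part_sizes ty n a = {upsilon ty n a * of_nat k | k. k \<ge> 1}"

definition partial_wt :: "(nat \<Rightarrow> int) \<Rightarrow> nat \<Rightarrow> int" where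
  "partial_wt lam a = (\<Sum>i = 1..a. lam i)"

definition config_size :: "aff_type \<Rightarrow> nat \<Rightarrow> (nat \<Rightarrow> int) \<Rightarrow> nat \<Rightarrow> nat \<Rightarrow> rat" where
  "config_size ty n lam L a =
    (if ty \<in> {B1, A2_odd, D1} \<and> a = n
     then of_int (int L - partial_wt lam n) / 2
     else if ty = D1 \<and> a = n - 1
     then of_int (int L - partial_wt lam (n - 1) + lam n) / 2
     else of_int (int L - partial_wt lam a))"

text \<open>
  A tuple \<open>(\<nu>\<^sup>(\<^sup>1\<^sup>), \<dots>, \<nu>\<^sup>(\<^sup>n\<^sup>))\<close> is a function on \<open>nat\<close>, extended by \<open>\<nu>\<^sup>(\<^sup>0\<^sup>) = (1\<^sup>L)\<close> and by the empty
  multiset beyond \<open>n\<close>.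
\<close>
definition is_config ::
  "aff_type \<Rightarrow> nat \<Rightarrow> (nat \<Rightarrow> int) \<Rightarrow> nat \<Rightarrow> (nat \<Rightarrow> rat multiset) \<Rightarrow> bool" where
  "is_config ty n lam L nu \<longleftrightarrow>
     nu 0 = replicate_mset L 1 \<and> (\<forall>a>n. nu a = {#}) \<and>
     (\<forall>a\<in>{1..n}. set_mset (nu a) \<subseteq> part_sizes ty n a
                 \<and> sum_mset (nu a) = config_size ty n lam L a) \<and>
     (ty = A1 \<longrightarrow> partial_wt lam (n + 1) = int L)"

definition Qsum :: "rat \<Rightarrow> rat multiset \<Rightarrow> rat" where
  "Qsum i tau = (\<Sum>x\<in>#tau. min x i)"

definition vacancy :: "aff_type \<Rightarrow> nat \<Rightarrow> (nat \<Rightarrow> rat multiset) \<Rightarrow> nat \<Rightarrow> rat \<Rightarrow> rat" where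
  "vacancy ty n nu a i =
    (let Q = (\<lambda>b. Qsum i (nu b)) in
     if ty = A1 \<and> a = n then Q (n - 1) - 2 * Q n
     else if ty = D1 \<and> a = n - 2 then Q (n - 3) - 2 * Q (n - 2) + Q (n - 1) + Q n
     else if ty = D1 \<and> a \<in> {n - 1, n} then Q (n - 2) - 2 * Q a
     else if ty = B1 \<and> a = n - 1 then Q (n - 2) - 2 * Q (n - 1) + 2 * Q n
     else if ty = B1 \<and> a = n then 2 * Q (n - 1) - 4 * Q n
     else if ty \<in> {C1, A2_even, A2_dagger} \<and> a = n then Q (n - 1) - Q n
     else if ty = A2_odd \<and> a = n - 1 then Q (n - 2) - 2 * Q (n - 1) + 2 * Q n
     else if ty = A2_odd \<and> a = n then Q (n - 1) - 2 * Q n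
     else if ty = D2 \<and> a = n then 2 * Q (n - 1) - 2 * Q n
     else Q (a - 1) - 2 * Q a + Q (a + 1))"

definition simple_root :: "aff_type \<Rightarrow> nat \<Rightarrow> nat \<Rightarrow> nat \<Rightarrow> rat" where
  "simple_root ty n a =
    (if a < n \<or> ty = A1 then (\<lambda>i. eps a i - eps (a + 1) i)
     else if ty \<in> {B1, A2_even, A2_dagger, D2} then eps n
     else if ty \<in> {C1, A2_odd} then (\<lambda>i. 2 * eps n i)
     else (\<lambda>i. eps (n - 1) i + eps n i))"

definition wt_form :: "aff_type \<Rightarrow> nat \<Rightarrow> (nat \<Rightarrow> rat) \<Rightarrow> (nat \<Rightarrow> rat) \<Rightarrow> rat" where
  "wt_form ty n u v =
    (if ty = C1 then 1/2 else if ty \<in> {A2_even, D2} then 2 else 1)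
      * (\<Sum>i = 1..wt_dim ty n. u i * v i)"

definition tt :: "aff_type \<Rightarrow> nat \<Rightarrow> nat \<Rightarrow> rat" where
  "tt ty n a = (if (ty = B1 \<and> a = n) \<or> (ty = C1 \<and> a < n) then 2 else 1)"

definition tt_vee :: "aff_type \<Rightarrow> nat \<Rightarrow> nat \<Rightarrow> rat" where
  "tt_vee ty n a =
    (if ty = A2_even \<or> (ty = A2_odd \<and> a = n) \<or> (ty = D2 \<and> a < n) then 2 else 1)"

text \<open>
  The sums over \<open>j, k \<ge> 1\<close> are restricted to the part sizes \<open>x = \<upsilon>\<^sub>a j\<close> and \<open>y = \<upsilon>\<^sub>b k\<close> that occur;
  all other summands vanish.
\<close>
definition cocharge :: "aff_type \<Rightarrow> nat \<Rightarrow> (nat \<Rightarrow> rat multiset) \<Rightarrow> rat" where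
  "cocharge ty n nu =
    1/2 * (\<Sum>a = 1..n. \<Sum>b = 1..n. \<Sum>x\<in>set_mset (nu a). \<Sum>y\<in>set_mset (nu b).
      wt_form ty n (simple_root ty n a) (simple_root ty n b)
      * min (tt ty n b * (x / upsilon ty n a)) (tt ty n a * (y / upsilon ty n b))
      * of_nat (count (nu a) x) * of_nat (count (nu b) y))"


section \<open>Fermionic formula\<close>

definition admissible_configs ::
  "aff_type \<Rightarrow> nat \<Rightarrow> (nat \<Rightarrow> int) \<Rightarrow> nat \<Rightarrow> (nat \<Rightarrow> rat multiset) set" where
  "admissible_configs ty n lam L =
    {nu. is_config ty n lam L nu \<and>
         (\<forall>a\<in>{1..n}. \<forall>i\<in>part_sizes ty n a. vacancy ty n nu a i \<ge> 0)}"

text \<open>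
  The vacancy numbers of configurations at the admissible indices are integers, so \<open>floor\<close> is only a
  coercion. The factors for sizes \<open>i\<close> that do not occur in \<open>nu a\<close> are equal to \<open>1\<close> and are left out.
\<close>
definition Mbar_generic :: "aff_type \<Rightarrow> nat \<Rightarrow> (nat \<Rightarrow> int) \<Rightarrow> nat \<Rightarrow> qpoly" where
  "Mbar_generic ty n lam L =
    (\<Sum>nu\<in>admissible_configs ty n lam L.
       qpow (cocharge ty n nu) *
       (\<Prod>a = 1..n. \<Prod>i\<in>set_mset (nu a).
          qbinom (qpow (tt_vee ty n a)) (nat \<lfloor>vacancy ty n nu a i\<rfloor>) (count (nu a) i)))"

definition odd_rat :: "rat \<Rightarrow> bool" where
  "odd_rat i \<longleftrightarrow> (\<exists>k::int. odd k \<and> i = of_int k)"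

text \<open>
  Pairs of a configuration and a family \<open>J\<close> of multisets indexed by \<open>a \<in> {1..n}\<close> and \<open>i\<close>.
  The family is empty at all other indices: for \<open>a \<in> {1..n}\<close> and \<open>i\<close> not an admissible size this
  follows from \<open>size (J a i) = count (nu a) i\<close>.
\<close>
definition dagger_rigged_configs ::
  "nat \<Rightarrow> (nat \<Rightarrow> int) \<Rightarrow> nat \<Rightarrow> ((nat \<Rightarrow> rat multiset) \<times> (nat \<Rightarrow> rat \<Rightarrow> rat multiset)) set" where
  "dagger_rigged_configs n lam L =
    {(nu, J). nu \<in> admissible_configs A2_dagger n lam L \<and>
       (\<forall>i\<in>part_sizes A2_dagger n n. odd_rat i \<and> count (nu n) i > 0
          \<longrightarrow> vacancy A2_dagger n nu n i \<ge> 1) \<and>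
       (\<forall>a\<in>{1..n}. \<forall>i. size (J a i) = count (nu a) i \<and>
          (\<forall>x\<in>#J a i. 0 \<le> x \<and> x \<le> vacancy A2_dagger n nu a i \<and>
             (if a = n \<and> odd_rat i then x - 1/2 \<in> \<int> else x \<in> \<int>))) \<and>
       (\<forall>a. a \<notin> {1..n} \<longrightarrow> (\<forall>i. J a i = {#}))}"

definition Mbar_dagger :: "nat \<Rightarrow> (nat \<Rightarrow> int) \<Rightarrow> nat \<Rightarrow> qpoly" where
  "Mbar_dagger n lam L =
    (\<Sum>(nu, J)\<in>dagger_rigged_configs n lam L.
       qpow (cocharge A2_dagger n nu + (\<Sum>a = 1..n. \<Sum>i\<in>set_mset (nu a). sum_mset (J a i))))"

definition Mbar :: "aff_type \<Rightarrow> nat \<Rightarrow> (nat \<Rightarrow> int) \<Rightarrow> nat \<Rightarrow> qpoly" where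
  "Mbar ty n lam L =
    (if ty = A2_dagger then Mbar_dagger n lam L else Mbar_generic ty n lam L)"

end

theory Submission
 imports Defs
begin

text \<open>
 One letter of a path is removed at a time, as in the bijection of Kerov, Kirillov and Reshetikhin. The letters of \<open>B\<^sup>1\<^sup>,\<^sup>1\<close>
 are the elements of a finite lattice \<open>S\<close> of weights of a minuscule representation, and the algorithm is a walk in \<open>S\<close>:
 at length \<open>t\<close> it moves up to the largest element that is reached with the singular parts of length \<open>t\<close> (riggings are colabels, so
 that the singular ones are zero). The inverse algorithm walks down, and a step up and a step down are adjoint maps of \<open>S\<close>. Hence
 the number of parts of the first colour changes by the local energy of the removed letter and the next one,
 while the cocharge changes by the number of these parts.

 This proves the theorem for \<open>A\<^sup>(\<^sup>1\<^sup>)\<^sub>n\<close>, \<open>D\<^sup>(\<^sup>1\<^sup>)\<^sub>n\<close> and \<open>A\<^sup>(\<^sup>2\<^sup>)\<close> with odd index. The other types are foldings, in which a letter is removed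
 by two walks: \<open>B\<^sup>(\<^sup>1\<^sup>)\<^sub>n\<close> consists of the rigged configurations for \<open>A\<^sup>(\<^sup>2\<^sup>)\<close> with odd index, \<open>2L\<close> boxes and even parts and riggings,
 and the remaining types consist of the symmetric rigged configurations of type \<open>A\<close> with \<open>2n - 1\<close> colours, with parity conditions
 in the middle colour.
\<close>

section \<open>Walkers on minuscule crystals\<close>

text \<open>Two obstacles shape the proof. A walk lowers vacancy numbers, and that none becomes
  negative has to come from convexity: a vanishing vacancy number spreads to the neighbouring
  length, downwards for the removal of a letter, where the start of the walk stops it, and upwards
  for the inverse, where dominance does. In the folded types each single walk destroys the symmetry
  or parity condition, so the configuration between the two walks lies outside the class. Both
  positions are therefore followed together, and only their joint effect on the multiplicities of
  the riggings is shown to respect the conditions. Equal final positions are the letters k and bar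
  k; the other final states are the letters 0 and phi, and the conditions on the middle colour
  decide which of them occur. The energy enters through a recursion alone: adding a letter to a path
  changes \<open>D_bar\<close> by an unweighted sum of local energies, and the number of parts of
  the first colour, suitably normalized, satisfies the same recursion.\<close>

text \<open>\<open>J a t\<close> consists of the riggings of the parts of length \<open>t\<close> in the partition of colour \<open>a\<close>.\<close>
type_synonym riggings = "nat => nat => int multiset"

text \<open>
 The element \<open>u\<close> of \<open>S\<close> stands for the weight \<open>\<Lambda> - \<Sum>\<^sub>a u\<^sub>a \<alpha>\<^sub>a\<close>, where \<open>\<Lambda>\<close> is the fundamental weight of colour \<open>a0\<close>;
 \<open>A\<close> is the Cartan matrix and \<open>d\<close> symmetrizes it.
\<close>
locale walker =
 fixes C :: "nat set" and A :: "nat => nat => int" and d :: "nat => int"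
  and a0 :: nat and S :: "(nat => nat) set"
 assumes finite_C: "finite C" and a0_in_C: "a0\<in>C" and finite_S: "finite S"
  and S_support: "!!u a. u\<in>S ==> a\<notin>C ==> u a = 0"
  and zero_in_S: "(%_. 0)\<in>S"
  and sup_in_S: "!!u v. u\<in>S ==> v\<in>S ==> sup u v\<in>S"
  and saturated: "!!u v. u\<in>S ==> v\<in>S ==> u<=v ==> u ~= v
          ==> \<exists>a. u(a := Suc (u a))\<in>S & u a < v a"
  and inf_in_S: "!!u v. u\<in>S ==> v\<in>S ==> inf u v\<in>S"
  and A_diag: "!!a. a\<in>C ==> A a a = 2"
  and A_off: "!!a b. a\<in>C ==> b\<in>C ==> a ~= b ==> A a b<=0"
  and symmetrized: "!!a b. a\<in>C ==> b\<in>C ==> d a * A a b = d b * A b a"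
  and minuscule: "!!u a. u\<in>S ==> a\<in>C ==>
   of_bool (a = a0) - (\<Sum>b\<in>C. A a b * int (u b))
    = of_bool (u(a := Suc (u a))\<in>S) - of_bool (u a > 0 & u(a := u a - 1)\<in>S)"
  and exclusive: "!!u a. u\<in>S ==> u(a := Suc (u a))\<in>S ==> u a > 0 ==> u(a := u a - 1)\<notin>S"
begin

text \<open>As \<open>u\<close> counts the simple roots subtracted from \<Lambda>, going up in
  \<open>S\<close> is going down in weight: \<open>up a u\<close> says that the lowering operator of
  colour \<open>a\<close> acts, and \<open>dn a u\<close> that the raising operator does.\<close>

definition up :: "nat => (nat => nat) => bool" where
 "up a u \<longleftrightarrow> u(a := Suc (u a))\<in>S"

definition dn :: "nat => (nat => nat) => bool" where
 "dn a u \<longleftrightarrow> u a > 0 & u(a := u a - 1)\<in>S"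

text \<open>The value of the coroot of colour \<open>a\<close> on the weight of \<open>u\<close>.
  Minuscule weights confine it to -1, 0, 1, so that it tells \<open>up\<close> from
  \<open>dn\<close>.\<close>

definition h :: "nat => (nat => nat) => int" where
 "h a u = of_bool (a = a0) - (\<Sum>b\<in>C. A a b * int (u b))"

lemma up_in_C: "up a u ==> a\<in>C"
 using S_support[of "u(a := Suc (u a))" a] by (auto simp: up_def)

lemma dn_in_C: "u\<in>S ==> dn a u ==> a\<in>C"
 using S_support[of u a] by (auto simp: dn_def)

lemma h_eq: "u\<in>S ==> a\<in>C ==> h a u = of_bool (up a u) - of_bool (dn a u)"
 using minuscule by (simp add: h_def up_def dn_def)

lemma not_up_dn: "u\<in>S ==> up a u ==> ~ dn a u"
 using exclusive by (auto simp: up_def dn_def)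

lemma h_zero: "h a (%_. 0) = of_bool (a = a0)"
 by (simp add: h_def)

lemma h_ge: "u\<in>S ==> a\<in>C ==> h a u >= -1" and h_le: "u\<in>S ==> a\<in>C ==> h a u<=1"
 by (auto simp: h_eq)

lemma h_pos: "u\<in>S ==> a\<in>C ==> h a u > 0 ==> up a u"
 and h_neg: "u\<in>S ==> a\<in>C ==> h a u < 0 ==> dn a u"
 by (auto simp: h_eq split: if_splits)

text \<open>The order dual of \<open>saturated\<close>: an element of the interval that is maximal
  among those different from \<open>v\<close> has a step up inside the interval, and this step can
  only arrive at \<open>v\<close>.\<close>

lemma saturated_dn:
 assumes "u\<in>S" "v\<in>S" "u<=v" "u ~= v"
 shows "\<exists>a. v a > u a & v(a := v a - 1)\<in>S"
proof -
 let ?X = "{w\<in>S. u<=w & w<=v & w ~= v}"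
 have "finite ?X" "u\<in>?X" using finite_S assms by auto
 then obtain w where w: "w\<in>?X" "!!z. z\<in>?X ==> w<=z ==> w = z"
  using finite_has_maximal[of ?X] by auto
 then obtain a where a: "w(a := Suc (w a))\<in>S" "w a < v a"
  using saturated[of w v] assms by auto
 have "w(a := Suc (w a)) = v"
 proof (rule ccontr)
  assume *: "w(a := Suc (w a)) ~= v"
  have "w<=w(a := Suc (w a))" by (auto simp: le_fun_def)
  moreover from this have "u<=w(a := Suc (w a))" using w(1) by (auto intro: order_trans)
  moreover have "w(a := Suc (w a))<=v" using w(1) a(2) by (auto simp: le_fun_def)
  ultimately have "w = w(a := Suc (w a))" using w(2) a(1) * by blast
  then have "w a = Suc (w a)" by (metis fun_upd_same)
  then show False by simp
 qed
 then have v: "v = w(a := Suc (w a))" by simp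
 then have "v(a := v a - 1) = w" by auto
 moreover have "u a<=w a" using w(1) by (auto simp: le_fun_def)
 ultimately show ?thesis using w(1) a(2) by (intro exI[of _ a]) auto
qed

lemma S_induct [consumes 1, case_names zero step]:
 assumes "u\<in>S" and "P (%_. 0)"
  and step: "!!v a. v\<in>S ==> up a v ==> P v ==> P (v(a := Suc (v a)))"
 shows "P u"
 using assms(1)
proof (induction "\<Sum>a\<in>C. u a" arbitrary: u rule: less_induct)
 case less
 show ?case
 proof (cases "u = (%_. 0)")
  case True
  then show ?thesis using assms(2) by simp
 next
  case False
  then obtain a where a: "u a > 0" "u(a := u a - 1)\<in>S"
   using saturated_dn[OF zero_in_S less.prems] by (auto simp: le_fun_def)
  let ?v = "u(a := u a - 1)"
  have aC: "a\<in>C" using a(1) S_support[OF less.prems] by fastforce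
  have "(\<Sum>b\<in>C. ?v b) < (\<Sum>b\<in>C. u b)"
   using a(1) aC finite_C by (intro sum_strict_mono_ex1) auto
  then have "P ?v" using less a(2) by blast
  then have "P (?v(a := Suc (?v a)))"
   using step[of ?v a] a less.prems by (auto simp: up_def)
  then show ?thesis using a(1) by simp
 qed
qed

text \<open>The weights of a minuscule representation form one Weyl orbit, so \<Lambda> - \<beta>
  has the norm of \<Lambda>, which means (\<beta>|\<beta>) = 2 (\<Lambda>|\<beta>). The orbit is
  replaced by an induction in which \<open>h c v = 1\<close> before each step up. The identity
  removes the boundary term in \<open>st_act\<close>.\<close>

lemma norm_S:
 assumes "u\<in>S"
 shows "(\<Sum>a\<in>C. \<Sum>b\<in>C. d a * A a b * int (u a) * int (u b)) = 2 * d a0 * int (u a0)"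
 using assms
proof (induction rule: S_induct)
 case zero
 then show ?case by simp
next
 case (step v c)
 have c: "c\<in>C" using step up_in_C by blast
 have hc: "h c v = 1" using h_eq[OF step(1) c] step not_up_dn by auto
 let ?e = "%a. of_bool (a = c) :: int"
 have upd: "int ((v(c := Suc (v c))) a) = int (v a) + ?e a" for a by auto
 have "(\<Sum>a\<in>C. \<Sum>b\<in>C. d a * A a b * int ((v(c := Suc (v c))) a) * int ((v(c := Suc (v c))) b))
  = (\<Sum>a\<in>C. \<Sum>b\<in>C. d a * A a b * int (v a) * int (v b))
   + (\<Sum>a\<in>C. \<Sum>b\<in>C. d a * A a b * ?e a * int (v b))
   + (\<Sum>a\<in>C. \<Sum>b\<in>C. d a * A a b * int (v a) * ?e b)
   + (\<Sum>a\<in>C. \<Sum>b\<in>C. d a * A a b * ?e a * ?e b)"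
  unfolding upd by (simp add: algebra_simps sum.distrib)
 also have "(\<Sum>a\<in>C. \<Sum>b\<in>C. d a * A a b * int (v a) * ?e b)
   = (\<Sum>a\<in>C. \<Sum>b\<in>C. d a * A a b * ?e a * int (v b))"
  by (subst sum.swap) (intro sum.cong refl, simp add: symmetrized)
 also have "(\<Sum>a\<in>C. \<Sum>b\<in>C. d a * A a b * ?e a * int (v b)) = (\<Sum>b\<in>C. d c * A c b * int (v b))"
  by (subst sum.remove[OF finite_C c]) simp
 also have "... = d c * (\<Sum>b\<in>C. A c b * int (v b))" by (simp add: sum_distrib_left mult.assoc)
 also have "(\<Sum>b\<in>C. A c b * int (v b)) = of_bool (c = a0) - 1" using hc by (simp add: h_def)
 also have "(\<Sum>a\<in>C. \<Sum>b\<in>C. d a * A a b * ?e a * ?e b) = 2 * d c"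
  by (subst sum.remove[OF finite_C c], simp, subst sum.remove[OF finite_C c]) (simp add: A_diag c)
 finally show ?case using step.IH by (auto simp: algebra_simps)
qed

text \<open>Maximality is demanded colour by colour only. This is the form that can be checked on
  riggings: at a colour that could still go up, all available parts have been used. Saturation makes
  it global, see \<open>fstep_greatest\<close>.\<close>

definition fstep :: "(nat => nat) => (nat => nat) => (nat => nat) => bool" where
 "fstep \<sigma> u v \<longleftrightarrow> v\<in>S & u<=v & (\<forall>a. v a<=u a + \<sigma> a) & (\<forall>a. up a v --> v a = u a + \<sigma> a)"

definition rstep :: "(nat => nat) => (nat => nat) => (nat => nat) => bool" where
 "rstep \<sigma> v u \<longleftrightarrow> u\<in>S & u<=v & (\<forall>a. v a<=u a + \<sigma> a) & (\<forall>a. dn a u --> v a = u a + \<sigma> a)"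

text \<open>If \<open>w\<close> were not below \<open>v\<close>, saturation would give a step up
  from \<open>v\<close> towards \<open>sup v w\<close>, at a colour where local maximality says that
  the bound is already attained.\<close>

lemma fstep_greatest:
 assumes "fstep \<sigma> u v" "w\<in>S" "!!a. w a<=u a + \<sigma> a"
 shows "w<=v"
proof (rule ccontr)
 assume *: "~ w<=v"
 have "v\<in>S" using assms by (simp add: fstep_def)
 moreover have "sup v w\<in>S" using assms sup_in_S by (simp add: fstep_def)
 moreover have "v ~= sup v w" using * by (metis sup_ge2)
 ultimately obtain a where a: "up a v" "v a < sup v w a"
  using saturated[of v "sup v w"] by (auto simp: up_def)
 then have "v a = u a + \<sigma> a" using assms(1) by (simp add: fstep_def)
 then show False using a(2) assms(3)[of a] by (simp add: sup_max)
qed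

lemma rstep_least:
 assumes "rstep \<sigma> v u" "w\<in>S" "!!a. v a<=w a + \<sigma> a"
 shows "u<=w"
proof (rule ccontr)
 assume *: "~ u<=w"
 have "u\<in>S" using assms by (simp add: rstep_def)
 moreover have "inf u w\<in>S" using assms inf_in_S by (simp add: rstep_def)
 moreover have "inf u w ~= u" using * by (metis inf_le2)
 ultimately obtain a where a: "u a > inf u w a" "u(a := u a - 1)\<in>S"
  using saturated_dn[of "inf u w" u] by auto
 then have "dn a u" by (simp add: dn_def)
 then have "v a = u a + \<sigma> a" using assms(1) by (simp add: rstep_def)
 then show False using a(1) assms(3)[of a] by (simp add: inf_min)
qed

lemma fstep_exists:
 assumes "u\<in>S"
 shows "\<exists>v. fstep \<sigma> u v"
proof -
 let ?X = "{w\<in>S. u<=w & (\<forall>a. w a<=u a + \<sigma> a)}"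
 have "finite ?X" "u\<in>?X" using finite_S assms by auto
 then have "\<exists>w\<in>?X. \<forall>z\<in>?X. w<=z --> w = z" by (intro finite_has_maximal) blast+
 then obtain w where w: "w\<in>?X" "!!z. z\<in>?X ==> w<=z ==> w = z" by blast
 have "w a = u a + \<sigma> a" if "up a w" for a
 proof (rule ccontr)
  assume "w a ~= u a + \<sigma> a"
  moreover have "w a<=u a + \<sigma> a" using w(1) by auto
  ultimately have lt: "w a < u a + \<sigma> a" by simp
  have le: "w<=w(a := Suc (w a))" by (auto simp: le_fun_def)
  have "w(a := Suc (w a))\<in>?X"
   using w(1) le lt that by (auto simp: up_def intro: order_trans)
  then have "w = w(a := Suc (w a))" using w(2) le by blast
  then show False by (metis fun_upd_same n_not_Suc_n)
 qed
 then show ?thesis using w(1) by (auto simp: fstep_def)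
qed

lemma rstep_exists:
 assumes "v\<in>S"
 shows "\<exists>u. rstep \<sigma> v u"
proof -
 let ?X = "{w\<in>S. w<=v & (\<forall>a. v a<=w a + \<sigma> a)}"
 have "finite ?X" "v\<in>?X" using finite_S assms by auto
 then have "\<exists>w\<in>?X. \<forall>z\<in>?X. z<=w --> w = z" by (intro finite_has_minimal) blast+
 then obtain w where w: "w\<in>?X" "!!z. z\<in>?X ==> z<=w ==> w = z" by blast
 have "v a = w a + \<sigma> a" if "dn a w" for a
 proof (rule ccontr)
  assume "v a ~= w a + \<sigma> a"
  moreover have "v a<=w a + \<sigma> a" using w(1) by auto
  ultimately have lt: "v a < w a + \<sigma> a" by simp
  have le: "w(a := w a - 1)<=w" by (auto simp: le_fun_def)
  have "w(a := w a - 1)\<in>?X"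
   using w(1) le lt that by (auto simp: dn_def intro: order_trans)
  then have "w = w(a := w a - 1)" using w(2) le by blast
  then have "w a = w a - 1" by (metis fun_upd_same)
  then show False using that unfolding dn_def by linarith
 qed
 then show ?thesis using w(1) by (auto simp: rstep_def)
qed

lemma fstep_unique: "fstep \<sigma> u v ==> fstep \<sigma> u w ==> v = w"
 by (intro antisym fstep_greatest) (auto simp: fstep_def)

lemma rstep_unique: "rstep \<sigma> v u ==> rstep \<sigma> v w ==> u = w"
 by (intro antisym rstep_least) (auto simp: rstep_def)

text \<open>Because of this adjunction the walks compute the energy function, see \<open>walk_energy\<close> below.\<close>
lemma step_adjoint:
 assumes "fstep \<sigma> u u'" "rstep \<sigma> p p'" "u\<in>S" "p\<in>S"
 shows "p<=u' \<longleftrightarrow> p'<=u"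
proof
 assume "p<=u'"
 moreover have "u' a<=u a + \<sigma> a" for a using assms by (simp add: fstep_def)
 ultimately show "p'<=u" using rstep_least[OF assms(2,3)] by (meson le_fun_def order_trans)
next
 assume *: "p'<=u"
 have "p a<=u a + \<sigma> a" for a
 proof -
  have "p a<=p' a + \<sigma> a" using assms by (simp add: rstep_def)
  also have "p' a<=u a" using * by (simp add: le_fun_def)
  finally show ?thesis by simp
 qed
 then show "p<=u'" using fstep_greatest[OF assms(1,4)] by blast
qed

end

section \<open>Box counts and their second differences\<close>

definition Qn :: "nat => (nat => int) => nat => int" where
 "Qn T m t = (\<Sum>s=1..T. int (min s t) * m s)"

definition m_of :: "riggings => nat => nat => int" where
 "m_of J a t = int (size (J a t))"

lemma Qn_0 [simp]: "Qn T m 0 = 0"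
 by (simp add: Qn_def)

lemma Qn_add: "Qn T (%s. f s + g s) t = Qn T f t + Qn T g t"
 by (simp add: Qn_def algebra_simps sum.distrib)

lemma Qn_second_difference:
 assumes "1<=t" "!!s. s > T ==> m s = 0"
 shows "Qn T m (t + 1) + Qn T m (t - 1) - 2 * Qn T m t = - m t"
proof -
 have "Qn T m (t + 1) + Qn T m (t - 1) - 2 * Qn T m t
  = (\<Sum>s=1..T. (int (min s (t + 1)) + int (min s (t - 1)) - 2 * int (min s t)) * m s)"
  by (simp add: Qn_def algebra_simps sum.distrib sum_subtractf sum_distrib_left)
 also have "... = (\<Sum>s=1..T. if s = t then - m t else 0)"
  using assms(1) by (intro sum.cong) (auto simp: min_def)
 also have "... = - m t" using assms by (auto simp: sum.delta)
 finally show ?thesis .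
qed

text \<open>The kernel \<open>min s t\<close> is the Green function of the discrete Laplacian with
  value zero at 0 and slope zero at \<open>T\<close>; this inverts
  \<open>Qn_second_difference\<close>.\<close>

lemma Qn_of_second_difference:
 assumes "f 0 = 0" "f (Suc T) = f T" "t<=T"
 shows "Qn T (%s. f (s + 1) + f (s - 1) - 2 * f s) t = - f t"
proof -
 \<comment> \<open>The sum is followed for every truncation \<open>k\<close>, where the slope at
   \<open>k\<close> is still present; \<open>f (Suc T) = f T\<close> removes it at
   \<open>k = T\<close>.\<close>
 have "Qn k (%s. f (s + 1) + f (s - 1) - 2 * f s) t
   = (if t<=k then int t * (f (k + 1) - f k) - f t
    else int k * (f (k + 1) - f k) - f k)" for k
 proof (induction k)
  case 0
  then show ?case using assms(1) by (simp add: Qn_def)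
 next
  case (Suc k)
  have "Qn (Suc k) (%s. f (s + 1) + f (s - 1) - 2 * f s) t
   = Qn k (%s. f (s + 1) + f (s - 1) - 2 * f s) t
    + int (min (Suc k) t) * (f (k + 2) + f k - 2 * f (k + 1))"
   by (simp add: Qn_def)
  also note Suc
  finally have eq: "Qn (Suc k) (%s. f (s + 1) + f (s - 1) - 2 * f s) t
   = (if t<=k then int t * (f (k + 1) - f k) - f t else int k * (f (k + 1) - f k) - f k)
    + int (min (Suc k) t) * (f (k + 2) + f k - 2 * f (k + 1))" .
  consider "t<=k" | "t = Suc k" | "t > Suc k" by linarith
  then show ?case
  proof cases
   case 1
   then show ?thesis unfolding eq by (simp add: algebra_simps)
  next
   case 2
   then show ?thesis unfolding eq by (simp add: algebra_simps)
  next
   case 3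
   then show ?thesis unfolding eq by (simp add: algebra_simps)
  qed
 qed
 then show ?thesis using assms(2,3) by simp
qed

lemma sum_Qn_commute:
 "(\<Sum>t=1..T. f t * Qn T g t) = (\<Sum>t=1..T. g t * Qn T f t)"
proof -
 have "(\<Sum>t=1..T. f t * Qn T g t) = (\<Sum>t=1..T. \<Sum>s=1..T. f t * int (min s t) * g s)"
  by (simp add: Qn_def sum_distrib_left mult.assoc)
 also have "... = (\<Sum>s=1..T. \<Sum>t=1..T. f t * int (min s t) * g s)" by (rule sum.swap)
 also have "... = (\<Sum>s=1..T. g s * Qn T f s)"
  by (simp add: Qn_def sum_distrib_left mult_ac min.commute)
 finally show ?thesis .
qed

lemma Qn_at_top: "Qn T m T = (\<Sum>s=1..T. int s * m s)"
 by (auto simp: Qn_def intro!: sum.cong)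

lemma Qn_beyond: "t>=T ==> Qn T m t = Qn T m T"
 by (auto simp: Qn_def intro!: sum.cong)

section \<open>Rigged configurations, walks through them, and the removal of a letter\<close>

locale rc = walker +
 fixes T :: nat
 assumes T_pos: "T>=1"
begin

text \<open>The vacancy number for \<open>Z a\<close> one-box factors of colour \<open>a\<close>.
  The value 0 at \<open>t = 0\<close> lets the second difference at \<open>t = 1\<close> see the
  term \<open>Z a\<close>.\<close>

definition vac :: "(nat => int) => riggings => nat => nat => int" where
 "vac Z J a t = Z a * of_bool (t>=1) - (\<Sum>b\<in>C. A a b * Qn T (m_of J b) t)"

definition supported :: "riggings => bool" where
 "supported J \<longleftrightarrow> (\<forall>a t. a\<notin>C | t < 1 | t > T --> J a t = {#})"

text \<open>The sizes \<open>N\<close> are rational because the prescribed sizes may be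
  half-integers, in which case the set is empty. Vacancy numbers have to be nonnegative at every
  length, also where there is no part.\<close>

definition RC :: "(nat => int) => (nat => rat) => riggings set" where
 "RC Z N = {J. supported J & (\<forall>a\<in>C. of_int (Qn T (m_of J a) T) = N a) &
  (\<forall>a\<in>C. \<forall>t. 0<=vac Z J a t & (\<forall>x\<in>#J a t. 0<=x & x<=vac Z J a t))}"

definition zc :: "riggings => nat => nat => nat" where
 "zc J t a = count (J a t) 0"

definition fwalk :: "riggings => (nat => nat => nat) => bool" where
 "fwalk J u \<longleftrightarrow> u 0 = (%_. 0) & (\<forall>t. fstep (zc J (Suc t)) (u t) (u (Suc t)))"

text \<open>The value \<open>v 0 = 0\<close> is outside the recursion: the jump from
  \<open>v 0\<close> to \<open>v 1\<close> counts the parts of length 1 that are created from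
  nothing.\<close>

definition rwalk :: "riggings => (nat => nat) => (nat => nat => nat) => bool" where
 "rwalk J x v \<longleftrightarrow> v 0 = (%_. 0) & x\<in>S & (\<forall>t\<ge>T. v t = x) &
  (\<forall>t\<ge>1. rstep (zc J t) (v (Suc t)) (v t))"

text \<open>A selected part of length \<open>t + 1\<close> returns as a singular part of length
  \<open>t\<close>, and one of length 1 disappears. The other colabels move by the same amount as
  the vacancy number (\<open>vac_change\<close>), so that the usual labels, vacancy number minus
  colabel, stay fixed.\<close>

definition act :: "(nat => nat => nat) => riggings => riggings" where
 "act u J a t = (if t = 0 then {#} else
  image_mset (%x. x - h a (u t)) (J a t - replicate_mset (u t a - u (t - 1) a) 0)
   + replicate_mset (u (Suc t) a - u t a) 0)"

definition unact :: "(nat => nat => nat) => riggings => riggings" where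
 "unact u J a t = (if t = 0 then {#} else
  image_mset (%x. x + h a (u t)) (J a t - replicate_mset (u (Suc t) a - u t a) 0)
   + replicate_mset (u t a - u (t - 1) a) 0)"

lemma fwalk_exists: "\<exists>u. fwalk J u"
proof -
 define u where "u = rec_nat (%_. 0) (%t w. SOME v. fstep (zc J (Suc t)) w v)"
 have "u t\<in>S & fstep (zc J (Suc t)) (u t) (u (Suc t))" for t
 proof (induction t)
  case 0
  show ?case using zero_in_S someI_ex[OF fstep_exists[of "u 0" "zc J (Suc 0)"]]
   by (simp add: u_def)
 next
  case (Suc t)
  then have "u (Suc t)\<in>S" by (simp add: fstep_def)
  then show ?case using someI_ex[OF fstep_exists[of "u (Suc t)" "zc J (Suc (Suc t))"]]
   by (simp add: u_def)
 qed
 then show ?thesis unfolding fwalk_def by (auto simp: u_def intro!: exI[of _ u])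
qed

lemma fwalk_unique:
 assumes "fwalk J u" "fwalk J v"
 shows "u = v"
proof
 fix t show "u t = v t"
  using assms by (induction t) (auto simp: fwalk_def intro: fstep_unique)
qed

lemma fwalk_in_S: "fwalk J u ==> u t\<in>S"
 by (cases t) (auto simp: fwalk_def fstep_def zero_in_S)

lemma fwalk_mono: "fwalk J u ==> u t<=u (Suc t)"
 by (auto simp: fwalk_def fstep_def)

lemma fwalk_stationary:
 assumes "fwalk J u" "supported J" "t>=T"
 shows "u t = u T"
 using assms(3)
proof (induction t rule: dec_induct)
 case (step t)
 then have "zc J (Suc t) = (%_. 0)" using assms(2) by (auto simp: supported_def zc_def)
 then have "u (Suc t)<=u t" "u t<=u (Suc t)"
  using assms(1) unfolding fwalk_def fstep_def le_fun_def by (metis add.right_neutral, blast)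
 then show ?case using step by simp
qed simp

lemma rwalk_in_S: "rwalk J x v ==> v t\<in>S"
 by (cases "t = 0") (auto simp: rwalk_def rstep_def zero_in_S)

lemma rwalk_mono: "rwalk J x v ==> v t<=v (Suc t)"
 by (cases "t = 0") (auto simp: rwalk_def rstep_def le_fun_def)

lemma rwalk_exists:
 assumes "x\<in>S" "supported J" "!!a. J a T = {#}"
 shows "\<exists>v. rwalk J x v"
proof -
 \<comment> \<open>The recursion runs downwards from \<open>T\<close>: index \<open>k\<close> of
   \<open>w\<close> belongs to length \<open>T - k\<close>.\<close>
 define w where "w = rec_nat x (%k y. SOME z. rstep (zc J (T - Suc k)) y z)"
 have w: "w k\<in>S & rstep (zc J (T - Suc k)) (w k) (w (Suc k))" for k
 proof (induction k)
  case 0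
  show ?case using assms(1) someI_ex[OF rstep_exists[of "w 0" "zc J (T - Suc 0)"]]
   by (simp add: w_def)
 next
  case (Suc k)
  then have "w (Suc k)\<in>S" by (simp add: rstep_def)
  then show ?case using someI_ex[OF rstep_exists[of "w (Suc k)" "zc J (T - Suc (Suc k))"]]
   by (simp add: w_def)
 qed
 define v where "v t = (if t = 0 then (%_. 0) else w (T - t))" for t
 have "rstep (zc J t) (v (Suc t)) (v t)" if "t>=1" for t
 proof (cases "t < T")
  case True
  then have "T - Suc (T - Suc t) = t" "Suc (T - Suc t) = T - t" by auto
  then show ?thesis using w[of "T - Suc t"] that by (simp add: v_def)
 next
  case False
  then have "zc J t = (%_. 0)" using assms(2,3)
   by (cases "t = T") (auto simp: supported_def zc_def)
  then show ?thesis using False assms(1) that by (simp add: v_def rstep_def w_def)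
 qed
 then have "rwalk J x v" using T_pos assms(1) by (auto simp: rwalk_def v_def w_def)
 then show ?thesis by blast
qed

lemma rwalk_unique:
 assumes "rwalk J x u" "rwalk J x v"
 shows "u = v"
proof
 have "u (T - k) = v (T - k)" for k
 proof (induction k)
  case 0
  then show ?case using assms by (simp add: rwalk_def)
 next
  case (Suc k)
  show ?case
  proof (cases "T - Suc k = 0")
   case True
   then show ?thesis using assms by (simp add: rwalk_def)
  next
   case False
   then have "Suc (T - Suc k) = T - k" by simp
   then show ?thesis using assms Suc False rstep_unique unfolding rwalk_def
    by (metis One_nat_def Suc_leI bot_nat_0.not_eq_extremum)
  qed
 qed
 then have *: "t<=T ==> u t = v t" for t by (metis diff_diff_cancel)
 show "u t = v t" for t
  using * assms by (cases "t<=T") (auto simp: rwalk_def)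
qed

text \<open>By \<open>step_adjoint\<close> the comparison of \<open>v (Suc t)\<close> with
  \<open>u t\<close> has the same outcome for all \<open>t\<close>. At \<open>T\<close> it compares
  \<open>x\<close> with the end of the forward walk, and at 0 it compares \<open>v 1\<close> with
  zero.\<close>

lemma walk_adjoint:
 assumes "fwalk J u" "rwalk J x v"
 shows "x<=u T \<longleftrightarrow> v 1 = (%_. 0)"
proof -
 have "v (Suc t)<=u t \<longleftrightarrow> v 1<=u 0" for t
 proof (induction t)
  case (Suc t)
  have "v (Suc (Suc t))<=u (Suc t) \<longleftrightarrow> v (Suc t)<=u t"
   using assms fwalk_in_S[OF assms(1)] rwalk_in_S[OF assms(2)]
   by (intro step_adjoint[of "zc J (Suc t)"]) (auto simp: fwalk_def rwalk_def)
  then show ?case using Suc by simp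
 qed simp
 from this[of T] show ?thesis using assms
  by (auto simp: fwalk_def rwalk_def le_fun_def fun_eq_iff)
qed

definition steps_ok :: "(nat => nat => nat) => bool" where
 "steps_ok u \<longleftrightarrow> u 0 = (%_. 0) & (\<forall>t. u t\<in>S) & (\<forall>t. u t<=u (Suc t)) & (\<forall>t\<ge>T. u t = u T)"

lemma fwalk_steps_ok: "fwalk J u ==> supported J ==> steps_ok u"
 unfolding steps_ok_def using fwalk_in_S fwalk_mono fwalk_stationary
 by (metis fwalk_def)

lemma rwalk_steps_ok: "rwalk J x u ==> steps_ok u"
 unfolding steps_ok_def using rwalk_in_S rwalk_mono by (metis order_refl rwalk_def)

lemma RC_D:
 assumes "J\<in>RC Z N"
 shows "supported J" "a\<in>C ==> of_int (Qn T (m_of J a) T) = N a"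
  "a\<in>C ==> 0<=vac Z J a t" "a\<in>C ==> x \<in># J a t ==> 0<=x"
  "a\<in>C ==> x \<in># J a t ==> x<=vac Z J a t"
 using assms unfolding RC_def by blast+

lemma supported_C: "supported J ==> x \<in># J a t ==> a\<in>C"
 unfolding supported_def by (metis empty_iff set_mset_empty)

lemma steps_ok_mono: "steps_ok u ==> u (t - 1) a<=u t a" "steps_ok u ==> u t a<=u (Suc t) a"
 unfolding steps_ok_def le_fun_def by (cases t; simp) simp

lemma m_of_supported: "supported J ==> a\<notin>C | t < 1 | t > T ==> m_of J a t = 0"
 by (simp add: supported_def m_of_def)

text \<open>One part of length \<open>T\<close> alone would have \<open>T\<close> boxes. Hence a
  reverse walk can be started at length \<open>T\<close> with nothing to select there.\<close>

lemma top_empty: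
 assumes "J\<in>RC Z N" "!!a. a\<in>C ==> N a < of_nat T"
 shows "J a T = {#}"
proof (rule ccontr)
 assume ne: "J a T ~= {#}"
 then have a: "a\<in>C" using RC_D(1)[OF assms(1)] by (auto simp: supported_def)
 have "1 * int T<=m_of J a T * int T"
  using ne by (intro mult_right_mono) (auto simp: m_of_def Suc_le_eq nonempty_has_size)
 also have "m_of J a T * int T<=(\<Sum>s=1..T. int s * m_of J a s)"
  using T_pos by (subst mult.commute, intro member_le_sum) (auto simp: m_of_def)
 also have "... = Qn T (m_of J a) T" by (simp add: Qn_at_top)
 finally have "of_nat T<=(of_int (Qn T (m_of J a) T) :: rat)" by linarith
 then show False using assms(2)[OF a] RC_D(2)[OF assms(1) a] by simp
qed

lemma m_act:
 assumes "steps_ok u" "!!a. u t a - u (t - 1) a<=zc J t a" "t>=1"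
 shows "m_of (act u J) a t = m_of J a t + (int (u (t + 1) a) + int (u (t - 1) a) - 2 * int (u t a))"
proof -
 have "replicate_mset (u t a - u (t - 1) a) 0 \<subseteq># J a t"
  using assms(2)[of a] by (simp add: zc_def count_le_replicate_mset_subset_eq)
 moreover have "u (t - 1) a<=u t a" "u t a<=u (Suc t) a"
  using steps_ok_mono[OF assms(1)] by auto
 moreover have "size (replicate_mset (u t a - u (t - 1) a) (0::int))<=size (J a t)"
  using calculation(1) size_mset_mono by blast
 ultimately show ?thesis using assms(3)
  by (simp add: m_of_def act_def size_Diff_submset of_nat_diff)
qed

lemma m_unact:
 assumes "steps_ok u" "!!a. u (Suc t) a - u t a<=zc J t a" "t>=1"
 shows "m_of (unact u J) a t = m_of J a t - (int (u (t + 1) a) + int (u (t - 1) a) - 2 * int (u t a))"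
proof -
 have "replicate_mset (u (Suc t) a - u t a) 0 \<subseteq># J a t"
  using assms(2)[of a] by (simp add: zc_def count_le_replicate_mset_subset_eq)
 moreover have "u (t - 1) a<=u t a" "u t a<=u (Suc t) a"
  using steps_ok_mono[OF assms(1)] by auto
 moreover have "size (replicate_mset (u (Suc t) a - u t a) (0::int))<=size (J a t)"
  using calculation(1) size_mset_mono by blast
 ultimately show ?thesis using assms(3)
  by (simp add: m_of_def unact_def size_Diff_submset of_nat_diff)
qed

text \<open>The multiplicities change by the second difference of the walk, so the first
  \<open>t\<close> columns of colour \<open>a\<close> lose exactly \<open>u t a\<close>
  boxes.\<close>

lemma Qn_steps:
 assumes "steps_ok u"
 shows "Qn T (%s. int (u (s + 1) a) + int (u (s - 1) a) - 2 * int (u s a)) t = - int (u t a)"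
proof -
 have *: "Qn T (%s. int (u (s + 1) a) + int (u (s - 1) a) - 2 * int (u s a)) t = - int (u t a)"
  if "t<=T" for t
 proof -
  have "u (Suc T) = u T" using assms unfolding steps_ok_def by (meson le_SucI order_refl)
  moreover have "u 0 a = 0" using assms by (simp add: steps_ok_def)
  ultimately show ?thesis
   using Qn_of_second_difference[of "%s. int (u s a)" T t] that by simp
 qed
 show ?thesis
 proof (cases "t<=T")
  case False
  then have "u t = u T" using assms unfolding steps_ok_def by (meson nat_le_linear)
  then show ?thesis using *[of T] False Qn_beyond[of T t] by simp
 qed (use * in simp)
qed

lemma Qn_change:
 assumes "steps_ok u"
  "!!s. s>=1 ==> m' s = m s + (int (u (s + 1) a) + int (u (s - 1) a) - 2 * int (u s a))"
 shows "Qn T m' t = Qn T m t - int (u t a)"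
proof -
 have "Qn T m' t = Qn T (%s. m s + (int (u (s + 1) a) + int (u (s - 1) a) - 2 * int (u s a))) t"
  unfolding Qn_def using assms(2) by (intro sum.cong) auto
 then show ?thesis by (simp add: Qn_add Qn_steps[OF assms(1), simplified])
qed

lemma vac_change:
 assumes "!!b. Qn T (m_of J' b) t = Qn T (m_of J b) t - int (u t b)" "t>=1"
 shows "vac (Z(a0 := Z a0 - 1)) J' a t = vac Z J a t - h a (u t)"
proof -
 have "(\<Sum>b\<in>C. A a b * Qn T (m_of J' b) t)
   = (\<Sum>b\<in>C. A a b * Qn T (m_of J b) t) - (\<Sum>b\<in>C. A a b * int (u t b))"
  by (simp add: assms(1) right_diff_distrib sum_subtractf)
 then show ?thesis using assms(2) by (simp add: vac_def h_def)
qed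

text \<open>The source of all positivity arguments: the off-diagonal entries of \<open>A\<close> are
  nonpositive, so vacancy numbers are concave at lengths where their own colour has no part.\<close>

lemma vac_second_difference:
 assumes "supported J" "t>=1"
 shows "vac Z J a (t + 1) + vac Z J a (t - 1) - 2 * vac Z J a t
  = (\<Sum>b\<in>C. A a b * m_of J b t) - Z a * of_bool (t = 1)"
proof -
 have "vac Z J a (t + 1) + vac Z J a (t - 1) - 2 * vac Z J a t
  = Z a * (1 + of_bool (t>=2) - 2)
   - (\<Sum>b\<in>C. A a b * (Qn T (m_of J b) (t + 1) + Qn T (m_of J b) (t - 1) - 2 * Qn T (m_of J b) t))"
  using assms(2) by (auto simp: vac_def algebra_simps sum.distrib sum_subtractf sum_distrib_left)
 also have "... = Z a * (1 + of_bool (t>=2) - 2) - (\<Sum>b\<in>C. A a b * (- m_of J b t))"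
  using assms m_of_supported[OF assms(1)] Qn_second_difference by simp
 finally show ?thesis using assms(2) by (auto simp: sum_negf)
qed

text \<open>In use, \<open>m\<close> counts all parts of one length and \<open>sel\<close> the
  selected ones. They agree in colour \<open>a\<close>, where the vacancy number vanishes, and the
  excess in the other colours meets coefficients \<open>A a b <= 0\<close>.\<close>

lemma sum_A_le:
 assumes "a\<in>C" "m a = sel a" "!!b. b\<in>C ==> sel b<=m b"
 shows "(\<Sum>b\<in>C. A a b * m b)<=(\<Sum>b\<in>C. A a b * sel b)"
proof (rule sum_mono)
 fix b assume "b\<in>C"
 then show "A a b * m b<=A a b * sel b"
  using assms A_off[of a b] by (cases "a = b") (auto intro: mult_left_mono_neg)
qed

lemma mset_in_zero:
 assumes "!!x. x \<in># M ==> x = (0::int)"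
 shows "int (size M) = int (count M 0)"
proof -
 have "M = replicate_mset (size M) 0" using assms
  by (metis set_mset_subset_singletonD singletonI subsetI)
 then show ?thesis by (metis count_replicate_mset)
qed

text \<open>Where the walk could still go up, \<open>h\<close> is 1 and the vacancy number is about
  to lose one. If it were zero, all parts of this length and colour would be singular and selected;
  the second difference then bounds the sum of the two neighbouring vacancy numbers by
  \<open>h a (u t) - 1\<close> and reproduces the situation one length below. At the start the term
  \<open>Z a0 >= 1\<close> excludes it.\<close>

lemma fwalk_vac_pos:
 assumes J: "J\<in>RC Z N" and u: "fwalk J u" and Z: "!!a. Z a>=0" "Z a0>=1"
  and t: "t>=1" and up: "up a (u t)"
 shows "vac Z J a t>=1"
 using t up
proof (induction t)
 case (Suc t)
 have aC: "a\<in>C" using Suc up_in_C by blast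
 have uS: "u t\<in>S" for t using fwalk_in_S u by blast
 show ?case
 proof (rule ccontr)
  assume "~ 1<=vac Z J a (Suc t)"
  then have v0: "vac Z J a (Suc t) = 0" using RC_D(3)[OF J aC, of "Suc t"] by simp
  have fs: "fstep (zc J (Suc t)) (u t) (u (Suc t))" using u by (simp add: fwalk_def)
  have "x = 0" if "x \<in># J a (Suc t)" for x
   using RC_D(4,5)[OF J aC that] v0 by simp
  then have ma: "m_of J a (Suc t) = int (zc J (Suc t) a)"
   using mset_in_zero by (simp add: m_of_def zc_def)
  also have "zc J (Suc t) a = u (Suc t) a - u t a"
   using fs Suc.prems by (auto simp: fstep_def)
  finally have ma': "m_of J a (Suc t) = int (u (Suc t) a) - int (u t a)"
   using fs by (simp add: fstep_def le_fun_def of_nat_diff)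
  have sel: "int (u (Suc t) b) - int (u t b)<=m_of J b (Suc t)" for b
  proof -
   have "u (Suc t) b<=u t b + zc J (Suc t) b" using fs by (simp add: fstep_def)
   moreover have "zc J (Suc t) b<=size (J b (Suc t))" by (simp add: zc_def count_le_size)
   ultimately show ?thesis by (simp add: m_of_def)
  qed
  have "vac Z J a (t + 2) + vac Z J a t = (\<Sum>b\<in>C. A a b * m_of J b (Suc t)) - Z a * of_bool (t = 0)"
   using vac_second_difference[OF RC_D(1)[OF J], of "Suc t" Z a] v0 by simp
  also have "(\<Sum>b\<in>C. A a b * m_of J b (Suc t))
    <= (\<Sum>b\<in>C. A a b * (int (u (Suc t) b) - int (u t b)))"
   by (rule sum_A_le) (use aC ma' sel in auto)
  also have "... = h a (u t) - h a (u (Suc t))"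
   by (simp add: h_def algebra_simps sum_subtractf)
  also have "h a (u (Suc t)) = 1"
   using h_eq[OF uS aC] Suc.prems not_up_dn[OF uS] by auto
  finally have *: "vac Z J a (t + 2) + vac Z J a t<=h a (u t) - 1 - Z a * of_bool (t = 0)"
   by simp
  have nn: "vac Z J a (t + 2)>=0" "vac Z J a t>=0" using RC_D(3)[OF J aC] by auto
  show False
  proof (cases "t = 0")
   case True
   then have "h a (u t) = of_bool (a = a0)" using u by (simp add: fwalk_def h_zero)
   then show False using * nn True Z(1)[of a] Z(2) by (cases "a = a0") auto
  next
   case False
   then have "h a (u t)>=1" using * nn by simp
   then have "up a (u t)" using h_pos[OF uS aC] by simp
   moreover have "h a (u t)<=1" using h_le uS aC by blast
   ultimately show False using Suc.IH False * nn by simp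
  qed
 qed
qed simp

text \<open>The dual argument carries the vanishing vacancy number to all larger lengths. Beyond
  \<open>T\<close> it says that the weight to which the letter is added back fails to be dominant,
  against \<open>dom\<close>.\<close>

lemma rwalk_vac_pos:
 assumes J: "J\<in>RC Z N" and v: "rwalk J x v" and Z: "!!a. Z a>=0"
  and dom: "!!a. a\<in>C ==> vac Z J a T + h a x>=0"
  and t: "t>=1" and dn: "dn a (v t)"
 shows "vac Z J a t>=1"
proof (rule ccontr)
 assume "~ 1<=vac Z J a t"
 have vS: "v t\<in>S" for t using rwalk_in_S v by blast
 have aC: "a\<in>C" using dn dn_in_C vS by blast
 have v0: "vac Z J a t = 0" using \<open>~ 1<=vac Z J a t\<close> RC_D(3)[OF J aC, of t] by simp
 have "dn a (v (t + k)) & vac Z J a (t + k) = 0" for k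
 proof (induction k)
  case 0
  then show ?case using dn v0 by simp
 next
  case (Suc k)
  let ?t = "t + k"
  have rs: "rstep (zc J ?t) (v (Suc ?t)) (v ?t)" using v t by (simp add: rwalk_def)
  have "x = 0" if "x \<in># J a ?t" for x
   using RC_D(4,5)[OF J aC that] Suc by simp
  then have ma: "m_of J a ?t = int (zc J ?t a)"
   using mset_in_zero by (simp add: m_of_def zc_def)
  also have "zc J ?t a = v (Suc ?t) a - v ?t a"
   using rs Suc by (auto simp: rstep_def)
  finally have ma': "m_of J a ?t = int (v (Suc ?t) a) - int (v ?t a)"
   using rs by (simp add: rstep_def le_fun_def of_nat_diff)
  have sel: "int (v (Suc ?t) b) - int (v ?t b)<=m_of J b ?t" for b
  proof -
   have "v (Suc ?t) b<=v ?t b + zc J ?t b" using rs by (simp add: rstep_def)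
   moreover have "zc J ?t b<=size (J b ?t)" by (simp add: zc_def count_le_size)
   ultimately show ?thesis by (simp add: m_of_def)
  qed
  have "vac Z J a (?t + 1) + vac Z J a (?t - 1)
    = (\<Sum>b\<in>C. A a b * m_of J b ?t) - Z a * of_bool (?t = 1)"
   using vac_second_difference[OF RC_D(1)[OF J], of ?t Z a] Suc t by simp
  also have "... <= (\<Sum>b\<in>C. A a b * m_of J b ?t)" using Z by simp
  also have "... <= (\<Sum>b\<in>C. A a b * (int (v (Suc ?t) b) - int (v ?t b)))"
   by (rule sum_A_le) (use aC ma' sel in auto)
  also have "... = h a (v ?t) - h a (v (Suc ?t))"
   by (simp add: h_def algebra_simps sum_subtractf)
  also have "h a (v ?t) = -1"
   using h_eq[OF vS aC] Suc not_up_dn[OF vS] by auto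
  finally have *: "vac Z J a (?t + 1) + vac Z J a (?t - 1) <= - 1 - h a (v (Suc ?t))" by simp
  have nn: "vac Z J a (?t + 1)>=0" "vac Z J a (?t - 1)>=0" using RC_D(3)[OF J aC] by auto
  have "h a (v (Suc ?t)) < 0" using * nn by simp
  then have "dn a (v (Suc ?t))" using h_neg[OF vS aC] by simp
  moreover have "h a (v (Suc ?t)) >= -1" using h_ge vS aC by blast
  ultimately show ?case using * nn by simp
 qed
 from this[of T] have "dn a x" "vac Z J a (t + T) = 0" using v by (auto simp: rwalk_def)
 moreover have "vac Z J a (t + T) = vac Z J a T" using T_pos t Qn_beyond[of T "t + T"] by (simp add: vac_def)
 moreover have "h a x = -1" using h_eq[of x a] aC \<open>dn a x\<close> not_up_dn[of x a] v by (auto simp: rwalk_def)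
 ultimately show False using dom[OF aC] by simp
qed

lemma fwalk_fstep: "fwalk J u ==> t>=1 ==> fstep (zc J t) (u (t - 1)) (u t)"
 by (cases t) (auto simp: fwalk_def)

lemma rwalk_rstep: "rwalk J x u ==> t>=1 ==> rstep (zc J t) (u (Suc t)) (u t)"
 by (simp add: rwalk_def)

lemma fwalk_sel: "fwalk J u ==> t>=1 ==> u t a - u (t - 1) a<=zc J t a"
 using fwalk_fstep[of J u t] unfolding fstep_def by (metis diff_le_mono diff_add_inverse)

lemma rwalk_sel: "rwalk J x u ==> t>=1 ==> u (Suc t) a - u t a<=zc J t a"
 using rwalk_rstep[of J x u t] unfolding rstep_def by (metis diff_le_mono diff_add_inverse)

lemma fwalk_up: "fwalk J u ==> t>=1 ==> up a (u t) ==> zc J t a = u t a - u (t - 1) a"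
 using fwalk_fstep[of J u t] unfolding fstep_def by (metis diff_add_inverse)

lemma rwalk_dn: "rwalk J x u ==> t>=1 ==> dn a (u t) ==> zc J t a = u (Suc t) a - u t a"
 using rwalk_rstep[of J x u t] unfolding rstep_def by (metis diff_add_inverse)

lemma rep_le: "k<=zc J t a ==> replicate_mset k 0 \<subseteq># J a t"
 by (simp add: zc_def count_le_replicate_mset_subset_eq)

lemma zero_in_rest: "0 \<in># J a t - replicate_mset k 0 ==> k < zc J t a"
 by (metis count_diff count_greater_zero_iff count_replicate_mset zc_def zero_less_diff)

lemma unact_act:
 assumes "supported J" "!!t a. t>=1 ==> u t a - u (t - 1) a<=zc J t a"
 shows "unact u (act u J) = J"
proof (intro ext)
 fix a t
 show "unact u (act u J) a t = J a t"
 proof (cases "t = 0")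
  case True
  then show ?thesis using assms(1) by (simp add: unact_def supported_def)
 next
  case False
  then show ?thesis using rep_le[OF assms(2)[of t a]]
   by (simp add: unact_def act_def multiset.map_comp comp_def)
 qed
qed

lemma act_unact:
 assumes "supported J" "!!t a. t>=1 ==> u (Suc t) a - u t a<=zc J t a"
 shows "act u (unact u J) = J"
proof (intro ext)
 fix a t
 show "act u (unact u J) a t = J a t"
 proof (cases "t = 0")
  case True
  then show ?thesis using assms(1) by (simp add: act_def supported_def)
 next
  case False
  then show ?thesis using rep_le[OF assms(2)[of t a]]
   by (simp add: unact_def act_def multiset.map_comp comp_def)
 qed
qed

lemma steps_ok_support: "steps_ok u ==> a\<notin>C ==> u t a = 0"
 unfolding steps_ok_def using S_support by blast

lemma steps_ok_top: "steps_ok u ==> t>=T ==> u t = u T"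
 unfolding steps_ok_def by blast

lemma act_supported:
 assumes "supported J" "steps_ok u"
 shows "supported (act u J)"
proof -
 have "act u J a t = {#}" if *: "a\<notin>C | t < 1 | t > T" for a t
 proof -
  have "J a t = {#}" using assms(1) * by (simp add: supported_def)
  moreover have "t = 0 | u (Suc t) a - u t a = 0"
   using * steps_ok_support[OF assms(2)] steps_ok_top[OF assms(2), of t]
    steps_ok_top[OF assms(2), of "Suc t"] by auto
  ultimately show ?thesis by (auto simp: act_def)
 qed
 then show ?thesis by (auto simp: supported_def)
qed

lemma unact_supported:
 assumes "supported J" "steps_ok u"
 shows "supported (unact u J)"
proof -
 have "unact u J a t = {#}" if *: "a\<notin>C | t < 1 | t > T" for a t
 proof -
  have "J a t = {#}" using assms(1) * by (simp add: supported_def)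
  moreover have "t = 0 | u t a - u (t - 1) a = 0"
   using * steps_ok_support[OF assms(2)] steps_ok_top[OF assms(2), of t]
    steps_ok_top[OF assms(2), of "t - 1"] by auto
  ultimately show ?thesis by (auto simp: unact_def)
 qed
 then show ?thesis by (auto simp: supported_def)
qed

context
 fixes Z :: "nat => int" and N :: "nat => rat"
 assumes Z_nonneg: "!!a. Z a>=0" and Z_a0: "Z a0>=1"
  and N_less_T: "!!a. a\<in>C ==> N a < of_nat T"
begin

abbreviation "Z1 \<equiv> Z(a0 := Z a0 - 1)"

text \<open>Reading the same walk backwards works because at a \<open>dn\<close> colour all colabels
  that stay have been raised by one. The singular parts there are then exactly those that the walk
  has just shortened, which is the local minimality in \<open>rstep\<close>.\<close>

lemma act_RC:
 assumes J: "J\<in>RC Z N" and u: "fwalk J u"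
 shows "act u J\<in>RC Z1 (%a. N a - of_nat (u T a))"
  and "rwalk (act u J) (u T) u"
  and "unact u (act u J) = J"
proof -
 note sup = RC_D(1)[OF J]
 have ok: "steps_ok u" using fwalk_steps_ok u sup by blast
 have uS: "u t\<in>S" for t using ok unfolding steps_ok_def by blast+
 have sel: "t>=1 ==> u t a - u (t - 1) a<=zc J t a" for t a using fwalk_sel u by blast
 have Q: "Qn T (m_of (act u J) b) t = Qn T (m_of J b) t - int (u t b)" for b t
  by (rule Qn_change[OF ok]) (use m_act[OF ok sel] in auto)
 have vac1: "vac Z1 (act u J) a t = vac Z J a t - h a (u t)" if "t>=1" for a t
  by (rule vac_change) (use Q that in auto)
 have vac_up: "of_bool (up a (u t))<=vac Z J a t" if "a\<in>C" "t>=1" for a t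
  using fwalk_vac_pos[OF J u Z_nonneg Z_a0] RC_D(3)[OF J] that by auto
 have rest: "of_bool (up a (u t))<=x"
  if "a\<in>C" "t>=1" "x \<in># J a t - replicate_mset (u t a - u (t - 1) a) 0" for a t x
 proof -
  have "x>=0" using that RC_D(4)[OF J] by (meson in_diffD)
  moreover have "x ~= 0" if "up a (u t)"
   using that zero_in_rest[of J a t] fwalk_up[OF u] \<open>t>=1\<close>
    \<open>x \<in># J a t - replicate_mset (u t a - u (t - 1) a) 0\<close> by fastforce
  ultimately show ?thesis by auto
 qed
 have sup': "supported (act u J)" using act_supported sup ok by blast
 have rest': "of_bool (dn a (u t))<=y"
  if "a\<in>C" "t>=1" "x \<in># J a t - replicate_mset (u t a - u (t - 1) a) 0" "y = x - h a (u t)" for a t x y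
  using rest[OF that(1-3)] that(4) h_eq[OF uS that(1)] not_up_dn[OF uS] by auto
 have vac_nn: "0<=vac Z1 (act u J) a t" if "a\<in>C" for a t
 proof (cases "t = 0")
  case False
  then show ?thesis using vac1[of t a] vac_up[OF that, of t] h_eq[OF uS that, of t] by auto
 qed (simp add: vac_def)
 show "act u J\<in>RC Z1 (%a. N a - of_nat (u T a))"
  unfolding RC_def
 proof (intro CollectI conjI ballI allI)
  show "supported (act u J)" by (rule sup')
 next
  fix a assume "a\<in>C"
  then show "of_int (Qn T (m_of (act u J) a) T) = N a - of_nat (u T a)"
   using RC_D(2)[OF J] by (simp add: Q)
 next
  fix a t assume a: "a\<in>C"
  show "0<=vac Z1 (act u J) a t" using vac_nn a by blast
  fix y assume y: "y \<in># act u J a t"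
  then have t: "t>=1" by (auto simp: act_def split: if_splits)
  have "y = 0 | (\<exists>x. x \<in># J a t - replicate_mset (u t a - u (t - 1) a) 0 & y = x - h a (u t))"
   using y t by (auto simp: act_def split: if_splits)
  then have "0<=y & y<=vac Z1 (act u J) a t"
  proof
   assume "y = 0"
   then show ?thesis using vac_nn a by simp
  next
   assume "\<exists>x. x \<in># J a t - replicate_mset (u t a - u (t - 1) a) 0 & y = x - h a (u t)"
   then obtain x where x: "x \<in># J a t - replicate_mset (u t a - u (t - 1) a) 0" "y = x - h a (u t)"
    by blast
   then have "x<=vac Z J a t" using RC_D(5)[OF J a] by (meson in_diffD)
   moreover have "0<=y" using rest'[OF a t x] by (cases "dn a (u t)") auto
   ultimately show ?thesis using x vac1[OF t] by simp
  qed
  then show "0<=y" "y<=vac Z1 (act u J) a t" by auto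
 qed
 show "rwalk (act u J) (u T) u"
  unfolding rwalk_def
 proof (intro conjI allI impI)
  show "u 0 = (%_. 0)" "u T\<in>S" using ok unfolding steps_ok_def by blast+
  show "u t = u T" if "T<=t" for t using ok that steps_ok_top by blast
  fix t :: nat assume t: "1<=t"
  have zc': "zc (act u J) t a = count (image_mset (%x. x - h a (u t)) (J a t - replicate_mset (u t a - u (t - 1) a) 0)) 0
    + (u (Suc t) a - u t a)" for a
   using t by (simp add: zc_def act_def)
  show "rstep (zc (act u J) t) (u (Suc t)) (u t)"
   unfolding rstep_def
  proof (intro conjI allI impI)
   show "u t\<in>S" by (rule uS)
   show "u t<=u (Suc t)" using ok unfolding steps_ok_def by blast+
   show "u (Suc t) a<=u t a + zc (act u J) t a" for a using zc' by simp
   fix a assume dn: "dn a (u t)"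
   then have a: "a\<in>C" using dn_in_C uS by blast
   have "y ~= 0" if "y \<in># image_mset (%x. x - h a (u t)) (J a t - replicate_mset (u t a - u (t - 1) a) 0)" for y
    using that rest'[OF a t] dn by fastforce
   then have "count (image_mset (%x. x - h a (u t)) (J a t - replicate_mset (u t a - u (t - 1) a) 0)) 0 = 0"
    by (metis count_eq_zero_iff)
   then show "u (Suc t) a = u t a + zc (act u J) t a"
    using zc'[of a] steps_ok_mono(2)[OF ok, of t a] by simp
  qed
 qed
 show "unact u (act u J) = J" using unact_act sup sel by blast
qed

text \<open>Dual to \<open>act_RC\<close>, with one more input: \<open>dom\<close> is the dominance
  of the enlarged weight, without which a vacancy number could become negative at infinity.\<close>

lemma unact_RC:
 assumes J: "J\<in>RC Z1 (%a. N a - of_nat (x a))" and u: "rwalk J x u"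
  and dom: "!!a. a\<in>C ==> 0<=of_int (Z a) - (\<Sum>b\<in>C. of_int (A a b) * N b)"
 shows "unact u J\<in>RC Z N"
  and "fwalk (unact u J) u"
  and "act u (unact u J) = J"
proof -
 note sup = RC_D(1)[OF J]
 have ok: "steps_ok u" using rwalk_steps_ok u by blast
 have uS: "u t\<in>S" for t using ok unfolding steps_ok_def by blast+
 have uT: "u T = x" using u by (simp add: rwalk_def)
 have xS: "x\<in>S" using u by (simp add: rwalk_def)
 have sel: "t>=1 ==> u (Suc t) a - u t a<=zc J t a" for t a using rwalk_sel u by blast
 have au: "act u (unact u J) = J" using act_unact sup sel by blast
 have Q: "Qn T (m_of J b) t = Qn T (m_of (unact u J) b) t - int (u t b)" for b t
  by (rule Qn_change[OF ok]) (use m_unact[OF ok sel] in auto)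
 have vac1: "vac Z1 J a t = vac Z (unact u J) a t - h a (u t)" if "t>=1" for a t
  by (rule vac_change) (use Q that in auto)
 have dom': "vac Z1 J a T + h a x>=0" if a: "a\<in>C" for a
 proof -
  have "(of_int (vac Z1 J a T + h a x) :: rat) = of_int (vac Z (unact u J) a T)"
   using vac1[OF T_pos] by (simp add: uT)
  also have "... = of_int (Z a) - (\<Sum>b\<in>C. of_int (A a b) * (of_int (Qn T (m_of J b) T) + of_nat (x b)))"
   using T_pos by (simp add: vac_def Q[of _ T] uT)
  also have "... = of_int (Z a) - (\<Sum>b\<in>C. of_int (A a b) * N b)"
   using RC_D(2)[OF J] by simp
  finally show ?thesis using dom[OF a] by simp
 qed
 have Z1_nonneg: "Z1 a>=0" for a using Z_nonneg Z_a0 by simp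
 have vac_dn: "of_bool (dn a (u t))<=vac Z1 J a t" if "a\<in>C" "t>=1" for a t
  using rwalk_vac_pos[OF J u Z1_nonneg dom'] RC_D(3)[OF J] that by auto
 have rest: "of_bool (dn a (u t))<=y"
  if "a\<in>C" "t>=1" "y \<in># J a t - replicate_mset (u (Suc t) a - u t a) 0" for a t y
 proof -
  have "y>=0" using that RC_D(4)[OF J] by (meson in_diffD)
  moreover have "y ~= 0" if "dn a (u t)"
   using that zero_in_rest[of J a t] rwalk_dn[OF u] \<open>t>=1\<close>
    \<open>y \<in># J a t - replicate_mset (u (Suc t) a - u t a) 0\<close> by fastforce
  ultimately show ?thesis by auto
 qed
 have sup': "supported (unact u J)" using unact_supported sup ok by blast
 have rest': "of_bool (up a (u t))<=x"
  if "a\<in>C" "t>=1" "y \<in># J a t - replicate_mset (u (Suc t) a - u t a) 0" "x = y + h a (u t)" for a t x y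
  using rest[OF that(1-3)] that(4) h_eq[OF uS that(1)] not_up_dn[OF uS] by auto
 have vac_nn: "0<=vac Z (unact u J) a t" if "a\<in>C" for a t
 proof (cases "t = 0")
  case False
  then show ?thesis using vac1[of t a] vac_dn[OF that, of t] h_eq[OF uS that, of t]
   by (cases "up a (u t)"; cases "dn a (u t)") auto
 qed (simp add: vac_def)
 show "unact u J\<in>RC Z N"
  unfolding RC_def
 proof (intro CollectI conjI ballI allI)
  show "supported (unact u J)" by (rule sup')
 next
  fix a assume "a\<in>C"
  then show "of_int (Qn T (m_of (unact u J) a) T) = N a"
   using RC_D(2)[OF J, of a] Q[of a T] by (simp add: uT)
 next
  fix a t assume a: "a\<in>C"
  show "0<=vac Z (unact u J) a t" using vac_nn a by blast
  fix y assume y: "y \<in># unact u J a t"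
  then have t: "t>=1" by (auto simp: unact_def split: if_splits)
  have "y = 0 | (\<exists>x. x \<in># J a t - replicate_mset (u (Suc t) a - u t a) 0 & y = x + h a (u t))"
   using y t by (auto simp: unact_def split: if_splits)
  then have "0<=y & y<=vac Z (unact u J) a t"
  proof
   assume "y = 0"
   then show ?thesis using vac_nn a by simp
  next
   assume "\<exists>x. x \<in># J a t - replicate_mset (u (Suc t) a - u t a) 0 & y = x + h a (u t)"
   then obtain x where x: "x \<in># J a t - replicate_mset (u (Suc t) a - u t a) 0" "y = x + h a (u t)"
    by blast
   then have "x<=vac Z1 J a t" using RC_D(5)[OF J a] by (meson in_diffD)
   moreover have "0<=y" using rest'[OF a t x] by (cases "up a (u t)") auto
   ultimately show ?thesis using x vac1[OF t, of a] by simp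
  qed
  then show "0<=y" "y<=vac Z (unact u J) a t" by auto
 qed
 show "fwalk (unact u J) u"
  unfolding fwalk_def
 proof (intro conjI allI impI)
  show "u 0 = (%_. 0)" using ok unfolding steps_ok_def by blast+
  fix t :: nat
  let ?t = "Suc t"
  have zc': "zc (unact u J) ?t a = count (image_mset (%x. x + h a (u ?t)) (J a ?t - replicate_mset (u (Suc ?t) a - u ?t a) 0)) 0
    + (u ?t a - u t a)" for a
   by (simp add: zc_def unact_def)
  show "fstep (zc (unact u J) ?t) (u t) (u ?t)"
   unfolding fstep_def
  proof (intro conjI allI impI)
   show "u ?t\<in>S" by (rule uS)
   show "u t<=u ?t" using ok unfolding steps_ok_def by blast+
   show "u ?t a<=u t a + zc (unact u J) ?t a" for a using zc' by simp
   fix a assume up: "up a (u ?t)"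
   then have a: "a\<in>C" using up_in_C by blast
   have "y ~= 0" if "y \<in># image_mset (%x. x + h a (u ?t)) (J a ?t - replicate_mset (u (Suc ?t) a - u ?t a) 0)" for y
    using that rest'[OF a, of ?t] up by fastforce
   then have "count (image_mset (%x. x + h a (u ?t)) (J a ?t - replicate_mset (u (Suc ?t) a - u ?t a) 0)) 0 = 0"
    by (metis count_eq_zero_iff)
   then show "u ?t a = u t a + zc (unact u J) ?t a"
    using zc'[of a] steps_ok_mono(2)[OF ok, of t a] by simp
  qed
 qed
 show "act u (unact u J) = J" by (rule au)
qed

end

text \<open>As \<open>d a * A a b\<close> is the invariant form, this is twice the sum of cocharge
  and weighted riggings; the factor 2 keeps it integral.\<close>

definition st :: "riggings => int" where
 "st J = (\<Sum>a\<in>C. \<Sum>b\<in>C. d a * A a b * (\<Sum>t=1..T. m_of J a t * Qn T (m_of J b) t))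
  + 2 * (\<Sum>a\<in>C. d a * (\<Sum>t=1..T. sum_mset (J a t)))"

definition np :: "riggings => nat => int" where
 "np J a = (\<Sum>t=1..T. m_of J a t)"

lemma sum_second_difference:
 fixes f :: "nat => int"
 shows "(\<Sum>t=1..k. f (t + 1) + f (t - 1) - 2 * f t) = f (k + 1) - f k - f 1 + f 0"
proof (induct k)
 case (Suc k)
 have "(\<Sum>t=1..Suc k. f (t + 1) + f (t - 1) - 2 * f t)
  = (\<Sum>t=1..k. f (t + 1) + f (t - 1) - 2 * f t) + (f (k + 2) + f k - 2 * f (k + 1))" by simp
 then show ?case unfolding Suc by simp
qed simp

lemma np_act:
 assumes "fwalk J u" "supported J"
 shows "np (act u J) a = np J a - int (u 1 a)"
proof -
 note ok = fwalk_steps_ok[OF assms]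
 have "np (act u J) a = np J a + (\<Sum>t=1..T. int (u (t + 1) a) + int (u (t - 1) a) - 2 * int (u t a))"
  unfolding np_def sum.distrib[symmetric]
  using m_act[OF ok fwalk_sel[OF assms(1)]] by (intro sum.cong) auto
 also have "(\<Sum>t=1..T. int (u (t + 1) a) + int (u (t - 1) a) - 2 * int (u t a))
   = int (u (T + 1) a) - int (u T a) - int (u 1 a) + int (u 0 a)"
  using sum_second_difference[of "%t. int (u t a)" T] by simp
 also have "... = - int (u 1 a)"
 proof -
  have "u (T + 1) = u T" by (rule steps_ok_top[OF ok]) simp
  moreover have "u 0 = (%_. 0)" using ok unfolding steps_ok_def by blast
  ultimately show ?thesis by simp
 qed
 finally show ?thesis by simp
qed

lemma sum_mset_act:
 assumes "fwalk J u" "t>=1"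
 shows "sum_mset (act u J a t) = sum_mset (J a t) - h a (u t) * (m_of J a t - (int (u t a) - int (u (t - 1) a)))"
proof -
 let ?r = "replicate_mset (u t a - u (t - 1) a) (0::int)"
 have le: "?r \<subseteq># J a t" using rep_le fwalk_sel assms by blast
 have "sum_mset (J a t) = sum_mset (J a t - ?r + ?r)" using le by simp
 also have "... = sum_mset (J a t - ?r)" by (simp only: sum_mset.union) simp
 finally have 1: "sum_mset (J a t - ?r) = sum_mset (J a t)" by simp
 have "u (t - 1) a<=u t a" using fwalk_mono[OF assms(1), of "t - 1"] assms(2) by (simp add: le_fun_def)
 then have 2: "int (size (J a t - ?r)) = m_of J a t - (int (u t a) - int (u (t - 1) a))"
  using le size_mset_mono[OF le] by (simp add: m_of_def size_Diff_submset of_nat_diff)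
 have "sum_mset (image_mset (%x. x - c) M) = sum_mset M - c * int (size M)" for c and M :: "int multiset"
  by (induction M) (auto simp: algebra_simps)
 then have "sum_mset (act u J a t) = sum_mset (J a t - ?r) - h a (u t) * int (size (J a t - ?r))"
  using assms(2) by (simp add: act_def)
 then show ?thesis by (simp only: 1 2)
qed

abbreviation form :: "(nat => nat => int) => int" where
 "form f \<equiv> \<Sum>a\<in>C. \<Sum>b\<in>C. d a * A a b * f a b"

lemma form_swap: "form (%a b. f b a) = form f"
 by (subst sum.swap) (intro sum.cong refl, simp add: symmetrized)

lemma form_add: "form (%a b. f a b + g a b) = form f + form g"
 by (simp add: distrib_left sum.distrib)

lemma form_diff: "form (%a b. f a b - g a b) = form f - form g"
 by (simp add: right_diff_distrib sum_subtractf)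

text \<open>With \<open>m' = m - e\<close>, where \<open>e\<close> has box counts \<open>x\<close>,
  the quadratic form drops by \<open>2 F - G\<close>. The riggings drop by the values of
  \<open>h\<close>, which gives \<open>F - R\<close> with the opposite sign and a term in colour
  \<open>a0\<close>. The \<open>F\<close> cancel, \<open>2 R - G\<close> is a boundary term, and
  \<open>norm_S\<close> cancels it against the \<open>x a0 T\<close> left over, so that only the
  number of parts survives.\<close>

theorem st_act:
 assumes u: "fwalk J u" and sup: "supported J"
 shows "st J = st (act u J) + 2 * d a0 * np J a0"
proof -
 note ok = fwalk_steps_ok[OF u sup]
 define m where "m = m_of J"
 define m' where "m' = m_of (act u J)"
 define x where "x a t = int (u t a)" for a t
 define e where "e a t = 2 * x a t - x a (t + 1) - x a (t - 1)" for a t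
 define F where "F a b = (\<Sum>t=1..T. m a t * x b t)" for a b
 define G where "G a b = (\<Sum>t=1..T. e a t * x b t)" for a b
 define R where "R a b = (\<Sum>t=1..T. (x a t - x a (t - 1)) * x b t)" for a b
 have x0: "x a 0 = 0" for a using ok unfolding steps_ok_def x_def by simp
 have xT: "x a (T + 1) = x a T" for a
 proof -
  have "u (T + 1) = u T" by (rule steps_ok_top[OF ok]) simp
  then show ?thesis by (simp add: x_def)
 qed
 have m': "m' a t = m a t - e a t" if "t>=1" for a t
  using m_act[OF ok fwalk_sel[OF u that] that] by (simp add: m_def m'_def e_def x_def)
 have Qe: "Qn T (e a) t = x a t" for a t
 proof -
  have "Qn T (e a) t + Qn T (%s. int (u (s + 1) a) + int (u (s - 1) a) - 2 * int (u s a)) t = Qn T (%_. 0) t"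
   unfolding Qn_add[symmetric] by (simp add: e_def x_def)
  then show ?thesis unfolding Qn_steps[OF ok] by (simp add: Qn_def x_def)
 qed
 have Q': "Qn T (m' a) t = Qn T (m a) t - x a t" for a t
  unfolding x_def using m'
  by (intro Qn_change[OF ok]) (simp add: e_def x_def)
 have mQ: "(\<Sum>t=1..T. m a t * Qn T (m b) t) = (\<Sum>t=1..T. m' a t * Qn T (m' b) t) + (F a b + F b a - G a b)" for a b
 proof -
  have "(\<Sum>t=1..T. m' a t * Qn T (m' b) t)
   = (\<Sum>t=1..T. m a t * Qn T (m b) t - m a t * x b t - e a t * Qn T (m b) t + e a t * x b t)"
   by (intro sum.cong refl) (simp add: Q' m' algebra_simps)
  also have "... = (\<Sum>t=1..T. m a t * Qn T (m b) t) - F a b - (\<Sum>t=1..T. e a t * Qn T (m b) t) + G a b"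
   by (simp add: F_def G_def sum.distrib sum_subtractf)
  also have "(\<Sum>t=1..T. e a t * Qn T (m b) t) = F b a"
   unfolding F_def by (subst sum_Qn_commute) (simp add: Qe)
  finally show ?thesis by simp
 qed
 have rig: "(\<Sum>t=1..T. sum_mset (J a t)) = (\<Sum>t=1..T. sum_mset (act u J a t))
   + of_bool (a = a0) * (np J a - x a T) - (\<Sum>b\<in>C. A a b * (F a b - R a b))" for a
 proof -
  have "(\<Sum>t=1..T. sum_mset (J a t)) - (\<Sum>t=1..T. sum_mset (act u J a t))
   = (\<Sum>t=1..T. h a (u t) * (m a t - (x a t - x a (t - 1))))"
   unfolding sum_subtractf[symmetric]
   by (intro sum.cong refl) (simp add: sum_mset_act[OF u] m_def x_def)
  also have "... = (\<Sum>t=1..T. of_bool (a = a0) * (m a t - (x a t - x a (t - 1))))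
    - (\<Sum>t=1..T. \<Sum>b\<in>C. A a b * (m a t * x b t - (x a t - x a (t - 1)) * x b t))"
   unfolding sum_subtractf[symmetric]
   by (intro sum.cong refl) (simp add: h_def x_def algebra_simps sum_distrib_left sum_subtractf sum.distrib)
  also have "(\<Sum>t=1..T. of_bool (a = a0) * (m a t - (x a t - x a (t - 1))))
   = of_bool (a = a0) * ((\<Sum>t=1..T. m a t) - (\<Sum>t=1..T. x a t - x a (t - 1)))"
   by (simp add: sum_distrib_left[symmetric] sum_subtractf)
  also have "(\<Sum>t=1..T. x a t - x a (t - 1)) = x a T"
   using sum_telescope''[of 0 T "x a"] x0 by simp
  also have "(\<Sum>t=1..T. \<Sum>b\<in>C. A a b * (m a t * x b t - (x a t - x a (t - 1)) * x b t))
   = (\<Sum>b\<in>C. A a b * (F a b - R a b))"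
   by (subst sum.swap) (simp add: F_def R_def sum_distrib_left sum_subtractf right_diff_distrib)
  finally show ?thesis by (simp add: np_def m_def)
 qed
 have "(\<Sum>a\<in>C. d a * (\<Sum>t=1..T. sum_mset (J a t)))
   = (\<Sum>a\<in>C. d a * (\<Sum>t=1..T. sum_mset (act u J a t)))
    + (\<Sum>a\<in>C. d a * (of_bool (a = a0) * (np J a - x a T))) - form (%a b. F a b - R a b)"
  unfolding rig by (simp add: distrib_left right_diff_distrib sum.distrib sum_subtractf sum_distrib_left mult.assoc)
 also have "(\<Sum>a\<in>C. d a * (of_bool (a = a0) * (np J a - x a T))) = d a0 * (np J a0 - x a0 T)"
  by (subst sum.remove[OF finite_C a0_in_C]) simp
 finally have rigs: "(\<Sum>a\<in>C. d a * (\<Sum>t=1..T. sum_mset (J a t)))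
   = (\<Sum>a\<in>C. d a * (\<Sum>t=1..T. sum_mset (act u J a t))) + d a0 * (np J a0 - x a0 T) - (form F - form R)"
  by (simp add: form_diff)
 have quad: "form (%a b. \<Sum>t=1..T. m a t * Qn T (m b) t)
   = form (%a b. \<Sum>t=1..T. m' a t * Qn T (m' b) t) + (2 * form F - form G)"
  unfolding mQ form_add form_diff form_swap[of F] by simp
 \<comment> \<open>By the symmetry of the form, the difference can be rearranged into a telescoping
   sum whose only surviving value is at \<open>T\<close>.\<close>
 have "2 * form R - form G = form (%a b. 2 * R a b - G a b)"
  unfolding form_diff by (simp add: sum_distrib_left mult_ac)
 also have "(%a b. 2 * R a b - G a b)
   = (%a b. (\<Sum>t=1..T. x a (t + 1) * x b t) - (\<Sum>t=1..T. x a (t - 1) * x b t))"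
  unfolding R_def G_def e_def sum_distrib_left sum_subtractf[symmetric]
  by (intro ext sum.cong refl) (simp add: algebra_simps)
 also have "form ... = form (%a b. \<Sum>t=1..T. x a (t + 1) * x b t) - form (%a b. \<Sum>t=1..T. x b (t - 1) * x a t)"
  unfolding form_diff by (subst form_swap[of "%a b. \<Sum>t=1..T. x b (t - 1) * x a t"]) simp
 also have "... = form (%a b. (\<Sum>t=1..T. x a (t + 1) * x b t) - (\<Sum>t=1..T. x b (t - 1) * x a t))"
  by (simp only: form_diff)
 also have "(%a b. (\<Sum>t=1..T. x a (t + 1) * x b t) - (\<Sum>t=1..T. x b (t - 1) * x a t)) = (%a b. x a T * x b T)"
 proof (intro ext)
  fix a b
  have "(\<Sum>t=1..T. x a (t + 1) * x b t) - (\<Sum>t=1..T. x b (t - 1) * x a t)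
   = (\<Sum>t=1..T. x a (t + 1) * x b t - x a t * x b (t - 1))"
   by (simp add: sum_subtractf mult.commute)
  also have "... = x a (T + 1) * x b T - x a 1 * x b 0"
   using sum_Suc_diff[of 1 T "%t. x a t * x b (t - 1)"] by simp
  finally show "(\<Sum>t=1..T. x a (t + 1) * x b t) - (\<Sum>t=1..T. x b (t - 1) * x a t) = x a T * x b T"
   using x0 xT by simp
 qed
 also have "form (%a b. x a T * x b T) = 2 * d a0 * x a0 T"
  using norm_S[OF fwalk_in_S[OF u, of T]] by (simp add: x_def mult.assoc)
 finally have "2 * form R - form G = 2 * d a0 * x a0 T" .
 then show ?thesis using quad rigs unfolding st_def m_def[symmetric] m'_def[symmetric]
  by (simp add: algebra_simps)
qed

definition del :: "riggings => (nat => nat) \<times> riggings" where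
 "del J = (let u = (THE u. fwalk J u) in (u T, act u J))"

lemma del_eq: "fwalk J u ==> del J = (u T, act u J)"
proof -
 assume "fwalk J u"
 then have "(THE u. fwalk J u) = u" by (blast intro: the_equality fwalk_unique)
 then show ?thesis by (simp add: del_def)
qed

theorem del_bij:
 assumes "!!a. Z a>=0" "Z a0>=1" "!!a. a\<in>C ==> N a < of_nat T"
  and dom: "!!a. a\<in>C ==> 0<=of_int (Z a) - (\<Sum>b\<in>C. of_int (A a b) * N b)"
 shows "bij_betw del (RC Z N) (SIGMA x:S. RC (Z(a0 := Z a0 - 1)) (%a. N a - of_nat (x a)))"
proof -
 note Zs = assms(1-3)
 let ?g = "%(x, J). unact (THE v. rwalk J x v) J"
 have g: "?g (x, J) = unact v J" if "rwalk J x v" for x J v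
  using rwalk_unique[OF that] that by (metis (mono_tags, lifting) case_prod_conv theI)
 show ?thesis
 proof (rule bij_betw_byWitness[where f' = ?g])
  show "\<forall>J\<in>RC Z N. ?g (del J) = J"
  proof
   fix J assume J: "J\<in>RC Z N"
   obtain u where u: "fwalk J u" using fwalk_exists by blast
   show "?g (del J) = J" unfolding del_eq[OF u] using g act_RC[OF Zs J u] by simp
  qed
  show "del ` RC Z N \<subseteq> (SIGMA x:S. RC (Z(a0 := Z a0 - 1)) (%a. N a - of_nat (x a)))"
  proof safe
   fix J x J' assume J: "J\<in>RC Z N" and *: "(x, J') = del J"
   obtain u where u: "fwalk J u" using fwalk_exists by blast
   have "x = u T" "J' = act u J" using * del_eq[OF u] by auto
   then show "x\<in>S" "J'\<in>RC (Z(a0 := Z a0 - 1)) (%a. N a - of_nat (x a))"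
    using act_RC[OF Zs J u] fwalk_in_S[OF u] by auto
  qed
  have *: "?g (x, J)\<in>RC Z N & del (?g (x, J)) = (x, J)"
   if x: "x\<in>S" and J: "J\<in>RC (Z(a0 := Z a0 - 1)) (%a. N a - of_nat (x a))" for x J
  proof -
   have "N a - of_nat (x a) < of_nat T" if "a\<in>C" for a
    using assms(3)[OF that] by (metis add_less_cancel_right diff_add_cancel diff_less_eq le_add_same_cancel1 of_nat_0_le_iff order_less_le_trans)
   then have "J a T = {#}" for a using top_empty[OF J] by blast
   then obtain v where v: "rwalk J x v" using rwalk_exists[OF x] RC_D(1)[OF J] by blast
   show ?thesis unfolding g[OF v]
    using unact_RC[OF Zs J v dom] del_eq v by (simp add: rwalk_def)
  qed
  then show "\<forall>y\<in>SIGMA x:S. RC (Z(a0 := Z a0 - 1)) (%a. N a - of_nat (x a)). del (?g y) = y"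
   by blast
  show "?g ` (SIGMA x:S. RC (Z(a0 := Z a0 - 1)) (%a. N a - of_nat (x a))) \<subseteq> RC Z N"
   using * by blast
 qed
qed

lemma RC_dominant:
 assumes "J\<in>RC Z N" "a\<in>C"
 shows "0<=of_int (Z a) - (\<Sum>b\<in>C. of_int (A a b) * N b)"
proof -
 have "(0::rat)<=of_int (vac Z J a T)" using RC_D(3)[OF assms] by simp
 also have "of_int (vac Z J a T) = of_int (Z a) - (\<Sum>b\<in>C. of_int (A a b) * N b)"
  using T_pos RC_D(2)[OF assms(1)] by (simp add: vac_def)
 finally show ?thesis .
qed

end

section \<open>Totally ordered weight sets\<close>

primrec pv :: "(nat => nat) => nat => nat => nat" where
 "pv col 0 = (%_. 0)"
| "pv col (Suc k) = (pv col k)(col k := Suc (pv col k (col k)))"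

lemma pv_Suc_le: "pv col k<=pv col (Suc k)"
 by (simp add: le_fun_def)

lemma pv_mono: "j<=k ==> pv col j<=pv col k"
 by (rule lift_Suc_mono_le[of "pv col"]) (rule pv_Suc_le)

lemma pv_Suc_neq: "pv col (Suc k) ~= pv col k"
 by (metis fun_upd_same n_not_Suc_n pv.simps(2))

lemma pv_le_iff: "pv col j<=pv col k \<longleftrightarrow> j<=k"
proof
 assume le: "pv col j<=pv col k"
 show "j<=k"
 proof (rule ccontr)
  assume "~ j<=k"
  then have "pv col (Suc k)<=pv col j" by (intro pv_mono) simp
  then have "pv col (Suc k) = pv col k" using le pv_Suc_le[of col k] by (meson antisym order_trans)
  then show False using pv_Suc_neq by metis
 qed
qed (rule pv_mono)

lemma pv_inject: "pv col j = pv col k \<longleftrightarrow> j = k"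
 by (metis antisym order_refl pv_le_iff)

lemma sup_pv: "sup (pv col j) (pv col k) = pv col (max j k)"
 using pv_mono[of j k col] pv_mono[of k j col] by (cases "j<=k") (auto simp: max_def sup_absorb1 sup_absorb2)

lemma inf_pv: "inf (pv col j) (pv col k) = pv col (min j k)"
 using pv_mono[of j k col] pv_mono[of k j col] by (cases "j<=k") (auto simp: min_def inf_absorb1 inf_absorb2)

text \<open>A chain element strictly above \<open>pv col k\<close> contains
  \<open>pv col (Suc k)\<close>, so the coordinate that was raised has to be
  \<open>col k\<close>.\<close>

lemma pv_upd:
 assumes "(pv col k)(a := Suc (pv col k a)) = pv col j"
 shows "j = Suc k & col k = a"
proof -
 have "pv col k<=pv col j" "pv col k ~= pv col j"
  using assms by (auto simp: le_fun_def simp flip: assms) (metis fun_upd_same n_not_Suc_n)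
 then have "k < j" using pv_le_iff pv_inject by (metis order_le_neq_trans)
 then have le: "pv col (Suc k)<=pv col j" using pv_mono by (metis Suc_leI)
 have "col k = a"
 proof (rule ccontr)
  assume "col k ~= a"
  then have "pv col (Suc k) (col k) > pv col j (col k)" by (simp flip: assms)
  then show False using le by (simp add: le_fun_def) (metis not_less)
 qed
 then have "pv col (Suc k) = pv col j" using assms by simp
 then show ?thesis using pv_inject \<open>col k = a\<close> by metis
qed

text \<open>The assumption \<open>A_col\<close> is the difference of the condition
  \<open>minuscule\<close> at positions \<open>k\<close> and \<open>Suc k\<close>; in this form it
  can be read off the Dynkin diagram. The vector representations of types A and C are such
  chains.\<close>

locale chain =
 fixes C :: "nat set" and A :: "nat => nat => int" and d :: "nat => int"
  and col :: "nat => nat" and K :: nat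
 assumes finite_C': "finite C" and K_pos: "K>=1"
  and col_in_C: "!!k. k < K ==> col k\<in>C"
  and col_step: "!!k. Suc k < K ==> col (Suc k) ~= col k"
  and A_diag': "!!a. a\<in>C ==> A a a = 2"
  and A_off': "!!a b. a\<in>C ==> b\<in>C ==> a ~= b ==> A a b<=0"
  and symmetrized': "!!a b. a\<in>C ==> b\<in>C ==> d a * A a b = d b * A b a"
  and A_col: "!!a k. a\<in>C ==> k < K ==> A a (col k)
    = 2 * of_bool (a = col k) - of_bool (Suc k < K & col (Suc k) = a) - of_bool (k > 0 & col (k - 1) = a)"
begin

definition S :: "(nat => nat) set" where
 "S = pv col ` {..K}"

lemma S_upd: "k<=K ==> (pv col k)(a := Suc (pv col k a))\<in>S \<longleftrightarrow> k < K & col k = a"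
proof
 assume k: "k<=K" and "(pv col k)(a := Suc (pv col k a))\<in>S"
 then obtain j where "j<=K" "(pv col k)(a := Suc (pv col k a)) = pv col j" by (auto simp: S_def)
 then show "k < K & col k = a" using pv_upd[of col k a j] by (metis Suc_le_eq)
next
 assume *: "k < K & col k = a"
 then have "(pv col k)(a := Suc (pv col k a)) = pv col (Suc k)" by auto
 moreover have "Suc k\<in>{..K}" using * by simp
 ultimately show "(pv col k)(a := Suc (pv col k a))\<in>S" unfolding S_def by (metis imageI)
qed

lemma S_dn: "k<=K ==> pv col k a > 0 & (pv col k)(a := pv col k a - 1)\<in>S \<longleftrightarrow> k > 0 & col (k - 1) = a"
proof
 assume k: "k<=K" and *: "pv col k a > 0 & (pv col k)(a := pv col k a - 1)\<in>S"
 then obtain j where j: "j<=K" "(pv col k)(a := pv col k a - 1) = pv col j" by (auto simp: S_def)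
 then have "(pv col j)(a := Suc (pv col j a)) = pv col k" using * by (auto simp flip: j(2))
 then have "k = Suc j & col j = a" by (rule pv_upd)
 then show "k > 0 & col (k - 1) = a" by simp
next
 assume *: "k<=K" "k > 0 & col (k - 1) = a"
 then obtain j where "k = Suc j" by (cases k) auto
 then show "pv col k a > 0 & (pv col k)(a := pv col k a - 1)\<in>S"
  using * by (auto simp: S_def intro!: image_eqI[of _ _ j])
qed

lemma minuscule':
 assumes "a\<in>C" "k<=K"
 shows "of_bool (a = col 0) - (\<Sum>b\<in>C. A a b * int (pv col k b))
  = of_bool (k < K & col k = a) - of_bool (k > 0 & col (k - 1) = a)"
 using assms(2)
proof (induction k)
 case 0
 then show ?case using K_pos by auto
next
 case (Suc k)
 have c: "col k\<in>C" using Suc col_in_C by simp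
 have "(\<Sum>b\<in>C. A a b * int (pv col (Suc k) b))
   = (\<Sum>b\<in>C. A a b * int (pv col k b) + (if b = col k then A a b else 0))"
  by (intro sum.cong) (auto simp: algebra_simps)
 also have "... = (\<Sum>b\<in>C. A a b * int (pv col k b)) + A a (col k)"
  using c finite_C' by (simp add: sum.distrib)
 finally show ?case using Suc A_col[OF assms(1), of k] col_step[of k] col_step[of "k - 1"] by auto
qed

sublocale walker C A d "col 0" S
proof
 show "finite C" by (rule finite_C')
 show "col 0\<in>C" using col_in_C K_pos by simp
 show "finite S" by (simp add: S_def)
 show "(%_. 0)\<in>S" unfolding S_def by (intro image_eqI[of _ _ 0]) auto
 show "u a = 0" if "u\<in>S" "a\<notin>C" for u a
 proof -
  have "pv col k a = 0" if "k<=K" for k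
   using that by (induction k) (use \<open>a\<notin>C\<close> col_in_C in auto)
  then show ?thesis using that by (auto simp: S_def)
 qed
 show "sup u v\<in>S" if "u\<in>S" "v\<in>S" for u v
  using that by (auto simp: S_def sup_pv)
 show "inf u v\<in>S" if "u\<in>S" "v\<in>S" for u v
  using that by (auto simp: S_def inf_pv)
 show "\<exists>a. u(a := Suc (u a))\<in>S & u a < v a" if uv: "u\<in>S" "v\<in>S" "u<=v" "u ~= v" for u v
 proof -
  obtain j k where jk: "u = pv col j" "v = pv col k" "j<=K" "k<=K" using uv by (auto simp: S_def)
  then have "j < k" using uv pv_le_iff pv_inject by (metis order_le_neq_trans)
  then have "pv col (Suc j)<=v" using jk by (auto intro!: pv_mono simp del: pv.simps)
  then have "u (col j) < v (col j)" using jk(1) by (simp add: le_fun_def) (metis Suc_le_eq)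
  then show ?thesis using S_upd[of j "col j"] jk \<open>j < k\<close> by auto
 qed
 show "A a a = 2" if "a\<in>C" for a using that by (rule A_diag')
 show "A a b<=0" if "a\<in>C" "b\<in>C" "a ~= b" for a b using that by (rule A_off')
 show "d a * A a b = d b * A b a" if "a\<in>C" "b\<in>C" for a b using that by (rule symmetrized')
 show "of_bool (a = col 0) - (\<Sum>b\<in>C. A a b * int (u b))
    = of_bool (u(a := Suc (u a))\<in>S) - of_bool (u a > 0 & u(a := u a - 1)\<in>S)"
  if uS: "u\<in>S" and "a\<in>C" for u a
 proof -
  obtain k where "u = pv col k" "k<=K" using uS by (auto simp: S_def)
  then show ?thesis using S_upd S_dn minuscule' that by simp
 qed
 show "u(a := u a - 1)\<notin>S" if uS: "u\<in>S" and "u(a := Suc (u a))\<in>S" "u a > 0" for u a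
 proof -
  obtain k where k: "u = pv col k" "k<=K" using uS by (auto simp: S_def)
  then have "k < K" "col k = a" using S_upd that by auto
  then show ?thesis using S_dn[of k a] k that(3) col_step[of "k - 1"] by auto
 qed
qed

lemma up_pv: "k<=K ==> up a (pv col k) \<longleftrightarrow> k < K & col k = a"
 using S_upd by (simp add: up_def)

lemma dn_pv: "k<=K ==> dn a (pv col k) \<longleftrightarrow> k > 0 & col (k - 1) = a"
 using S_dn by (simp add: dn_def)

lemma h_pv: "a\<in>C ==> k<=K ==> h a (pv col k)
  = of_bool (k < K & col k = a) - of_bool (k > 0 & col (k - 1) = a)"
 using minuscule' by (simp add: h_def)

lemma S_pv: "u\<in>S ==> \<exists>k\<le>K. u = pv col k"
 by (auto simp: S_def)

end

lemma count_image_diff: "count (image_mset (%x. x - c) M) x = count M (x + c :: int)"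
 by (induction M) auto

context rc
begin

lemma count_act:
 assumes "steps_ok u" "!!t a. t>=1 ==> u t a - u (t - 1) a<=zc J t a" "t>=1"
 shows "int (count (act u J a t) x) = int (count (J a t) (x + h a (u t)))
  - (int (u t a) - int (u (t - 1) a)) * of_bool (x + h a (u t) = 0)
  + (int (u (Suc t) a) - int (u t a)) * of_bool (x = 0)"
proof -
 have "u (t - 1) a<=u t a" "u t a<=u (Suc t) a" using steps_ok_mono[OF assms(1)] by auto
 moreover have "u t a - u (t - 1) a<=count (J a t) 0" using assms(2,3) by (simp add: zc_def)
 ultimately show ?thesis using assms(3)
  by (auto simp: act_def count_image_diff of_nat_diff)
qed

end

locale chain_rc = chain +
 fixes T :: nat
 assumes T_pos': "T>=1"
begin

sublocale rc C A d "col 0" S T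
 by unfold_locales (rule T_pos')

definition pos :: "(nat => nat) => nat" where
 "pos u = (THE k. k<=K & u = pv col k)"

lemma pos_pv [simp]: "k<=K ==> pos (pv col k) = k"
 unfolding pos_def by (rule the_equality) (auto simp: pv_inject)

lemma pv_pos: "u\<in>S ==> pv col (pos u) = u" and pos_le: "u\<in>S ==> pos u<=K"
 using S_pv by fastforce+

lemma pv_in_S: "k<=K ==> pv col k\<in>S"
 by (auto simp: S_def)

end

locale inj_chain_rc = chain_rc +
 assumes inj_col: "inj_on col {..<K}"
begin

lemma pv_inj: "k<=K ==> pv col k a = of_bool (\<exists>j<k. col j = a)"
proof (induction k)
 case (Suc k)
 have "~ (\<exists>j<k. col j = col k)"
 proof clarify
  fix j assume "j < k" "col j = col k"
  then show False using inj_onD[OF inj_col, of j k] Suc.prems by simp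
 qed
 then show ?case using Suc by (auto simp: less_Suc_eq)
qed simp

lemma pv_inj_diff:
 assumes "i<=j" "j<=K"
 shows "pv col j a<=pv col i a + s \<longleftrightarrow> (\<forall>k. i<=k & k < j & col k = a --> s>=1)"
proof -
 have "(\<exists>l<j. col l = a) & ~ (\<exists>l<i. col l = a) \<longleftrightarrow> (\<exists>k. i<=k & k < j & col k = a)"
 proof
  assume "\<exists>k. i<=k & k < j & col k = a"
  then obtain k where k: "i<=k" "k < j" "col k = a" by blast
  have "col l ~= a" if "l < i" for l
   using inj_col that k assms unfolding inj_on_def by (metis lessThan_iff less_le_trans not_less)
  then show "(\<exists>l<j. col l = a) & ~ (\<exists>l<i. col l = a)" using k by blast
 next
  assume *: "(\<exists>l<j. col l = a) & ~ (\<exists>l<i. col l = a)"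
  then obtain l where "l < j" "col l = a" by blast
  moreover from this * have "i<=l" using not_less by blast
  ultimately show "\<exists>k. i<=k & k < j & col k = a" by blast
 qed
 then show ?thesis using assms by (simp add: pv_inj) (auto simp: of_bool_def split: if_splits)
qed

text \<open>No colour repeats, so one singular part of a colour is enough to pass it: the walker
  runs on until it meets a colour without singular parts.\<close>

lemma fstep_pos:
 assumes "i<=K" "j<=K"
 shows "fstep \<sigma> (pv col i) (pv col j) \<longleftrightarrow>
  i<=j & (\<forall>k. i<=k & k < j --> \<sigma> (col k)>=1) & (j < K --> \<sigma> (col j) = 0)"
proof (cases "i<=j")
 case True
 have "pv col j (col j) = pv col i (col j) + \<sigma> (col j) \<longleftrightarrow> \<sigma> (col j) = 0" if "j < K"
 proof -
  have "col l ~= col j" if "l < j" for l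
   using inj_col that \<open>j < K\<close> unfolding inj_on_def by (metis lessThan_iff less_trans less_irrefl)
  then show ?thesis using True assms by (simp add: pv_inj) (metis True less_le_trans)
 qed
 then show ?thesis
  using True assms pv_in_S up_pv[OF assms(2)]
  by (auto simp: fstep_def pv_le_iff pv_inj_diff[OF True assms(2)])
qed (use assms in \<open>auto simp: fstep_def pv_le_iff\<close>)

lemma rstep_pos:
 assumes "i<=K" "j<=K"
 shows "rstep \<sigma> (pv col j) (pv col i) \<longleftrightarrow>
  i<=j & (\<forall>k. i<=k & k < j --> \<sigma> (col k)>=1) & (i > 0 --> \<sigma> (col (i - 1)) = 0)"
proof (cases "i<=j")
 case True
 have "pv col j (col (i - 1)) = pv col i (col (i - 1)) + \<sigma> (col (i - 1)) \<longleftrightarrow> \<sigma> (col (i - 1)) = 0" if "i > 0"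
 proof -
  have "\<exists>l<i. col l = col (i - 1)" using that by (intro exI[of _ "i - 1"]) simp
  moreover from this have "\<exists>l<j. col l = col (i - 1)" using True by (meson less_le_trans)
  ultimately show ?thesis using True assms by (simp add: pv_inj)
 qed
 then show ?thesis
  using True assms pv_in_S dn_pv[OF assms(1)]
  by (auto simp: rstep_def pv_le_iff pv_inj_diff[OF True assms(2)])
qed (use assms in \<open>auto simp: rstep_def pv_le_iff\<close>)

end

section \<open>Two walkers from opposite ends of a diagram of type A\<close>

definition cartan :: "nat => nat => int" where
 "cartan a b = (if a = b then 2 else if a = Suc b | b = Suc a then -1 else 0)"

definition lcol :: "nat => nat" where
 "lcol k = Suc k"

definition rcol :: "nat => nat => nat" where
 "rcol n k = 2 * n - Suc 0 - k"

lemma pv_lcol: "pv lcol k a = of_bool (1<=a & a<=k)"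
 by (induction k) (auto simp: lcol_def)

lemma pv_rcol: "n>=1 ==> k<=2 * n - Suc 0 ==> pv (rcol n) k a = of_bool (2 * n - k<=a & a<=2 * n - Suc 0)"
 by (induction k) (auto simp: rcol_def)

text \<open>\<open>L\<close> walks in the vector representation starting with colour 1, and
  \<open>R\<close> in its dual starting with colour 2n - 1. The constants \<open>RC\<close>,
  \<open>vac\<close>, \<open>st\<close> and \<open>np\<close> do not mention the walker, so a
  configuration passes from \<open>L\<close> to \<open>R\<close> without conversion.\<close>

locale sym_pair =
 fixes n T :: nat
 assumes n_pos: "n>=1" and T_pos: "T>=1"
begin

abbreviation "nn \<equiv> 2 * n - Suc 0"
abbreviation "lv \<equiv> pv lcol"
abbreviation "rv \<equiv> pv (rcol n)"
abbreviation "lpath p \<equiv> (%t. lv (p t))"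
abbreviation "rpath q \<equiv> (%t. rv (q t))"

sublocale L: inj_chain_rc "{Suc 0..nn}" cartan "%_. 1" lcol "nn" T
 using n_pos T_pos by unfold_locales (auto simp: cartan_def lcol_def inj_on_def)

sublocale R: inj_chain_rc "{Suc 0..nn}" cartan "%_. 1" "rcol n" "nn" T
proof unfold_locales
 show "cartan a (rcol n k) = 2 * of_bool (a = rcol n k) - of_bool (Suc k < nn & rcol n (Suc k) = a)
   - of_bool (k > 0 & rcol n (k - 1) = a)"
  if "a\<in>{Suc 0..nn}" "k < nn" for a k
 proof -
  define m where "m = nn - k"
  have "Suc k < nn & rcol n (Suc k) = a \<longleftrightarrow> m = Suc a"
   "k > 0 & rcol n (k - 1) = a \<longleftrightarrow> a = Suc m"
   using that by (auto simp: m_def rcol_def)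
  moreover have "rcol n k = m" by (simp add: m_def rcol_def)
  ultimately show ?thesis by (auto simp: cartan_def)
 qed
qed (use n_pos T_pos in \<open>auto simp: cartan_def rcol_def inj_on_def\<close>)

definition sym :: "riggings => bool" where
 "sym J \<longleftrightarrow> (\<forall>a\<in>{Suc 0..nn}. \<forall>t. J (2 * n - a) t = J a t)"

end

context sym_pair
begin

text \<open>
 \<open>p\<close> and \<open>q\<close> are the positions of the two walkers of a symmetric rigged configuration, counted from opposite ends of the diagram.
\<close>
definition trans :: "nat => nat => nat => nat => bool" where
 "trans p q p' q' \<longleftrightarrow>
  (p = q & p' = q' & p<=p' & (p'<=n - 1 | n<=p)) |
  (p = q & p<=p' & p'<=n - 1 & q' = nn - p') |
  (p<=n - 1 & q = nn - p & p' = q' & q<=p') |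
  (p = n - 1 & q = n & p' = n - 1 & q' = n) |
  (p' = nn & q' = 0 & q = 0 & (p = 0 | p = nn))"

lemma rcol_eq: "rcol n k = nn - k"
 by (simp add: rcol_def)

lemma h_l: "1<=a ==> a<=nn ==> k<=nn ==>
  L.h a (lv k) = of_bool (a = Suc k) - of_bool (a = k)"
 by (subst L.h_pv) (auto simp: lcol_def)

lemma h_r: "1<=a ==> a<=nn ==> k<=nn ==>
  R.h a (rv k) = of_bool (a + k = nn) - of_bool (a + k = 2 * n)"
 by (subst R.h_pv) (auto simp: rcol_def)

context
 fixes J :: riggings and p q :: "nat => nat"
 assumes nonneg: "\<forall>a t. \<forall>x\<in>#J a t. 0<=x" and symJ: "sym J"
  and u: "L.fwalk J (lpath p)" and p_le: "!!t. p t<=nn"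
  and v: "R.fwalk (L.act (lpath p) J) (rpath q)" and q_le: "!!t. q t<=nn"
  and ok: "L.steps_ok (lpath p)"
begin

abbreviation "J1 \<equiv> L.act (lpath p) J"

lemma p0: "p 0 = 0" and q0: "q 0 = 0"
proof -
 have "lv (p 0) = lv 0" using u by (simp add: L.fwalk_def)
 then show "p 0 = 0" by (simp add: pv_inject del: pv.simps)
 have "rv (q 0) = rv 0" using v by (simp add: R.fwalk_def)
 then show "q 0 = 0" by (simp add: pv_inject del: pv.simps)
qed

lemma l_step:
 shows "p s<=p (Suc s)" "p s<=k ==> k < p (Suc s) ==> L.zc J (Suc s) (Suc k)>=1"
  "p (Suc s) < nn ==> L.zc J (Suc s) (Suc (p (Suc s))) = 0"
proof -
 have "L.fstep (L.zc J (Suc s)) (lv (p s)) (lv (p (Suc s)))" using u by (simp add: L.fwalk_def)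
 then have *: "p s<=p (Suc s) & (\<forall>k. p s<=k & k < p (Suc s) --> L.zc J (Suc s) (lcol k)>=1)
   & (p (Suc s) < nn --> L.zc J (Suc s) (lcol (p (Suc s))) = 0)"
  using L.fstep_pos[OF p_le p_le] by blast
 show "p s<=p (Suc s)" using * by blast
 show "L.zc J (Suc s) (Suc k)>=1" if "p s<=k" "k < p (Suc s)" using * that by (auto simp: lcol_def)
 show "L.zc J (Suc s) (Suc (p (Suc s))) = 0" if "p (Suc s) < nn" using * that by (auto simp: lcol_def)
qed

lemma r_fstep: "R.fstep (R.zc J1 (Suc s)) (rv (q s)) (rv (q (Suc s)))"
 using v by (simp add: R.fwalk_def)

lemma r_step:
 shows "q s<=q (Suc s)" "q s<=k ==> k < q (Suc s) ==> R.zc J1 (Suc s) (nn - k)>=1"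
  "q (Suc s) < nn ==> R.zc J1 (Suc s) (nn - q (Suc s)) = 0"
proof -
 have *: "q s<=q (Suc s) & (\<forall>k. q s<=k & k < q (Suc s) --> R.zc J1 (Suc s) (rcol n k)>=1)
   & (q (Suc s) < nn --> R.zc J1 (Suc s) (rcol n (q (Suc s))) = 0)"
  using R.fstep_pos[OF q_le q_le] r_fstep by blast
 show "q s<=q (Suc s)" using * by blast
 show "R.zc J1 (Suc s) (nn - k)>=1" if "q s<=k" "k < q (Suc s)" using * that by (auto simp: rcol_def)
 show "R.zc J1 (Suc s) (nn - q (Suc s)) = 0" if "q (Suc s) < nn" using * that by (auto simp: rcol_def)
qed

lemma r_target:
 assumes "q s<=X" "X<=nn"
  "!!k. q s<=k ==> k < X ==> R.zc J1 (Suc s) (nn - k)>=1"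
  "X < nn ==> R.zc J1 (Suc s) (nn - X) = 0"
 shows "q (Suc s) = X"
proof -
 have "R.fstep (R.zc J1 (Suc s)) (rv (q s)) (rv X)"
  using R.fstep_pos[OF q_le assms(2)] assms by (simp add: rcol_eq)
 then have "rv (q (Suc s)) = rv X" using R.fstep_unique r_fstep by blast
 then show ?thesis by (simp add: pv_inject)
qed

lemma zc_mirror: "1<=a ==> a<=nn ==> L.zc J t (2 * n - a) = L.zc J t a"
 using symJ by (simp add: sym_def L.zc_def)

text \<open>The case of rigging 0 in \<open>count_act\<close>. The colours \<open>p t\<close> and
  \<open>Suc (p t)\<close> are singled out because these are the ones where \<open>h\<close> is
  nonzero.\<close>

lemma zc_J1:
 assumes "t>=1" "1<=a" "a<=nn"
 shows "int (R.zc J1 t a) = int (count (J a t) (of_bool (a = Suc (p t)) - of_bool (a = p t)))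
  - of_bool (p (t - 1) < a & a<=p t & a ~= Suc (p t) & a ~= p t) + of_bool (p t < a & a<=p (Suc t))"
proof -
 have sel: "lv (p t) a - lv (p (t - 1)) a<=L.zc J t a" if "t>=1" for t a
  using L.fwalk_sel[OF u that] .
 have "p (t - 1)<=p t" "p t<=p (Suc t)" using l_step(1)[of "t - 1"] l_step(1)[of t] assms(1) by auto
 then have e: "(int (lv (p t) a) - int (lv (p (t - 1)) a)) * of_bool (0 + L.h a (lv (p t)) = 0)
   = of_bool (p (t - 1) < a & a<=p t & a ~= Suc (p t) & a ~= p t)"
  "(int (lv (p (Suc t)) a) - int (lv (p t) a)) * of_bool ((0::int) = 0)
   = of_bool (p t < a & a<=p (Suc t))"
  using assms(2) unfolding h_l[OF assms(2,3) p_le] pv_lcol by (auto split: if_splits)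
 show ?thesis
  using L.count_act[OF ok sel assms(1), of a 0] unfolding e
  unfolding h_l[OF assms(2,3) p_le] by (simp add: R.zc_def)
qed

lemma zc_J1_created: "t>=1 ==> p t < a ==> a<=p (Suc t) ==> R.zc J1 t a>=1"
 using zc_J1[of t a] p_le[of "Suc t"] by auto

text \<open>At colour \<open>p t\<close> the value of \<open>h\<close> is -1, so colabels that stay
  are at least 1 afterwards, and the walk creates no part of this colour at length
  \<open>t\<close>.\<close>

lemma zc_J1_dn: "t>=1 ==> p t>=1 ==> R.zc J1 t (p t) = 0"
proof -
 assume *: "t>=1" "p t>=1"
 have "count (J (p t) t) (- 1) = 0" using nonneg by (metis not_in_iff neg_0_le_iff_le not_one_le_zero)
 then show "R.zc J1 t (p t) = 0" using zc_J1[OF *(1) *(2) p_le] by simp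
qed

lemma zc_J1_same:
 assumes "t>=1" "1<=a" "a<=nn" "a ~= p t" "a ~= Suc (p t)"
  "a<=p (t - 1) | p t < a" "a<=p t | p (Suc t) < a"
 shows "R.zc J1 t a = L.zc J t a"
 using zc_J1[OF assms(1-3)] assms(4-) by (auto simp: L.zc_def)

text \<open>A walker that crosses the middle reaches at least the mirror image of its starting
  point. If it stopped earlier, at \<open>k\<close>, colour \<open>Suc k\<close> would have no
  singular part, while its mirror colour was passed in the same step.\<close>

lemma l_crossing:
 assumes "p s<=n - 1" "n<=p (Suc s)"
 shows "nn - p s<=p (Suc s)"
proof (rule ccontr)
 assume *: "~ ?thesis"
 let ?k = "p (Suc s)"
 have "L.zc J (Suc s) (Suc (2 * n - 2 - ?k))>=1"
  by (rule l_step(2)) (use * assms in auto)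
 also have "Suc (2 * n - 2 - ?k) = 2 * n - Suc ?k" using * assms by simp
 also have "L.zc J (Suc s) (2 * n - Suc ?k) = L.zc J (Suc s) (Suc ?k)"
  by (rule zc_mirror) (use * in auto)
 finally show False using l_step(3)[of s] * by simp
qed

text \<open>Normally the second walker copies the first one from its own end. If the first is about
  to cross the middle, the parts it leaves behind at length \<open>t\<close> carry the second walker
  ahead to the mirror position. At \<open>p t = n - 1\<close> the second walker may also have passed
  the middle colour by itself, which is the state of the letter 0.\<close>

definition inv :: "nat => bool" where
 "inv t \<longleftrightarrow> (if p t<=n - 1 & n<=p (Suc t) then q t = nn - p t
  else if p t ~= n - 1 then q t = p t else q t = n - 1 | q t = n)"

text \<open>A crossing at length 1 starts at position 0 and hence, by \<open>l_crossing\<close>,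
  ends at the far end at once. From then on the first colour of the second walker has no singular
  part, and it never starts.\<close>

lemma phi_walk:
 assumes "n<=p 1"
 shows "p (Suc t) = nn" "q t = 0"
proof -
 have p1: "p 1 = nn" using l_crossing[of 0] p0 p_le[of 1] assms by simp
 show pt: "p (Suc t) = nn" for t
 proof (induction t)
  case (Suc t)
  then show ?case using l_step(1)[of "Suc t"] p_le[of "Suc (Suc t)"] by simp
 qed (use p1 in simp)
 show "q t = 0"
 proof (induction t)
  case (Suc t)
  show ?case
  proof (rule r_target)
   show "R.zc J1 (Suc t) (nn - 0) = 0" using zc_J1_dn[of "Suc t"] pt[of t] n_pos by simp
  qed (use Suc in auto)
 qed (rule q0)
qed

text \<open>Colours left alone by the first walker keep their singular parts, and by symmetry the
  second walker finds there what the first one found. The cases differ in how the parts removed or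
  created by the first walker interfere near the middle.\<close>

lemma inv_step:
 assumes inv: "inv s" and p1: "p 1<=n - 1"
 shows "inv (Suc s)"
proof -
 let ?t = "Suc s"
 have mono: "p s<=p ?t" "p ?t<=p (Suc ?t)" using l_step(1) by auto
 \<comment> \<open>\<open>mir\<close> lets the second walker pass the mirror images of the colours
   that the first one passed, and \<open>mir0\<close> stops it where the first one stopped.\<close>
 have mir: "R.zc J1 ?t (nn - k)>=1"
  if "p s<=k" "k < p ?t" "nn - k ~= p ?t" "nn - k ~= Suc (p ?t)"
   "nn - k<=p s | p ?t < nn - k" "nn - k<=p ?t | p (Suc ?t) < nn - k" for k
 proof -
  have k: "k < nn" using that p_le[of ?t] by simp
  have "R.zc J1 ?t (nn - k) = L.zc J ?t (2 * n - Suc k)"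
   using zc_J1_same[of ?t "nn - k"] that k by simp
  also have "... = L.zc J ?t (Suc k)" using zc_mirror[of "Suc k"] k by simp
  finally show ?thesis using l_step(2)[OF that(1,2)] by simp
 qed
 have mir0: "R.zc J1 ?t (nn - p ?t) = 0"
  if "p ?t < nn" "nn - p ?t ~= p ?t" "nn - p ?t ~= Suc (p ?t)"
   "nn - p ?t<=p s | p ?t < nn - p ?t"
   "nn - p ?t<=p ?t | p (Suc ?t) < nn - p ?t"
 proof -
  have "R.zc J1 ?t (nn - p ?t) = L.zc J ?t (2 * n - Suc (p ?t))"
   using zc_J1_same[of ?t "nn - p ?t"] that by simp
  also have "... = L.zc J ?t (Suc (p ?t))" using zc_mirror[of "Suc (p ?t)"] that by simp
  finally show ?thesis using l_step(3)[of s] that by simp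
 qed
 consider (small) "p ?t < n - 1" "p (Suc ?t)<=n - 1"
  | (edge) "p ?t = n - 1" "p (Suc ?t)<=n - 1"
  | (cross) "p ?t<=n - 1" "n<=p (Suc ?t)"
  | (big) "n<=p ?t" by linarith
 then show ?thesis
 proof cases
  case small
  then have q: "q s = p s" using inv mono by (auto simp: inv_def)
  have "q ?t = p ?t"
  proof (rule r_target)
   show "q s<=p ?t" "p ?t<=nn" using q mono p_le by auto
   show "R.zc J1 ?t (nn - k)>=1" if "q s<=k" "k < p ?t" for k
    by (rule mir) (use that q small mono in auto)
   show "R.zc J1 ?t (nn - p ?t) = 0" if "p ?t < nn"
    by (rule mir0) (use that small mono in auto)
  qed
  then show ?thesis using small n_pos by (auto simp: inv_def)
 next
  case edge
  have qs: "q s = p s | (p s = n - 1 & q s = n)" using inv mono edge by (auto simp: inv_def split: if_splits)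
  have "q ?t>=n - 1"
  proof (rule ccontr)
   assume *: "~ n - 1<=q ?t"
   then have "q s = p s" using qs r_step(1)[of s] by auto
   have "R.zc J1 ?t (nn - q ?t)>=1"
    by (rule mir) (use * edge mono r_step(1)[of s] \<open>q s = p s\<close> in auto)
   moreover have "q ?t < nn" using * by simp
   ultimately show False using r_step(3)[of s] by simp
  qed
  moreover have "q ?t<=n"
  proof (rule ccontr)
   assume *: "~ q ?t<=n"
   have "R.zc J1 ?t (nn - n)>=1" using r_step(2)[of s n] * qs edge mono by auto
   moreover have "n - 1>=1" using * q_le[of ?t] by simp
   ultimately show False using zc_J1_dn[of ?t] edge by simp
  qed
  ultimately show ?thesis using edge by (auto simp: inv_def)
 next
  case cross
  have qs: "q s = p s | (p s = n - 1 & q s = n & p ?t = n - 1)" using inv mono cross by (auto simp: inv_def split: if_splits)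
  have c: "nn - p ?t<=p (Suc ?t)" using l_crossing cross by simp
  have "q ?t = nn - p ?t"
  proof (rule r_target)
   show "q s<=nn - p ?t" using qs mono cross n_pos by auto
   show "R.zc J1 ?t (nn - k)>=1" if k: "q s<=k" "k < nn - p ?t" for k
   proof (cases "nn - k<=p (Suc ?t)")
    case True
    then show ?thesis using zc_J1_created[of ?t "nn - k"] k by simp
   next
    case False
    show ?thesis by (rule mir) (use False c k qs cross in auto)
   qed
   show "R.zc J1 ?t (nn - (nn - p ?t)) = 0" if "nn - p ?t < nn"
    using zc_J1_dn[of ?t] that p_le[of ?t] by simp
  qed simp
  then show ?thesis using cross by (simp add: inv_def)
 next
  case big
  have s: "s>=1" using big p1 n_pos by (cases s) auto
  have qs: "(n<=p s & q s = p s) | (p s<=n - 1 & q s = nn - p s)"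
   using inv big s by (auto simp: inv_def split: if_splits)
  have c: "p s<=n - 1 ==> nn - p s<=p ?t" using l_crossing big by simp
  have "q ?t = p ?t"
  proof (rule r_target)
   show "q s<=p ?t" "p ?t<=nn" using qs c mono p_le by auto
   show "R.zc J1 ?t (nn - k)>=1" if "q s<=k" "k < p ?t" for k
    by (rule mir) (use that qs big mono in auto)
   show "R.zc J1 ?t (nn - p ?t) = 0" if "p ?t < nn"
    by (rule mir0) (use that big qs c mono in auto)
  qed
  then show ?thesis using big by (auto simp: inv_def)
 qed
qed

lemma inv_all:
 assumes "p 1<=n - 1"
 shows "inv t"
proof (induction t)
 case 0
 then show ?case using assms p0 q0 n_pos by (auto simp: inv_def)
qed (use inv_step assms in blast)

lemma forward_trans: "trans (p t) (q t) (p (Suc t)) (q (Suc t))"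
proof (cases "p 1<=n - 1")
 case True
 have m: "p t<=p (Suc t)" "p (Suc t)<=p (Suc (Suc t))" "q t<=q (Suc t)" using l_step r_step by auto
 note i = inv_all[OF True, of t, unfolded inv_def] and i' = inv_all[OF True, of "Suc t", unfolded inv_def]
 consider (cross) "p t<=n - 1" "n<=p (Suc t)" | (big) "n<=p t"
  | (pre) "p (Suc t)<=n - 1" "n<=p (Suc (Suc t))"
  | (small) "p (Suc t) < n - 1" "p (Suc (Suc t))<=n - 1"
  | (edge) "p (Suc t) = n - 1" "p (Suc (Suc t))<=n - 1" by linarith
 then show ?thesis
 proof cases
  case cross
  then have "q t = nn - p t" "q (Suc t) = p (Suc t)" using i i' by (auto split: if_splits)
  then show ?thesis using cross l_crossing[OF cross] by (simp add: trans_def)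
 next
  case big
  then have "q t = p t" "q (Suc t) = p (Suc t)" using i i' m by (auto split: if_splits)
  then show ?thesis using big m by (simp add: trans_def)
 next
  case pre
  then have q': "q (Suc t) = nn - p (Suc t)" using i' by (auto split: if_splits)
  have "~ (p t<=n - 1 & n<=p (Suc t))" using pre n_pos by linarith
  then have "q t = p t | p t = n - 1 & q t = n" using i by argo
  then consider "q t = p t" | "p t = n - 1" "q t = n" "p (Suc t) = n - 1" using m pre by linarith
  then show ?thesis
  proof cases
   case 2
   moreover have "nn - (n - 1) = n" using n_pos by simp
   ultimately show ?thesis using q' by (simp add: trans_def)
  qed (use pre m q' in \<open>simp add: trans_def\<close>)
 next
  case small
  then have "q t = p t" "q (Suc t) = p (Suc t)" using i i' m by (auto split: if_splits)
  then show ?thesis using small m by (simp add: trans_def)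
 next
  case edge
  have pt: "p t<=n - 1" "~ (p t<=n - 1 & n<=p (Suc t))" using edge m n_pos by linarith+
  have "q t = p t | p t = n - 1 & q t = n" using i pt by argo
  moreover have "q (Suc t) = n - 1 | q (Suc t) = n"
  proof -
   have "~ (p (Suc t)<=n - 1 & n<=p (Suc (Suc t)))" using edge n_pos by linarith
   then show ?thesis using edge(1) i' by argo
  qed
  moreover have "nn - (n - 1) = n" using n_pos by simp
  ultimately consider "q t = p t" "q (Suc t) = n - 1" | "q t = p t" "q (Suc t) = n"
   | "p t = n - 1" "q t = n" "q (Suc t) = n" using m(3) n_pos by linarith
  then show ?thesis using edge(1) pt(1) \<open>nn - (n - 1) = n\<close> unfolding trans_def by cases auto
 qed
next
 case False
 then have phi: "n<=p 1" by simp
 note phi_walk[OF phi, of t] phi_walk(2)[OF phi, of "Suc t"]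
 moreover have "p t = 0 | p t = nn" using phi_walk(1)[OF phi] p0 by (cases t) auto
 ultimately show ?thesis by (simp add: trans_def)
qed

lemma forward_phi: "p (Suc t) = nn ==> q (Suc t) = 0 ==> n<=p 1"
proof (rule ccontr)
 assume *: "p (Suc t) = nn" "q (Suc t) = 0" "~ n<=p 1"
 then have "inv (Suc t)" using inv_all[of "Suc t"] by simp
 then show False using * n_pos by (auto simp: inv_def split: if_splits)
qed

text \<open>The first walker stopped at \<open>n - 1\<close>, so colour \<open>n\<close> had no
  rigging 0. Its riggings are then lowered by one, hence a part that the second walker can use there
  had rigging 1, unless the first walker created it by crossing at the next length.\<close>

lemma forward_one:
 assumes "q s < n" "q (Suc s) = n" "p (Suc s) = n - 1" "p (Suc (Suc s))<=n - 1"
 shows "1 \<in># J n (Suc s)"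
proof -
 have "R.zc J1 (Suc s) (nn - (n - 1))>=1"
  using r_step(2)[of s "n - 1"] assms n_pos by simp
 then have "R.zc J1 (Suc s) n>=1" using n_pos by (simp add: numeral_2_eq_2)
 moreover have "of_bool (n = Suc (p (Suc s))) - of_bool (n = p (Suc s)) = (1::int)"
  "n<=nn" "~ n<=p (Suc (Suc s))" "~ n<=p (Suc s)"
  using n_pos assms by auto
 ultimately have "count (J n (Suc s)) 1>=1"
  using zc_J1[of "Suc s" n] n_pos by (auto simp del: of_bool_eq_iff)
 then show ?thesis by (metis count_eq_zero_iff not_one_le_zero)
qed

text \<open>One goes back to the length at which the second walker entered position \<open>n\<close>
  and applies \<open>forward_one\<close> there. The disjunction excludes that this entry was caused
  by an imminent crossing.\<close>

lemma forward_zero: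
 assumes "p 1<=n - 1" "p t = n - 1" "q t = n" "t>=1" "p (Suc t)<=n - 1 | q (t - 1) = n"
 shows "\<exists>s. 1 \<in># J n s"
proof -
 have "t>=1 ==> p t = n - 1 ==> q t = n ==> p (Suc t)<=n - 1 | q (t - 1) = n ==> ?thesis" for t
 proof (induction t)
  case (Suc s)
  show ?case
  proof (cases "q s = n")
   case True
   have "p s<=n - 1" using l_step(1)[of s] Suc.prems by simp
   then have ps: "p s = n - 1" using inv_all[OF assms(1), of s] True Suc.prems by (auto simp: inv_def split: if_splits)
   have "s>=1" using True q0 n_pos by (cases s) auto
   then show ?thesis using Suc.IH True ps Suc.prems by simp
  next
   case False
   then have qs: "q s < n" using r_step(1)[of s] Suc.prems by simp
   then have np: "p (Suc (Suc s))<=n - 1" using Suc.prems by auto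
   then show ?thesis using forward_one[OF qs] Suc.prems by blast
  qed
 qed simp
 then show ?thesis using assms by blast
qed

end

end

section \<open>The pair of walkers run backwards\<close>

lemma count_image_plus: "count (image_mset (%x. x + c) M) x = count M (x - c :: int)"
 by (induction M) auto

context rc
begin

lemma count_unact:
 assumes "steps_ok u" "!!t a. t>=1 ==> u (Suc t) a - u t a<=zc J t a" "t>=1"
 shows "int (count (unact u J a t) x) = int (count (J a t) (x - h a (u t)))
  - (int (u (Suc t) a) - int (u t a)) * of_bool (x - h a (u t) = 0)
  + (int (u t a) - int (u (t - 1) a)) * of_bool (x = 0)"
proof -
 have "u (t - 1) a<=u t a" "u t a<=u (Suc t) a" using steps_ok_mono[OF assms(1)] by auto
 moreover have "u (Suc t) a - u t a<=count (J a t) 0" using assms(2,3) by (simp add: zc_def)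
 ultimately show ?thesis using assms(3)
  by (auto simp: unact_def count_image_plus of_nat_diff)
qed

end

context sym_pair
begin

context
 fixes M :: riggings and p q :: "nat => nat" and xl xr :: nat
 assumes nonneg: "\<forall>a t. \<forall>x\<in>#M a t. 0<=x" and symM: "sym M"
  and v: "R.rwalk M (rv xr) (rpath q)" and q_le: "!!t. q t<=nn"
  and u: "L.rwalk (R.unact (rpath q) M) (lv xl) (lpath p)"
  and p_le: "!!t. p t<=nn"
begin

abbreviation "M1 \<equiv> R.unact (rpath q) M"

lemma rp0: "p 0 = 0" and rq0: "q 0 = 0"
 and rp_top: "t>=T ==> p t = xl" and rq_top: "t>=T ==> q t = xr"
proof -
 have "lv (p 0) = lv 0" using u by (simp add: L.rwalk_def)
 then show "p 0 = 0" by (simp add: pv_inject del: pv.simps)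
 have "rv (q 0) = rv 0" using v by (simp add: R.rwalk_def)
 then show "q 0 = 0" by (simp add: pv_inject del: pv.simps)
 show "p t = xl" if "t>=T" using u that by (simp add: L.rwalk_def pv_inject)
 show "q t = xr" if "t>=T" using v that by (simp add: R.rwalk_def pv_inject)
qed

lemma rr_step:
 assumes "t>=1"
 shows "q t<=q (Suc t)" "q t<=k ==> k < q (Suc t) ==> R.zc M t (nn - k)>=1"
  "q t > 0 ==> R.zc M t (2 * n - q t) = 0"
proof -
 have "R.rstep (R.zc M t) (rv (q (Suc t))) (rv (q t))" using v assms by (simp add: R.rwalk_def)
 then have *: "q t<=q (Suc t) & (\<forall>k. q t<=k & k < q (Suc t) --> R.zc M t (rcol n k)>=1)
   & (q t > 0 --> R.zc M t (rcol n (q t - 1)) = 0)"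
  using R.rstep_pos[OF q_le q_le] by blast
 show "q t<=q (Suc t)" using * by blast
 show "R.zc M t (nn - k)>=1" if "q t<=k" "k < q (Suc t)" using * that by (auto simp: rcol_def)
 show "R.zc M t (2 * n - q t) = 0" if "q t > 0"
  using * that by (simp add: rcol_def)
qed

lemma rl_rstep: "t>=1 ==> L.rstep (L.zc M1 t) (lv (p (Suc t))) (lv (p t))"
 using u by (simp add: L.rwalk_def)

lemma rl_step:
 assumes "t>=1"
 shows "p t<=p (Suc t)" "p t<=k ==> k < p (Suc t) ==> L.zc M1 t (Suc k)>=1"
  "p t > 0 ==> L.zc M1 t (p t) = 0"
proof -
 have *: "p t<=p (Suc t) & (\<forall>k. p t<=k & k < p (Suc t) --> L.zc M1 t (lcol k)>=1)
   & (p t > 0 --> L.zc M1 t (lcol (p t - 1)) = 0)"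
  using L.rstep_pos[OF p_le p_le] rl_rstep[OF assms] by blast
 show "p t<=p (Suc t)" using * by blast
 show "L.zc M1 t (Suc k)>=1" if "p t<=k" "k < p (Suc t)" using * that by (auto simp: lcol_def)
 show "L.zc M1 t (p t) = 0" if "p t > 0" using * that by (simp add: lcol_def)
qed

lemma rl_target:
 assumes "t>=1" "X<=p (Suc t)"
  "!!k. X<=k ==> k < p (Suc t) ==> L.zc M1 t (Suc k)>=1"
  "X > 0 ==> L.zc M1 t X = 0"
 shows "p t = X"
proof -
 have X: "X<=nn" using assms(2) p_le order_trans by blast
 have "L.rstep (L.zc M1 t) (lv (p (Suc t))) (lv X)"
  using L.rstep_pos[OF X p_le] assms by (simp add: lcol_def)
 then have "lv (p t) = lv X" using L.rstep_unique rl_rstep[OF assms(1)] by blast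
 then show ?thesis by (simp add: pv_inject)
qed

lemma rzc_mirror: "1<=a ==> a<=nn ==> R.zc M t (2 * n - a) = R.zc M t a"
 using symM by (simp add: sym_def R.zc_def)

lemma zc_M1:
 assumes "t>=1" "1<=a" "a<=nn"
 shows "int (L.zc M1 t a) = int (count (M a t) (of_bool (a + q t = 2 * n) - of_bool (a + q t = nn)))
  - of_bool (2 * n - q (Suc t)<=a & a < 2 * n - q t & a + q t ~= nn)
  + of_bool (2 * n - q t<=a & a < 2 * n - q (t - 1))"
proof -
 have sel: "rv (q (Suc t)) a - rv (q t) a<=R.zc M t a" if "t>=1" for t a
  using R.rwalk_sel[OF v that] .
 note ok = R.rwalk_steps_ok[OF v]
 have m1: "q (t - 1)<=q t" "q t<=q (Suc t)"
  using rr_step(1)[of "t - 1"] rr_step(1)[of t] assms(1) rq0 by (cases "t = 1"; simp)+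
 have e: "(int (rv (q (Suc t)) a) - int (rv (q t) a)) * of_bool (0 - R.h a (rv (q t)) = 0)
   = of_bool (2 * n - q (Suc t)<=a & a < 2 * n - q t & a + q t ~= nn)"
  "(int (rv (q t) a) - int (rv (q (t - 1)) a)) * of_bool ((0::int) = 0)
   = of_bool (2 * n - q t<=a & a < 2 * n - q (t - 1))"
  using assms(2,3) m1 n_pos unfolding h_r[OF assms(2,3) q_le] pv_rcol[OF n_pos q_le] by (auto split: if_splits)
 have h': "0 - R.h a (rv (q t)) = of_bool (a + q t = 2 * n) - of_bool (a + q t = nn)"
  unfolding h_r[OF assms(2,3) q_le] by simp
 show ?thesis
  using R.count_unact[OF ok sel assms(1), of a 0] unfolding e unfolding h' by (simp add: R.zc_def)
qed

lemma zc_M1_created: "t>=1 ==> 1<=a ==> a<=nn ==> 2 * n - q t<=a ==> a < 2 * n - q (t - 1) ==> L.zc M1 t a>=1"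
 using zc_M1[of t a] by auto

lemma zc_M1_up:
 assumes "t>=1" "q t < nn"
 shows "L.zc M1 t (nn - q t) = 0"
proof -
 let ?a = "nn - q t"
 have "count (M ?a t) (- 1) = 0" using nonneg by (metis not_in_iff neg_0_le_iff_le not_one_le_zero)
 moreover have e: "of_bool (?a + q t = 2 * n) - of_bool (?a + q t = nn) = (-1::int)"
  "of_bool (2 * n - q (Suc t)<=?a & ?a < 2 * n - q t & ?a + q t ~= nn) = (0::int)"
  "of_bool (2 * n - q t<=?a & ?a < 2 * n - q (t - 1)) = (0::int)"
  "1<=?a" "?a<=nn" using assms by auto
 ultimately show ?thesis using zc_M1[OF assms(1) e(4,5)] unfolding e(1-3) by simp
qed

lemma zc_M1_same:
 assumes "t>=1" "1<=a" "a<=nn" "a + q t ~= 2 * n" "a + q t ~= nn"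
  "a + q (Suc t) < 2 * n | a + q t>=2 * n" "a + q t < 2 * n | a + q (t - 1)>=2 * n"
 shows "L.zc M1 t a = R.zc M t a"
proof -
 have "~ (2 * n - q (Suc t)<=a & a < 2 * n - q t & a + q t ~= nn)"
  "~ (2 * n - q t<=a & a < 2 * n - q (t - 1))" using assms(6,7) by linarith+
 then have e: "of_bool (2 * n - q (Suc t)<=a & a < 2 * n - q t & a + q t ~= nn) = (0::int)"
  "of_bool (2 * n - q t<=a & a < 2 * n - q (t - 1)) = (0::int)" by (simp_all only: of_bool_eq)
 show ?thesis using zc_M1[OF assms(1-3)] assms(4,5) unfolding e by (simp add: L.zc_def)
qed

text \<open>As in \<open>l_crossing\<close>: passing the colour \<open>q t\<close> would require a
  singular part there, while the mirror colour, at which the walker stopped, has none.\<close>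

lemma r_crossing:
 assumes "t>=1" "q t<=n - 1" "n<=q (Suc t)"
 shows "q t + q (Suc t)<=nn"
proof (rule ccontr)
 assume *: "~ ?thesis"
 have q1: "q t>=1" using * q_le[of "Suc t"] by simp
 have "R.zc M t (nn - (nn - q t))>=1"
  by (rule rr_step(2)[OF assms(1)]) (use * assms in linarith)+
 also have "nn - (nn - q t) = q t" using q_le[of t] by simp
 also have "R.zc M t (q t) = R.zc M t (2 * n - q t)" using rzc_mirror[OF q1 q_le] by simp
 finally show False using rr_step(3)[OF assms(1)] q1 by simp
qed

text \<open>The right walk is undone first and takes the lead, so the exceptional case lies just
  after its crossing instead of just before the crossing of the left walker.\<close>

definition rinv :: "nat => bool" where
 "rinv t \<longleftrightarrow> (if n<=q t & q (t - 1)<=n - 1 then p t + q t = nn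
  else if q t ~= n then p t = q t else p t = n - 1 | p t = n)"

lemma rphi_walk:
 assumes "xr = 0" "xl = nn"
 shows "q t = 0" "p (Suc t) = nn"
proof -
 have mono: "q t<=q (t + k)" for t k
 proof (induction k)
  case (Suc k)
  then show ?case using rr_step(1)[of "t + k"] rq0 by (cases "t + k = 0") auto
 qed simp
 show q: "q t = 0" for t
 proof -
  have "q t<=q (t + T)" using mono[of t T] .
  also have "... = 0" using rq_top[of "t + T"] assms by simp
  finally show ?thesis by simp
 qed
 have "1<=s ==> p s = nn" if "s<=Suc T" for s
  using that
 proof (induction s rule: inc_induct)
  case base
  then show ?case using rp_top[of "Suc T"] assms by simp
 next
  case (step s)
  show ?case
  proof (rule rl_target)
   show "L.zc M1 s (nn) = 0" using zc_M1_up[of s] q n_pos step by simp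
  qed (use step in auto)
 qed
 then show "p (Suc t) = nn" using rp_top[of "Suc t"] assms by (cases "t<=T") auto
qed

lemma rinv_step:
 assumes inv: "rinv (Suc t)" and t: "t>=1"
 shows "rinv t"
proof -
 have mono: "q (t - 1)<=q t" "q t<=q (Suc t)"
  using rr_step(1)[of "t - 1"] rr_step(1)[of t] t rq0 by (cases "t = 1"; simp)+
 have mir: "L.zc M1 t (Suc k)>=1"
  if "q t<=k" "k < q (Suc t)" "Suc k + q t ~= 2 * n" "Suc k + q t ~= nn"
   "Suc k + q (Suc t) < 2 * n | Suc k + q t>=2 * n" "Suc k + q t < 2 * n | Suc k + q (t - 1)>=2 * n" for k
 proof -
  have k: "k < nn" using that q_le[of "Suc t"] by simp
  have "L.zc M1 t (Suc k) = R.zc M t (Suc k)"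
   using zc_M1_same[of t "Suc k"] that k t by simp
  also have "... = R.zc M t (nn - k)" using rzc_mirror[of "Suc k"] k by simp
  finally show ?thesis using rr_step(2)[OF t that(1,2)] by simp
 qed
 have mir0: "L.zc M1 t (q t) = 0"
  if "q t > 0" "q t + q t ~= 2 * n" "q t + q t ~= nn"
   "q t + q (Suc t) < 2 * n | q t + q t>=2 * n" "q t + q t < 2 * n | q t + q (t - 1)>=2 * n"
 proof -
  have "L.zc M1 t (q t) = R.zc M t (q t)"
   using zc_M1_same[of t "q t"] that t q_le[of t] by simp
  also have "... = R.zc M t (2 * n - q t)" using rzc_mirror[of "q t"] that q_le[of t] by simp
  finally show ?thesis using rr_step(3)[OF t] that by simp
 qed
 consider (big) "n < q t" "n<=q (t - 1)" | (edge) "q t = n" "n<=q (t - 1)"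
  | (double) "n<=q t" "q (t - 1)<=n - 1"
  | (cross) "q t<=n - 1" "n<=q (Suc t)"
  | (small) "q (Suc t)<=n - 1" by linarith
 then show ?thesis
 proof cases
  case big
  then have ps: "p (Suc t) = q (Suc t)" using inv mono by (auto simp: rinv_def split: if_splits)
  have "p t = q t"
  proof (rule rl_target[OF t])
   show "q t<=p (Suc t)" using ps mono by simp
   show "L.zc M1 t (Suc k)>=1" if "q t<=k" "k < p (Suc t)" for k
    by (rule mir) (use that ps big mono in linarith)+
   show "L.zc M1 t (q t) = 0" if "q t > 0"
    by (rule mir0) (use that big mono in linarith)+
  qed
  then show ?thesis using big n_pos by (auto simp: rinv_def)
 next
  case edge
  have ps: "p (Suc t) = q (Suc t) | (q (Suc t) = n & p (Suc t) = n - 1)"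
   using inv mono edge n_pos by (auto simp: rinv_def split: if_splits)
  have "p t<=n"
  proof (rule ccontr)
   assume *: "~ p t<=n"
   then have eq: "p (Suc t) = q (Suc t)" using ps rl_step(1)[OF t] by auto
   have "L.zc M1 t (Suc (p t - 1))>=1"
    by (rule mir) (use * edge mono rl_step(1)[OF t] eq in linarith)+
   then show False using rl_step(3)[OF t] * by simp
  qed
  moreover have "p t>=n - 1"
  proof (rule ccontr)
   assume *: "~ n - 1<=p t"
   have "n - 1 < p (Suc t) | n - 1 = p (Suc t)" using ps mono edge by linarith
   then have "L.zc M1 t (Suc (n - 2))>=1"
    using rl_step(2)[OF t, of "n - 2"] * by auto
   moreover have "Suc (n - 2) = nn - q t" "q t < nn" using * edge by auto
   ultimately show False using zc_M1_up[OF t] by simp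
  qed
  ultimately show ?thesis using edge n_pos by (auto simp: rinv_def)
 next
  case double
  have ps: "p (Suc t) = q (Suc t) | (q (Suc t) = n & q t = n & p (Suc t) = n - 1)"
   using inv mono double n_pos by (auto simp: rinv_def split: if_splits)
  have c: "q (t - 1) + q t<=nn"
  proof (cases "t = 1")
   case True
   then show ?thesis using rq0 q_le by simp
  next
   case False
   then show ?thesis using r_crossing[of "t - 1"] double t by simp
  qed
  have "p t = nn - q t"
  proof (rule rl_target[OF t])
   show "nn - q t<=p (Suc t)" using ps mono double n_pos by auto
   show "L.zc M1 t (Suc k)>=1" if k: "nn - q t<=k" "k < p (Suc t)" for k
   proof (cases "Suc k < 2 * n - q (t - 1)")
    case True
    show ?thesis
     by (rule zc_M1_created[OF t]) (use True k p_le[of "Suc t"] in linarith)+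
   next
    case False
    show ?thesis by (rule mir) (use False c k ps double mono n_pos in linarith)+
   qed
   show "L.zc M1 t (nn - q t) = 0" if "nn - q t > 0"
    using zc_M1_up[OF t] that by simp
  qed
  then show ?thesis using double q_le[of t] by (simp add: rinv_def)
 next
  case cross
  have ps: "p (Suc t) = nn - q (Suc t)"
   using inv cross by (auto simp: rinv_def split: if_splits)
  have c: "q t + q (Suc t)<=nn" using r_crossing t cross by simp
  have "p t = q t"
  proof (rule rl_target[OF t])
   show "q t<=p (Suc t)" using ps c by simp
   show "L.zc M1 t (Suc k)>=1" if "q t<=k" "k < p (Suc t)" for k
    by (rule mir) (use that ps cross mono n_pos in linarith)+
   show "L.zc M1 t (q t) = 0" if "q t > 0"
    by (rule mir0) (use that cross c mono n_pos in linarith)+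
  qed
  then show ?thesis using cross n_pos by (auto simp: rinv_def)
 next
  case small
  then have ps: "p (Suc t) = q (Suc t)" using inv mono n_pos by (auto simp: rinv_def split: if_splits)
  have "p t = q t"
  proof (rule rl_target[OF t])
   show "q t<=p (Suc t)" using ps mono by simp
   show "L.zc M1 t (Suc k)>=1" if "q t<=k" "k < p (Suc t)" for k
    by (rule mir) (use that ps small mono n_pos in linarith)+
   show "L.zc M1 t (q t) = 0" if "q t > 0"
    by (rule mir0) (use that small mono n_pos in linarith)+
  qed
  then show ?thesis using small mono n_pos by (auto simp: rinv_def)
 qed
qed

lemma rinv_all:
 assumes x: "xl = xr | (xl = n - 1 & xr = n)" and "t>=1"
 shows "rinv t"
proof (cases "t<=Suc T")
 case True
 have top: "rinv (Suc T)"
  using x rp_top[of "Suc T"] rq_top[of "Suc T"] rq_top[of T] n_pos by (auto simp: rinv_def)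
 show ?thesis using True assms(2)
 proof (induction t rule: inc_induct)
  case base
  then show ?case using top by simp
 next
  case (step t)
  then show ?case using rinv_step by simp
 qed
next
 case False
 then show ?thesis using x rp_top[of t] rq_top[of t] rq_top[of "t - 1"] n_pos by (auto simp: rinv_def)
qed

text \<open>Both directions pass through the same list of joint transitions. One symmetry
  computation, \<open>DD_mirror\<close>, therefore serves for the removal and for its
  inverse.\<close>

lemma reverse_trans:
 assumes x: "xl = xr | (xl = n - 1 & xr = n) | (xl = nn & xr = 0)"
 shows "trans (p t) (q t) (p (Suc t)) (q (Suc t))"
proof (cases "xl = xr | (xl = n - 1 & xr = n)")
 case False
 then have phi: "xr = 0" "xl = nn" using x by auto
 have "p t = 0 | p t = nn" using rphi_walk(2)[OF phi] rp0 by (cases t) auto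
 then show ?thesis using rphi_walk[OF phi] by (simp add: trans_def)
next
 case True
 note i' = rinv_all[OF True, of "Suc t", unfolded rinv_def, simplified]
 have n1: "nn - (n - 1) = n" using n_pos by simp
 show ?thesis
 proof (cases "t = 0")
  case True
  show ?thesis
  proof (cases "n<=q 1")
   case True
   then have "p 1 + q 1 = nn" using i' \<open>t = 0\<close> rq0 by simp
   then have "q 1 = nn - p 1" "p 1<=n - 1" using True by linarith+
   then show ?thesis using \<open>t = 0\<close> rq0 rp0 by (simp add: trans_def)
  next
   case False
   then have "p 1 = q 1" "p 1<=n - 1" using i' \<open>t = 0\<close> rq0 by auto
   then show ?thesis using \<open>t = 0\<close> rq0 rp0 by (simp add: trans_def)
  qed
 next
  case False
  then have t: "t>=1" by simp
  note i = rinv_all[OF True t, unfolded rinv_def]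
  note m = rr_step(1)[OF t] rl_step(1)[OF t]
  consider (pre) "n<=q (Suc t)" "q t<=n - 1" | (small) "q (Suc t)<=n - 1"
   | (double) "n<=q (Suc t)" "n<=q t" "q (t - 1)<=n - 1"
   | (big) "n<=q (Suc t)" "n<=q t" "n<=q (t - 1)" by linarith
  then show ?thesis
  proof cases
   case pre
   then have "p (Suc t) + q (Suc t) = nn" using i' by simp
   moreover have "p t = q t" using pre i n_pos by (auto split: if_splits)
   ultimately have "q (Suc t) = nn - p (Suc t)" "p (Suc t)<=n - 1" "p t = q t"
    using pre by linarith+
   then show ?thesis using m by (simp add: trans_def)
  next
   case small
   have "~ n<=q (Suc t)" "q (Suc t) ~= n" "~ n<=q t" "q t ~= n" using small m n_pos by linarith+
   then have "p t = q t" "p (Suc t) = q (Suc t)" using i i' by auto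
   then show ?thesis using small m by (simp add: trans_def)
  next
   case double
   then have "p t + q t = nn" using i by simp
   then have d: "p t<=n - 1" "q t = nn - p t" using double by linarith+
   have "p (Suc t) = q (Suc t) | (q (Suc t) = n & p (Suc t) = n - 1)"
    using i' double n_pos by (auto split: if_splits)
   then show ?thesis
   proof
    assume "p (Suc t) = q (Suc t)"
    then show ?thesis using d m by (simp add: trans_def)
   next
    assume *: "q (Suc t) = n & p (Suc t) = n - 1"
    then have "q t = n" "p t = n - 1" using m double d n_pos by linarith+
    then show ?thesis using * by (simp add: trans_def)
   qed
  next
   case big
   then have s: "~ (n<=q t & q (t - 1)<=n - 1)" "~ q t<=n - 1" using n_pos by linarith+
   have a: "p t = q t | (q t = n & p t = n - 1)" using i s(1) by argo
   have b: "p (Suc t) = q (Suc t) | (q (Suc t) = n & p (Suc t) = n - 1)" using i' s(2) by (auto split: if_splits)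
   consider "p t = q t" "p (Suc t) = q (Suc t)" | "q t = n" "p t = n - 1" "p (Suc t) = q (Suc t)"
    | "q t = n" "p t = n - 1" "q (Suc t) = n" "p (Suc t) = n - 1"
    using a b m big n_pos by linarith
   then show ?thesis
   proof cases
    case 1
    then show ?thesis using big m by (simp add: trans_def)
   next
    case 2
    then show ?thesis using big n1 by (simp add: trans_def)
   next
    case 3
    then show ?thesis by (simp add: trans_def)
   qed
  qed
 qed
qed

end

end

section \<open>Mirror symmetry of the joint effect of both walks\<close>

context sym_pair
begin

definition HH :: "nat => nat => nat => int" where
 "HH p q a = of_bool (a = Suc p) - of_bool (a = p) + (of_bool (a + q = nn) - of_bool (a + q = 2 * n))"

text \<open>The correction to the multiplicity of rigging \<open>x\<close> at length
  \<open>t\<close>, with positions at lengths \<open>t - 1\<close>, \<open>t\<close>,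
  \<open>t + 1\<close>. Parts removed by the first walker are seen before both shifts, parts it
  creates and parts removed by the second between the shifts, and parts created by the second after
  both.\<close>

definition DD :: "nat => nat => nat => nat => nat => nat => nat => int => int" where
 "DD p0 q0 p1 q1 p2 q2 a x =
  - of_bool (p0 < a & a<=p1) * of_bool (x + HH p1 q1 a = 0)
  + (of_bool (p1 < a & a<=p2) - of_bool (2 * n - q1<=a & a < 2 * n - q0))
   * of_bool (x + (of_bool (a + q1 = nn) - of_bool (a + q1 = 2 * n)) = 0)
  + of_bool (2 * n - q2<=a & a < 2 * n - q1) * of_bool (x = 0)"

lemma trans_state: "trans p q p' q' ==> p'<=nn ==> p' = q' | p' + q' = nn"
 using n_pos by (auto simp: trans_def)

lemma HH_mirror:
 assumes "p = q | p + q = nn" "1<=a" "a<=nn"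
 shows "HH p q (2 * n - a) = HH p q a"
proof -
 have e: "2 * n - a = Suc p \<longleftrightarrow> a + p = nn" "2 * n - a = p \<longleftrightarrow> a + p = 2 * n"
  "2 * n - a + q = nn \<longleftrightarrow> a = Suc q" "2 * n - a + q = 2 * n \<longleftrightarrow> a = q"
  using assms(2,3) by linarith+
 from assms(1) show ?thesis
 proof
  assume "p = q"
  then show ?thesis unfolding HH_def e by (simp only: add.commute)
 next
  assume "p + q = nn"
  then have f: "a = Suc p \<longleftrightarrow> a + q = 2 * n" "a = p \<longleftrightarrow> a + q = nn"
   "a = Suc q \<longleftrightarrow> a + p = 2 * n" "a = q \<longleftrightarrow> a + p = nn"
   using assms(2,3) by linarith+
  show ?thesis unfolding HH_def e f by simp
 qed
qed

text \<open>For \<open>a < n\<close> and its mirror colour \<open>b > n\<close> an admissible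
  transition leaves few indicators alive, and what one walker removes or creates on one side is
  balanced by the other walker on the other side. The hypothesis on \<open>p2\<close> and
  \<open>q2\<close> prevents the state of the letter phi from being entered late.\<close>

lemma DD_mirror_small:
 assumes t: "trans p0 q0 p1 q1" "trans p1 q1 p2 q2"
  and phi: "p2 = nn & q2 = 0 ==> p1 = nn & q1 = 0"
  and le: "p2<=nn" "q2<=nn" and a: "1<=a" "a < n"
 shows "DD p0 q0 p1 q1 p2 q2 (2 * n - a) x = DD p0 q0 p1 q1 p2 q2 a x"
proof -
 define b where "b = 2 * n - a"
 have b: "a + b = 2 * n" "n < b" using a by (auto simp: b_def)
 define I where "I y z c = (of_bool (y < c & c<=z) :: int)" for y z c :: nat
 define E where "E y = (of_bool (x + y = 0) :: int)" for y
 define h2a where "h2a = (of_bool (a + q1 = nn) - of_bool (a + q1 = 2 * n) :: int)"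
 define h2b where "h2b = (of_bool (b + q1 = nn) - of_bool (b + q1 = 2 * n) :: int)"
 define H where "H = HH p1 q1 a"
 define h1a where "h1a = (of_bool (a = Suc p1) - of_bool (a = p1) :: int)"
 have st: "p1 = q1 | p1 + q1 = nn" using t(1) n_pos by (auto simp: trans_def)
 have Hb: "HH p1 q1 b = H" unfolding b_def H_def by (rule HH_mirror[OF st]) (use a in auto)
 have H': "H = h1a + h2a" by (simp add: H_def HH_def h1a_def h2a_def)
 \<comment> \<open>Written in the mirror colour, the intervals of the second walker take the same
   form as those of the first.\<close>
 have eqs: "2 * n - q1<=a & a < 2 * n - q0 \<longleftrightarrow> q0 < b & b<=q1"
  "2 * n - q2<=a & a < 2 * n - q1 \<longleftrightarrow> q1 < b & b<=q2"
  "2 * n - q1<=b & b < 2 * n - q0 \<longleftrightarrow> q0 < a & a<=q1"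
  "2 * n - q2<=b & b < 2 * n - q1 \<longleftrightarrow> q1 < a & a<=q2" using b a by auto
 have Da: "DD p0 q0 p1 q1 p2 q2 a x
   = - I p0 p1 a * E H + (I p1 p2 a - I q0 q1 b) * E h2a + I q1 q2 b * E 0"
  unfolding DD_def eqs I_def E_def H_def h2a_def by simp
 have Db: "DD p0 q0 p1 q1 p2 q2 b x
   = - I p0 p1 b * E H + (I p1 p2 b - I q0 q1 a) * E h2b + I q1 q2 a * E 0"
  unfolding DD_def eqs Hb I_def E_def H_def h2b_def by simp
 have "DD p0 q0 p1 q1 p2 q2 b x = DD p0 q0 p1 q1 p2 q2 a x"
 proof (cases "p1 = q1")
  case True
  show ?thesis
  proof (cases "p1<=n - 1")
   case k: True
   have h: "h2a = 0" "h2b = H"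
    using k True a b by (auto simp: h2a_def h2b_def H' h1a_def)
   have "p0 = q0" using t(1) True k n_pos by (auto simp: trans_def)
   have z: "I p0 p1 b = 0" "I q0 q1 b = 0" "I q0 q1 a = I p0 p1 a"
    using k True b \<open>p0 = q0\<close> by (auto simp: I_def)
   consider "p2 = q2" "p1<=p2" "p2<=n - 1" | "p1<=p2" "p2<=n - 1" "q2 = nn - p2"
    using t(2) True k n_pos phi by (auto simp: trans_def)
   then have f: "I p1 p2 a + I q1 q2 b = I q1 q2 a & I p1 p2 b = 0"
   proof cases
    case 1
    then show ?thesis using True k b a by (auto simp: I_def)
   next
    case 2
    then show ?thesis using True k b a by (auto simp: I_def)
   qed
   then show ?thesis unfolding Da Db z h f[THEN conjunct1, symmetric] f[THEN conjunct2] by (simp add: algebra_simps)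
  next
   case False
   then have k: "n<=p1" by simp
   have h: "h2b = 0" "h2a = H"
    using k True a b by (auto simp: h2b_def H' h1a_def)
   have "p2 = q2" using t(2) k True n_pos phi by (auto simp: trans_def)
   then have z: "I p1 p2 a = 0" "I q1 q2 a = 0" "I q1 q2 b = I p1 p2 b"
    using k True b a by (auto simp: I_def)
   consider "p0 = q0" "n<=p0" | "p0<=n - 1" "q0 = nn - p0" "q0<=p1"
    using t(1) True k n_pos by (auto simp: trans_def)
   then have f: "I p0 p1 a + I q0 q1 b = I p0 p1 b & I q0 q1 a = 0"
   proof cases
    case 1
    then show ?thesis using True k b a by (auto simp: I_def)
   next
    case 2
    then show ?thesis using True k b a by (auto simp: I_def)
   qed
   then show ?thesis unfolding Da Db z h f[THEN conjunct1, symmetric] f[THEN conjunct2] by (simp add: algebra_simps)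
  qed
 next
  case False
  then have sum: "p1 + q1 = nn" using st by simp
  have H0: "H = 0" using sum a b by (auto simp: H_def HH_def)
  show ?thesis
  proof (cases "q1 = 0")
   case True
   have "p0 = 0 | p0 = nn" "q0 = 0" "p2 = nn" "q2 = 0" "p1 = nn"
    using t True sum False n_pos by (auto simp: trans_def)
   then have "I q0 q1 a = 0" "I q0 q1 b = 0" "I p1 p2 a = 0" "I p1 p2 b = 0" "I q1 q2 a = 0" "I q1 q2 b = 0"
    "I p0 p1 a = I p0 p1 b" using True a b by (auto simp: I_def)
   then show ?thesis unfolding Da Db by simp
  next
   case q1: False
   have j: "p1<=n - 1" "n<=q1" using t(1) False sum q1 n_pos by (auto simp: trans_def)
   have h: "h2b = 0" using j a b by (auto simp: h2b_def)
   have z: "I p0 p1 b = 0" "I q1 q2 a = 0" using j a b by (auto simp: I_def)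
   consider "p0 = q0" "p0<=p1" | "p0 = p1" "q0 = q1" "p1 = n - 1"
    using t(1) False sum q1 j n_pos by (auto simp: trans_def)
   then have prev: "I q0 q1 b = (if p0 = q0 then I p1 q1 a else 0)
    & (p0 = q0 --> I q0 q1 a = I p0 p1 a + I p1 q1 a) & (p0 ~= q0 --> I q0 q1 a = 0 & I p0 p1 a = 0 & p1 = n - 1)"
   proof cases
    case 1
    then show ?thesis using a b j sum False by (auto simp: I_def)
   next
    case 2
    then show ?thesis using a b j sum False by (auto simp: I_def)
   qed
   consider "p2 = q2" "q1<=p2" | "p2 = p1" "q2 = q1" "p1 = n - 1"
    using t(2) False sum q1 j n_pos by (auto simp: trans_def)
   then have nxt: "I p1 p2 a = (if p2 = q2 then I p1 q1 a else 0)
    & (p2 = q2 --> I p1 p2 b = I q1 q2 b + I p1 q1 a) & (p2 ~= q2 --> I p1 p2 b = 0 & I q1 q2 b = 0 & p1 = n - 1)"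
   proof cases
    case 1
    then show ?thesis using a b j sum False by (auto simp: I_def)
   next
    case 2
    then show ?thesis using a b j sum False by (auto simp: I_def)
   qed
   have e: "I p1 q1 a = 0" if "p1 = n - 1" using that a by (auto simp: I_def)
   show ?thesis unfolding Da Db z h H0
    using prev nxt e by (cases "p0 = q0"; cases "p2 = q2") (auto simp: algebra_simps)
  qed
 qed
 then show ?thesis by (simp add: b_def)
qed

lemma DD_mirror:
 assumes "trans p0 q0 p1 q1" "trans p1 q1 p2 q2"
  and "p2 = nn & q2 = 0 ==> p1 = nn & q1 = 0"
  and "p2<=nn" "q2<=nn" and a: "1<=a" "a<=nn"
 shows "DD p0 q0 p1 q1 p2 q2 (2 * n - a) x = DD p0 q0 p1 q1 p2 q2 a x"
proof -
 consider "a < n" | "a = n" | "2 * n - a < n" "1<=2 * n - a" "2 * n - (2 * n - a) = a" using a by linarith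
 then show ?thesis
 proof cases
  case 1
  then show ?thesis using DD_mirror_small assms by blast
 next
  case 2
  then show ?thesis by simp
 next
  case 3
  then show ?thesis using DD_mirror_small[OF assms(1-5), of "2 * n - a" x] by simp
 qed
qed

end

context rc
begin

text \<open>The value of the vacancy numbers at large lengths. Once \<open>N\<close> is prescribed
  by a weight it is, up to a positive factor, the pairing of this weight with a coroot.\<close>

definition dm :: "(nat => int) => (nat => rat) => nat => rat" where
 "dm Z N a = of_int (Z a) - (\<Sum>b\<in>C. of_int (A a b) * N b)"

lemma dm_change:
 "dm (Z(a0 := Z a0 - 1)) (%a. N a - of_nat (x a)) a = dm Z N a - of_int (h a x)"
proof -
 have "(\<Sum>b\<in>C. of_int (A a b) * (N b - of_nat (x b)))
   = (\<Sum>b\<in>C. of_int (A a b) * N b) - of_int (\<Sum>b\<in>C. A a b * int (x b))"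
  by (simp add: right_diff_distrib sum_subtractf)
 then show ?thesis by (simp add: dm_def h_def)
qed

lemma RC_dm: "J\<in>RC Z N ==> a\<in>C ==> 0<=dm Z N a"
 using RC_dominant by (simp add: dm_def)

end

text \<open>
 Rigged configurations of type \<open>A\<close> with colours \<open>1, \<dots>, 2n - 1\<close> that are invariant under the reflection
 of the diagram. The predicate \<open>cls t x\<close> restricts the riggings \<open>x\<close> of the parts of length \<open>t\<close> in the middle colour \<open>n\<close>;
 it distinguishes the four types obtained by folding.
\<close>
locale sym_class = sym_pair +
 fixes cls :: "nat => int => bool" and zero_ok phi_ok :: bool
 assumes cls_shift: "!!t x. cls t (x + 2) = cls t x"
  and one_zero: "!!t. cls t 1 ==> zero_ok"
  and cls_0_1: "!!t. zero_ok ==> cls (Suc t) 0 \<longleftrightarrow> cls t 1"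
  and cls_1_0: "!!t. zero_ok ==> cls (Suc t) 1 \<longleftrightarrow> cls t 0"
  and cls_0_0: "!!t. cls (Suc (Suc t)) 0 \<longleftrightarrow> cls t 0"
  and cls_init: "cls 0 0" and phi_ok: "phi_ok \<longleftrightarrow> cls 1 0"
begin

definition in_cls :: "riggings => bool" where
 "in_cls J \<longleftrightarrow> (\<forall>t. \<forall>x\<in>#J n t. cls t x)"

definition Zof :: "nat => nat => int" where
 "Zof L a = int L * (of_bool (a = Suc 0) + of_bool (a = nn))"

definition KS :: "nat => (nat => rat) => riggings set" where
 "KS L N = {J\<in>L.RC (Zof L) N. sym J & in_cls J}"

definition allowed :: "nat => nat => bool" where
 "allowed x y \<longleftrightarrow> (x = y & x<=nn) | (x = n - 1 & y = n & zero_ok)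
  | (x = nn & y = 0 & phi_ok)"

definition NN :: "(nat => rat) => nat => nat => nat => rat" where
 "NN N x y a = N a - of_nat (lv x a) - of_nat (rv y a)"

lemma count_pair:
 assumes J: "J\<in>L.RC Z N"
  and u: "L.fwalk J (lpath p)" and p_le: "!!t. p t<=nn"
  and v: "R.fwalk (L.act (lpath p) J) (rpath q)" and q_le: "!!t. q t<=nn"
  and t: "t>=1" and a: "1<=a" "a<=nn"
 shows "int (count (R.act (rpath q) (L.act (lpath p) J) a t) x)
  = int (count (J a t) (x + HH (p t) (q t) a))
   + DD (p (t - 1)) (q (t - 1)) (p t) (q t) (p (Suc t)) (q (Suc t)) a x"
proof -
 note ok = L.fwalk_steps_ok[OF u L.RC_D(1)[OF J]]
 note ok' = R.fwalk_steps_ok[OF v L.act_supported[OF L.RC_D(1)[OF J] ok]]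
 have mp: "p (t - 1)<=p t" "p t<=p (Suc t)" "q (t - 1)<=q t" "q t<=q (Suc t)"
  using L.fwalk_mono[OF u, of "t - 1"] L.fwalk_mono[OF u, of t]
   R.fwalk_mono[OF v, of "t - 1"] R.fwalk_mono[OF v, of t] t by (auto simp: pv_le_iff)
 have hl: "L.h a (lv (p t)) = of_bool (a = Suc (p t)) - of_bool (a = p t)"
  by (rule h_l[OF a p_le])
 have hr: "R.h a (rv (q t)) = of_bool (a + q t = nn) - of_bool (a + q t = 2 * n)"
  by (rule h_r[OF a q_le])
 have l: "int (lv (p t) a) - int (lv (p (t - 1)) a) = of_bool (p (t - 1) < a & a<=p t)"
  "int (lv (p (Suc t)) a) - int (lv (p t) a) = of_bool (p t < a & a<=p (Suc t))"
  using mp a by (auto simp: pv_lcol)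
 have r: "int (rv (q t) a) - int (rv (q (t - 1)) a) = of_bool (2 * n - q t<=a & a < 2 * n - q (t - 1))"
  "int (rv (q (Suc t)) a) - int (rv (q t) a) = of_bool (2 * n - q (Suc t)<=a & a < 2 * n - q t)"
  using mp a unfolding pv_rcol[OF n_pos q_le] by (auto split: if_splits)
 define hL hR where "hL = L.h a (lv (p t))" and "hR = R.h a (rv (q t))"
 have HH: "HH (p t) (q t) a = hR + hL"
  by (simp add: HH_def hl hr hL_def hR_def)
 have e2: "int (count (R.act (rpath q) (L.act (lpath p) J) a t) x)
  = int (count (L.act (lpath p) J a t) (x + hR))
   - of_bool (2 * n - q t<=a & a < 2 * n - q (t - 1)) * of_bool (x + hR = 0)
   + of_bool (2 * n - q (Suc t)<=a & a < 2 * n - q t) * of_bool (x = 0)"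
  unfolding hR_def r[symmetric] by (rule R.count_act[OF ok' _ t]) (rule R.fwalk_sel[OF v])
 have e1: "int (count (L.act (lpath p) J a t) (x + hR))
  = int (count (J a t) (x + hR + hL))
   - of_bool (p (t - 1) < a & a<=p t) * of_bool (x + hR + hL = 0)
   + of_bool (p t < a & a<=p (Suc t)) * of_bool (x + hR = 0)"
  unfolding hL_def l[symmetric] by (rule L.count_act[OF ok _ t]) (rule L.fwalk_sel[OF u])
 have hR': "of_bool (a + q t = nn) - of_bool (a + q t = 2 * n) = hR" by (simp add: hR_def hr)
 show ?thesis
  unfolding e2 e1 DD_def hR' HH add.assoc left_diff_distrib by simp
qed

end

context chain_rc
begin

lemma fwalk_positions: "fwalk J u ==> \<exists>p. (\<forall>t. p t<=K) & u = (%t. pv col (p t))"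
 using fwalk_in_S pv_pos pos_le by (intro exI[of _ "%t. pos (u t)"]) (auto simp: fun_eq_iff)

lemma rwalk_positions: "rwalk J x u ==> \<exists>p. (\<forall>t. p t<=K) & u = (%t. pv col (p t))"
 using rwalk_in_S pv_pos pos_le by (intro exI[of _ "%t. pos (u t)"]) (auto simp: fun_eq_iff)

end

lemma count_pos_cases:
 assumes "0 < int k - of_bool b * of_bool c + (of_bool d - of_bool e) * of_bool f + of_bool g * of_bool i"
 shows "k > 0 | (d & ~ e & f) | (g & i)"
 using assms by (cases b; cases c; cases d; cases e; cases f; cases g; cases i) auto

lemma count_neg_cases:
 assumes "int k' = int k - of_bool b * of_bool c + (of_bool d - of_bool e) * of_bool f + of_bool g * of_bool i" "k > 0"
 shows "k' > 0 | (b & c) | (e & ~ d & f)"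
 using assms by (cases b; cases c; cases d; cases e; cases f; cases g; cases i) auto

context sym_class
begin

lemma cls_even: "H = 0 | H = 2 | H = -2 ==> cls t (x + H) = cls t x"
 using cls_shift[of t x] cls_shift[of t "x - 2"] by auto

text \<open>The middle colour is its own mirror image, so the two shifts either agree or cancel.
  That the total is even is what allows parity conditions on this colour.\<close>

lemma HH_n:
 assumes "p = q | p + q = nn"
 shows "HH p q n = 0 | HH p q n = 2 | HH p q n = -2"
 using assms n_pos by (auto simp: HH_def)

context
 fixes J :: riggings and p q :: "nat => nat" and Z N
 assumes J: "J\<in>L.RC Z N"
  and u: "L.fwalk J (lpath p)" and p_le: "!!t. p t<=nn"
  and v: "R.fwalk (L.act (lpath p) J) (rpath q)" and q_le: "!!t. q t<=nn"
  and tr: "!!t. trans (p t) (q t) (p (Suc t)) (q (Suc t))"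
  and phi: "\<forall>t\<ge>1. p (Suc t) = nn & q (Suc t) = 0 --> p t = nn & q t = 0"
begin

abbreviation "J2 \<equiv> R.act (rpath q) (L.act (lpath p) J)"

lemma state: "t>=1 ==> p t = q t | p t + q t = nn"
 using trans_state[OF tr[of "t - 1"]] p_le[of t] by simp

lemma DD_sym:
 assumes "t>=1" "1<=a" "a<=nn"
 shows "DD (p (t - 1)) (q (t - 1)) (p t) (q t) (p (Suc t)) (q (Suc t)) (2 * n - a) x
  = DD (p (t - 1)) (q (t - 1)) (p t) (q t) (p (Suc t)) (q (Suc t)) a x"
 using tr[of "t - 1"] tr[of t] phi[rule_format, OF assms(1)] assms p_le q_le by (intro DD_mirror) auto

text \<open>By \<open>count_pair\<close> the multiplicities before and after differ by a shift
  \<open>HH\<close> and a correction \<open>DD\<close>, both invariant under the reflection. Being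
  an equivalence, it covers both directions.\<close>

lemma sym_iff: "sym J2 \<longleftrightarrow> sym J"
proof -
 have cp: "int (count (J2 a t) x) = int (count (J a t) (x + HH (p t) (q t) a))
   + DD (p (t - 1)) (q (t - 1)) (p t) (q t) (p (Suc t)) (q (Suc t)) a x"
  if "t>=1" "1<=a" "a<=nn" for a t x
  by (rule count_pair[OF J u p_le v q_le that])
 have J0: "J a 0 = {#}" "J2 a 0 = {#}" for a
  using L.RC_D(1)[OF J] by (auto simp: L.supported_def R.act_def)
 show ?thesis
  unfolding sym_def
 proof (intro ball_cong refl iffI allI)
  fix a t assume a: "a\<in>{Suc 0..nn}" and eq: "\<forall>t. J2 (2 * n - a) t = J2 a t"
  show "J (2 * n - a) t = J a t"
  proof (cases "t = 0")
   case False
   show ?thesis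
   proof (rule multiset_eqI)
    fix y
    let ?x = "y - HH (p t) (q t) a"
    have b: "t>=1" "1<=a" "a<=nn" "1<=2 * n - a" "2 * n - a<=nn" using a False by auto
    show "count (J (2 * n - a) t) y = count (J a t) y"
     using cp[OF b(1-3), of ?x] cp[OF b(1,4,5), of ?x] eq DD_sym[OF b(1-3), of ?x]
      HH_mirror[OF state[OF b(1)] b(2,3)] by simp
   qed
  qed (simp add: J0)
 next
  fix a t assume a: "a\<in>{Suc 0..nn}" and eq: "\<forall>t. J (2 * n - a) t = J a t"
  show "J2 (2 * n - a) t = J2 a t"
  proof (cases "t = 0")
   case False
   show ?thesis
   proof (rule multiset_eqI)
    fix x
    have b: "t>=1" "1<=a" "a<=nn" "1<=2 * n - a" "2 * n - a<=nn" using a False by auto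
    show "count (J2 (2 * n - a) t) x = count (J2 a t) x"
     using cp[OF b(1-3), of x] cp[OF b(1,4,5), of x] eq DD_sym[OF b(1-3), of x]
      HH_mirror[OF state[OF b(1)] b(2,3)] by simp
   qed
  qed (simp add: J0)
 qed
qed

lemma count_n:
 assumes "t>=1"
 obtains H where "H = 0 | H = 2 | H = -2" "H = HH (p t) (q t) n"
  "!!x. int (count (J2 n t) x) = int (count (J n t) (x + H))
  - of_bool (p (t - 1) < n & n<=p t) * of_bool (x + H = 0)
  + (of_bool (p t < n & n<=p (Suc t)) - of_bool (q (t - 1) < n & n<=q t))
   * of_bool (x = of_bool (q t = n) - of_bool (Suc (q t) = n))
  + of_bool (q t < n & n<=q (Suc t)) * of_bool (x = 0)"
proof
 show "HH (p t) (q t) n = 0 | HH (p t) (q t) n = 2 | HH (p t) (q t) n = -2"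
  using HH_n state assms by blast
 show "HH (p t) (q t) n = HH (p t) (q t) n" ..
 have e: "2 * n - q t<=n & n < 2 * n - q (t - 1) \<longleftrightarrow> q (t - 1) < n & n<=q t"
  "2 * n - q (Suc t)<=n & n < 2 * n - q t \<longleftrightarrow> q t < n & n<=q (Suc t)"
  "n + q t = nn \<longleftrightarrow> Suc (q t) = n" "n + q t = 2 * n \<longleftrightarrow> q t = n"
  using n_pos by auto
 have f: "x + (of_bool (Suc (q t) = n) - of_bool (q t = n)) = 0 \<longleftrightarrow> x = of_bool (q t = n) - of_bool (Suc (q t) = n)" for x :: int
  by linarith
 show "int (count (J2 n t) x) = int (count (J n t) (x + HH (p t) (q t) n))
  - of_bool (p (t - 1) < n & n<=p t) * of_bool (x + HH (p t) (q t) n = 0)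
  + (of_bool (p t < n & n<=p (Suc t)) - of_bool (q (t - 1) < n & n<=q t))
   * of_bool (x = of_bool (q t = n) - of_bool (Suc (q t) = n))
  + of_bool (q t < n & n<=q (Suc t)) * of_bool (x = 0)" for x
  using count_pair[OF J u p_le v q_le assms, of n x] n_pos unfolding DD_def e f by simp
qed

lemma r_crosses: "q t < n ==> n<=q (Suc t) ==> p (Suc t)<=n - 1 & q (Suc t) = nn - p (Suc t)"
 using tr[of t] n_pos by (auto simp: trans_def)

lemma l_crosses: "p t < n ==> n<=p (Suc t) ==> t>=1 ==> n<=q t & q t = nn - p t"
 using tr[of t] phi[rule_format, of t] n_pos by (auto simp: trans_def)

lemma double_or_zero: "p t<=n - 1 ==> n<=q t ==> n<=p (Suc t) | (p t = n - 1 & q t = n & p (Suc t) = n - 1 & q (Suc t) = n)"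
 using tr[of t] n_pos by (auto simp: trans_def)

lemma stay_zero: "p (Suc t)<=n - 1 ==> n<=q t ==> p t = n - 1 & q t = n & p (Suc t) = n - 1 & q (Suc t) = n"
 using tr[of t] n_pos by (auto simp: trans_def)

end

text \<open>Riggings that stay move by an even amount. A new part of the middle colour at length
  \<open>t\<close> comes from a singular part of length \<open>t + 1\<close> or
  \<open>t + 2\<close>, or is accompanied by a rigging 1 at length \<open>t + 1\<close>. The axioms
  \<open>cls_0_1\<close>, \<open>cls_0_0\<close> and \<open>cls_1_0\<close> transport membership in
  these three situations.\<close>

lemma in_cls_forward:
 assumes J: "J\<in>L.RC Z N" and s: "sym J" and c: "in_cls J"
  and u: "L.fwalk J (lpath p)" and p_le: "!!t. p t<=nn"
  and v: "R.fwalk (L.act (lpath p) J) (rpath q)" and q_le: "!!t. q t<=nn"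
 shows "sym (R.act (rpath q) (L.act (lpath p) J))"
  and "in_cls (R.act (rpath q) (L.act (lpath p) J))"
  and "t>=T ==> allowed (p t) (q t)"
  and "trans (p t) (q t) (p (Suc t)) (q (Suc t))"
  and "t>=1 ==> p (Suc t) = nn & q (Suc t) = 0 ==> p t = nn & q t = 0"
proof -
 have nonneg: "\<forall>a t. \<forall>x\<in>#J a t. 0<=x"
  using L.RC_D(4)[OF J] L.supported_C[OF L.RC_D(1)[OF J]] by blast
 note ok = L.fwalk_steps_ok[OF u L.RC_D(1)[OF J]]
 note F = nonneg s u p_le v q_le ok
 have tr: "trans (p t) (q t) (p (Suc t)) (q (Suc t))" for t by (rule forward_trans[OF F])
 then show "trans (p t) (q t) (p (Suc t)) (q (Suc t))" .
 have phi1: "p (Suc t) = nn ==> q (Suc t) = 0 ==> n<=p 1" for t by (rule forward_phi[OF F])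
 have phi: "\<forall>t\<ge>1. p (Suc t) = nn & q (Suc t) = 0 --> p t = nn & q t = 0"
 proof (intro allI impI)
  fix t assume that: "(1::nat)<=t" "p (Suc t) = nn & q (Suc t) = 0"
  then have "n<=p 1" using phi1 by blast
  then show "p t = nn & q t = 0"
   using phi_walk(1)[OF F, of "t - 1"] phi_walk(2)[OF F, of t] that(1) by simp
 qed
 then show "t>=1 ==> p (Suc t) = nn & q (Suc t) = 0 ==> p t = nn & q t = 0" by blast
 note G = J u p_le v q_le tr phi
 show "sym (R.act (rpath q) (L.act (lpath p) J))"
  using sym_iff[OF G] s by simp
 have p0: "p 0 = 0" and q0: "q 0 = 0" using p0[OF F] q0[OF F] by auto
 have lz: "0 \<in># J n (Suc t)" if "p t < n" "n<=p (Suc t)" for t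
  using l_step(2)[OF F, of t "n - 1"] that n_pos by (auto simp: L.zc_def)
 have zero: "zero_ok" if zz: "q (t - 1) = n" "p t = n - 1" "q t = n" "t>=1" for t
 proof -
  have "p 1<=n - 1"
  proof (rule ccontr)
   assume "~ p 1<=n - 1"
   then have "q t = 0" using phi_walk(2)[OF F, of t] by simp
   then show False using that n_pos by simp
  qed
  then obtain s where "1 \<in># J n s"
   using forward_zero[OF F _ zz(2,3,4) disjI2[OF zz(1)]] by blast
  then have "cls s 1" using c by (simp add: in_cls_def)
  then show ?thesis by (rule one_zero)
 qed
 show "in_cls (R.act (rpath q) (L.act (lpath p) J))"
  unfolding in_cls_def
 proof (intro allI ballI)
  fix t x assume x: "x \<in># R.act (rpath q) (L.act (lpath p) J) n t"
  have t: "t>=1" using x by (cases t) (auto simp: R.act_def)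
  obtain H where H: "H = 0 | H = 2 | H = -2" "H = HH (p t) (q t) n"
   and cnt: "!!x. int (count (R.act (rpath q) (L.act (lpath p) J) n t) x) = int (count (J n t) (x + H))
   - of_bool (p (t - 1) < n & n<=p t) * of_bool (x + H = 0)
   + (of_bool (p t < n & n<=p (Suc t)) - of_bool (q (t - 1) < n & n<=q t))
    * of_bool (x = of_bool (q t = n) - of_bool (Suc (q t) = n))
   + of_bool (q t < n & n<=q (Suc t)) * of_bool (x = 0)"
   by (rule count_n[OF G t]) blast
  have "0 < int (count (R.act (rpath q) (L.act (lpath p) J) n t) x)" using x by simp
  then consider "x + H \<in># J n t"
   | "p t < n" "n<=p (Suc t)" "~ (q (t - 1) < n & n<=q t)" "x = of_bool (q t = n) - of_bool (Suc (q t) = n)"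
   | "q t < n" "n<=q (Suc t)" "x = 0"
   unfolding cnt using count_pos_cases by fastforce
  then show "cls t x"
  proof cases
   case 1
   then have "cls t (x + H)" using c by (simp add: in_cls_def)
   then show ?thesis using cls_even[OF H(1)] by simp
  next
   case 2
   have q: "n<=q t" using l_crosses[OF G 2(1,2) t] by simp
   then have "n<=q (t - 1)" using 2 by simp
   then have st: "q (t - 1) = n" "p t = n - 1" "q t = n"
    using stay_zero[OF G, of "t - 1"] 2 t by auto
   have z: zero_ok using zero[OF st t] .
   have "cls (Suc t) 0" using lz[OF 2(1,2)] c by (simp add: in_cls_def)
   then show ?thesis using cls_0_1[OF z] 2(4) st n_pos by simp
  next
   case 3
   have st: "p (Suc t)<=n - 1" "q (Suc t) = nn - p (Suc t)" using r_crosses[OF G 3(1,2)] by auto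
   from double_or_zero[OF G st(1) 3(2)] show ?thesis
   proof
    assume "n<=p (Suc (Suc t))"
    then have "0 \<in># J n (Suc (Suc t))" using lz st(1) n_pos by simp
    then have "cls (Suc (Suc t)) 0" using c by (simp add: in_cls_def)
    then show ?thesis using cls_0_0 3(3) by simp
   next
    assume *: "p (Suc t) = n - 1 & q (Suc t) = n & p (Suc (Suc t)) = n - 1 & q (Suc (Suc t)) = n"
    then have "1 \<in># J n (Suc t)" using forward_one[OF F 3(1)] by simp
    then have "cls (Suc t) 1" using c by (simp add: in_cls_def)
    then show ?thesis using cls_1_0[OF one_zero] 3(3) by blast
   qed
  qed
 qed
 show "allowed (p t) (q t)" if "t>=T"
 proof -
  have "(%a. lv (p (Suc t)) a) = lv (p t)" 
   using L.steps_ok_top[OF ok, of "Suc t"] L.steps_ok_top[OF ok, of t] that by simp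
  then have pp: "p (Suc t) = p t" by (simp add: pv_inject)
  note ok' = R.fwalk_steps_ok[OF v L.act_supported[OF L.RC_D(1)[OF J] ok]]
  have "(%a. rv (q (Suc t)) a) = rv (q t)" 
   using R.steps_ok_top[OF ok', of "Suc t"] R.steps_ok_top[OF ok', of t] that by simp
  then have qq: "q (Suc t) = q t" by (simp add: pv_inject)
  have t1: "t>=1" using that T_pos by simp
  consider "p t = q t" | "p t = n - 1" "q t = n" | "p t = nn" "q t = 0"
   using tr[of t] pp qq n_pos by (auto simp: trans_def)
  then show ?thesis
  proof cases
   case 1
   then show ?thesis using p_le[of t] by (simp add: allowed_def)
  next
   case 2
   then have zero_ok using zero[of "Suc t"] pp qq by simp
   then show ?thesis unfolding allowed_def using 2 by blast
  next
   case 3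
   then have "n<=p 1" using phi1[of "t - 1"] t1 by simp
   then have "0 \<in># J n (Suc 0)" using lz[of 0] p0 n_pos by simp
   then have "cls 1 0" using c by (simp add: in_cls_def)
   then have phi_ok using phi_ok by simp
   then show ?thesis unfolding allowed_def using 3 by blast
  qed
 qed
qed

end

context sym_class
begin

text \<open>The same transport from shorter lengths to longer ones. A part that starts from nothing
  has no shorter origin; \<open>cls_init\<close> supplies it, or \<open>phi_ok\<close> when the pair
  ends in the state of phi.\<close>

lemma in_cls_backward:
 assumes J: "J\<in>L.RC Z N"
  and u: "L.fwalk J (lpath p)" and p_le: "!!t. p t<=nn"
  and v: "R.fwalk (L.act (lpath p) J) (rpath q)" and q_le: "!!t. q t<=nn"
  and M: "M = R.act (rpath q) (L.act (lpath p) J)"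
  and nonneg: "\<forall>a t. \<forall>x\<in>#M a t. 0<=x" and s: "sym M" and c: "in_cls M"
  and v': "R.rwalk M (rv y) (rpath q)"
  and u': "L.rwalk (R.unact (rpath q) M) (lv x) (lpath p)"
  and al: "allowed x y"
 shows "sym J" and "in_cls J"
proof -
 note F = nonneg s v' q_le u' p_le
 have xy: "x = y | (x = n - 1 & y = n) | (x = nn & y = 0)" using al by (auto simp: allowed_def)
 have tr: "trans (p t) (q t) (p (Suc t)) (q (Suc t))" for t using reverse_trans[OF F xy] .
 have p0: "p 0 = 0" and q0: "q 0 = 0" using rp0[OF F] rq0[OF F] by auto
 have pT: "p t = x" and qT: "q t = y" if "t>=T" for t using rp_top[OF F that] rq_top[OF F that] by auto
 have phi_xy: "x = nn & y = 0" if "p (Suc t) = nn" "q (Suc t) = 0" for t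
 proof (rule ccontr)
  assume "~ ?thesis"
  then have "x = y | x = n - 1 & y = n" using xy by auto
  then have "rinv p q (Suc t)" using rinv_all[OF F] by simp
  then show False using that n_pos by (auto simp: rinv_def[OF F] split: if_splits)
 qed
 have phi: "\<forall>t\<ge>1. p (Suc t) = nn & q (Suc t) = 0 --> p t = nn & q t = 0"
 proof (intro allI impI)
  fix t assume t: "(1::nat)<=t" "p (Suc t) = nn & q (Suc t) = 0"
  then have "x = nn" "y = 0" using phi_xy by auto
  then show "p t = nn & q t = 0"
   using rphi_walk(1)[OF F, of t] rphi_walk(2)[OF F, of "t - 1"] t(1) by simp
 qed
 note G = J u p_le v q_le tr phi
 show "sym J" using sym_iff[OF G] s M by simp
 have rz: "0 \<in># M n t" if "q t < n" "n<=q (Suc t)" "t>=1" for t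
  using rr_step(2)[OF F that(3), of "n - 1"] that n_pos by (auto simp: R.zc_def numeral_2_eq_2)
 have lone: "1 \<in># M n t" if "q (t - 1)>=n" "q t = n" "p t < n" "n<=p (Suc t)" "t>=1" for t
 proof -
  have "L.zc (R.unact (rpath q) M) t n>=1"
   using rl_step(2)[OF F that(5), of "n - 1"] that n_pos by simp
  moreover have e: "of_bool (n + q t = 2 * n) - of_bool (n + q t = nn) = (1::int)"
   "of_bool (2 * n - q t<=n & n < 2 * n - q (t - 1)) = (0::int)" "1<=n" "n<=nn"
   using that n_pos by auto
  moreover have "int (L.zc (R.unact (rpath q) M) t n)<=int (count (M n t) 1)"
   unfolding zc_M1[OF F that(5) e(3,4)] e(1,2) by simp
  ultimately have "count (M n t) 1 > 0" by linarith
  then show ?thesis by simp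
 qed
 have init: "cls t 0" if "q t < n" "n<=q (Suc t)" for t
 proof (cases "t = 0")
  case False
  then have "0 \<in># M n t" using rz that by simp
  then show ?thesis using c by (simp add: in_cls_def)
 qed (use cls_init in simp)
 show "in_cls J"
  unfolding in_cls_def
 proof (intro allI ballI)
  fix t y' assume x: "y' \<in># J n t"
  have t: "t>=1" using x L.RC_D(1)[OF J] by (cases t) (auto simp: L.supported_def)
  obtain H where H: "H = 0 | H = 2 | H = -2" "H = HH (p t) (q t) n"
   and cnt: "!!x. int (count (R.act (rpath q) (L.act (lpath p) J) n t) x) = int (count (J n t) (x + H))
   - of_bool (p (t - 1) < n & n<=p t) * of_bool (x + H = 0)
   + (of_bool (p t < n & n<=p (Suc t)) - of_bool (q (t - 1) < n & n<=q t))
    * of_bool (x = of_bool (q t = n) - of_bool (Suc (q t) = n))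
   + of_bool (q t < n & n<=q (Suc t)) * of_bool (x = 0)"
   by (rule count_n[OF G t]) blast
  have "0 < count (J n t) (y' - H + H)" using x by simp
  from count_neg_cases[OF cnt[of "y' - H", folded M] this]
  consider "y' - H \<in># M n t"
   | "p (t - 1) < n" "n<=p t" "y' = 0"
   | "q (t - 1) < n" "n<=q t" "~ (p t < n & n<=p (Suc t))" "y' - H = of_bool (q t = n) - of_bool (Suc (q t) = n)"
   by auto
  then show "cls t y'"
  proof cases
   case 1
   then have "cls t (y' - H)" using c by (simp add: in_cls_def)
   then show ?thesis using cls_even[OF H(1), of t "y' - H"] by simp
  next
   case 2
   obtain s where ts: "t = Suc s" using t by (cases t) auto
   show ?thesis
   proof (cases "s = 0")
    case True
    have "p (Suc 0) = nn" "q (Suc 0) = 0" using tr[of 0] p0 q0 2 ts True n_pos by (auto simp: trans_def)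
    then have "x = nn & y = 0" using phi_xy by blast
    then have "phi_ok" using al n_pos unfolding allowed_def by auto
    then have "cls 1 0" using phi_ok by blast
    then show ?thesis using 2 ts True by simp
   next
    case False
    then have s1: "s>=1" by simp
    have cr: "n<=q s" "q s = nn - p s" using l_crosses[OF G _ _ s1] 2 ts by auto
    show ?thesis
    proof (cases "q (s - 1) < n")
     case True
     then have "cls (s - 1) 0" using init[of "s - 1"] cr s1 by simp
     then show ?thesis using cls_0_0[of "s - 1"] 2 ts s1 by simp
    next
     case False
     then have st: "p s = n - 1" "q s = n" using stay_zero[OF G, of "s - 1"] 2 ts s1 by auto
     then have "1 \<in># M n s" using lone[of s] False 2 ts s1 by simp
     then have "cls s 1" using c by (simp add: in_cls_def)
     then show ?thesis using cls_0_1[OF one_zero] 2 ts by blast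
    qed
   qed
  next
   case 3
   have cr: "p t<=n - 1" "q t = nn - p t" using r_crosses[OF G, of "t - 1"] 3 t by auto
   have st: "p t = n - 1" "q t = n" "p (Suc t) = n - 1" "q (Suc t) = n"
    using double_or_zero[OF G cr(1) 3(2)] 3(3) cr(1) n_pos by auto
   have "HH (n - 1) n n = 0" using n_pos unfolding HH_def by (cases n) auto
   then have y1: "y' = 1" using 3(4) st H(2) n_pos by simp
   \<comment> \<open>A crossing out of the state \<open>(n - 1, n)\<close> at a later length would
     show a rigging 1, which \<open>one_zero\<close> forbids without the letter 0. The state would
     then persist up to \<open>T\<close> and be the final one, which is not allowed.\<close>
   have zero_ok
   proof (rule ccontr)
    assume nz: "~ zero_ok"
    have "p (t + k) = n - 1 & q (t + k) = n & p (Suc (t + k)) = n - 1 & q (Suc (t + k)) = n" for k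
    proof (induction k)
     case (Suc k)
     let ?s = "Suc (t + k)"
     have "~ n<=p (Suc ?s)"
     proof
      assume "n<=p (Suc ?s)"
      then have "1 \<in># M n ?s" using lone[of ?s] Suc n_pos by simp
      then have "cls ?s 1" using c by (simp add: in_cls_def)
      then show False using one_zero nz by blast
     qed
     then show ?case using double_or_zero[OF G, of ?s] Suc by auto
    qed (use st in simp)
    from this[of T] have "x = n - 1" "y = n" using pT[of "t + T"] qT[of "t + T"] by auto
    then show False using al nz n_pos unfolding allowed_def by auto
   qed
   moreover have "cls (t - 1) 0" using init[of "t - 1"] 3 t by simp
   ultimately show ?thesis using cls_1_0[of "t - 1"] t y1 by simp
  qed
 qed
qed

text \<open>The adjunction \<open>walk_adjoint\<close> compares two walks in the same lattice.
  Symmetry moves the reverse walk of the second walker to the left end, where the next letter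
  begins.\<close>

lemma mirror_rwalk:
 assumes s: "sym M" and v: "R.rwalk M (rv y) (rpath q)"
  and q_le: "!!t. q t<=nn"
 shows "L.rwalk M (lv y) (%t. lv (q t))"
proof -
 have mir: "L.zc M t (Suc k) = R.zc M t (rcol n k)" if "k < nn" for t k
  using s that unfolding sym_def by (auto simp: L.zc_def R.zc_def rcol_def dest!: bspec[of _ _ "Suc k"])
 have "rv (q 0) = rv 0" using v by (simp add: R.rwalk_def)
 then have q0: "q 0 = 0" by (simp add: pv_inject del: pv.simps)
 have qT: "q t = y" if "t>=T" for t using v that by (simp add: R.rwalk_def pv_inject)
 have "L.rstep (L.zc M t) (lv (q (Suc t))) (lv (q t))" if t: "t>=1" for t
 proof -
  have "R.rstep (R.zc M t) (rv (q (Suc t))) (rv (q t))" using v t by (simp add: R.rwalk_def)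
  then have *: "q t<=q (Suc t) & (\<forall>k. q t<=k & k < q (Suc t) --> R.zc M t (rcol n k)>=1)
   & (q t > 0 --> R.zc M t (rcol n (q t - 1)) = 0)"
   using R.rstep_pos[OF q_le q_le] by blast
  have A: "L.zc M t (lcol k)>=1" if k: "q t<=k" "k < q (Suc t)" for k
  proof -
   have "k < nn" using k q_le[of "Suc t"] by linarith
   then have "L.zc M t (lcol k) = R.zc M t (rcol n k)" unfolding lcol_def by (rule mir)
   moreover have "R.zc M t (rcol n k)>=1" using * k by blast
   ultimately show ?thesis by simp
  qed
  have B: "L.zc M t (lcol (q t - 1)) = 0" if k: "q t > 0"
  proof -
   have "q t - 1 < nn" using k q_le[of t] by linarith
   then have "L.zc M t (lcol (q t - 1)) = R.zc M t (rcol n (q t - 1))" unfolding lcol_def by (rule mir)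
   also have "R.zc M t (rcol n (q t - 1)) = 0" using * k by blast
   finally show ?thesis .
  qed
  show ?thesis
   unfolding L.rstep_pos[OF q_le q_le]
  proof (intro conjI allI impI)
   show "q t<=q (Suc t)" using * by blast
   show "L.zc M t (lcol k)>=1" if "q t<=k & k < q (Suc t)" for k using A that by blast
   show "L.zc M t (lcol (q t - 1)) = 0" if "q t > 0" using B that by blast
  qed
 qed
 moreover have "lv y\<in>L.S" using qT[of T] q_le[of T] L.pv_in_S by simp
 ultimately show ?thesis using q0 qT by (simp add: L.rwalk_def)
qed

end

context sym_class
begin

definition Dmap :: "riggings => (nat \<times> nat) \<times> riggings" where
 "Dmap J = (let (u, K1) = L.del J; (v, K2) = R.del K1 in ((L.pos u, R.pos v), K2))"

abbreviation "Zl L \<equiv> (Zof (Suc L))(lcol 0 := Zof (Suc L) (lcol 0) - 1)"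

lemma Zof_nonneg: "Zof L a>=0" "Zof (Suc L) (lcol 0)>=1" "Zl L a>=0" "Zl L (rcol n 0)>=1"
 using n_pos by (auto simp: Zof_def lcol_def rcol_def)

lemma Zlr: "(Zl L)(rcol n 0 := Zl L (rcol n 0) - 1) = Zof L"
 using n_pos by (auto simp: Zof_def lcol_def rcol_def fun_eq_iff)

lemma pair_walks:
 assumes J: "J\<in>KS (Suc L) N" and NT: "!!a. a\<in>{Suc 0..nn} ==> N a < of_nat T"
 obtains p q K1 K2 where
  "!!t. p t<=nn" "!!t. q t<=nn"
  "L.fwalk J (lpath p)" "K1 = L.act (lpath p) J"
  "R.fwalk K1 (rpath q)" "K2 = R.act (rpath q) K1"
  "K1\<in>L.RC (Zl L) (%a. N a - of_nat (lv (p T) a))"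
  "L.rwalk K1 (lv (p T)) (lpath p)" "L.unact (lpath p) K1 = J"
  "K2\<in>L.RC (Zof L) (NN N (p T) (q T))"
  "R.rwalk K2 (rv (q T)) (rpath q)" "R.unact (rpath q) K2 = K1"
  "Dmap J = ((p T, q T), K2)"
proof -
 have JR: "J\<in>L.RC (Zof (Suc L)) N" using J by (simp add: KS_def)
 obtain u where u: "L.fwalk J u" using L.fwalk_exists by blast
 obtain p where p: "!!t. p t<=nn" "u = (lpath p)" using L.fwalk_positions[OF u] by blast
 define K1 where "K1 = L.act u J"
 note l = L.act_RC[OF Zof_nonneg(1,2) NT JR u, folded K1_def]
 obtain v where v: "R.fwalk K1 v" using R.fwalk_exists by blast
 obtain q where q: "!!t. q t<=nn" "v = (rpath q)" using R.fwalk_positions[OF v] by blast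
 define K2 where "K2 = R.act v K1"
 have NT1: "N a - of_nat (u T a) < of_nat T" if "a\<in>{Suc 0..nn}" for a
  using NT[OF that] by (meson diff_le_eq le_add_same_cancel1 of_nat_0_le_iff order_le_less_trans)
 note r = R.act_RC[OF Zof_nonneg(3,4) NT1 l(1) v, folded K2_def, unfolded Zlr]
 have D: "Dmap J = ((p T, q T), K2)"
 proof -
  have "Dmap J = ((L.pos (u T), R.pos (v T)), K2)"
   unfolding Dmap_def L.del_eq[OF u] K1_def[symmetric] by (simp add: R.del_eq[OF v] K2_def)
  then show ?thesis using p q by simp
 qed
 show thesis
  by (rule that[of p q K1 K2]) (use u v p q l r D K1_def K2_def in \<open>simp_all add: NN_def[abs_def]\<close>)
qed

text \<open>This is where the extra condition for the letter 0 comes from: the first walker ends at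
  \<open>n - 1\<close>, where \<open>h\<close> of colour \<open>n\<close> is 1, and the
  configuration between the two walks still has a nonnegative vacancy number at infinity.\<close>

lemma dm_NN_bound:
 assumes "K1\<in>L.RC (Zl L) (%a. N a - of_nat (lv (n - 1) a))"
 shows "1<=L.dm (Zof (Suc L)) N n"
proof -
 have nC: "n\<in>{Suc 0..nn}" using n_pos by auto
 have "L.h n (lv (n - 1)) = 1" using h_l[of n "n - 1"] n_pos by auto
 then show ?thesis using L.RC_dm[OF assms nC] unfolding L.dm_change by simp
qed

theorem pair_forward:
 assumes J: "J\<in>KS (Suc L) N" and NT: "!!a. a\<in>{Suc 0..nn} ==> N a < of_nat T"
 obtains x y K2 where "Dmap J = ((x, y), K2)" "allowed x y" "K2\<in>KS L (NN N x y)"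
  "x = n - 1 & y = n ==> 1<=L.dm (Zof (Suc L)) N n"
proof -
 have JR: "J\<in>L.RC (Zof (Suc L)) N" "sym J" "in_cls J" using J by (auto simp: KS_def)
 obtain p q K1 K2 where w:
  "!!t. p t<=nn" "!!t. q t<=nn"
  "L.fwalk J (lpath p)" "K1 = L.act (lpath p) J"
  "R.fwalk K1 (rpath q)" "K2 = R.act (rpath q) K1"
  "K1\<in>L.RC (Zl L) (%a. N a - of_nat (lv (p T) a))"
  "K2\<in>L.RC (Zof L) (NN N (p T) (q T))" "Dmap J = ((p T, q T), K2)"
  by (rule pair_walks[OF J NT]) auto
 note f = in_cls_forward[OF JR w(3) w(1) w(5)[unfolded w(4)] w(2), folded w(4), folded w(6)]
 show thesis
 proof (rule that[of "p T" "q T" K2])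
  show "Dmap J = ((p T, q T), K2)" by (rule w(9))
  show "allowed (p T) (q T)" using f(3) by simp
  show "K2\<in>KS L (NN N (p T) (q T))" using w(8) f(1,2) by (simp add: KS_def)
  show "1<=L.dm (Zof (Suc L)) N n" if "p T = n - 1 & q T = n"
   using dm_NN_bound w(7) that by simp
 qed
qed

theorem pair_backward:
 assumes M: "M\<in>KS L (NN N x y)" and al: "allowed x y"
  and NT: "!!a. a\<in>{Suc 0..nn} ==> N a < of_nat T"
  and dom: "!!a. a\<in>{Suc 0..nn} ==> 0<=L.dm (Zof (Suc L)) N a"
  and zero: "x = n - 1 & y = n ==> 1<=L.dm (Zof (Suc L)) N n"
 shows "\<exists>J\<in>KS (Suc L) N. Dmap J = ((x, y), M)"
proof -
 have MR: "M\<in>L.RC (Zof L) (NN N x y)" "sym M" "in_cls M" using M by (auto simp: KS_def)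
 have le: "x<=nn" "y<=nn" using al n_pos unfolding allowed_def by auto
 let ?N1 = "%a. N a - of_nat (lv x a)"
 have NN_eq: "NN N x y = (%a. ?N1 a - of_nat (rv y a))" by (simp add: NN_def[abs_def])
 have NT1: "?N1 a < of_nat T" if "a\<in>{Suc 0..nn}" for a
  using NT[OF that] by (meson diff_le_eq le_add_same_cancel1 of_nat_0_le_iff order_le_less_trans)
 have NT2: "NN N x y a < of_nat T" if "a\<in>{Suc 0..nn}" for a
  using NT1[OF that] unfolding NN_eq by (meson diff_le_eq le_add_same_cancel1 of_nat_0_le_iff order_le_less_trans)
 \<comment> \<open>The weight between the two walks lies one step from a dominant weight on either
   side. It could fail to be dominant only where the first step lowers the pairing and the second
   raises it again, which happens for the letter 0 at the middle colour alone.\<close>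
 have dom1: "0<=R.dm (Zl L) ?N1 a" if a: "a\<in>{Suc 0..nn}" for a
 proof -
  have a': "1<=a" "a<=nn" using a by auto
  have P: "R.dm (Zl L) ?N1 a = L.dm (Zof (Suc L)) N a - of_int (L.h a (lv x))"
   by (rule L.dm_change)
  have P2: "L.dm (Zof L) (NN N x y) a = R.dm (Zl L) ?N1 a - of_int (R.h a (rv y))"
   unfolding NN_eq using R.dm_change[of "Zl L" ?N1 "rv y" a] unfolding Zlr by blast
  have nn: "0<=L.dm (Zof L) (NN N x y) a" using L.RC_dm[OF MR(1) a] .
  consider "R.h a (rv y)>=0" | "L.h a (lv x)<=0"
   | "x = n - 1" "y = n" "a = n"
  proof (cases "a + y = 2 * n")
   case False
   then have "R.h a (rv y)>=0" unfolding h_r[OF a' le(2)] by simp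
   then show ?thesis by (rule that(1))
  next
   case True
   consider "x = y" | "x = n - 1" "y = n" | "y = 0" using al unfolding allowed_def by blast
   then show ?thesis
   proof cases
    case 1
    then have "a ~= Suc x" using True by presburger
    then have "L.h a (lv x)<=0" unfolding h_l[OF a' le(1)] by simp
    then show ?thesis by (rule that(2))
   next
    case 2
    then show ?thesis using that(3) True by simp
   next
    case 3
    then show ?thesis using True a' by simp
   qed
  qed
  then show ?thesis
  proof cases
   case 1
   then show ?thesis using nn P2 by simp
  next
   case 2
   then have "(of_int (L.h a (lv x)) :: rat)<=0" by simp
   then show ?thesis using dom[OF a] P by simp
  next
   case 3
   have "L.h n (lv (n - 1)) = 1" using h_l[of n "n - 1"] n_pos by auto
   then show ?thesis using zero P 3 by simp
  qed
 qed
 have "M a T = {#}" for a using L.top_empty[OF MR(1) NT2] .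
 then obtain v where v: "R.rwalk M (rv y) v"
  using R.rwalk_exists[OF R.pv_in_S[OF le(2)] R.RC_D(1)[OF MR(1)]] by blast
 obtain q where q: "!!t. q t<=nn" "v = (rpath q)" using R.rwalk_positions[OF v] by blast
 define K0 where "K0 = R.unact v M"
 have MR': "M\<in>R.RC ((Zl L)(rcol n 0 := Zl L (rcol n 0) - 1)) (%a. ?N1 a - of_nat (rv y a))"
  using MR(1) unfolding Zlr NN_eq .
 note r = R.unact_RC[OF Zof_nonneg(3,4) NT1 MR' v dom1[unfolded R.dm_def], folded K0_def]
 have "K0 a T = {#}" for a using L.top_empty[OF r(1) NT1] .
 then obtain u where u: "L.rwalk K0 (lv x) u"
  using L.rwalk_exists[OF L.pv_in_S[OF le(1)] L.RC_D(1)[OF r(1)]] by blast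
 obtain p where p: "!!t. p t<=nn" "u = (lpath p)" using L.rwalk_positions[OF u] by blast
 define J where "J = L.unact u K0"
 note l = L.unact_RC[OF Zof_nonneg(1,2) NT r(1) u dom[unfolded L.dm_def], folded J_def]
 have nonneg: "\<forall>a t. \<forall>x\<in>#M a t. 0<=x"
  using L.RC_D(4)[OF MR(1)] L.supported_C[OF L.RC_D(1)[OF MR(1)]] by blast
 have "sym J" "in_cls J"
 proof -
  have 1: "L.fwalk J (lpath p)" using l(2) p by simp
  have 2: "R.fwalk (L.act (lpath p) J) (rpath q)" using l(3) r(2) p q by simp
  have 3: "M = R.act (rpath q) (L.act (lpath p) J)" using l(3) r(3) p q by simp
  have 4: "R.rwalk M (rv y) (rpath q)" using v q by simp
  have 5: "L.rwalk (R.unact (rpath q) M) (lv x) (lpath p)"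
   using u p q K0_def by simp
  show "sym J" "in_cls J"
   using in_cls_backward[OF l(1) 1 p(1) 2 q(1) 3 nonneg MR(2,3) 4 5 al] by auto
 qed
 moreover have "Dmap J = ((x, y), M)"
 proof -
  have "L.del J = (lv x, K0)" using L.del_eq[OF l(2)] l(3) u by (simp add: L.rwalk_def)
  moreover have "R.del K0 = (rv y, M)" using R.del_eq[OF r(2)] r(3) v by (simp add: R.rwalk_def)
  ultimately show ?thesis using le by (simp add: Dmap_def)
 qed
 ultimately show ?thesis using l(1) by (auto simp: KS_def)
qed

theorem pair_inj:
 assumes NT: "!!a. a\<in>{Suc 0..nn} ==> N a < of_nat T"
 shows "inj_on Dmap (KS (Suc L) N)"
proof (rule inj_onI)
 fix J J' assume J: "J\<in>KS (Suc L) N" and J': "J'\<in>KS (Suc L) N" and eq: "Dmap J = Dmap J'"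
 obtain p q K1 K2 where w:
  "L.rwalk K1 (lv (p T)) (lpath p)" "L.unact (lpath p) K1 = J"
  "R.rwalk K2 (rv (q T)) (rpath q)" "R.unact (rpath q) K2 = K1"
  "Dmap J = ((p T, q T), K2)"
  by (rule pair_walks[OF J NT]) auto
 obtain p' q' K1' K2' where w':
  "L.rwalk K1' (lv (p' T)) (lpath p')" "L.unact (lpath p') K1' = J'"
  "R.rwalk K2' (rv (q' T)) (rpath q')" "R.unact (rpath q') K2' = K1'"
  "Dmap J' = ((p' T, q' T), K2')"
  by (rule pair_walks[OF J' NT]) auto
 have e: "p T = p' T" "q T = q' T" "K2 = K2'" using eq w(5) w'(5) by auto
 have "(rpath q) = (rpath q')" using R.rwalk_unique[OF w(3)] w'(3) e by simp
 then have e1: "K1 = K1'" using w(4) w'(4) e by simp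
 then have "(lpath p) = (lpath p')" using L.rwalk_unique[OF w(1)] w'(1) e by simp
 then show "J = J'" using w(2) w'(2) e1 by simp
qed

text \<open>Position \<open>2 n - 1\<close> of the first walker and \<open>0\<close> of the second encode the letter \<open>\<phi>\<close>.\<close>

theorem pair_stat:
 assumes J: "J\<in>KS (Suc L) N" and NT: "!!a. a\<in>{Suc 0..nn} ==> N a < of_nat T"
  and D: "Dmap J = ((x, y), K2)"
 shows "L.st J = L.st K2 + 2 * (2 * L.np J (Suc 0) - of_bool (x = nn & y = 0))"
  and "Dmap K2 = ((x', y'), J3) ==>
   L.np J (Suc 0) = L.np K2 (Suc 0) + of_bool ((x = nn & y = 0) | ~ y<=x')"
proof -
 have JR: "J\<in>L.RC (Zof (Suc L)) N" "sym J" "in_cls J" using J by (auto simp: KS_def)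
 obtain p q K1 K2' where w:
  "!!t. p t<=nn" "!!t. q t<=nn"
  "L.fwalk J (lpath p)" "K1 = L.act (lpath p) J"
  "R.fwalk K1 (rpath q)" "K2' = R.act (rpath q) K1"
  "K1\<in>L.RC (Zl L) (%a. N a - of_nat (lv (p T) a))"
  "R.rwalk K2' (rv (q T)) (rpath q)" "Dmap J = ((p T, q T), K2')"
  by (rule pair_walks[OF J NT]) auto
 have xy: "x = p T" "y = q T" "K2' = K2" using w(9) D by auto
 note f = in_cls_forward[OF JR w(3) w(1) w(5)[unfolded w(4)] w(2), folded w(4), folded w(6)]
 have nonneg: "\<forall>a t. \<forall>x\<in>#J a t. 0<=x"
  using L.RC_D(4)[OF JR(1)] L.supported_C[OF L.RC_D(1)[OF JR(1)]] by blast
 note ok = L.fwalk_steps_ok[OF w(3) L.RC_D(1)[OF JR(1)]]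
 note F = nonneg JR(2) w(3) w(1) w(5)[unfolded w(4)] w(2) ok
 have sup: "L.supported J" "R.supported K1" using L.RC_D(1)[OF JR(1)] L.RC_D(1)[OF w(7)] by auto
 obtain T' where T': "T = Suc T'" using T_pos by (cases T) auto
 \<comment> \<open>The first walker takes a part of length 1 from the last colour exactly in the
   case of phi. This is the only discrepancy between the part counts seen by the two
   walkers.\<close>
 have phi_iff: "p 1 = nn \<longleftrightarrow> x = nn & y = 0"
 proof
  assume "p 1 = nn"
  then have "n<=p 1" using n_pos by simp
  then show "x = nn & y = 0"
   using phi_walk(1)[OF F, of T'] phi_walk(2)[OF F, of T] xy T' by simp
 next
  assume "x = nn & y = 0"
  then have "n<=p 1" using forward_phi[OF F, of T'] xy T' by simp
  then show "p 1 = nn" using phi_walk(1)[OF F, of 0] by simp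
 qed
 have n1: "1<=nn" using n_pos by simp
 have np1: "L.np K1 a = L.np J a - int (lv (p 1) a)" for a
  using L.np_act[OF w(3) sup(1), of a] w(4) by simp
 have np2: "L.np K2 a = L.np K1 a - int (rv (q 1) a)" for a
  using R.np_act[OF w(5) sup(2), of a] w(6) xy by simp
 have symnp: "L.np J (nn) = L.np J (Suc 0)"
 proof -
  have "J (nn) t = J (Suc 0) t" for t
   using JR(2) n_pos unfolding sym_def by (auto dest: bspec[of _ _ "Suc 0"])
  then show ?thesis by (simp add: L.np_def m_of_def)
 qed
 have "L.st J = L.st K1 + 2 * 1 * L.np J (lcol 0)" using L.st_act[OF w(3) sup(1)] w(4) by simp
 moreover have "L.st K1 = L.st K2 + 2 * 1 * L.np K1 (rcol n 0)" using R.st_act[OF w(5) sup(2)] w(6) xy by simp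
 moreover have "L.np K1 (rcol n 0) = L.np J (Suc 0) - of_bool (p 1 = nn)"
  using np1[of "nn"] symnp n1 w(1)[of 1] by (auto simp: rcol_def pv_lcol)
 moreover have "lcol 0 = Suc 0" by (simp add: lcol_def)
 ultimately show "L.st J = L.st K2 + 2 * (2 * L.np J (Suc 0) - of_bool (x = nn & y = 0))"
  using phi_iff by simp
 assume D2: "Dmap K2 = ((x', y'), J3)"
 obtain u' where u': "L.fwalk K2 u'" using L.fwalk_exists by blast
 have x': "u' T = lv x'" "x'<=nn"
  using D2 L.del_eq[OF u'] L.pv_pos[OF L.fwalk_in_S[OF u', of T]] L.pos_le[OF L.fwalk_in_S[OF u', of T]]
  by (auto simp: Dmap_def split: prod.splits)
 have rw: "L.rwalk K2 (lv y) (%t. lv (q t))"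
  using mirror_rwalk[OF _ _ w(2)] w(8) f(1) xy by simp
 \<comment> \<open>The reverse walk belonging to this letter, mirrored, is paired with the forward
   walk of the next letter on the same configuration \<open>K2\<close>.\<close>
 have q1: "q 1 = 0 \<longleftrightarrow> y<=x'"
 proof -
  have "lv y<=u' T \<longleftrightarrow> lv (q 1) = lv 0" using L.walk_adjoint[OF u' rw] by simp
  then show ?thesis unfolding x' pv_le_iff pv_inject by simp
 qed
 have tr0: "trans 0 0 (p 1) (q 1)" using f(4)[of 0] p0[OF F] q0[OF F] by simp
 have "int (lv (p 1) (Suc 0)) + int (rv (q 1) (Suc 0)) = of_bool (p 1 = nn | q 1 ~= 0)"
  using tr0 n_pos w(1)[of 1] unfolding pv_lcol pv_rcol[OF n_pos w(2)] trans_def by auto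
 then show "L.np J (Suc 0) = L.np K2 (Suc 0) + of_bool ((x = nn & y = 0) | ~ y<=x')"
  unfolding phi_iff[symmetric] q1[symmetric] np2 np1 by simp
qed

end

context rc
begin

text \<open>
 A part of length 1 is created in colour \<open>a0\<close> by the reverse walk from \<open>x\<close> as often as the energy
 function of the pair \<open>x, y\<close> says, where \<open>y\<close> is the end of the forward walk.
\<close>
lemma walk_energy:
 assumes u: "fwalk J u" and v: "rwalk J x v"
  and S0: "!!w. w\<in>S ==> w a0 = 0 ==> w = (%_. 0)"
  and top: "mx\<in>S" "!!w. w\<in>S ==> w<=mx" "!!w. w\<in>S ==> mx a0<=w a0 ==> w = mx"
   "dn a0 mx" "mx a0<=2" and up0: "up a0 (%_. 0)"
 shows "v 1 a0 = (if x<=u T then 0 else if x = mx & u T = (%_. 0) then mx a0 else 1)"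
proof -
 have vS: "v t\<in>S" for t using rwalk_in_S v by blast
 have vmono: "v t<=v (t + k)" for t k
  by (induction k) (use rwalk_mono[OF v] order_trans in auto)
 have umono: "u t<=u (t + k)" for t k
  by (induction k) (use fwalk_mono[OF u] order_trans in auto)
 have supT: "u 0 = (%_. 0)" using u by (simp add: fwalk_def)
 have vx: "v t<=x" if "t<=T" for t
  using vmono[of t "T - t"] that v by (simp add: rwalk_def)
 show ?thesis
 proof (cases "x<=u T")
  case True
  then show ?thesis using walk_adjoint[OF u v] by simp
 next
  case False
  then have ne: "v 1 a0 ~= 0" using walk_adjoint[OF u v] S0[OF vS] by auto
  \<comment> \<open>The full amount is created only if the reverse walk never moves, hence only if
    colour \<open>a0\<close> has no singular part at any length. The forward walk then cannot leave
    zero either, and conversely.\<close>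
  have "v 1 = mx \<longleftrightarrow> x = mx & u T = (%_. 0)"
  proof
   assume v1: "v 1 = mx"
   have vt: "v t = mx" if "t>=1" for t
    using vmono[of 1 "t - 1"] that v1 top(2)[OF vS] by (simp add: antisym)
   then have x: "x = mx" using v T_pos by (auto simp: rwalk_def)
   have z: "zc J t a0 = 0" if "t>=1" for t
   proof -
    have "rstep (zc J t) mx mx" using v that vt by (simp add: rwalk_def)
    then show ?thesis using top(4) by (simp add: rstep_def)
   qed
   have "u t = (%_. 0)" for t
   proof (induction t)
    case (Suc t)
    have "fstep (zc J (Suc t)) (u t) (u (Suc t))" using u by (simp add: fwalk_def)
    then have "u (Suc t)\<in>S" "u (Suc t) a0<=u t a0 + zc J (Suc t) a0" by (auto simp: fstep_def)
    then show ?case using Suc z[of "Suc t"] S0 by simp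
   qed (rule supT)
   then show "x = mx & u T = (%_. 0)" using x by blast
  next
   assume *: "x = mx & u T = (%_. 0)"
   have ut: "u t = (%_. 0)" if "t<=T" for t
    using umono[of t "T - t"] that * by (auto simp: le_fun_def fun_eq_iff)
   have z: "zc J (Suc t) a0 = 0" if "Suc t<=T" for t
   proof -
    have "fstep (zc J (Suc t)) (u t) (u (Suc t))" using u by (simp add: fwalk_def)
    then show ?thesis using up0 ut that by (simp add: fstep_def)
   qed
   have "1<=s ==> v s = mx" if "s<=T" for s
    using that
   proof (induction s rule: inc_induct)
    case base
    then show ?case using v * by (simp add: rwalk_def)
   next
    case (step s)
    have "rstep (zc J s) (v (Suc s)) (v s)" using v step.prems unfolding rwalk_def by blast
    then have rs: "rstep (zc J s) mx (v s)" using step by simp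
    have "mx a0<=v s a0 + zc J s a0" using rs by (simp add: rstep_def)
    then show ?case using z[of "s - 1"] step top(3)[OF vS] by simp
   qed
   then show "v 1 = mx" using T_pos by simp
  qed
  moreover have "v 1 a0 < mx a0" if "v 1 ~= mx" using top(3)[OF vS, of 1] that by (meson not_le)
  ultimately show ?thesis using False ne top(5) by auto
 qed
qed

end

section \<open>The vector representation of type C\<close>

definition cartanC :: "nat => nat => nat => int" where
 "cartanC n a b = (if Suc a = n & b = n then -2 else cartan a b)"

text \<open>The colours of the arrows along the vector representation: 1, ..., n and back to 1, with
  \<open>n\<close> passed once.\<close>

definition ccol :: "nat => nat => nat" where
 "ccol n k = (if k < n then Suc k else 2 * n - Suc 0 - k)"

definition dC :: "nat => nat => int" where
 "dC n a = (if a = n then 2 else 1)"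

locale type_C =
 fixes n T :: nat
 assumes n_ge_2: "n>=2" and T_ge_1: "T>=1"
begin

abbreviation "nn \<equiv> 2 * n - Suc 0"
abbreviation "cv \<equiv> pv (ccol n)"

sublocale chain_rc "{Suc 0..n}" "cartanC n" "dC n" "ccol n" "nn" T
proof unfold_locales
 show "cartanC n a (ccol n k) = 2 * of_bool (a = ccol n k) - of_bool (Suc k < nn & ccol n (Suc k) = a)
   - of_bool (k > 0 & ccol n (k - 1) = a)"
  if a: "a\<in>{Suc 0..n}" and k: "k < nn" for a k
 proof -
  consider "Suc k < n" | "Suc k = n" | "n<=k" by linarith
  then show ?thesis
  proof cases
   case 1
   then show ?thesis using a n_ge_2 by (auto simp: ccol_def cartanC_def cartan_def)
  next
   case 2
   have "ccol n k = n" "ccol n (Suc k) = n - 1" "ccol n (k - 1) = n - 1" "k > 0" "Suc k < nn"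
    using 2 n_ge_2 by (auto simp: ccol_def)
   then show ?thesis using a n_ge_2 by (auto simp: cartanC_def cartan_def)
  next
   case 3
   define m where "m = nn - k"
   have m: "1<=m" "m < n" using k 3 by (auto simp: m_def)
   have e: "ccol n k = m" "Suc k < nn & ccol n (Suc k) = a \<longleftrightarrow> m = Suc a"
    "k > 0 & ccol n (k - 1) = a \<longleftrightarrow> a = Suc m"
    using 3 k a m by (auto simp: ccol_def m_def)
   show ?thesis unfolding e using m by (auto simp: cartanC_def cartan_def)
  qed
 qed
 show "dC n a * cartanC n a b = dC n b * cartanC n b a" if "a\<in>{Suc 0..n}" "b\<in>{Suc 0..n}" for a b
  using that by (auto simp: dC_def cartanC_def cartan_def)
 show "ccol n (Suc k) ~= ccol n k" if "Suc k < nn" for k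
  using that by (auto simp: ccol_def)
 show "finite {Suc 0..n}" "1<=nn" "1<=T" using n_ge_2 T_ge_1 by auto
 show "ccol n k\<in>{Suc 0..n}" if "k < nn" for k using that by (auto simp: ccol_def)
 show "cartanC n a a = 2" for a by (simp add: cartanC_def cartan_def)
 show "cartanC n a b<=0" if "a ~= b" for a b using that by (simp add: cartanC_def cartan_def)
qed

lemma ccol_n: "k < nn ==> ccol n k = n \<longleftrightarrow> Suc k = n"
 by (auto simp: ccol_def)

lemma ccol_1: "ccol n 0 = Suc 0" "ccol n (nn - 1) = Suc 0"
 using n_ge_2 by (auto simp: ccol_def)

lemma pv_ccol: "k<=n ==> cv k a = of_bool (1<=a & a<=k)"
 by (induction k) (auto simp: ccol_def)

lemma pv_ccol':
 "n<=k ==> k<=nn ==>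
  cv k a = of_bool (1<=a & a<=n) + of_bool (2 * n - k<=a & a < n)"
proof (induction k rule: dec_induct)
 case base
 then show ?case by (auto simp: pv_ccol)
next
 case (step k)
 then have "ccol n k = 2 * n - Suc k" by (simp add: ccol_def)
 then show ?case using step by auto
qed

abbreviation "ptop \<equiv> cv (nn)"

lemma top_1: "ptop (Suc 0) = 2"
 using pv_ccol'[of "nn" "Suc 0"] n_ge_2 by auto

lemma energy_top:
 assumes "fwalk J u" "rwalk J x v"
 shows "v 1 (Suc 0) = (if x<=u T then 0 else if x = ptop & u T = (%_. 0) then 2 else 1)"
proof -
 have S0: "w = (%_. 0)" if w: "w\<in>S" "w (ccol n 0) = 0" for w
 proof -
  obtain k where k: "k<=nn" "w = cv k" using S_pv[OF w(1)] by blast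
  have "k = 0"
  proof (rule ccontr)
   assume "k ~= 0"
   then have "cv 1<=w" unfolding k(2) pv_le_iff using \<open>k ~= 0\<close> by simp
   then show False using w(2) pv_ccol[of 1 "Suc 0"] n_ge_2 by (auto simp: le_fun_def ccol_1 dest: spec[of _ "Suc 0"])
  qed
  then show ?thesis using k by simp
 qed
 have t1: "ptop\<in>S" using pv_in_S by simp
 have t2: "w<=ptop" if "w\<in>S" for w using S_pv[OF that] pv_le_iff by auto
 have t3: "w = ptop" if w: "w\<in>S" "ptop (ccol n 0)<=w (ccol n 0)" for w
 proof -
  obtain k where k: "k<=nn" "w = cv k" using S_pv[OF w(1)] by blast
  have "k = nn"
  proof (rule ccontr)
   assume "k ~= nn"
   then have "w (Suc 0)<=1" using k n_ge_2 pv_ccol[of k "Suc 0"] pv_ccol'[of k "Suc 0"] by (cases "k<=n") auto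
   then show False using w(2) top_1 by (simp add: ccol_1)
  qed
  then show ?thesis using k by simp
 qed
 have t4: "dn (ccol n 0) ptop" using dn_pv[of "nn" "ccol n 0"] ccol_1 n_ge_2 by simp
 have up0: "up (ccol n 0) (%_. 0)" using up_pv[of 0 "ccol n 0"] n_ge_2 by simp
 show ?thesis
  using walk_energy[OF assms S0 t1 t2 t3 t4 _ up0] top_1 by (simp add: ccol_1)
qed

end

section \<open>Two successive walks from the same end, for type B\<close>

context rc
begin

lemma zc_act_ge:
 assumes "fwalk J u" "supported J" "t>=1"
 shows "u (Suc t) a - u t a<=zc (act u J) t a"
 using assms(3) by (simp add: zc_def act_def)

lemma zc_unact_ge:
 assumes "t>=1"
 shows "u t a - u (t - 1) a<=zc (unact u J) t a"
 using assms by (simp add: zc_def unact_def)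

text \<open>Each part that the first walker takes at length \<open>t + 1\<close> is left as a
  singular part of length \<open>t\<close>, so the second walker can follow one length earlier. The
  walks can be offset by one because the first one rests at length 1.\<close>

lemma second_walker_ahead:
 assumes u: "fwalk J u" and v: "fwalk (act u J) v" and sup: "supported J" and u1: "u 1 = (%_. 0)"
 shows "u (Suc t)<=v t"
proof (induction t)
 case 0
 then show ?case using u1 v by (simp add: fwalk_def)
next
 case (Suc t)
 have fs: "fstep (zc (act u J) (Suc t)) (v t) (v (Suc t))" using v by (simp add: fwalk_def)
 show ?case
 proof (rule fstep_greatest[OF fs fwalk_in_S[OF u]])
  fix a
  have "u (Suc (Suc t)) a - u (Suc t) a<=zc (act u J) (Suc t) a" by (rule zc_act_ge[OF u sup]) simp
  moreover have "u (Suc t) a<=v t a" using Suc by (simp add: le_fun_def)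
  ultimately show "u (Suc (Suc t)) a<=v t a + zc (act u J) (Suc t) a" by linarith
 qed
qed

text \<open>Undoing \<open>v\<close> leaves the lengthened parts singular at their new length. They
  suffice for the next reverse walk to come down at least as far as \<open>v\<close> does one length
  below.\<close>

lemma second_walker_behind:
 assumes v: "rwalk M y v" and u: "rwalk (unact v M) x u" and le: "x<=y"
 shows "u (Suc t)<=v t"
proof -
 have "u (Suc t)<=v t" if "t<=T" for t
  using that
 proof (induction t rule: inc_induct)
  case base
  then show ?case using u v le by (simp add: rwalk_def)
 next
  case (step t)
  have rs: "rstep (zc (unact v M) (Suc t)) (u (Suc (Suc t))) (u (Suc t))" using u by (simp add: rwalk_def)
  show ?case
  proof (rule rstep_least[OF rs rwalk_in_S[OF v]])
   fix a
   have "v (Suc t) a - v t a<=zc (unact v M) (Suc t) a" using zc_unact_ge[of "Suc t"] by simp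
   moreover have "u (Suc (Suc t)) a<=v (Suc t) a" using step by (simp add: le_fun_def)
   ultimately show "u (Suc (Suc t)) a<=v t a + zc (unact v M) (Suc t) a" by linarith
  qed
 qed
 moreover have "u (Suc t)<=v t" if "t>=T" using u v le that by (simp add: rwalk_def)
 ultimately show ?thesis by (meson nat_le_linear)
qed

end

context type_C
begin

text \<open>The rigged configurations of type \<open>B\<^sup>(\<^sup>1\<^sup>)\<^sub>n\<close>, with all parts doubled, and all riggings of the colours \<open>a < n\<close> doubled.\<close>
definition evn :: "riggings => bool" where
 "evn J \<longleftrightarrow> (\<forall>a\<in>{Suc 0..<n}. \<forall>t. (odd t --> J a t = {#}) & (\<forall>x\<in>#J a t. even x))"

abbreviation eqn :: "(nat => nat) => (nat => nat) => bool" where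
 "eqn u v \<equiv> (\<forall>a. a ~= n --> u a = v a)"

text \<open>Colour \<open>n\<close> occurs once among the steps, from position \<open>n - 1\<close>
  to \<open>n\<close>. Ignoring it can therefore only identify these two positions.\<close>

lemma eqn_pv:
 assumes "eqn (cv i) (cv j)" "i<=j" "j<=nn"
 shows "i = j | (i = n - 1 & j = n)"
proof (rule ccontr)
 assume *: "~ ?thesis"
 then have ij: "i < j" using assms by simp
 have e: "ccol n k = n" if k: "i<=k" "k < j" for k
 proof (rule ccontr)
  assume ne: "ccol n k ~= n"
  have "cv i (ccol n k)<=cv k (ccol n k)" "cv (Suc k) (ccol n k)<=cv j (ccol n k)"
   using pv_mono[of i k "ccol n"] pv_mono[of "Suc k" j "ccol n"] k by (auto simp: le_fun_def simp del: pv.simps)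
  then show False using assms(1) ne by simp
 qed
 have "Suc i = n" using e[of i] ccol_n[of i] ij assms(3) by simp
 moreover have "j = Suc i"
 proof (rule ccontr)
  assume "j ~= Suc i"
  then have "Suc (Suc i) = n" using e[of "Suc i"] ccol_n[of "Suc i"] ij assms(3) by simp
  then show False using \<open>Suc i = n\<close> by simp
 qed
 ultimately show False using * by auto
qed

text \<open>Colour \<open>n\<close> enters the coroots of the colours below \<open>n\<close> only
  through the entry -2 at \<open>n - 1\<close>.\<close>

lemma h_parity: "a < n ==> eqn u v ==> even (h a u - h a v)"
proof -
 assume a: "a < n" and e: "eqn u v"
 have "h a u - h a v = (\<Sum>b\<in>{Suc 0..n}. cartanC n a b * (int (v b) - int (u b)))"
  by (simp add: h_def sum_subtractf right_diff_distrib)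
 also have "... = (\<Sum>b\<in>{Suc 0..n}. if b = n then cartanC n a n * (int (v n) - int (u n)) else 0)"
  using e by (intro sum.cong) auto
 also have "... = cartanC n a n * (int (v n) - int (u n))" using n_ge_2 by simp
 finally show ?thesis using a by (auto simp: cartanC_def cartan_def)
qed

lemma odd_h_zc:
 assumes "evn J" "a\<in>{Suc 0..<n}" "odd c" shows "count (J a t) c = 0"
 using assms by (metis evn_def not_in_iff)

lemma zc_J_odd: "evn J ==> a\<in>{Suc 0..<n} ==> odd t ==> zc J t a = 0"
 by (simp add: evn_def zc_def)

lemma S_eqnI: "u\<in>S ==> v\<in>S ==> (!!a. a\<in>{Suc 0..<n} ==> u a = v a) ==> eqn u v"
 using S_support by (metis (no_types, lifting) atLeastAtMost_iff atLeastLessThan_iff order_le_neq_trans)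

lemma S_zero: "u\<in>S ==> u (Suc 0) = 0 ==> u = (%_. 0)"
proof -
 assume w: "u\<in>S" "u (Suc 0) = 0"
 obtain k where k: "k<=nn" "u = cv k" using S_pv[OF w(1)] by blast
 have "k = 0"
 proof (rule ccontr)
  assume "k ~= 0"
  then have "cv 1<=u" unfolding k(2) pv_le_iff by simp
  then show False using w(2) pv_ccol[of 1 "Suc 0"] n_ge_2 by (auto simp: le_fun_def ccol_1 dest: spec[of _ "Suc 0"])
 qed
 then show ?thesis using k by simp
qed

context
 fixes J :: riggings and u v :: "nat => nat => nat"
 assumes ev: "evn J" and sup: "supported J"
  and u: "fwalk J u" and v: "fwalk (act u J) v"
begin

lemma u_odd: "odd t ==> a\<in>{Suc 0..<n} ==> u t a = u (t - 1) a"
 using fwalk_fstep[OF u, of t] zc_J_odd[OF ev, of a t]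
 by (auto simp: fstep_def le_fun_def dest!: spec[of _ a] odd_pos)

lemma u_1: "u 1 = (%_. 0)"
 using u_odd[of 1 "Suc 0"] n_ge_2 S_zero[OF fwalk_in_S[OF u, of 1]] u by (simp add: fwalk_def)

lemma act_odd: "odd t ==> a\<in>{Suc 0..<n} ==> act u J a t = replicate_mset (u (Suc t) a - u t a) 0"
 using ev by (auto simp: act_def evn_def)

lemma act_even:
 assumes "even t" "t>=1" "a\<in>{Suc 0..<n}"
 shows "act u J a t = image_mset (%x. x - h a (u t)) (J a t - replicate_mset (u t a - u (t - 1) a) 0)"
 using u_odd[of "Suc t" a] assms by (simp add: act_def)

lemma zc_act_odd_h:
 assumes "even t" "t>=1" "a\<in>{Suc 0..<n}" "odd (h a (u t))"
 shows "zc (act u J) t a = 0"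
 unfolding zc_def act_even[OF assms(1-3)] count_image_diff
 using odd_h_zc[OF ev assms(3,4), of t] by simp

text \<open>At an odd length the colours below \<open>n\<close> contain only parts that the first
  walker has just shortened, so the second walker goes exactly to where the first one will be at the
  next even length. At an even length the even riggings become odd wherever \<open>h\<close> is odd,
  so the next colour below \<open>n\<close> has no singular part; only the step of colour
  \<open>n\<close> remains free.\<close>

lemma v_walk: "(even t --> eqn (v t) (u t)) & (odd t --> eqn (v t) (u (Suc t)))"
proof (induction t)
 case 0
 then show ?case using u v by (simp add: fwalk_def)
next
 case (Suc t)
 have fs: "fstep (zc (act u J) (Suc t)) (v t) (v (Suc t))" using v by (simp add: fwalk_def)
 have le: "v t<=v (Suc t)" "v (Suc t) a<=v t a + zc (act u J) (Suc t) a" for a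
  using fs by (auto simp: fstep_def)
 note ahead = second_walker_ahead[OF u v sup u_1]
 show ?case
 proof (cases "even t")
  case True
  have "eqn (v (Suc t)) (u (Suc (Suc t)))"
  proof (rule S_eqnI[OF fwalk_in_S[OF v] fwalk_in_S[OF u]])
   fix a assume a: "a\<in>{Suc 0..<n}"
   have "zc (act u J) (Suc t) a = u (Suc (Suc t)) a - u (Suc t) a"
    using act_odd[of "Suc t" a] a True by (simp add: zc_def)
   moreover have "u (Suc t) a = u t a" using u_odd[of "Suc t" a] True a by simp
   moreover have "v t a = u t a" using Suc True a by simp
   moreover have "u (Suc (Suc t)) a<=v (Suc t) a" using ahead[of "Suc t"] by (simp add: le_fun_def)
   moreover have "u (Suc t) a<=u (Suc (Suc t)) a" using fwalk_mono[OF u] by (simp add: le_fun_def)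
   ultimately show "v (Suc t) a = u (Suc (Suc t)) a" using le(2)[of a] by linarith
  qed
  then show ?thesis using True by simp
 next
  case False
  then have e: "eqn (v t) (u (Suc t))" using Suc by simp
  obtain k where k: "k<=nn" "u (Suc t) = cv k" using S_pv[OF fwalk_in_S[OF u]] by blast
  obtain i where i: "i<=nn" "v t = cv i" using S_pv[OF fwalk_in_S[OF v]] by blast
  obtain j where j: "j<=nn" "v (Suc t) = cv j" using S_pv[OF fwalk_in_S[OF v]] by blast
  have ij: "i<=j" using le(1) i j by (simp add: pv_le_iff)
  have "k<=i" using ahead[of t] i k by (simp add: pv_le_iff)
  moreover have "eqn (cv k) (cv i)" using e i k by simp
  ultimately have ki: "i = k | (k = n - 1 & i = n)" using eqn_pv[of k i] i by auto
  have stuck: "~ (i<=l & l < j)" if l: "ccol n l\<in>{Suc 0..<n}" "odd (h (ccol n l) (u (Suc t)))" for l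
  proof
   assume "i<=l & l < j"
   then have "cv i (ccol n l)<=cv l (ccol n l)"
    "cv (Suc l) (ccol n l)<=cv j (ccol n l)"
    using pv_mono[of i l "ccol n"] pv_mono[of "Suc l" j "ccol n"] by (auto simp: le_fun_def simp del: pv.simps)
   then have "v t (ccol n l) < v (Suc t) (ccol n l)" using i j by simp
   then show False using le(2)[of "ccol n l"] zc_act_odd_h[OF _ _ l] False by simp
  qed
  have dn1: "odd (h (n - 1) (u (Suc t)))" "ccol n n = n - 1" if "k = n - 1"
   using that h_pv[of "n - 1" k] k n_ge_2 by (auto simp: ccol_def)
  have "eqn (v (Suc t)) (u (Suc t))"
  proof (cases "k = n - 1")
   case True
   have "j<=n"
   proof (rule ccontr)
    assume "~ j<=n"
    moreover have "ccol n n\<in>{Suc 0..<n}" using dn1(2)[OF True] n_ge_2 by simp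
    moreover have "odd (h (ccol n n) (u (Suc t)))" using dn1[OF True] by simp
    ultimately show False using stuck[of n] ki True by auto
   qed
   then have "j = n - 1 | j = n" using ij ki True by auto
   then show ?thesis using j k True pv.simps(2)[of "ccol n" "n - 1"] n_ge_2 by (auto simp: ccol_def)
  next
   case kn: False
   then have "i = k" using ki by simp
   have "j = i"
   proof (rule ccontr)
    assume "j ~= i"
    then have lt: "i < j" using ij by simp
    then have "k < nn" using j \<open>i = k\<close> by simp
    then have c: "ccol n k\<in>{Suc 0..<n}" using col_in_C[of k] ccol_n[of k] kn by fastforce
    have "up (ccol n k) (u (Suc t))" using up_pv[OF k(1)] k(2) \<open>k < nn\<close> by simp
    then have "h (ccol n k) (u (Suc t)) = 1"
     using h_eq[OF fwalk_in_S[OF u]] not_up_dn[OF fwalk_in_S[OF u]] up_in_C by simp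
    then show False using stuck[OF c] lt \<open>i = k\<close> by simp
   qed
   then show ?thesis using j k \<open>i = k\<close> by simp
  qed
  then show ?thesis using False by simp
 qed
qed

lemma v_even: "even t ==> a ~= n ==> v t a = u t a"
 and v_odd: "odd t ==> a ~= n ==> v t a = u (Suc t) a"
 using v_walk[of t] by auto

text \<open>The second walker uses up the parts of odd length that the first one created. At even
  lengths the two shifts have equal parity by \<open>h_parity\<close>, so riggings stay
  even.\<close>

lemma evn_forward: "evn (act v (act u J))"
 unfolding evn_def
proof (intro ballI allI conjI impI)
 fix a t :: nat assume a: "a\<in>{Suc 0..<n}" and t: "odd t"
 have an: "a ~= n" using a by auto
 have t1: "t ~= 0" "even (t - 1)" "even (Suc t)" "Suc (t - 1) = t" using t by (auto simp: odd_pos)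
 have "v t a - v (t - 1) a = u (Suc t) a - u t a"
  using v_odd[OF t an] v_even[OF t1(2) an] u_odd[OF t a] by simp
 moreover have "v (Suc t) a - v t a = 0" using v_odd[OF t an] v_even[OF t1(3) an] by simp
 ultimately show "act v (act u J) a t = {#}" using t1(1) act_odd[OF t a] unfolding act_def[of v] by simp
next
 fix a t :: nat and y assume a: "a\<in>{Suc 0..<n}" and y: "y \<in># act v (act u J) a t"
 have an: "a ~= n" "a < n" using a by auto
 have t0: "t ~= 0" using y by (cases t) (auto simp: act_def[of v])
 show "even y"
 proof (cases "even t")
  case True
  have z: "v t a - v (t - 1) a = 0"
   using v_even[OF True an(1)] v_odd[of "t - 1" a] True t0 an by (cases t) auto
  from y t0 consider "y = 0" | "y \<in># image_mset (%x. x - h a (v t)) (act u J a t)"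
   unfolding act_def[of v] z by (auto split: if_splits)
  then show ?thesis
  proof cases
   case 2
   then obtain x where x: "x \<in># J a t" "y = x - h a (u t) - h a (v t)"
    using act_even[OF True _ a] t0 by (auto dest: in_diffD)
   have "even x" using ev a x by (auto simp: evn_def)
   moreover have "even (h a (v t) - h a (u t))" using h_parity[OF an(2)] v_walk True by simp
   ultimately show ?thesis using x(2) by simp
  qed simp
 next
  case False
  have e: "even (t - 1)" "even (Suc t)" using False t0 by auto
  have "v t a - v (t - 1) a = u (Suc t) a - u t a"
   using v_odd[OF False an(1)] v_even[OF e(1) an(1)] u_odd[OF False a] by simp
  moreover have "v (Suc t) a - v t a = 0"
   using v_odd[OF False an(1)] v_even[OF e(2) an(1)] by simp
  ultimately have "act v (act u J) a t = {#}" using t0 act_odd[OF False a] unfolding act_def[of v] by simp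
  then show ?thesis using y by simp
 qed
qed

lemma end_forward:
 assumes "u T = cv x" "v T = cv y" "x<=nn" "y<=nn"
  "supported (act u J)"
 shows "x = y | (x = n - 1 & y = n)"
proof -
 \<comment> \<open>An even length beyond \<open>T\<close>, so that the even case of
   \<open>v_walk\<close> speaks about the final positions.\<close>
 have top: "u (2 * T) = u T" "v (2 * T) = v T"
  by (rule fwalk_stationary[OF u sup], simp) (rule fwalk_stationary[OF v assms(5)], simp)
 have "u (2 * T)<=v (2 * T)"
  using fwalk_mono[OF u, of "2 * T"] second_walker_ahead[OF u v sup u_1, of "2 * T"] by (rule order_trans)
 then have "x<=y" using assms top by (simp add: pv_le_iff)
 moreover have "eqn (cv x) (cv y)" using v_walk[of "2 * T"] top assms by simp
 ultimately show ?thesis using eqn_pv assms by blast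
qed

end

end

context type_C
begin

context
 fixes M :: riggings and u v :: "nat => nat => nat" and x y :: nat
 assumes ev: "evn M" and supM: "supported M"
  and v: "rwalk M (cv y) v" and u: "rwalk (unact v M) (cv x) u"
  and xy: "x = y | (x = n - 1 & y = n)"
begin

lemma eqn_xy: "eqn (cv x) (cv y)" "cv x<=cv y"
proof -
 show "eqn (cv x) (cv y)"
  using xy pv.simps(2)[of "ccol n" "n - 1"] n_ge_2 by (auto simp: ccol_def)
 show "cv x<=cv y" using xy by (auto simp: pv_le_iff)
qed

lemma rv_odd: "odd t ==> a\<in>{Suc 0..<n} ==> v (Suc t) a = v t a"
 using rwalk_rstep[OF v, of t] zc_J_odd[OF ev, of a t]
 by (auto simp: rstep_def le_fun_def odd_pos Suc_le_eq intro!: antisym dest!: spec[of _ a])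

lemma unact_odd: "odd t ==> a\<in>{Suc 0..<n} ==> unact v M a t = replicate_mset (v t a - v (t - 1) a) 0"
 using ev rv_odd[of t a] by (auto simp: unact_def evn_def)

lemma unact_even:
 assumes "even t" "t>=1" "a\<in>{Suc 0..<n}"
 shows "unact v M a t = image_mset (%x. x + h a (v t)) (M a t - replicate_mset (v (Suc t) a - v t a) 0)"
proof -
 have "odd (t - 1)" "Suc (t - 1) = t" using assms by auto
 then have "v t a - v (t - 1) a = 0" using rv_odd[of "t - 1" a] assms by simp
 then show ?thesis using assms(2) by (simp add: unact_def)
qed

lemma zc_unact_odd_h:
 assumes "even t" "t>=1" "a\<in>{Suc 0..<n}" "odd (h a (v t))"
 shows "zc (unact v M) t a = 0"
proof -
 have "odd (0 - h a (v t))" using assms(4) by simp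
 then show ?thesis
  unfolding zc_def unact_even[OF assms(1-3)] count_image_plus
  using odd_h_zc[OF ev assms(3), of "0 - h a (v t)" t] by simp
qed

text \<open>The parity obstruction of \<open>v_walk\<close> met from above: now \<open>v\<close> is
  given, and \<open>u\<close> is the walk that comes down through the parts lengthened by
  it.\<close>

lemma u_walk_step:
 assumes t: "t>=1"
  and IH: "(even (Suc t) --> eqn (u (Suc t)) (v (Suc t))) & (odd (Suc t) --> eqn (u (Suc t)) (v t))"
 shows "(even t --> eqn (u t) (v t)) & (odd t --> eqn (u t) (v (t - 1)))"
proof -
 note behind = second_walker_behind[OF v u eqn_xy(2)]
 have rs: "rstep (zc (unact v M) t) (u (Suc t)) (u t)" using rwalk_rstep[OF u t] .
 have le: "u t<=u (Suc t)" "u (Suc t) a<=u t a + zc (unact v M) t a" for a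
  using rs by (auto simp: rstep_def)
 show ?thesis
 proof (cases "even t")
  case False
  have "eqn (u t) (v (t - 1))"
  proof (rule S_eqnI[OF rwalk_in_S[OF u] rwalk_in_S[OF v]])
   fix a assume a: "a\<in>{Suc 0..<n}"
   have "zc (unact v M) t a = v t a - v (t - 1) a" using unact_odd[OF False a] by (simp add: zc_def)
   moreover have "u (Suc t) a = v t a" using IH False rv_odd[OF False a] a by simp
   moreover have "u t a<=v (t - 1) a" using behind[of "t - 1"] t by (simp add: le_fun_def)
   moreover have "v (t - 1) a<=v t a" using rwalk_mono[OF v, of "t - 1"] t by (simp add: le_fun_def)
   ultimately show "u t a = v (t - 1) a" using le(2)[of a] by linarith
  qed
  then show ?thesis using False by simp
 next
  case True
  then have e: "eqn (u (Suc t)) (v t)" using IH by simp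
  obtain k where k: "k<=nn" "v t = cv k" using S_pv[OF rwalk_in_S[OF v]] by blast
  obtain i where i: "i<=nn" "u (Suc t) = cv i" using S_pv[OF rwalk_in_S[OF u]] by blast
  obtain j where j: "j<=nn" "u t = cv j" using S_pv[OF rwalk_in_S[OF u]] by blast
  have ij: "j<=i" using le(1) i j by (simp add: pv_le_iff)
  have "i<=k" using behind[of t] i k by (simp add: pv_le_iff)
  moreover have "eqn (cv i) (cv k)" using e i k by simp
  ultimately have ki: "i = k | (i = n - 1 & k = n)" using eqn_pv[of i k] k by auto
  have stuck: "~ (j<=l & l < i)" if l: "ccol n l\<in>{Suc 0..<n}" "odd (h (ccol n l) (v t))" for l
  proof
   assume "j<=l & l < i"
   then have "cv j (ccol n l)<=cv l (ccol n l)"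
    "cv (Suc l) (ccol n l)<=cv i (ccol n l)"
    using pv_mono[of j l "ccol n"] pv_mono[of "Suc l" i "ccol n"] by (auto simp: le_fun_def simp del: pv.simps)
   then have "u t (ccol n l) < u (Suc t) (ccol n l)" using i j by simp
   then show False using le(2)[of "ccol n l"] zc_unact_odd_h[OF True t l] by simp
  qed
  have "eqn (u t) (v t)"
  proof (cases "k = n")
   case kn: True
   have c: "ccol n n = n - 1" "ccol n (n - 2) = n - 1" "n - 1\<in>{Suc 0..<n}" using n_ge_2 by (auto simp: ccol_def)
   have "up (n - 1) (v t)" using up_pv[OF k(1), of "n - 1"] k(2) kn c n_ge_2 by simp
   then have "h (n - 1) (v t) = 1"
    using h_eq[OF rwalk_in_S[OF v]] not_up_dn[OF rwalk_in_S[OF v]] up_in_C by simp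
   then have "~ (j<=n - 2 & n - 2 < i)" using stuck[of "n - 2"] c by simp
   then have "j = n - 1 | j = n" using ij ki kn n_ge_2 by auto
   then show ?thesis using j k kn pv.simps(2)[of "ccol n" "n - 1"] n_ge_2 by (auto simp: ccol_def)
  next
   case kn: False
   then have "i = k" using ki by simp
   have "j = i"
   proof (rule ccontr)
    assume "j ~= i"
    then have lt: "j < i" using ij by simp
    have k0: "k > 0" "k - 1 < nn" using lt \<open>i = k\<close> k by auto
    then have c: "ccol n (k - 1)\<in>{Suc 0..<n}" using col_in_C[of "k - 1"] ccol_n[of "k - 1"] kn by fastforce
    have dn: "dn (ccol n (k - 1)) (v t)" using dn_pv[OF k(1)] k(2) k0 by simp
    then have "h (ccol n (k - 1)) (v t) = -1"
     using h_eq[OF rwalk_in_S[OF v] dn_in_C[OF rwalk_in_S[OF v] dn]] not_up_dn[OF rwalk_in_S[OF v]] by auto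
    then show False using stuck[OF c] lt \<open>i = k\<close> k0 by simp
   qed
   then show ?thesis using j k \<open>i = k\<close> by simp
  qed
  then show ?thesis using True by simp
 qed
qed

lemma u_walk:
 assumes "t>=1"
 shows "(even t --> eqn (u t) (v t)) & (odd t --> eqn (u t) (v (t - 1)))"
proof -
 have top: "u t = cv x" "v t = cv y" if "t>=T" for t
  using u v that by (auto simp: rwalk_def)
 have base: "(even t --> eqn (u t) (v t)) & (odd t --> eqn (u t) (v (t - 1)))" if "t>=Suc T" for t
  using top[of t] top[of "t - 1"] that eqn_xy(1) by auto
 have "1<=t ==> (even t --> eqn (u t) (v t)) & (odd t --> eqn (u t) (v (t - 1)))" if "t<=Suc T" for t
  using that
 proof (induction t rule: inc_induct)
  case base
  then show ?case using \<open>!!t. Suc T<=t ==> _\<close>[of "Suc T"] by simp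
 next
  case (step t)
  then show ?case using u_walk_step[of t] by simp
 qed
 then show ?thesis using base assms by (meson nat_le_linear)
qed

lemma u_even: "even t ==> a ~= n ==> u t a = v t a"
 using u_walk[of t] u v by (cases "t = 0") (auto simp: rwalk_def)

lemma u_odd': "odd t ==> a ~= n ==> u t a = v (t - 1) a"
 using u_walk[of t] by (cases "t = 0") auto

lemma evn_backward: "evn (unact u (unact v M))"
proof -
 have o: "unact u (unact v M) a t = {#}" if a: "a\<in>{Suc 0..<n}" and t: "odd t" for a t
 proof -
  have an: "a ~= n" using a by auto
  have e: "even (t - 1)" "even (Suc t)" "t ~= 0" using t by (auto simp: odd_pos)
  have "u (Suc t) a - u t a = v t a - v (t - 1) a"
   using u_even[OF e(2) an] u_odd'[OF t an] rv_odd[OF t a] by simp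
  moreover have "u t a - u (t - 1) a = 0" using u_odd'[OF t an] u_even[OF e(1) an] by simp
  ultimately show ?thesis using e(3) unact_odd[OF t a] unfolding unact_def[of u] by simp
 qed
 have "even z" if a: "a\<in>{Suc 0..<n}" and z: "z \<in># unact u (unact v M) a t" for a t z
 proof (cases "even t")
  case True
  have an: "a ~= n" "a < n" using a by auto
  have t0: "t ~= 0" using z by (cases t) (auto simp: unact_def[of u])
  have "u (Suc t) a - u t a = 0" using u_even[OF True an(1)] u_odd'[of "Suc t" a] True an by simp
  then consider "z = 0" | "z \<in># image_mset (%x. x + h a (u t)) (unact v M a t)"
   using z t0 unfolding unact_def[of u] by (auto split: if_splits)
  then show ?thesis
  proof cases
   case 2
   then obtain w where w: "w \<in># M a t" "z = w + h a (v t) + h a (u t)"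
    using unact_even[OF True _ a] t0 by (auto dest: in_diffD)
   have "even w" using ev a w by (auto simp: evn_def)
   moreover have "even (h a (u t) - h a (v t))" using h_parity[OF an(2)] u_walk[of t] t0 True by simp
   ultimately show ?thesis using w(2) by simp
  qed simp
 next
  case False
  then show ?thesis using o[OF a False] z by simp
 qed
 then show ?thesis using o by (auto simp: evn_def)
qed

end

definition Zc :: "nat => nat => int" where
 "Zc L a = int L * of_bool (a = Suc 0)"

lemma Zc_step: "(Zc (Suc L))(ccol n 0 := Zc (Suc L) (ccol n 0) - 1) = Zc L"
 by (auto simp: Zc_def ccol_1 fun_eq_iff)

lemma Zc_nonneg: "Zc L a>=0" "Zc (Suc L) (ccol n 0)>=1"
 by (auto simp: Zc_def ccol_1)

definition ES :: "nat => (nat => rat) => riggings set" where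
 "ES L N = {J\<in>RC (Zc L) N. evn J}"

definition ealw :: "nat => nat => bool" where
 "ealw x y \<longleftrightarrow> (x = y & x<=nn) | (x = n - 1 & y = n)"

definition EN :: "(nat => rat) => nat => nat => nat => rat" where
 "EN N x y a = N a - of_nat (cv x a) - of_nat (cv y a)"

definition Emap :: "riggings => (nat \<times> nat) \<times> riggings" where
 "Emap J = (let (u, J1) = del J; (v, J2) = del J1 in ((pos u, pos v), J2))"

lemma even_walks:
 assumes J: "J\<in>ES (Suc (Suc L)) N" and NT: "!!a. a\<in>{Suc 0..n} ==> N a < of_nat T"
 obtains x y u v J1 J2 where "x<=nn" "y<=nn"
  "fwalk J u" "J1 = act u J" "fwalk J1 v" "J2 = act v J1" "u T = cv x" "v T = cv y"
  "J1\<in>RC (Zc (Suc L)) (%a. N a - of_nat (cv x a))"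
  "rwalk J1 (cv x) u" "unact u J1 = J"
  "J2\<in>RC (Zc L) (EN N x y)" "rwalk J2 (cv y) v" "unact v J2 = J1"
  "Emap J = ((x, y), J2)"
proof -
 have JR: "J\<in>RC (Zc (Suc (Suc L))) N" using J by (simp add: ES_def)
 obtain u where u: "fwalk J u" using fwalk_exists by blast
 obtain x where x: "x<=nn" "u T = cv x" using S_pv[OF fwalk_in_S[OF u]] by blast
 define J1 where "J1 = act u J"
 note l = act_RC[OF Zc_nonneg NT JR u, folded J1_def, unfolded Zc_step x(2)]
 obtain v where v: "fwalk J1 v" using fwalk_exists by blast
 obtain y where y: "y<=nn" "v T = cv y" using S_pv[OF fwalk_in_S[OF v]] by blast
 define J2 where "J2 = act v J1"
 have NT1: "N a - of_nat (cv x a) < of_nat T" if "a\<in>{Suc 0..n}" for a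
  using NT[OF that] by (meson diff_le_eq le_add_same_cancel1 of_nat_0_le_iff order_le_less_trans)
 note r = act_RC[OF Zc_nonneg NT1 l(1) v, folded J2_def, unfolded Zc_step y(2)]
 have D: "Emap J = ((x, y), J2)"
  unfolding Emap_def del_eq[OF u] using del_eq[OF v] x y by (simp add: J1_def[symmetric] J2_def[symmetric])
 show thesis
  by (rule that[of x y u J1 v J2]) (use u v x y l r D J1_def J2_def in \<open>simp_all add: EN_def[abs_def]\<close>)
qed

theorem even_forward:
 assumes J: "J\<in>ES (Suc (Suc L)) N" and NT: "!!a. a\<in>{Suc 0..n} ==> N a < of_nat T"
 obtains x y J2 where "Emap J = ((x, y), J2)" "ealw x y" "J2\<in>ES L (EN N x y)"
  "x = n - 1 & y = n ==> 1<=dm (Zc (Suc (Suc L))) N n"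
proof -
 have JR: "J\<in>RC (Zc (Suc (Suc L))) N" "evn J" using J by (auto simp: ES_def)
 obtain x y u v J1 J2 where w: "x<=nn" "y<=nn"
  "fwalk J u" "J1 = act u J" "fwalk J1 v" "J2 = act v J1" "u T = cv x" "v T = cv y"
  "J1\<in>RC (Zc (Suc L)) (%a. N a - of_nat (cv x a))"
  "J2\<in>RC (Zc L) (EN N x y)" "Emap J = ((x, y), J2)"
  by (rule even_walks[OF J NT]) auto
 note F = JR(2) RC_D(1)[OF JR(1)] w(3) w(5)[unfolded w(4)]
 show thesis
 proof (rule that[OF w(11)])
  show "ealw x y"
   using end_forward[OF F w(7,8,1,2)] RC_D(1)[OF w(9)] w(1,4) by (auto simp: ealw_def)
  show "J2\<in>ES L (EN N x y)" using w(4,6,10) evn_forward[OF F] by (simp add: ES_def)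
  show "1<=dm (Zc (Suc (Suc L))) N n" if "x = n - 1 & y = n"
  proof -
   have nC: "n\<in>{Suc 0..n}" using n_ge_2 by auto
   have "up n (cv (n - 1))" using up_pv[of "n - 1" n] n_ge_2 by (auto simp: ccol_def)
   then have "h n (cv (n - 1)) = 1"
    using h_eq[OF pv_in_S[of "n - 1"] nC] not_up_dn[OF pv_in_S[of "n - 1"]] by auto
   then show ?thesis
    using RC_dm[OF w(9) nC] dm_change[of "Zc (Suc (Suc L))" N "cv x" n] that
    unfolding Zc_step by simp
  qed
 qed
qed

theorem even_backward:
 assumes M: "M\<in>ES L (EN N x y)" and al: "ealw x y"
  and NT: "!!a. a\<in>{Suc 0..n} ==> N a < of_nat T"
  and dom: "!!a. a\<in>{Suc 0..n} ==> 0<=dm (Zc (Suc (Suc L))) N a"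
  and zero: "x = n - 1 & y = n ==> 1<=dm (Zc (Suc (Suc L))) N n"
 shows "\<exists>J\<in>ES (Suc (Suc L)) N. Emap J = ((x, y), M)"
proof -
 have MR: "M\<in>RC (Zc L) (EN N x y)" "evn M" using M by (auto simp: ES_def)
 have le: "x<=nn" "y<=nn" using al n_ge_2 unfolding ealw_def by auto
 have xy: "x = y | x = n - 1 & y = n" using al by (auto simp: ealw_def)
 let ?N1 = "%a. N a - of_nat (cv x a)"
 have EN_eq: "EN N x y = (%a. ?N1 a - of_nat (cv y a))" by (simp add: EN_def[abs_def])
 have NT1: "?N1 a < of_nat T" if "a\<in>{Suc 0..n}" for a
  using NT[OF that] by (meson diff_le_eq le_add_same_cancel1 of_nat_0_le_iff order_le_less_trans)
 have NT2: "EN N x y a < of_nat T" if "a\<in>{Suc 0..n}" for a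
  using NT1[OF that] unfolding EN_eq by (meson diff_le_eq le_add_same_cancel1 of_nat_0_le_iff order_le_less_trans)
 have xS: "cv x\<in>S" "cv y\<in>S" using le pv_in_S by auto
 have dom1: "0<=dm (Zc (Suc L)) ?N1 a" if a: "a\<in>{Suc 0..n}" for a
 proof -
  have P: "dm (Zc (Suc L)) ?N1 a = dm (Zc (Suc (Suc L))) N a - of_int (h a (cv x))"
   using dm_change[of "Zc (Suc (Suc L))" N "cv x" a] unfolding Zc_step .
  have P2: "dm (Zc L) (EN N x y) a = dm (Zc (Suc L)) ?N1 a - of_int (h a (cv y))"
   unfolding EN_eq using dm_change[of "Zc (Suc L)" ?N1 "cv y" a] unfolding Zc_step .
  have nn: "0<=dm (Zc L) (EN N x y) a" using RC_dm[OF MR(1) a] .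
  show ?thesis
  proof (cases "h a (cv y)>=0")
   case True
   then show ?thesis using nn P2 by simp
  next
   case False
   show ?thesis
   proof (cases "x = y")
    case True
    then have "(of_int (h a (cv x)) :: rat)<=0" using False by simp
    then show ?thesis using dom[OF a] P by simp
   next
    case ne: False
    then have xy': "x = n - 1" "y = n" using xy by auto
    have "dn a (cv y)" using False h_neg[OF xS(2) a] by simp
    then have "a = n" using dn_pv[OF le(2)] xy' n_ge_2 by (auto simp: ccol_def)
    moreover have "(of_int (h a (cv x)) :: rat)<=1" using h_le[OF xS(1) a] by simp
    ultimately show ?thesis using zero P xy' by simp
   qed
  qed
 qed
 have "M a T = {#}" for a using top_empty[OF MR(1) NT2] .
 then obtain v where v: "rwalk M (cv y) v"
  using rwalk_exists[OF xS(2) RC_D(1)[OF MR(1)]] by blast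
 define M1 where "M1 = unact v M"
 have MR': "M\<in>RC ((Zc (Suc L))(ccol n 0 := Zc (Suc L) (ccol n 0) - 1)) (%a. ?N1 a - of_nat (cv y a))"
  using MR(1) unfolding Zc_step EN_eq .
 note r = unact_RC[OF Zc_nonneg NT1 MR' v dom1[unfolded dm_def], folded M1_def]
 have "M1 a T = {#}" for a using top_empty[OF r(1) NT1] .
 then obtain u where u: "rwalk M1 (cv x) u"
  using rwalk_exists[OF xS(1) RC_D(1)[OF r(1)]] by blast
 define J where "J = unact u M1"
 have r1': "M1\<in>RC ((Zc (Suc (Suc L)))(ccol n 0 := Zc (Suc (Suc L)) (ccol n 0) - 1)) (%a. N a - of_nat (cv x a))"
  using r(1) unfolding Zc_step .
 note l = unact_RC[OF Zc_nonneg NT r1' u dom[unfolded dm_def], folded J_def]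
 have "evn J"
  unfolding J_def M1_def by (rule evn_backward[OF MR(2) RC_D(1)[OF MR(1)] v u[unfolded M1_def] xy])
 moreover have "Emap J = ((x, y), M)"
 proof -
  have "del J = (cv x, M1)" using del_eq[OF l(2)] l(3) u by (simp add: rwalk_def)
  moreover have "del M1 = (cv y, M)" using del_eq[OF r(2)] r(3) v by (simp add: rwalk_def)
  ultimately show ?thesis using le by (simp add: Emap_def)
 qed
 ultimately show ?thesis using l(1) by (auto simp: ES_def)
qed

theorem even_inj:
 assumes NT: "!!a. a\<in>{Suc 0..n} ==> N a < of_nat T"
 shows "inj_on Emap (ES (Suc (Suc L)) N)"
proof (rule inj_onI)
 fix J J' assume J: "J\<in>ES (Suc (Suc L)) N" and J': "J'\<in>ES (Suc (Suc L)) N" and eq: "Emap J = Emap J'"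
 obtain x y u v J1 J2 where w: "rwalk J1 (cv x) u" "unact u J1 = J"
  "rwalk J2 (cv y) v" "unact v J2 = J1" "Emap J = ((x, y), J2)"
  by (rule even_walks[OF J NT]) auto
 obtain x' y' u' v' J1' J2' where w': "rwalk J1' (cv x') u'" "unact u' J1' = J'"
  "rwalk J2' (cv y') v'" "unact v' J2' = J1'" "Emap J' = ((x', y'), J2')"
  by (rule even_walks[OF J' NT]) auto
 have e: "x = x'" "y = y'" "J2 = J2'" using eq w(5) w'(5) by auto
 have "v = v'" using rwalk_unique[OF w(3)] w'(3) e by simp
 then have e1: "J1 = J1'" using w(4) w'(4) e by simp
 then have "u = u'" using rwalk_unique[OF w(1)] w'(1) e by simp
 then show "J = J'" using w(2) w'(2) e1 by simp
qed

text \<open>The first walker rests at length 1 (\<open>u_1\<close>), so both walkers see the same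
  number of parts of colour 1 and each contributes twice this number. What the second one takes at
  length 1 is the energy, by \<open>energy_top\<close>.\<close>

theorem even_stat:
 assumes J: "J\<in>ES (Suc (Suc L)) N" and NT: "!!a. a\<in>{Suc 0..n} ==> N a < of_nat T"
  and D: "Emap J = ((x, y), J2)"
 shows "st J = st J2 + 4 * np J (Suc 0)"
  and "Emap J2 = ((x', y'), J3) ==> np J (Suc 0) = np J2 (Suc 0)
   + (if y<=x' then 0 else if y = nn & x' = 0 then 2 else 1)"
proof -
 have JR: "J\<in>RC (Zc (Suc (Suc L))) N" "evn J" using J by (auto simp: ES_def)
 obtain xx yy u v J1 J2' where w: "xx<=nn" "yy<=nn"
  "fwalk J u" "J1 = act u J" "fwalk J1 v" "J2' = act v J1"
  "J1\<in>RC (Zc (Suc L)) (%a. N a - of_nat (cv xx a))"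
  "rwalk J2' (cv yy) v" "Emap J = ((xx, yy), J2')"
  by (rule even_walks[OF J NT]) auto
 have e: "xx = x" "yy = y" "J2' = J2" using w(9) D by auto
 note F = JR(2) RC_D(1)[OF JR(1)] w(3) w(5)[unfolded w(4)]
 have d1: "dC n (Suc 0) = 1" using n_ge_2 by (simp add: dC_def)
 have np1: "np J1 (Suc 0) = np J (Suc 0)"
  using np_act[OF w(3) RC_D(1)[OF JR(1)], of "Suc 0"] u_1[OF F] w(4) by simp
 have np2: "np J2 (Suc 0) = np J1 (Suc 0) - int (v 1 (Suc 0))"
  using np_act[OF w(5) RC_D(1)[OF w(7)], of "Suc 0"] w(6) e by simp
 show "st J = st J2 + 4 * np J (Suc 0)"
  using st_act[OF w(3) RC_D(1)[OF JR(1)]] st_act[OF w(5) RC_D(1)[OF w(7)]] w(4,6) e d1 np1 by (simp add: ccol_1)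
 assume D2: "Emap J2 = ((x', y'), J3)"
 obtain u' where u': "fwalk J2 u'" using fwalk_exists by blast
 have x': "u' T = cv x'" "x'<=nn"
  using D2 del_eq[OF u'] pv_pos[OF fwalk_in_S[OF u', of T]] pos_le[OF fwalk_in_S[OF u', of T]]
  by (auto simp: Emap_def split: prod.splits)
 have z: "cv x' = (%_. 0) \<longleftrightarrow> x' = 0" using pv_inject[of "ccol n" x' 0] by simp
 show "np J (Suc 0) = np J2 (Suc 0) + (if y<=x' then 0 else if y = nn & x' = 0 then 2 else 1)"
  using energy_top[OF u' w(8)[unfolded e]] np1 np2 unfolding x' z by (simp add: pv_le_iff pv_inject)
qed

end

section \<open>The vector representation of type D\<close>

definition cartanD :: "nat => nat => nat => int" where
 "cartanD n a b = (if a = b then 2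
  else if (Suc a = b & b < n) | (Suc b = a & a < n) | (Suc (Suc a) = n & b = n) | (Suc (Suc b) = n & a = n)
  then -1 else 0)"

definition dcol :: "nat => nat => nat" where
 "dcol n k = (if k < n then Suc k else 2 * n - 2 - k)"

locale type_D =
 fixes n T :: nat
 assumes n_ge_4: "n>=4" and T_ge_1: "T>=1"
begin

abbreviation "dv \<equiv> pv (dcol n)"

text \<open>The element of the fork that is not on the chain: \<open>w\<close> belongs to the letter
  bar n, and \<open>dv (n - 1)\<close> to the letter n.\<close>

definition w :: "nat => nat" where
 "w = (dv (n - 2))(n := 1)"

definition SD :: "(nat => nat) set" where
 "SD = insert w (dv ` {..2 * n - 2})"

lemma pv_dcol: "k<=n ==> dv k a = of_bool (1<=a & a<=k)"
 by (induction k) (auto simp: dcol_def)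

lemma pv_dcol':
 "n<=k ==> k<=2 * n - 2 ==>
  dv k a = of_bool (1<=a & a<=n) + of_bool (2 * n - 1 - k<=a & a<=n - 2)"
proof (induction k rule: dec_induct)
 case base
 then show ?case using n_ge_4 by (auto simp: pv_dcol)
next
 case (step k)
 then have "dcol n k = 2 * n - 2 - k" by (simp add: dcol_def)
 then show ?case using step by auto
qed

lemma w_eq: "w a = of_bool (1<=a & a<=n - 2 | a = n)"
 using n_ge_4 pv_dcol[of "n - 2" a] by (auto simp: w_def)

lemma pv_le_w: "dv k<=w \<longleftrightarrow> k<=n - 2"
proof
 assume le: "dv k<=w"
 show "k<=n - 2"
 proof (rule ccontr)
  assume "~ k<=n - 2"
  then have "dv (n - 1)<=dv k" by (simp add: pv_le_iff)
  from le_funD[OF order_trans[OF this le], of "n - 1"]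
  have "dv (n - 1) (n - 1)<=w (n - 1)" .
  then show False using pv_dcol[of "n - 1" "n - 1"] w_eq[of "n - 1"] n_ge_4 by auto
 qed
next
 assume "k<=n - 2"
 then show "dv k<=w" using pv_dcol[of k] w_eq by (auto simp: le_fun_def)
qed

lemma w_le_pv: "k<=2 * n - 2 ==> w<=dv k \<longleftrightarrow> n<=k"
proof
 assume "w<=dv k"
 then have "w n<=dv k n" by (simp add: le_fun_def)
 then show "n<=k" using pv_dcol[of k n] w_eq[of n] by (cases "k<=n") (auto simp: of_bool_def split: if_splits)
next
 assume "n<=k"
 have "w<=dv n" using pv_dcol[of n] w_eq n_ge_4 by (auto simp: le_fun_def)
 also have "... <= dv k" using \<open>n<=k\<close> by (simp add: pv_le_iff)
 finally show "w<=dv k" .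
qed

lemma pv_upd_w:
 assumes "k<=2 * n - 2" "(dv k)(a := Suc (dv k a)) = w"
 shows "k = n - 2 & a = n"
proof -
 have "dv k<=w" unfolding assms(2)[symmetric] by (auto simp: le_fun_def)
 then have k: "k<=n - 2" using pv_le_w by simp
 then have "dv k n ~= w n" using pv_dcol[of k n] w_eq[of n] n_ge_4 by simp
 then have a: "a = n" using assms(2) by (metis fun_upd_other)
 have "k = n - 2"
 proof (rule ccontr)
  assume "k ~= n - 2"
  then have "dv k (n - 2) ~= w (n - 2)" using k pv_dcol[of k "n - 2"] w_eq[of "n - 2"] n_ge_4 by simp
  then have "a = n - 2" using assms(2) by (metis fun_upd_other)
  then show False using a n_ge_4 by simp
 qed
 then show ?thesis using a by simp
qed

lemma w_upd:
 assumes "w(a := Suc (w a)) = dv k" "k<=2 * n - 2"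
 shows "k = n & a = n - 1"
proof -
 have "w<=dv k" unfolding assms(1)[symmetric] by (auto simp: le_fun_def)
 then have k: "n<=k" using w_le_pv assms(2) by simp
 have "dv n<=dv k" using k by (simp add: pv_le_iff)
 then have "dv n (n - 1)<=dv k (n - 1)" by (simp add: le_fun_def)
 then have "dv k (n - 1) ~= w (n - 1)" using pv_dcol[of n "n - 1"] w_eq[of "n - 1"] n_ge_4 by auto
 then have a: "a = n - 1" using assms(1) by (metis fun_upd_other)
 have "w(n - 1 := Suc (w (n - 1))) = dv n"
  using pv_dcol[of n] w_eq n_ge_4 by (auto simp: fun_eq_iff)
 then show ?thesis using assms(1) a by (simp add: pv_inject)
qed

lemma w_up_eq: "w(n - 1 := Suc (w (n - 1))) = dv n"
 using pv_dcol[of n] w_eq n_ge_4 by (auto simp: fun_eq_iff)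

lemma w_dn_eq: "(dv (n - 2))(n := Suc (dv (n - 2) n)) = w"
proof -
 have "~ n<=n - 2" using n_ge_4 by linarith
 then show ?thesis using pv_dcol[of "n - 2" n] by (simp add: w_def)
qed

lemma SD_up: "k<=2 * n - 2 ==> (dv k)(a := Suc (dv k a))\<in>SD
  \<longleftrightarrow> (k < 2 * n - 2 & dcol n k = a) | (k = n - 2 & a = n)"
proof
 assume k: "k<=2 * n - 2" and "(dv k)(a := Suc (dv k a))\<in>SD"
 then consider "(dv k)(a := Suc (dv k a)) = w"
  | j where "j<=2 * n - 2" "(dv k)(a := Suc (dv k a)) = dv j" by (auto simp: SD_def)
 then show "(k < 2 * n - 2 & dcol n k = a) | (k = n - 2 & a = n)"
 proof cases
  case 1
  then show ?thesis using pv_upd_w[OF k] by blast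
 next
  case 2
  then show ?thesis using pv_upd[of "dcol n" k a j] by (metis Suc_le_eq)
 qed
next
 assume *: "(k < 2 * n - 2 & dcol n k = a) | (k = n - 2 & a = n)"
 have "(dv k)(a := Suc (dv k a)) = dv (Suc k)" if "dcol n k = a"
  using that by auto
 moreover have "dv (Suc k)\<in>SD" if "k < 2 * n - 2"
  using that unfolding SD_def by (intro insertI2 imageI) simp
 moreover have "w\<in>SD" by (simp add: SD_def)
 ultimately show "(dv k)(a := Suc (dv k a))\<in>SD" using * w_dn_eq by metis
qed

lemma SD_up_w: "w(a := Suc (w a))\<in>SD \<longleftrightarrow> a = n - 1"
proof
 assume "w(a := Suc (w a))\<in>SD"
 moreover have "w(a := Suc (w a)) ~= w" by (metis fun_upd_same n_not_Suc_n)
 ultimately obtain k where "k<=2 * n - 2" "w(a := Suc (w a)) = dv k" by (auto simp: SD_def)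
 then show "a = n - 1" using w_upd by blast
next
 assume "a = n - 1"
 moreover have "dv n\<in>SD" using n_ge_4 unfolding SD_def by (intro insertI2 imageI) simp
 ultimately show "w(a := Suc (w a))\<in>SD" using w_up_eq by metis
qed

text \<open>Turns the question of what lies below an element into one about steps up, for which
  \<open>pv_upd\<close>, \<open>pv_upd_w\<close> and \<open>w_upd\<close> are available.\<close>

lemma dn_as_up:
 "(v a > 0 & v(a := v a - 1)\<in>SD) \<longleftrightarrow> (\<exists>u\<in>SD. u(a := Suc (u a)) = v)"
proof
 assume "v a > 0 & v(a := v a - 1)\<in>SD"
 then show "\<exists>u\<in>SD. u(a := Suc (u a)) = v" by (intro bexI[of _ "v(a := v a - 1)"]) auto
next
 assume "\<exists>u\<in>SD. u(a := Suc (u a)) = v"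
 then obtain u where "u\<in>SD" "u(a := Suc (u a)) = v" by blast
 moreover from this(2) have "v(a := v a - 1) = u" by auto
 ultimately show "v a > 0 & v(a := v a - 1)\<in>SD" by auto
qed

lemma SD_dn: "k<=2 * n - 2 ==> (dv k a > 0 & (dv k)(a := dv k a - 1)\<in>SD)
  \<longleftrightarrow> (k > 0 & dcol n (k - 1) = a) | (k = n & a = n - 1)"
 unfolding dn_as_up
proof
 assume k: "k<=2 * n - 2" and "\<exists>u\<in>SD. u(a := Suc (u a)) = dv k"
 then consider "w(a := Suc (w a)) = dv k"
  | j where "j<=2 * n - 2" "(dv j)(a := Suc (dv j a)) = dv k" by (auto simp: SD_def)
 then show "(k > 0 & dcol n (k - 1) = a) | (k = n & a = n - 1)"
 proof cases
  case 1
  then show ?thesis using w_upd k by blast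
 next
  case 2
  then have "k = Suc j & dcol n j = a" by (intro pv_upd)
  then show ?thesis by simp
 qed
next
 assume k: "k<=2 * n - 2" and *: "(k > 0 & dcol n (k - 1) = a) | (k = n & a = n - 1)"
 show "\<exists>u\<in>SD. u(a := Suc (u a)) = dv k"
 proof (cases "k = n & a = n - 1")
  case True
  then show ?thesis using w_up_eq by (intro bexI[of _ w]) (auto simp: SD_def)
 next
  case False
  then obtain j where j: "k = Suc j" "dcol n j = a" using * by (cases k) auto
  then have "(dv j)(a := Suc (dv j a)) = dv k" by auto
  moreover have "dv j\<in>SD" using k j unfolding SD_def by (intro insertI2 imageI) simp
  ultimately show ?thesis by blast
 qed
qed

lemma SD_dn_w: "(w a > 0 & w(a := w a - 1)\<in>SD) \<longleftrightarrow> a = n"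
 unfolding dn_as_up
proof
 assume "\<exists>u\<in>SD. u(a := Suc (u a)) = w"
 moreover have "w(a := Suc (w a)) ~= w" by (metis fun_upd_same n_not_Suc_n)
 ultimately obtain j where "j<=2 * n - 2" "(dv j)(a := Suc (dv j a)) = w" by (auto simp: SD_def)
 then show "a = n" using pv_upd_w by blast
next
 assume "a = n"
 moreover have "dv (n - 2)\<in>SD" unfolding SD_def by (intro insertI2 imageI) simp
 ultimately show "\<exists>u\<in>SD. u(a := Suc (u a)) = w" using w_dn_eq by blast
qed

text \<open>The right-hand side of \<open>minuscule\<close> at position \<open>k\<close> of the
  chain. The two extra disjuncts are the arrows through \<open>w\<close>.\<close>

definition hh :: "nat => nat => int" where
 "hh k a = of_bool ((k < 2 * n - 2 & dcol n k = a) | (k = n - 2 & a = n))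
  - of_bool ((k > 0 & dcol n (k - 1) = a) | (k = n & a = n - 1))"

lemma hh_eqI:
 assumes "(k < 2 * n - 2 & dcol n k = a) | (k = n - 2 & a = n) \<longleftrightarrow> P"
  "(k > 0 & dcol n (k - 1) = a) | (k = n & a = n - 1) \<longleftrightarrow> Q"
 shows "hh k a = of_bool P - of_bool Q"
 unfolding hh_def assms ..

lemma hh_small: "k + 2 < n ==> hh k a = of_bool (a = Suc k) - of_bool (k > 0 & a = k)"
 by (rule hh_eqI) (auto simp: dcol_def)

lemma hh_n2: "k + 2 = n ==> hh k a = of_bool (a = n | a = n - 1) - of_bool (a = n - 2)"
 by (rule hh_eqI) (use n_ge_4 in \<open>auto simp: dcol_def\<close>)

lemma hh_n1: "k + 1 = n ==> hh k a = of_bool (a = n) - of_bool (a = n - 1)"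
 by (rule hh_eqI) (use n_ge_4 in \<open>auto simp: dcol_def\<close>)

lemma hh_n: "hh n a = of_bool (a = n - 2) - of_bool (a = n | a = n - 1)"
 by (rule hh_eqI) (use n_ge_4 in \<open>auto simp: dcol_def\<close>)

lemma hh_big:
 assumes "n < k" "k<=2 * n - 2"
 shows "hh k a = of_bool (k < 2 * n - 2 & a + k = 2 * n - 2) - of_bool (a + k = 2 * n - 1)"
proof (rule hh_eqI)
 have "dcol n k = 2 * n - 2 - k" "dcol n (k - 1) = 2 * n - 1 - k" using assms by (auto simp: dcol_def)
 then show "(k < 2 * n - 2 & dcol n k = a) | (k = n - 2 & a = n) \<longleftrightarrow> k < 2 * n - 2 & a + k = 2 * n - 2"
  "(k > 0 & dcol n (k - 1) = a) | (k = n & a = n - 1) \<longleftrightarrow> a + k = 2 * n - 1"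
  using assms by auto
qed

lemma cd_small: "b + 2 < n ==> a<=n ==> cartanD n a b = 2 * of_bool (a = b) - of_bool (a = Suc b) - of_bool (Suc a = b)"
 by (auto simp: cartanD_def)

lemma cd_n2: "a<=n ==> cartanD n a (n - 2) = 2 * of_bool (a = n - 2) - of_bool (a = n - 3) - of_bool (a = n | a = n - 1)"
proof -
 assume a: "a<=n"
 obtain m where n: "n = Suc (Suc (Suc m))" using n_ge_4 that[of "n - 3"] by simp
 have e: "n - 2 = Suc m" "n - 3 = m" "n - 1 = Suc (Suc m)" using n by auto
 consider "a < m" | "a = m" | "a = Suc m" | "a = Suc (Suc m)" | "a = n" using a n by linarith
 then show ?thesis unfolding e by cases (simp_all add: cartanD_def n)
qed

lemma cd_n1: "a<=n ==> cartanD n a (n - 1) = 2 * of_bool (a = n - 1) - of_bool (a = n - 2)"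
 using n_ge_4 by (auto simp: cartanD_def)

lemma cd_n: "a<=n ==> cartanD n a n = 2 * of_bool (a = n) - of_bool (a = n - 2)"
 using n_ge_4 by (auto simp: cartanD_def)

text \<open>The counterpart of \<open>A_col\<close>: along the chain part of \<open>SD\<close> the
  coroot values still telescope. Near the fork each position has its own formula, hence the case
  distinction.\<close>

lemma hh_step:
 assumes "k < 2 * n - 2" "a\<in>{Suc 0..n}"
 shows "cartanD n a (dcol n k) = hh k a - hh (Suc k) a"
proof -
 have a: "a<=n" "a>=1" using assms by auto
 consider "k + 3 < n" | "k + 3 = n" | "k + 2 = n" | "k + 1 = n" | "k = n" | "n < k" by linarith
 then show ?thesis
 proof cases
  case 1
  then have d: "dcol n k = Suc k" by (simp add: dcol_def)
  have "Suc a = Suc k \<longleftrightarrow> k > 0 & a = k" using a by auto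
  then show ?thesis unfolding d using cd_small[of "Suc k" a] hh_small[of k a] hh_small[of "Suc k" a] 1 a by simp
 next
  case 2
  then have d: "dcol n k = n - 2" "n - 2 = Suc k" "n - 3 = k" "k > 0" using n_ge_4 by (auto simp: dcol_def)
  show ?thesis unfolding d(1) using cd_n2[OF a(1)] hh_small[of k a] hh_n2[of "Suc k" a] 2 d(2-) by simp
 next
  case 3
  then have d: "dcol n k = n - 1" by (auto simp: dcol_def)
  show ?thesis unfolding d using cd_n1[OF a(1)] hh_n2[of k a] hh_n1[of "Suc k" a] 3 n_ge_4 by (cases "a = n") auto
 next
  case 4
  then have d: "dcol n k = n" "Suc k = n" by (auto simp: dcol_def)
  show ?thesis unfolding d using cd_n[OF a(1)] hh_n1[of k a] hh_n[of a] 4 n_ge_4 by (cases "a = n") auto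
 next
  case 5
  then have d: "dcol n k = n - 2" "hh k a = hh n a" "hh (Suc k) a = hh (Suc n) a" by (auto simp: dcol_def)
  have e: "Suc n < 2 * n - 2 & a + Suc n = 2 * n - 2 \<longleftrightarrow> a = n - 3" "a + Suc n = 2 * n - 1 \<longleftrightarrow> a = n - 2"
   using n_ge_4 a by linarith+
  have "hh (Suc n) a = of_bool (a = n - 3) - of_bool (a = n - 2)"
   using hh_big[of "Suc n" a] n_ge_4 unfolding e by simp
  then show ?thesis unfolding d cd_n2[OF a(1)] hh_n by simp
 next
  case 6
  then have d: "dcol n k = 2 * n - 2 - k" by (auto simp: dcol_def)
  have e: "a = 2 * n - 2 - k \<longleftrightarrow> a + k = 2 * n - 2" "a = Suc (2 * n - 2 - k) \<longleftrightarrow> a + k = 2 * n - 1"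
   "Suc a = 2 * n - 2 - k \<longleftrightarrow> Suc k < 2 * n - 2 & a + Suc k = 2 * n - 2"
   "a + Suc k = 2 * n - 1 \<longleftrightarrow> a + k = 2 * n - 2"
   using assms a 6 by auto
  have b: "2 * n - 2 - k + 2 < n" using 6 assms by simp
  show ?thesis unfolding d cd_small[OF b a(1)] e
   using hh_big[of k a] hh_big[of "Suc k" a] assms 6 by (simp, linarith)
 qed
qed

lemma h_D:
 assumes "k<=2 * n - 2" "a\<in>{Suc 0..n}"
 shows "of_bool (a = Suc 0) - (\<Sum>b\<in>{Suc 0..n}. cartanD n a b * int (dv k b)) = hh k a"
 using assms(1)
proof (induction k)
 case 0
 then show ?case using n_ge_4 assms(2) by (auto simp: hh_def dcol_def)
next
 case (Suc k)
 have c: "dcol n k\<in>{Suc 0..n}" using Suc by (auto simp: dcol_def)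
 have "(\<Sum>b\<in>{Suc 0..n}. cartanD n a b * int (dv (Suc k) b))
   = (\<Sum>b\<in>{Suc 0..n}. cartanD n a b * int (dv k b) + (if b = dcol n k then cartanD n a b else 0))"
  by (intro sum.cong) (auto simp: algebra_simps)
 also have "... = (\<Sum>b\<in>{Suc 0..n}. cartanD n a b * int (dv k b)) + cartanD n a (dcol n k)"
  using c by (simp add: sum.distrib)
 finally show ?case using Suc hh_step[of k a] assms(2) by simp
qed

lemma h_D_w:
 assumes "a\<in>{Suc 0..n}"
 shows "of_bool (a = Suc 0) - (\<Sum>b\<in>{Suc 0..n}. cartanD n a b * int (w b)) = of_bool (a = n - 1) - of_bool (a = n)"
proof -
 have "(\<Sum>b\<in>{Suc 0..n}. cartanD n a b * int (w b))
   = (\<Sum>b\<in>{Suc 0..n}. cartanD n a b * int (dv (n - 2) b) + (if b = n then cartanD n a b else 0))"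
  using pv_dcol[of "n - 2" n] n_ge_4 by (intro sum.cong) (auto simp: w_def)
 also have "... = (\<Sum>b\<in>{Suc 0..n}. cartanD n a b * int (dv (n - 2) b)) + cartanD n a n"
  using n_ge_4 by (simp add: sum.distrib)
 finally have "of_bool (a = Suc 0) - (\<Sum>b\<in>{Suc 0..n}. cartanD n a b * int (w b)) = hh (n - 2) a - cartanD n a n"
  using h_D[of "n - 2" a] assms by simp
 also have "... = of_bool (a = n - 1) - of_bool (a = n)"
  using n_ge_4 assms by (auto simp: hh_def cartanD_def dcol_def)
 finally show ?thesis .
qed

lemma cartanD_off: "a ~= b ==> cartanD n a b<=0"
 by (simp add: cartanD_def)

lemma cartanD_sym: "cartanD n a b = cartanD n b a"
 unfolding cartanD_def by (rule if_cong) auto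

text \<open>The only chain element incomparable to \<open>w\<close> is \<open>dv (n - 1)\<close>,
  and their join and meet are \<open>dv n\<close> and \<open>dv (n - 2)\<close>.\<close>

lemma w_pv_join:
 assumes "k<=2 * n - 2"
 shows "sup w (dv k) = (if k<=n - 2 then w else dv (max k n))"
  and "inf w (dv k) = (if n<=k then w else dv (min k (n - 2)))"
proof -
 consider "k<=n - 2" | "k = n - 1" | "n<=k" by linarith
 then have "sup w (dv k) = (if k<=n - 2 then w else dv (max k n))
  & inf w (dv k) = (if n<=k then w else dv (min k (n - 2)))"
 proof cases
  case 1
  then have "~ n<=k" using n_ge_4 by simp
  with 1 show ?thesis using pv_le_w[of k] by (simp add: sup_absorb1 inf_absorb2 min_absorb1)
 next
  case 2
  have "sup w (dv (n - 1)) a = dv n a" for a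
   using pv_dcol[of "n - 1" a] pv_dcol[of n a] w_eq[of a] n_ge_4 by (auto simp: of_bool_def sup_max inf_min)
  moreover have "inf w (dv (n - 1)) a = dv (n - 2) a" for a
   using pv_dcol[of "n - 1" a] pv_dcol[of "n - 2" a] w_eq[of a] n_ge_4 by (auto simp: of_bool_def sup_max inf_min)
  moreover have "max k n = n" "min k (n - 2) = n - 2" "~ k<=n - 2" "~ n<=k" using 2 n_ge_4 by auto
  ultimately show ?thesis using 2 by (auto simp: fun_eq_iff)
 next
  case 3
  then have "~ k<=n - 2" using n_ge_4 by simp
  with 3 show ?thesis using w_le_pv[of k] assms by (simp add: sup_absorb2 inf_absorb1 max_absorb1)
 qed
 then show "sup w (dv k) = (if k<=n - 2 then w else dv (max k n))"
  "inf w (dv k) = (if n<=k then w else dv (min k (n - 2)))" by auto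
qed

lemma pv_in_SD: "k<=2 * n - 2 ==> dv k\<in>SD"
 unfolding SD_def by (intro insertI2 imageI) simp

lemma w_in_SD: "w\<in>SD"
 by (simp add: SD_def)

lemma SD_cases:
 assumes "u\<in>SD"
 obtains "u = w" | k where "k<=2 * n - 2" "u = dv k"
 using assms by (auto simp: SD_def)

lemma SD_lattice:
 assumes "u\<in>SD" "v\<in>SD"
 shows "sup u v\<in>SD" "inf u v\<in>SD"
proof -
 have 1: "sup w (dv k)\<in>SD" "inf w (dv k)\<in>SD" if "k<=2 * n - 2" for k
  unfolding w_pv_join[OF that] using that n_ge_4 by (auto simp: w_in_SD intro!: pv_in_SD)
 have "sup u v\<in>SD & inf u v\<in>SD"
  using assms(1)
 proof (cases rule: SD_cases)
  case 1
  note u = this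
  show ?thesis using assms(2) by (cases rule: SD_cases) (simp_all add: u w_in_SD \<open>!!k. k<=2 * n - 2 ==> sup w (dv k)\<in>SD\<close> \<open>!!k. k<=2 * n - 2 ==> inf w (dv k)\<in>SD\<close>)
 next
  case (2 k)
  note u = this
  show ?thesis using assms(2)
  proof (cases rule: SD_cases)
   case 1
   have "sup u v = sup w u" "inf u v = inf w u" using 1 by (simp_all add: sup.commute inf.commute)
   then show ?thesis using \<open>!!k. k<=2 * n - 2 ==> sup w (dv k)\<in>SD\<close>
     \<open>!!k. k<=2 * n - 2 ==> inf w (dv k)\<in>SD\<close> u by simp
  next
   case (2 j)
   then show ?thesis using u by (auto simp: sup_pv inf_pv intro!: pv_in_SD)
  qed
 qed
 then show "sup u v\<in>SD" "inf u v\<in>SD" by auto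
qed

lemma SD_saturated:
 assumes uv: "u\<in>SD" "v\<in>SD" "u<=v" "u ~= v"
 shows "\<exists>a. u(a := Suc (u a))\<in>SD & u a < v a"
proof -
 have *: "\<exists>a. u(a := Suc (u a))\<in>SD & u a < v a"
  if u: "u = dv j" "j < 2 * n - 2" and le: "dv (Suc j)<=v" for j
 proof -
  have "u (dcol n j) < v (dcol n j)" using le_funD[OF le, of "dcol n j"] u by simp
  moreover have "u(dcol n j := Suc (u (dcol n j)))\<in>SD" unfolding u(1) using SD_up[of j "dcol n j"] u(2) by simp
  ultimately show ?thesis by blast
 qed
 show ?thesis using uv(1)
 proof (cases rule: SD_cases)
  case 1
  note u = this
  show ?thesis using uv(2)
  proof (cases rule: SD_cases)
   case 1
   then show ?thesis using u uv(4) by simp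
  next
   case (2 k)
   then have "n<=k" using uv(3) u w_le_pv by simp
   then have "dv n<=v" using 2 by (simp add: pv_le_iff)
   from le_funD[OF this, of "n - 1"] have "u (n - 1) < v (n - 1)"
    using u w_eq[of "n - 1"] pv_dcol[of n "n - 1"] n_ge_4 by auto
   then show ?thesis using SD_up_w u by blast
  qed
 next
  case (2 j)
  note u = this
  show ?thesis using uv(2)
  proof (cases rule: SD_cases)
   case 1
   then have j: "j<=n - 2" using u uv(3) pv_le_w by simp
   show ?thesis
   proof (cases "j = n - 2")
    case True
    have "u n < v n" using u True 1 w_eq[of n] pv_dcol[of "n - 2" n] n_ge_4 by simp
    then show ?thesis using SD_up[of j n] u True by blast
   next
    case False
    then have "dv (Suc j)<=v" "j < 2 * n - 2" using 1 pv_le_w[of "Suc j"] j by auto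
    then show ?thesis using * u by blast
   qed
  next
   case (2 k)
   then have "Suc j<=k" using u uv(3,4) by (metis pv_le_iff pv_inject le_neq_implies_less Suc_leI)
   then have "dv (Suc j)<=v" "j < 2 * n - 2" using 2 by (auto simp: pv_le_iff simp del: pv.simps)
   then show ?thesis using * u by blast
  qed
 qed
qed

lemma SD_exclusive:
 assumes "u\<in>SD" "u(a := Suc (u a))\<in>SD"
 shows "~ (u a > 0 & u(a := u a - 1)\<in>SD)"
 using assms(1)
proof (cases rule: SD_cases)
 case 1
 then show ?thesis using assms(2) SD_up_w SD_dn_w n_ge_4 by auto
next
 case (2 k)
 have c: "(k < 2 * n - 2 & dcol n k = a) | (k = n - 2 & a = n)" using assms(2) SD_up 2 by simp
 have "~ ((k > 0 & dcol n (k - 1) = a) | (k = n & a = n - 1))"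
  using c n_ge_4 by (auto simp: dcol_def split: if_splits)
 then show ?thesis using SD_dn[of k a] 2 by simp
qed

lemma SD_support: "u\<in>SD ==> a\<notin>{Suc 0..n} ==> u a = 0"
proof -
 assume u: "u\<in>SD" and a: "a\<notin>{Suc 0..n}"
 show ?thesis using u
 proof (cases rule: SD_cases)
  case 1
  then show ?thesis using a w_eq[of a] n_ge_4 by auto
 next
  case (2 k)
  then show ?thesis using a pv_dcol[of k a] pv_dcol'[of k a] n_ge_4 by (cases "k<=n") auto
 qed
qed

sublocale rc "{Suc 0..n}" "cartanD n" "%_. 1" "Suc 0" SD T
proof
 show "finite {Suc 0..n}" "Suc 0\<in>{Suc 0..n}" "finite SD" "1<=T" using n_ge_4 T_ge_1 by (auto simp: SD_def)
 show "u a = 0" if "u\<in>SD" "a\<notin>{Suc 0..n}" for u a using SD_support that .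
 show "(%_. 0)\<in>SD" using pv_in_SD[of 0] by simp
 show "sup u v\<in>SD" "inf u v\<in>SD" if "u\<in>SD" "v\<in>SD" for u v using SD_lattice that by auto
 show "\<exists>a. u(a := Suc (u a))\<in>SD & u a < v a" if "u\<in>SD" "v\<in>SD" "u<=v" "u ~= v" for u v
  using SD_saturated that .
 show "cartanD n a a = 2" for a by (simp add: cartanD_def)
 show "cartanD n a b<=0" if "a ~= b" for a b using cartanD_off that .
 show "1 * cartanD n a b = 1 * cartanD n b a" for a b using cartanD_sym by simp
 show "u(a := u a - 1)\<notin>SD" if "u\<in>SD" "u(a := Suc (u a))\<in>SD" "0 < u a" for u a
  using SD_exclusive that by blast
 show "of_bool (a = Suc 0) - (\<Sum>b\<in>{Suc 0..n}. cartanD n a b * int (u b)) =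
   of_bool (u(a := Suc (u a))\<in>SD) - of_bool (0 < u a & u(a := u a - 1)\<in>SD)"
  if u: "u\<in>SD" and a: "a\<in>{Suc 0..n}" for u a
  using u
 proof (cases rule: SD_cases)
  case 1
  then show ?thesis using h_D_w[OF a] SD_up_w SD_dn_w by simp
 next
  case (2 k)
  show ?thesis unfolding 2(2) h_D[OF 2(1) a] SD_up[OF 2(1)] SD_dn[OF 2(1)] hh_def ..
 qed
qed

abbreviation "dtop \<equiv> dv (2 * n - 2)"

lemma dtop_1: "dtop (Suc 0) = 2"
 using pv_dcol'[of "2 * n - 2" "Suc 0"] n_ge_4 by auto

lemma energy_D:
 assumes "fwalk J u" "rwalk J x v"
 shows "v 1 (Suc 0) = (if x<=u T then 0 else if x = dtop & u T = (%_. 0) then 2 else 1)"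
proof -
 have S0: "v = (%_. 0)" if v: "v\<in>SD" "v (Suc 0) = 0" for v
  using v(1)
 proof (cases rule: SD_cases)
  case 1
  then show ?thesis using v(2) w_eq[of "Suc 0"] n_ge_4 by simp
 next
  case (2 k)
  have "k = 0"
   using v(2) 2 pv_dcol[of k "Suc 0"] pv_dcol'[of k "Suc 0"] n_ge_4 by (cases "k<=n") (auto simp: of_bool_def split: if_splits)
  then show ?thesis using 2 by simp
 qed
 have t2: "v<=dtop" if v: "v\<in>SD" for v
  using v by (cases rule: SD_cases) (use w_le_pv[of "2 * n - 2"] n_ge_4 in \<open>simp_all add: pv_le_iff\<close>)
 have t3: "v = dtop" if v: "v\<in>SD" "dtop (Suc 0)<=v (Suc 0)" for v
  using v(1)
 proof (cases rule: SD_cases)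
  case 1
  then show ?thesis using v(2) w_eq[of "Suc 0"] unfolding dtop_1 by (simp add: of_bool_def split: if_splits)
 next
  case (2 k)
  have "k = 2 * n - 2"
   using v(2) 2 pv_dcol[of k "Suc 0"] pv_dcol'[of k "Suc 0"] n_ge_4 unfolding dtop_1 by (cases "k<=n") (auto simp: of_bool_def split: if_splits)
  then show ?thesis using 2 by simp
 qed
 have t4: "dn (Suc 0) dtop" unfolding dn_def using SD_dn[of "2 * n - 2" "Suc 0"] n_ge_4 by (auto simp: dcol_def)
 have up0: "up (Suc 0) (%_. 0)" unfolding up_def using SD_up[of 0 "Suc 0"] n_ge_4 by (simp add: dcol_def)
 show ?thesis
  using walk_energy[OF assms S0 pv_in_SD t2 t3 t4 _ up0] dtop_1 by simp
qed

end

section \<open>Strings in tensor products\<close>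

text \<open>Local axioms for \<epsilon> and \<phi>. They determine the maxima in
  \<open>string_length\<close> and pass to tensor products, so that no iterated operator has to be
  computed.\<close>

definition strings :: "'b crystal => nat => ('b => nat) => ('b => nat) => bool" where
 "strings C i e p \<longleftrightarrow>
  (\<forall>b. (eop C i b = None \<longleftrightarrow> e b = 0) & (fop C i b = None \<longleftrightarrow> p b = 0)) &
  (\<forall>b c. eop C i b = Some c --> e b = Suc (e c) & p c = Suc (p b)) &
  (\<forall>b c. fop C i b = Some c --> p b = Suc (p c) & e c = Suc (e b))"

lemma string_length_eq:
 assumes "!!b. g b = None \<longleftrightarrow> e b = 0" "!!b c. g b = Some c ==> e b = Suc (e c)"
 shows "string_length g b = e b"
proof -
 have N: "((%x. Option.bind x g) ^^ k) None = None" for k by (induction k) auto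
 have "((%x. Option.bind x g) ^^ k) (Some b) ~= None \<longleftrightarrow> k<=e b" for k
 proof (induction k arbitrary: b)
  case (Suc k)
  show ?case
  proof (cases "g b")
   case None
   then have "e b = 0" using assms(1) by simp
   then show ?thesis using None N by (simp add: funpow_Suc_right del: funpow.simps)
  next
   case (Some c)
   then show ?thesis using assms(2)[OF Some] Suc[of c] by (simp add: funpow_Suc_right del: funpow.simps)
  qed
 qed auto
 then have eq: "{k. ((%x. Option.bind x g) ^^ k) (Some b) ~= None} = {..e b}" by blast
 show ?thesis unfolding string_length_def eq by (rule Max_eqI) auto
qed

lemma strings_length:
 assumes "strings C i e p"
 shows "varepsilon C i b = e b" "varphi C i b = p b"
 using assms unfolding varepsilon_def varphi_def strings_def
 by (auto intro!: string_length_eq)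

lemma strings_tensor:
 assumes C: "strings C i e p" and D: "strings D i e' p'"
 shows "strings (tensor C D) i (%(x, y). e' y + (e x - p' y)) (%(x, y). p x + (p' y - e x))"
proof -
 note c = C[unfolded strings_def] and d = D[unfolded strings_def]
 have eo: "eop (tensor C D) i (x, y) = (if e x > p' y
   then map_option (%x'. (x', y)) (eop C i x) else map_option (%y'. (x, y')) (eop D i y))"
 and fo: "fop (tensor C D) i (x, y) = (if e x>=p' y
   then map_option (%x'. (x', y)) (fop C i x) else map_option (%y'. (x, y')) (fop D i y))" for x y
  by (simp_all add: tensor_def strings_length[OF C] strings_length[OF D])
 have 1: "eop (tensor C D) i (x, y) = None \<longleftrightarrow> e' y + (e x - p' y) = 0"
  "fop (tensor C D) i (x, y) = None \<longleftrightarrow> p x + (p' y - e x) = 0" for x y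
  unfolding eo fo using c d by auto
 have 2: "e' y + (e x - p' y) = Suc (e' y' + (e x' - p' y')) & p x' + (p' y' - e x') = Suc (p x + (p' y - e x))"
  if "eop (tensor C D) i (x, y) = Some (x', y')" for x y x' y'
 proof (cases "e x > p' y")
  case True
  then have "eop C i x = Some x'" "y' = y" using that unfolding eo by auto
  then have "e x = Suc (e x')" "p x' = Suc (p x)" using c by blast+
  then show ?thesis using True \<open>y' = y\<close> by simp
 next
  case False
  then have "eop D i y = Some y'" "x' = x" using that unfolding eo by auto
  then have "e' y = Suc (e' y')" "p' y' = Suc (p' y)" using d by blast+
  then show ?thesis using False \<open>x' = x\<close> by simp
 qed
 have 3: "p x + (p' y - e x) = Suc (p x' + (p' y' - e x')) & e' y' + (e x' - p' y') = Suc (e' y + (e x - p' y))"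
  if "fop (tensor C D) i (x, y) = Some (x', y')" for x y x' y'
 proof (cases "e x>=p' y")
  case True
  then have "fop C i x = Some x'" "y' = y" using that unfolding fo by auto
  then have "p x = Suc (p x')" "e x' = Suc (e x)" using c by blast+
  then show ?thesis using True \<open>y' = y\<close> by simp
 next
  case False
  then have "fop D i y = Some y'" "x' = x" using that unfolding fo by auto
  then have "p' y = Suc (p' y')" "e' y' = Suc (e' y)" using d by blast+
  then show ?thesis using False \<open>x' = x\<close> by simp
 qed
 show ?thesis unfolding strings_def using 1 2 3 by auto
qed

fun elen :: "('b => nat) => ('b => nat) => 'b list => nat"
 and plen :: "('b => nat) => ('b => nat) => 'b list => nat" where
 "elen e p [] = 0"
| "elen e p (x # b) = elen e p b + (e x - plen e p b)"
| "plen e p [] = 0"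
| "plen e p (x # b) = p x + (plen e p b - e x)"

text \<open>The operators of \<open>tensor_power C L\<close> look at the first \<open>L\<close>
  entries of any list; with \<open>cut\<close> the string lengths are right on all lists, as
  \<open>strings\<close> demands.\<close>

primrec cut :: "nat => 'b list => 'b list" where
 "cut 0 b = []"
| "cut (Suc L) b = (case b of [] => [] | x # b' => x # cut L b')"

lemma strings_tensor_power:
 assumes C: "strings C i e p"
 shows "strings (tensor_power C L) i (%b. elen e p (cut L b)) (%b. plen e p (cut L b))"
proof (induction L)
 case 0
 then show ?case by (simp add: strings_def)
next
 case (Suc L)
 note T = strings_tensor[OF C Suc]
 let ?T = "tensor C (tensor_power C L)"
 have eo: "eop (tensor_power C (Suc L)) i b =
   (case b of [] => None | x # xs => map_option (%(x, xs). x # xs) (eop ?T i (x, xs)))"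
  and fo: "fop (tensor_power C (Suc L)) i b =
   (case b of [] => None | x # xs => map_option (%(x, xs). x # xs) (fop ?T i (x, xs)))" for b
  by (simp_all add: Let_def)
 note t = T[unfolded strings_def]
 have t1: "eop ?T i (x, y) = None \<longleftrightarrow> elen e p (x # cut L y) = 0"
   "fop ?T i (x, y) = None \<longleftrightarrow> plen e p (x # cut L y) = 0" for x y
  using t by auto
 have t2: "eop ?T i (x, y) = Some (x', y') ==> elen e p (x # cut L y) = Suc (elen e p (x' # cut L y'))
   & plen e p (x' # cut L y') = Suc (plen e p (x # cut L y))" for x y x' y'
  using t by simp
 have t3: "fop ?T i (x, y) = Some (x', y') ==> plen e p (x # cut L y) = Suc (plen e p (x' # cut L y'))
   & elen e p (x' # cut L y') = Suc (elen e p (x # cut L y))" for x y x' y'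
  using t by simp
 show ?case
  unfolding strings_def eo fo
 proof (intro conjI allI impI)
  fix b
  show "(case b of [] => None | x # xs => map_option (%(x, xs). x # xs) (eop ?T i (x, xs))) = None
   \<longleftrightarrow> elen e p (cut (Suc L) b) = 0"
   "(case b of [] => None | x # xs => map_option (%(x, xs). x # xs) (fop ?T i (x, xs))) = None
   \<longleftrightarrow> plen e p (cut (Suc L) b) = 0"
   by (cases b; use t1 in simp)+
 next
  fix b c
  assume "(case b of [] => None | x # xs => map_option (%(x, xs). x # xs) (eop ?T i (x, xs))) = Some c"
  then obtain x y x' y' where "b = x # y" "c = x' # y'" "eop ?T i (x, y) = Some (x', y')" by (auto split: list.splits)
  then show "elen e p (cut (Suc L) b) = Suc (elen e p (cut (Suc L) c))"
   "plen e p (cut (Suc L) c) = Suc (plen e p (cut (Suc L) b))" using t2 by auto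
 next
  fix b c
  assume "(case b of [] => None | x # xs => map_option (%(x, xs). x # xs) (fop ?T i (x, xs))) = Some c"
  then obtain x y x' y' where "b = x # y" "c = x' # y'" "fop ?T i (x, y) = Some (x', y')" by (auto split: list.splits)
  then show "plen e p (cut (Suc L) b) = Suc (plen e p (cut (Suc L) c))"
   "elen e p (cut (Suc L) c) = Suc (elen e p (cut (Suc L) b))" using t3 by auto
 qed
qed

lemma cut_id [simp]: "length b = L ==> cut L b = b"
 by (induction L arbitrary: b) (auto split: list.splits)

lemma elts_tensor_power: "elts (tensor_power C L) = {b. length b = L & set b \<subseteq> elts C}"
proof (induction L)
 case (Suc L)
 have "elts (tensor_power C (Suc L)) = (%(x, xs). x # xs) ` (elts C \<times> {b. length b = L & set b \<subseteq> elts C})"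
  using Suc by (simp add: Let_def tensor_def)
 also have "... = {b. length b = Suc L & set b \<subseteq> elts C}"
  by (auto simp: length_Suc_conv image_iff)
 finally show ?case .
qed auto

lemma wt_tensor_power: "length b = L ==> wt (tensor_power C L) b = (%k. \<Sum>x\<leftarrow>b. wt C x k)"
 by (induction L arbitrary: b) (auto simp: Let_def tensor_def length_Suc_conv fun_eq_iff split: list.splits)

section \<open>Strings in \<open>B\<^sup>1\<^sup>,\<^sup>1\<close>\<close>

text \<open>The closed form of \<epsilon> on letters, for colour \<open>i\<close>. Outside type
  \<open>A1\<close> the bar involution reverses the arrows, which is how \<open>lp\<close> obtains
  \<phi> from it.\<close>

fun le :: "aff_type => nat => nat => letter => nat" where
 "le ty n i (Ltr k) = (if i = 0
  then if ty\<in>{B1, D1, A2_odd} then of_bool (k = 1 | k = 2)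
   else if ty\<in>{A2_even, D2} then 2 * of_bool (k = 1) else of_bool (k = 1)
  else of_bool (k = Suc i & (i < n | ty = A1 & i = n)))"
| "le ty n i (Bar k) = (if i = 0 | ty = A1 then 0 else if i = n
  then if ty\<in>{B1, A2_dagger, D2} then 2 * of_bool (k = n) else if ty = D1 then of_bool (k = n | Suc k = n)
   else of_bool (k = n)
  else of_bool (k = i & i < n))"
| "le ty n i Zero = of_bool (i = n & ty\<in>{B1, A2_dagger, D2})"
| "le ty n i Phi = of_bool (i = 0 & ty\<in>{A2_even, D2})"

fun lp :: "aff_type => nat => nat => letter => nat" where
 "lp ty n i (Ltr k) = (if ty = A1 then of_bool (i = 0 & k = Suc n | k = i & 1<=i & i<=n) else le ty n i (Bar k))"
| "lp ty n i (Bar k) = (if ty = A1 then 0 else le ty n i (Ltr k))"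
| "lp ty n i Zero = le ty n i Zero"
| "lp ty n i Phi = le ty n i Phi"

text \<open>The pairing of a weight with the classical coroot of colour \<open>i\<close>, normalized
  so that it equals \<phi> minus \<epsilon> on letters.\<close>

definition pr :: "aff_type => nat => nat => (nat => int) => int" where
 "pr ty n i mu = (if i < n | ty = A1 then mu i - mu (Suc i)
  else if ty\<in>{C1, A2_even, A2_odd} then mu n
  else if ty = D1 then mu (n - 1) + mu n else 2 * mu n)"

lemma pr_add: "pr ty n i (%k. f k + g k) = pr ty n i f + pr ty n i g"
 by (simp add: pr_def)

lemma pr_letter:
 assumes "nonexceptional ty n" "i\<in>{1..n}" "x\<in>letters ty n"
 shows "pr ty n i (letter_wt x) = int (lp ty n i x) - int (le ty n i x)"
proof -
 obtain m where m: "n = Suc m" "i>=1" "i<=n"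
  using assms(1,2) that[of "n - 1"] by (cases n) (auto simp: nonexceptional_def split: aff_type.splits)
 show ?thesis
 proof (cases x)
  case (Ltr k)
  then have "k>=1" "k<=Suc n" "ty ~= A1 ==> k<=n" using assms(3) by (auto simp: letters_def split: if_splits)
  then show ?thesis using m assms(1) Ltr by (cases ty) (simp_all add: pr_def eps_def nonexceptional_def)
 next
  case (Bar k)
  then have "k>=1" "k<=n" "ty ~= A1" using assms(3) by (auto simp: letters_def split: if_splits)
  then show ?thesis using m assms(1) Bar by (cases ty) (simp_all add: pr_def eps_def nonexceptional_def)
 qed (use m in \<open>simp_all add: pr_def\<close>)
qed

text \<open>The source of the arrow of colour \<open>i\<close> that ends in the given letter; it has
  this meaning only where \<open>le\<close> is positive.\<close>

fun src :: "aff_type => nat => nat => letter => letter" where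
 "src ty n i (Ltr k) = (if i = 0
  then if ty\<in>{B1, D1, A2_odd} then Bar (3 - k) else if ty\<in>{A2_even, D2} then Phi
   else if ty = A1 then Ltr (Suc n) else Bar 1
  else Ltr i)"
| "src ty n i (Bar k) = (if i = n
  then if ty\<in>{B1, A2_dagger, D2} then Zero else if ty = D1 & k = n then Ltr (n - 1) else Ltr n
  else Bar (Suc k))"
| "src ty n i Zero = Ltr n"
| "src ty n i Phi = Bar 1"

lemmas arrow_defs = arrows_def colour_n_arrows_def colour_0_arrows_def nonexceptional_def

lemma arrow_src:
 assumes "nonexceptional ty n"
 shows "(x, i, y)\<in>arrows ty n \<longleftrightarrow> le ty n i y > 0 & x = src ty n i y"
 using assms by (cases ty; cases y) (auto simp: arrow_defs)

lemma arrow_lp: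
 assumes "nonexceptional ty n"
 shows "(\<exists>y. (x, i, y)\<in>arrows ty n) \<longleftrightarrow> lp ty n i x > 0"
 using assms by (cases ty; cases x) (auto simp: arrow_defs)

lemma arrow_target_unique:
 assumes "nonexceptional ty n"
 shows "(x, i, y)\<in>arrows ty n ==> (x, i, y')\<in>arrows ty n ==> y = y'"
 using assms by (cases ty) (auto simp: arrow_defs)

lemma arrow_step:
 assumes "nonexceptional ty n" "(x, i, y)\<in>arrows ty n"
 shows "le ty n i y = Suc (le ty n i x) & lp ty n i x = Suc (lp ty n i y)"
 using assms by (cases ty) (auto simp: arrow_defs)

lemma eop_B11:
 assumes "nonexceptional ty n"
 shows "eop (B11 ty n) i y = (if le ty n i y > 0 then Some (src ty n i y) else None)"
 using arrow_src[OF assms] by (auto simp: B11_def)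

lemma strings_B11:
 assumes "nonexceptional ty n"
 shows "strings (B11 ty n) i (le ty n i) (lp ty n i)"
proof -
 note e = eop_B11[OF assms]
 have f: "fop (B11 ty n) i x = Some y \<longleftrightarrow> (x, i, y)\<in>arrows ty n"
  "fop (B11 ty n) i x = None \<longleftrightarrow> lp ty n i x = 0" for x y
 proof -
  have "(THE y. (x, i, y)\<in>arrows ty n) = y" if "(x, i, y)\<in>arrows ty n" for y
   by (rule the_equality) (use that arrow_target_unique[OF assms] in blast)+
  then show "fop (B11 ty n) i x = Some y \<longleftrightarrow> (x, i, y)\<in>arrows ty n" "fop (B11 ty n) i x = None \<longleftrightarrow> lp ty n i x = 0"
   using arrow_lp[OF assms, of x i] by (auto simp: B11_def)
 qed
 have "le ty n i y = Suc (le ty n i x) & lp ty n i x = Suc (lp ty n i y)"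
  if "eop (B11 ty n) i y = Some x" for x y
  using arrow_step[OF assms, of x i y] arrow_src[OF assms, of x i y] that unfolding e by (simp split: if_splits)
 then show ?thesis using arrow_step[OF assms] unfolding strings_def f by (auto simp: e)
qed

lemma src_letters:
 assumes "nonexceptional ty n" "le ty n i y > 0"
 shows "src ty n i y\<in>letters ty n"
proof -
 have "(src ty n i y, i, y)\<in>arrows ty n" using arrow_src[OF assms(1)] assms(2) by simp
 then show ?thesis using assms(1) by (cases ty) (auto simp: arrow_defs letters_def)
qed

lemma paths_0: "paths ty n lam 0 = (if lam = (%_. 0) then {[]} else {})"
 by (auto simp: paths_def)

lemma paths_elen:
 assumes "nonexceptional ty n"
 shows "b\<in>paths ty n lam L \<longleftrightarrow> length b = L & set b \<subseteq> letters ty n & (%k. \<Sum>x\<leftarrow>b. letter_wt x k) = lam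
  & (\<forall>i\<in>{1..n}. elen (le ty n i) (lp ty n i) b = 0)"
proof -
 have "eop (tensor_power (B11 ty n) L) i b = None \<longleftrightarrow> elen (le ty n i) (lp ty n i) b = 0" if "length b = L" for i
  using strings_tensor_power[OF strings_B11[OF assms], of L i] that by (simp add: strings_def)
 then show ?thesis
  using wt_tensor_power[of b L "B11 ty n"] by (auto simp: paths_def elts_tensor_power B11_def)
qed

lemma plen_elen:
 assumes "nonexceptional ty n" "i\<in>{1..n}" "set b \<subseteq> letters ty n"
 shows "int (plen (le ty n i) (lp ty n i) b) - int (elen (le ty n i) (lp ty n i) b) = pr ty n i (%k. \<Sum>x\<leftarrow>b. letter_wt x k)"
 using assms(3)
proof (induction b)
 case Nil
 then show ?case by (simp add: pr_def)
next
 case (Cons x b)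
 have pr_eq: "pr ty n i (%k. \<Sum>x\<leftarrow>x # b. letter_wt x k) = pr ty n i (letter_wt x) + pr ty n i (%k. \<Sum>x\<leftarrow>b. letter_wt x k)"
  by (simp add: pr_add)
 have "pr ty n i (letter_wt x) = int (lp ty n i x) - int (le ty n i x)"
  using pr_letter[OF assms(1,2)] Cons by simp
 then show ?case unfolding pr_eq using Cons by simp
qed

text \<open>For a highest weight element the value of \<phi> is the pairing of its weight. By the
  tensor rule a letter may be added on the left exactly when its \<epsilon> does not exceed this
  value, which turns paths into walks in the dominant chamber.\<close>

lemma paths_Cons:
 assumes "nonexceptional ty n"
 shows "x # b\<in>paths ty n lam (Suc L) \<longleftrightarrow> x\<in>letters ty n & b\<in>paths ty n (%k. lam k - letter_wt x k) L
  & (\<forall>i\<in>{1..n}. int (le ty n i x)<=pr ty n i (%k. lam k - letter_wt x k))"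
proof -
 have w: "(%k. \<Sum>x\<leftarrow>x # b. letter_wt x k) = lam \<longleftrightarrow> (%k. \<Sum>x\<leftarrow>b. letter_wt x k) = (%k. lam k - letter_wt x k)"
  by (auto simp: fun_eq_iff algebra_simps)
 have "elen (le ty n i) (lp ty n i) (x # b) = 0 \<longleftrightarrow> elen (le ty n i) (lp ty n i) b = 0
   & int (le ty n i x)<=pr ty n i (%k. \<Sum>x\<leftarrow>b. letter_wt x k)"
  if "i\<in>{1..n}" "set b \<subseteq> letters ty n" for i
  using plen_elen[OF assms that] by auto
 then show ?thesis unfolding paths_elen[OF assms] w by auto
qed

lemma paths_Suc_nonempty: "[]\<notin>paths ty n lam (Suc L)"
 by (simp add: paths_def elts_tensor_power del: tensor_power.simps)

section \<open>The local energy function\<close>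

text \<open>The place in the order 1, ..., n, 0, bar n, ..., bar 1, centred at zero.\<close>

fun lpos :: "nat => letter => int" where
 "lpos n (Ltr k) = int k - int n - 1"
| "lpos n (Bar k) = int n + 1 - int k"
| "lpos n Zero = 0"
| "lpos n Phi = 0"

text \<open>The negation of the order in which the walkers compare letters. In type
  \<open>D1\<close> the letters n and bar n are incomparable, so both orders are descents. The pair
  0, 0 is one because the two walkers of the letter 0 end at different positions.\<close>

definition descent :: "aff_type => nat => letter => letter => bool" where
 "descent ty n x y \<longleftrightarrow> lpos n y < lpos n x | (x = Zero & y = Zero) | (ty = D1 & x = Ltr n & y = Bar n)"

text \<open>Minus the local energy function, see \<open>local_energy_eq\<close>. In types
  \<open>A2_even\<close> and \<open>D2\<close> the 0-arrows pass through phi, which doubles descents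
  and leaves the intermediate value 1 to pairs with a single phi.\<close>

definition eh :: "aff_type => nat => letter => letter => int" where
 "eh ty n x y = (if x = Phi & y = Phi then 2 else if x = Phi | y = Phi then 1
  else if ty\<in>{A2_even, D2} then 2 * of_bool (descent ty n x y)
  else if ty\<in>{B1, D1, A2_odd} & x = Bar 1 & y = Ltr 1 then 2
  else of_bool (descent ty n x y))"

lemma letters_simps:
 "Ltr k\<in>letters ty n \<longleftrightarrow> 1<=k & (if ty = A1 then k<=Suc n else k<=n)"
 "Bar k\<in>letters ty n \<longleftrightarrow> ty ~= A1 & 1<=k & k<=n"
 "Zero\<in>letters ty n \<longleftrightarrow> ty\<in>{B1, A2_dagger, D2}"
 "Phi\<in>letters ty n \<longleftrightarrow> ty\<in>{A2_even, D2}"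
 by (auto simp: letters_def)

lemma eh_left:
 assumes "nonexceptional ty n" "(w, i, x)\<in>arrows ty n" "y\<in>letters ty n" "le ty n i x > lp ty n i y"
 shows "eh ty n w y = eh ty n x y + of_bool (i = 0)"
 using assms(2,3,4,1)
 apply (cases ty; cases y; simp add: letters_simps arrow_defs)
 apply (safe; simp add: eh_def descent_def of_bool_def split: if_splits)+
 done

lemma eh_right:
 assumes "nonexceptional ty n" "(w, i, y)\<in>arrows ty n" "x\<in>letters ty n" "le ty n i x<=lp ty n i y"
 shows "eh ty n x w = eh ty n x y - of_bool (i = 0)"
 using assms(2,3,4,1)
 apply (cases ty; cases x; simp add: letters_simps arrow_defs)
 apply (safe; simp add: eh_def descent_def of_bool_def split: if_splits)+
 done

lemma is_local_energy_iff:
 assumes ne: "nonexceptional ty n"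
 shows "is_local_energy ty n H \<longleftrightarrow> H\<in>extensional (letters ty n \<times> letters ty n) & H (Ltr 1, Ltr 1) = 0 &
  (\<forall>i w x y. i<=n --> (w, i, x)\<in>arrows ty n --> x\<in>letters ty n --> y\<in>letters ty n -->
   (le ty n i x > lp ty n i y --> H (w, y) = H (x, y) - of_bool (i = 0)) &
   (le ty n i y<=lp ty n i x --> H (y, w) = H (y, x) + of_bool (i = 0)))"
  (is "_ \<longleftrightarrow> ?E & ?Z & ?R")
proof -
 let ?B = "B11 ty n"
 have el: "elts (tensor ?B ?B) = letters ty n \<times> letters ty n" by (simp add: tensor_def B11_def)
 have vs: "varepsilon ?B i b = le ty n i b" "varphi ?B i b = lp ty n i b" for i b
  using strings_length[OF strings_B11[OF ne]] by auto
 have eo: "eop (tensor ?B ?B) i (x, y) = (if lp ty n i y < le ty n i x then Some (src ty n i x, y)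
   else if 0 < le ty n i y then Some (x, src ty n i y) else None)" for i x y
  by (auto simp: tensor_def vs eop_B11[OF ne])
 have "(\<forall>i\<in>{0..n}. \<forall>(b, b')\<in>elts (tensor ?B ?B). \<forall>c.
    eop (tensor ?B ?B) i (b, b') = Some c -->
    H c = (if i ~= 0 then H (b, b')
        else if varepsilon ?B 0 b > varphi ?B 0 b' then H (b, b') - 1
        else H (b, b') + 1)) \<longleftrightarrow> ?R"
  (is "?L \<longleftrightarrow> _")
 proof
  assume L: ?L
  have *: "H c = (if i ~= 0 then H (b, b') else if le ty n 0 b > lp ty n 0 b' then H (b, b') - 1 else H (b, b') + 1)"
   if "i<=n" "b\<in>letters ty n" "b'\<in>letters ty n" "eop (tensor ?B ?B) i (b, b') = Some c" for i b b' c
   using bspec[OF bspec[OF L, of i], of "(b, b')"] that by (cases c) (simp add: el vs)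
  show ?R
  proof (intro allI impI conjI)
   fix i w x y
   assume i: "i<=n" and a: "(w, i, x)\<in>arrows ty n" and x: "x\<in>letters ty n" and y: "y\<in>letters ty n"
   have w: "le ty n i x > 0" "src ty n i x = w" using a arrow_src[OF ne] by auto
   show "H (w, y) = H (x, y) - of_bool (i = 0)" if "le ty n i x > lp ty n i y"
    using *[OF i x y, of "(w, y)"] that w unfolding eo by (cases "i = 0") auto
   show "H (y, w) = H (y, x) + of_bool (i = 0)" if "le ty n i y<=lp ty n i x"
    using *[OF i y x, of "(y, w)"] that w unfolding eo by (cases "i = 0") auto
  qed
 next
  assume R: ?R
  show ?L unfolding el vs
  proof safe
   fix i b b' c1 c2
   assume i: "i\<in>{0..n}" and b: "b\<in>letters ty n" "b'\<in>letters ty n"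
    and e: "eop (tensor ?B ?B) i (b, b') = Some (c1, c2)"
   show "H (c1, c2) = (if i ~= 0 then H (b, b') else if le ty n 0 b > lp ty n 0 b' then H (b, b') - 1 else H (b, b') + 1)"
   proof (cases "lp ty n i b' < le ty n i b")
    case True
    then have "c1 = src ty n i b" "c2 = b'" "(c1, i, b)\<in>arrows ty n" using e arrow_src[OF ne] unfolding eo by auto
    then show ?thesis using R i b True by (cases "i = 0") auto
   next
    case False
    then have "c1 = b" "c2 = src ty n i b'" "(c2, i, b')\<in>arrows ty n"
     using e arrow_src[OF ne] unfolding eo by (auto split: if_splits)
    then show ?thesis using R i b False by (cases "i = 0") auto
   qed
  qed
 qed
 then show ?thesis by (simp add: is_local_energy_def el Let_def)
qed

lemma rank_pos: "nonexceptional ty n ==> n>=1"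
 by (cases ty) (auto simp: nonexceptional_def)

lemma Ltr_1_letter: "nonexceptional ty n ==> Ltr 1\<in>letters ty n"
 using rank_pos by (simp add: letters_simps)

text \<open>The pairs killed by all classical raising operators, spelled out with the tensor
  rule.\<close>

definition hw_pair :: "aff_type => nat => letter => letter => bool" where
 "hw_pair ty n x y \<longleftrightarrow> (\<forall>i\<in>{1..n}. le ty n i y = 0 & le ty n i x<=lp ty n i y)"

lemma le_0_letter:
 assumes "nonexceptional ty n" "y\<in>letters ty n" "\<forall>i\<in>{1..n}. le ty n i y = 0"
 shows "y = Ltr 1 | y = Phi"
proof (cases y)
 case (Ltr k)
 have "k = 1"
 proof (rule ccontr)
  assume "k ~= 1"
  then have "k - 1\<in>{1..n}" using assms(2) Ltr by (auto simp: letters_simps split: if_splits)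
  then have "le ty n (k - 1) y = 0" using assms(3) by blast
  then show False using Ltr \<open>k ~= 1\<close> assms(2) by (auto simp: letters_simps split: if_splits)
 qed
 then show ?thesis using Ltr by simp
next
 case (Bar k)
 then have "k\<in>{1..n}" using assms(2) by (auto simp: letters_simps)
 then have "le ty n k y = 0" using assms(3) by blast
 then show ?thesis using Bar assms(2) by (auto simp: letters_simps split: if_splits)
next
 case Zero
 have "n\<in>{1..n}" using assms(1) by (cases ty) (auto simp: nonexceptional_def)
 then have "le ty n n y = 0" using assms(3) by blast
 then show ?thesis using Zero assms(2) by (auto simp: letters_simps)
qed auto

lemma src_lower:
 assumes "nonexceptional ty n" "(w, i, x)\<in>arrows ty n" "i>=1"
 shows "lpos n w < lpos n x" "x ~= Phi" "w ~= Phi" "w\<in>letters ty n" "x\<in>letters ty n"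
  "lpos n w >= - int n" "lpos n x >= - int n"
 using assms by (cases ty; auto simp: arrow_defs letters_simps)+

context
 fixes ty :: aff_type and n :: nat and G :: "letter => letter => int"
 assumes ne: "nonexceptional ty n" and G1: "G (Ltr 1) (Ltr 1) = 0"
  and GL: "!!i w x y. i<=n ==> (w, i, x)\<in>arrows ty n ==> x\<in>letters ty n ==> y\<in>letters ty n ==>
   le ty n i x > lp ty n i y ==> G w y = G x y"
  and GR: "!!i w x y. i<=n ==> (w, i, x)\<in>arrows ty n ==> x\<in>letters ty n ==> y\<in>letters ty n ==>
   le ty n i y<=lp ty n i x ==> G y w = G y x"
begin

lemmas n_pos = rank_pos[OF ne]
lemmas Ltr_1 = Ltr_1_letter[OF ne]

text \<open>Classical raising moves letters down in the order of \<open>lpos\<close> and changes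
  neither \<open>G\<close> nor \<open>eh\<close>. Hence it remains to treat highest weight pairs, of
  which there are few.\<close>

lemma raise:
 assumes "x\<in>letters ty n" "y\<in>letters ty n"
 shows "\<exists>x'\<in>letters ty n. \<exists>y'\<in>letters ty n. hw_pair ty n x' y' & G x' y' = G x y & eh ty n x' y' = eh ty n x y
  & (y = Phi --> y' = Phi)"
 using assms
proof (induction "nat (lpos n x + n) + nat (lpos n y + n)" arbitrary: x y rule: less_induct)
 case less
 show ?case
 proof (cases "hw_pair ty n x y")
  case True
  then show ?thesis using less.prems by blast
 next
  case False
  then obtain i where i: "i\<in>{1..n}" "le ty n i y > 0 | le ty n i x > lp ty n i y" by (auto simp: hw_pair_def)
  show ?thesis
  proof (cases "le ty n i x > lp ty n i y")
   case True
   then have a: "(src ty n i x, i, x)\<in>arrows ty n" using arrow_src[OF ne] by auto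
   note l = src_lower[OF ne a]
   have "nat (lpos n (src ty n i x) + n) + nat (lpos n y + n) < nat (lpos n x + n) + nat (lpos n y + n)"
    using l i by simp
   from less.hyps[OF this _ less.prems(2)] l i
   obtain x' y' where "x'\<in>letters ty n" "y'\<in>letters ty n" "hw_pair ty n x' y'" "G x' y' = G (src ty n i x) y"
    "eh ty n x' y' = eh ty n (src ty n i x) y" "y = Phi --> y' = Phi" by auto
   then show ?thesis
    using GL[OF _ a less.prems True] eh_left[OF ne a less.prems(2) True] i by force
  next
   case False
   then have a: "(src ty n i y, i, y)\<in>arrows ty n" using arrow_src[OF ne] i by auto
   note l = src_lower[OF ne a]
   have "nat (lpos n x + n) + nat (lpos n (src ty n i y) + n) < nat (lpos n x + n) + nat (lpos n y + n)"
    using l i by simp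
   from less.hyps[OF this less.prems(1)] l i
   obtain x' y' where "x'\<in>letters ty n" "y'\<in>letters ty n" "hw_pair ty n x' y'" "G x' y' = G x (src ty n i y)"
    "eh ty n x' y' = eh ty n x (src ty n i y)" "y ~= Phi" by auto
   then show ?thesis
    using GR[OF _ a less.prems(2,1)] eh_right[OF ne a less.prems(1)] i False by force
  qed
 qed
qed

lemma hw_cases:
 assumes "hw_pair ty n x y" "x\<in>letters ty n" "y\<in>letters ty n"
 shows "y = Ltr 1 | (y = Phi & (x = Ltr 1 | x = Phi))"
proof -
 have y: "y = Ltr 1 | y = Phi" using le_0_letter[OF ne assms(3)] assms(1) by (simp add: hw_pair_def)
 have "x = Ltr 1 | x = Phi" if "y = Phi"
  using le_0_letter[OF ne assms(2)] assms(1) that by (simp add: hw_pair_def)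
 then show ?thesis using y by blast
qed

lemma zero_right:
 assumes "(w, 0, y)\<in>arrows ty n" "x\<in>letters ty n" "y\<in>letters ty n" "le ty n 0 x<=lp ty n 0 y"
 shows "G x y = G x w" "eh ty n x y = eh ty n x w + 1"
 using GR[OF _ assms(1,3,2,4)] eh_right[OF ne assms(1,2,4)] by auto

lemma eh_0:
 assumes "x\<in>letters ty n" "y\<in>letters ty n" "eh ty n x y = 0"
 shows "G x y = 0"
proof -
 obtain x' y' where h: "hw_pair ty n x' y'" "x'\<in>letters ty n" "y'\<in>letters ty n" "G x' y' = G x y" "eh ty n x' y' = 0"
  using raise[OF assms(1,2)] assms(3) by auto
 have "y' ~= Phi" using h(5) by (auto simp: eh_def split: if_splits)
 then have y: "y' = Ltr 1" using hw_cases[OF h(1-3)] by auto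
 have "x' ~= Phi" "~ descent ty n x' (Ltr 1)" using h(5) y by (auto simp: eh_def split: if_splits)
 then have "x' = Ltr 1" using h(2) n_pos by (cases x') (auto simp: descent_def letters_simps)
 then show ?thesis using h y G1 by simp
qed

lemma le_0_eh_0:
 assumes "x\<in>letters ty n" "le ty n 0 x = 0" "(w, 0, Ltr 1)\<in>arrows ty n" "ty\<in>{A1, C1, A2_dagger}"
 shows "eh ty n x w = 0"
 using assms by (cases x) (auto simp: arrow_defs letters_simps eh_def descent_def split: if_splits)

text \<open>Uniqueness of the energy function: \<open>G\<close> is constant along all arrows and
  vanishes at the pair 1, 1. Arrows of colour 0 join pairs whose values of \<open>eh\<close> differ
  by one, and \<open>eh\<close> identifies the highest weight pair to which the new pair is
  raised.\<close>

lemma G_zero: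
 assumes "x\<in>letters ty n" "y\<in>letters ty n"
 shows "G x y = 0"
proof -
 consider "ty\<in>{A1, C1, A2_dagger}" | "ty\<in>{B1, D1, A2_odd}" | "ty\<in>{A2_even, D2}" by (cases ty) auto
 then show ?thesis
 proof cases
  case 1
  obtain x' y' where h: "hw_pair ty n x' y'" "x'\<in>letters ty n" "y'\<in>letters ty n" "G x' y' = G x y"
   using raise[OF assms] by auto
  have y: "y' = Ltr 1" using hw_cases[OF h(1-3)] h(3) 1 by (auto simp: letters_simps)
  show ?thesis
  proof (cases "le ty n 0 x' = 0")
   case True
   obtain w where w: "(w, 0, Ltr 1)\<in>arrows ty n" using 1 by (auto simp: arrow_defs)
   have wl: "w\<in>letters ty n" using w 1 n_pos by (auto simp: arrow_defs letters_simps)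
   have "G x' (Ltr 1) = G x' w" using zero_right(1)[OF w h(2) Ltr_1] True by simp
   also have "... = 0" using eh_0[OF h(2) wl le_0_eh_0[OF h(2) True w 1]] .
   finally show ?thesis using h y by simp
  next
   case False
   then have "x' = Ltr 1" using 1 h(2) n_pos by (cases x') (auto simp: letters_simps split: if_splits)
   then show ?thesis using h y G1 by simp
  qed
 next
  case 2
  have n: "n>=2" using 2 ne by (auto simp: nonexceptional_def)
  have hw: "x' = Ltr 1 | x' = Ltr 2 | x' = Bar 1" "y' = Ltr 1"
   if h: "hw_pair ty n x' y'" "x'\<in>letters ty n" "y'\<in>letters ty n" for x' y'
  proof -
   show y: "y' = Ltr 1" using hw_cases[OF h] h(3) 2 by (auto simp: letters_simps)
   have le0: "le ty n i x' = 0" if "i\<in>{2..n}" for i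
   proof -
    have "lp ty n i (Ltr 1) = 0" using 2 n that ne by (auto simp: nonexceptional_def)
    moreover have "le ty n i x'<=lp ty n i (Ltr 1)" using h(1) that y unfolding hw_pair_def by simp
    ultimately show ?thesis by simp
   qed
   show "x' = Ltr 1 | x' = Ltr 2 | x' = Bar 1"
   proof (cases x')
    case (Ltr k)
    have "k<=2"
    proof (rule ccontr)
     assume "~ k<=2"
     then obtain j where "k = Suc j" "j>=2" by (cases k) auto
     then show False using le0[of j] h(2) 2 Ltr by (auto simp: letters_simps split: if_splits)
    qed
    moreover have "k>=1" using h(2) Ltr by (simp add: letters_simps)
    ultimately have "k = 1 | k = 2" by linarith
    then show ?thesis using Ltr by auto
   next
    case (Bar k)
    have "~ 2<=k" using le0[of k] h(2) 2 Bar by (auto simp: letters_simps split: if_splits)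
    moreover have "k>=1" using h(2) Bar by (simp add: letters_simps)
    ultimately have "k = 1" by linarith
    then show ?thesis using Bar by simp
   qed (use le0[of n] n h(2) 2 in \<open>auto simp: letters_simps\<close>)
  qed
  have B2: "Bar 2\<in>letters ty n" "Bar 1\<in>letters ty n" using 2 n by (auto simp: letters_simps)
  have a: "(Bar 2, 0, Ltr 1)\<in>arrows ty n" using 2 by (auto simp: arrow_defs)
  have GB: "G (Bar 2) (Ltr 1) = 0" using GL[OF _ a Ltr_1 Ltr_1] G1 2 by auto
  have eB: "eh ty n (Bar 2) (Ltr 1) = 1" using eh_left[OF ne a Ltr_1] 2 by (auto simp: eh_def descent_def)
  have e2: "eh ty n (Ltr 1) (Ltr 1) = 0" "eh ty n (Bar 1) (Ltr 1) = 2" "eh ty n (Ltr 2) (Ltr 1) = 1"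
   using 2 n by (auto simp: eh_def descent_def)
  have G2: "G (Ltr 2) (Ltr 1) = 0"
  proof -
   obtain x' y' where h: "hw_pair ty n x' y'" "x'\<in>letters ty n" "y'\<in>letters ty n" "G x' y' = 0" "eh ty n x' y' = 1"
    using raise[OF B2(1) Ltr_1] GB eB by auto
   then have "x' = Ltr 2" "y' = Ltr 1" using hw[OF h(1-3)] e2 by auto
   then show ?thesis using h by simp
  qed
  \<comment> \<open>A 0-arrow on the right leads to the pair bar 1, bar 2 with \<open>eh\<close>
    equal to 1. Among the three highest weight pairs only 2, 1 has this value.\<close>
  have GB1: "G (Bar 1) (Ltr 1) = 0"
  proof -
   have z: "G (Bar 1) (Ltr 1) = G (Bar 1) (Bar 2)" "eh ty n (Bar 1) (Ltr 1) = eh ty n (Bar 1) (Bar 2) + 1"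
    using zero_right[OF a B2(2) Ltr_1] by auto
   obtain x' y' where h: "hw_pair ty n x' y'" "x'\<in>letters ty n" "y'\<in>letters ty n"
    "G x' y' = G (Bar 1) (Bar 2)" "eh ty n x' y' = eh ty n (Bar 1) (Bar 2)"
    using raise[OF B2(2,1)] by auto
   then have "x' = Ltr 2" "y' = Ltr 1" using hw[OF h(1-3)] e2 z(2) by auto
   then show ?thesis using h z G2 by simp
  qed
  obtain x' y' where h: "hw_pair ty n x' y'" "x'\<in>letters ty n" "y'\<in>letters ty n" "G x' y' = G x y"
   using raise[OF assms] by auto
  show ?thesis using hw[OF h(1-3)] h(4) G1 G2 GB1 by auto
 next
  case 3
  have B: "Bar 1\<in>letters ty n" "Phi\<in>letters ty n" using 3 n_pos by (auto simp: letters_simps)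
  have a: "(Phi, 0, Ltr 1)\<in>arrows ty n" "(Bar 1, 0, Phi)\<in>arrows ty n" using 3 by (auto simp: arrow_defs)
  have G\<phi>: "G Phi (Ltr 1) = 0" using GL[OF _ a(1) Ltr_1 Ltr_1] G1 3 by auto
  have G1\<phi>: "G (Ltr 1) Phi = 0"
  proof -
   have "G (Bar 1) Phi = G (Bar 1) (Bar 1)" "eh ty n (Bar 1) Phi = eh ty n (Bar 1) (Bar 1) + 1"
    using zero_right[OF a(2) B] by auto
   moreover have "G (Bar 1) (Bar 1) = 0" using eh_0[OF B(1) B(1)] 3 by (auto simp: eh_def descent_def)
   moreover obtain x' y' where h: "hw_pair ty n x' y'" "x'\<in>letters ty n" "y'\<in>letters ty n"
    "G x' y' = G (Bar 1) Phi" "eh ty n x' y' = eh ty n (Bar 1) Phi" "y' = Phi"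
    using raise[OF B] by auto
   moreover from this have "x' = Ltr 1" using hw_cases[OF h(1-3)] by (auto simp: eh_def)
   ultimately show ?thesis by simp
  qed
  have le1: "G x' y' = 0" if xy: "x'\<in>letters ty n" "y'\<in>letters ty n" and e: "eh ty n x' y' = 1" for x' y'
  proof -
   obtain x'' y'' where h: "hw_pair ty n x'' y''" "x''\<in>letters ty n" "y''\<in>letters ty n" "G x'' y'' = G x' y'"
    "eh ty n x'' y'' = 1"
    using raise[OF xy] e by auto
   have "y'' = Ltr 1 & x'' = Phi | y'' = Phi & x'' = Ltr 1"
    using hw_cases[OF h(1-3)] h(5) 3 by (auto simp: eh_def of_bool_def split: if_splits)
   then show ?thesis using h G\<phi> G1\<phi> by auto
  qed
  have le1': "G x' y' = 0" if xy: "x'\<in>letters ty n" "y'\<in>letters ty n" and "eh ty n x' y' = 2" "hw_pair ty n x' y'" for x' y'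
  proof (cases "y' = Phi")
   case True
   then have "x' = Phi" using hw_cases[OF that(4) xy] that(3) by (auto simp: eh_def)
   then have "G x' y' = G Phi (Bar 1)" using zero_right(1)[OF a(2) B(2) B(2)] True by simp
   then show ?thesis using le1[OF B(2,1)] by (simp add: eh_def)
  next
   case False
   then have y: "y' = Ltr 1" using hw_cases[OF that(4) xy] by auto
   then have "x' ~= Phi" "x' ~= Ltr 1" using that(3) 3 by (auto simp: eh_def descent_def)
   then have "le ty n 0 x' = 0" using 3 n_pos by (cases x') auto
   then have "G x' y' = G x' Phi" using zero_right(1)[OF a(1) xy(1) Ltr_1] y by simp
   then show ?thesis using le1[OF xy(1) B(2)] \<open>x' ~= Phi\<close> by (simp add: eh_def)
  qed
  obtain x' y' where h: "hw_pair ty n x' y'" "x'\<in>letters ty n" "y'\<in>letters ty n" "G x' y' = G x y"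
   using raise[OF assms] by auto
  have "eh ty n x' y' = 0 | eh ty n x' y' = 1 | eh ty n x' y' = 2" by (auto simp: eh_def)
  then show ?thesis using eh_0[OF h(2,3)] le1[OF h(2,3)] le1'[OF h(2,3) _ h(1)] h(4) by auto
 qed
qed

end

theorem local_energy_eq:
 assumes ne: "nonexceptional ty n" and xy: "x\<in>letters ty n" "y\<in>letters ty n"
 shows "local_energy ty n (x, y) = - eh ty n x y"
proof -
 let ?H = "restrict (%(x, y). - eh ty n x y) (letters ty n \<times> letters ty n)"
 have L1: "Ltr 1\<in>letters ty n" using Ltr_1_letter[OF ne] .
 have w: "w\<in>letters ty n" if "(w, i, x)\<in>arrows ty n" for w i x
  using src_letters[OF ne] that arrow_src[OF ne] by auto
 have H: "is_local_energy ty n ?H"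
  unfolding is_local_energy_iff[OF ne]
  using eh_left[OF ne] eh_right[OF ne] w L1 by (simp add: eh_def descent_def)
 have "H' = ?H" if H': "is_local_energy ty n H'" for H'
 proof -
  let ?G = "%x y. H' (x, y) + eh ty n x y"
  note h = H'[unfolded is_local_energy_iff[OF ne]]
  have "?G x y = 0" if xy: "x\<in>letters ty n" "y\<in>letters ty n" for x y
  proof (rule G_zero[OF ne, where G = ?G])
   show "?G (Ltr 1) (Ltr 1) = 0" using h by (simp add: eh_def descent_def)
   show "?G w y = ?G x y" if "i<=n" "(w, i, x)\<in>arrows ty n" "x\<in>letters ty n" "y\<in>letters ty n"
    "le ty n i x > lp ty n i y" for i w x y
    using h that eh_left[OF ne that(2,4,5)] by auto
   show "?G y w = ?G y x" if "i<=n" "(w, i, x)\<in>arrows ty n" "x\<in>letters ty n" "y\<in>letters ty n"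
    "le ty n i y<=lp ty n i x" for i w x y
    using h that eh_right[OF ne that(2,4,5)] by auto
  qed (use xy in auto)
  then have "H' (x, y) = - eh ty n x y" if "x\<in>letters ty n" "y\<in>letters ty n" for x y
   using that by (simp add: eq_neg_iff_add_eq_0)
  then show ?thesis using h by (intro extensionalityI[of _ "letters ty n \<times> letters ty n"]) auto
 qed
 then have "local_energy ty n = ?H" unfolding local_energy_def using H by blast
 then show ?thesis using xy by simp
qed

section \<open>The energy of a path\<close>

text \<open>The increment of \<open>D_bar\<close> when a letter is added to a path.\<close>
fun ehs :: "aff_type => nat => letter list => int" where
 "ehs ty n [] = 0"
| "ehs ty n [x] = of_bool (x = Phi)"
| "ehs ty n (x # y # b) = eh ty n x y + ehs ty n (y # b)"

primrec hsum :: "(letter \<times> letter => int) => letter => letter list => int" where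
 "hsum H z [] = 0"
| "hsum H z (x # b) = H (x, if b = [] then z else hd b) + hsum H z b"

lemma hsum_nth:
 "b ~= [] ==> hsum H z b = H (last b, z) + (\<Sum>j=1..length b - 1. H (b ! (length b - (j + 1)), b ! (length b - j)))"
proof (induction b)
 case (Cons x b)
 show ?case
 proof (cases b)
  case Nil
  then show ?thesis by simp
 next
  case (Cons y b')
  then obtain l where l: "length b = Suc l" by simp
  have "(\<Sum>j=1..Suc l. H ((x # b) ! (Suc (Suc l) - (j + 1)), (x # b) ! (Suc (Suc l) - j)))
    = (\<Sum>j=1..l. H ((x # b) ! (Suc (Suc l) - (j + 1)), (x # b) ! (Suc (Suc l) - j))) + H (x, b ! 0)"
   by simp
  also have "(\<Sum>j=1..l. H ((x # b) ! (Suc (Suc l) - (j + 1)), (x # b) ! (Suc (Suc l) - j)))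
    = (\<Sum>j=1..l. H (b ! (Suc l - (j + 1)), b ! (Suc l - j)))"
   by (intro sum.cong) (auto simp: nth_Cons' Suc_diff_le)
  finally show ?thesis using Cons.IH Cons l by (simp add: hd_conv_nth)
 qed
qed simp

lemma sum_weight_Suc:
 fixes f :: "nat => int"
 shows "(\<Sum>j=1..l. int (Suc l - j) * f j) = (\<Sum>j=1..l. int (l - j) * f j) + (\<Sum>j=1..l. f j)"
 unfolding sum.distrib[symmetric] by (intro sum.cong) (auto simp: Suc_diff_le algebra_simps)

text \<open>All weights in the energy grow by one when a letter is added on the left, so the
  increment is an unweighted sum over neighbouring letters.\<close>

lemma energy_Cons:
 "energy ty n (x # b) = energy ty n b + hsum (local_energy ty n) (b_natural ty n) (x # b)"
proof -
 let ?H = "local_energy ty n" and ?l = "length b"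
 let ?f = "%j. ?H ((x # b) ! (Suc ?l - (j + 1)), (x # b) ! (Suc ?l - j))"
 let ?g = "%j. ?H (b ! (?l - (j + 1)), b ! (?l - j))"
 have last: "(x # b) ! (Suc ?l - 1) = last (x # b)" by (simp add: last_conv_nth nth_Cons')
 have 1: "energy ty n (x # b) = int (Suc ?l) * ?H (last (x # b), b_natural ty n)
   + (\<Sum>j=1..?l. int (Suc ?l - j) * ?f j)"
  unfolding energy_def Let_def using last by simp
 show ?thesis
 proof (cases "b = []")
  case True
  then show ?thesis using 1 by (simp add: energy_def)
 next
  case False
  have 2: "energy ty n b = int ?l * ?H (last b, b_natural ty n) + (\<Sum>j=1..?l - 1. int (?l - j) * ?g j)"
   unfolding energy_def Let_def using False by (simp add: last_conv_nth)
  have 3: "hsum ?H (b_natural ty n) (x # b) = ?H (last (x # b), b_natural ty n) + (\<Sum>j=1..?l. ?f j)"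
   using hsum_nth[of "x # b" ?H "b_natural ty n"] by simp
  have "(\<Sum>j=1..?l - 1. int (?l - j) * ?g j) = (\<Sum>j=1..?l - 1. int (?l - j) * ?f j)"
   by (intro sum.cong) (auto simp: nth_Cons' Suc_diff_le)
  also have "... = (\<Sum>j=1..?l. int (?l - j) * ?f j)"
   by (intro sum.mono_neutral_left) auto
  finally have 4: "energy ty n b = int ?l * ?H (last b, b_natural ty n) + (\<Sum>j=1..?l. int (?l - j) * ?f j)"
   using 2 by simp
  show ?thesis using False unfolding 1 3 4 sum_weight_Suc by (simp add: algebra_simps)
 qed
qed

text \<open>In a path that ends in 1 the boundary term is the one of the reference path and cancels.
  The value of \<open>b_natural\<close> is asked for when the last letter is phi.\<close>

lemma b_natural_Phi:
 assumes "ty\<in>{A2_even, D2}" "nonexceptional ty n"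
 shows "b_natural ty n = Phi"
proof -
 have "varphi (B11 ty n) i b = lp ty n i b" for i b using strings_length[OF strings_B11[OF assms(2)]] by simp
 moreover have "b = Phi" if "b\<in>letters ty n" "lp ty n 0 b = 1" for b
  using that assms rank_pos[OF assms(2)] by (cases b) (auto split: if_splits)
 moreover have "Phi\<in>letters ty n" "lp ty n i Phi = (if i = 0 then 1 else 0)" for i
  using assms by (auto simp: letters_simps)
 ultimately show ?thesis unfolding b_natural_def by (intro the_equality) (auto simp: B11_def)
qed

lemma last_path:
 assumes "nonexceptional ty n" "b\<in>paths ty n lam L" "b ~= []"
 shows "last b = Ltr 1 | (last b = Phi & ty\<in>{A2_even, D2})"
 using assms(2,3)
proof (induction b arbitrary: lam L)
 case (Cons x b)
 obtain L' where L: "L = Suc L'" using Cons.prems(1) by (cases L) (auto simp: paths_def elts_tensor_power)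
 note p = Cons.prems(1)[unfolded L paths_Cons[OF assms(1)]]
 show ?case
 proof (cases "b = []")
  case True
  then have "(%k. lam k - letter_wt x k) = (%_. 0)" using p by (auto simp: paths_elen[OF assms(1)])
  moreover have "pr ty n i (%_. 0) = 0" for i by (simp add: pr_def)
  ultimately have "\<forall>i\<in>{1..n}. le ty n i x = 0" using p by simp
  then have "x = Ltr 1 | x = Phi" using le_0_letter[OF assms(1)] p by blast
  then show ?thesis using True p by (auto simp: letters_simps)
 next
  case False
  have "b\<in>paths ty n (%k. lam k - letter_wt x k) L'" using p by blast
  from Cons.IH[OF this False] False show ?thesis by simp
 qed
qed simp

text \<open>For the last letter phi the boundary terms differ by 2 - 1, the values of
  \<open>eh\<close> at phi, phi and at 1, phi. This is the value of \<open>ehs\<close> on a single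
  phi.\<close>

lemma hsum_path:
 assumes ne: "nonexceptional ty n" and "set b \<subseteq> letters ty n" "b ~= []"
  and "last b = Ltr 1 | (last b = Phi & ty\<in>{A2_even, D2})"
 shows "hsum (local_energy ty n) (b_natural ty n) b = local_energy ty n (Ltr 1, b_natural ty n) - ehs ty n b"
 using assms(2-)
proof (induction b)
 case (Cons x b)
 show ?case
 proof (cases b)
  case Nil
  show ?thesis
  proof (cases "x = Ltr 1")
   case False
   then have x: "x = Phi" "ty\<in>{A2_even, D2}" using Cons.prems Nil by auto
   have l: "Phi\<in>letters ty n" "Ltr 1\<in>letters ty n" using x Ltr_1_letter[OF ne] by (auto simp: letters_simps)
   show ?thesis using Nil x local_energy_eq[OF ne l(1,1)] local_energy_eq[OF ne l(2,1)]
    by (simp add: b_natural_Phi[OF x(2) ne] eh_def)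
  qed (use Nil in simp)
 next
  case (Cons y b')
  then show ?thesis using Cons.IH Cons.prems local_energy_eq[OF ne, of x y] by simp
 qed
qed simp

lemma hsum_replicate:
 assumes "nonexceptional ty n" "L>=1"
 shows "hsum (local_energy ty n) (b_natural ty n) (replicate L (Ltr 1)) = local_energy ty n (Ltr 1, b_natural ty n)"
 using assms(2)
proof (induction L rule: dec_induct)
 case (step L)
 then obtain L' where L: "L = Suc L'" by (cases L) auto
 have "local_energy ty n (Ltr 1, Ltr 1) = 0"
  using local_energy_eq[OF assms(1) Ltr_1_letter[OF assms(1)] Ltr_1_letter[OF assms(1)]] by (simp add: eh_def descent_def)
 then show ?case using step L by simp
qed simp

lemma D_bar_Nil: "D_bar ty n [] = 0"
 by (simp add: D_bar_def D_energy_def)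

lemma D_bar_Cons:
 assumes ne: "nonexceptional ty n" and b: "x # b\<in>paths ty n lam L"
 shows "D_bar ty n (x # b) = D_bar ty n b + ehs ty n (x # b)"
proof -
 have "set (x # b) \<subseteq> letters ty n" using b by (simp add: paths_elen[OF ne])
 then show ?thesis
  using hsum_path[OF ne _ _ last_path[OF ne b]] hsum_replicate[OF ne, of "Suc (length b)"]
  unfolding D_bar_def D_energy_def energy_Cons length_Cons replicate_Suc by simp
qed

section \<open>From rigged configurations to paths\<close>

definition sub_wt :: "(nat => int) => letter => nat => int" where
 "sub_wt lam x = (%k. lam k - letter_wt x k)"

definition hw_step :: "aff_type => nat => letter => (nat => int) => bool" where
 "hw_step ty n x mu \<longleftrightarrow> (\<forall>i\<in>{1..n}. int (le ty n i x)<=pr ty n i mu)"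

fun lw :: "letter => nat => int" where
 "lw (Ltr k) a = of_bool (1<=k & k<=a)"
| "lw (Bar k) a = - of_bool (1<=k & k<=a)"
| "lw Zero a = 0"
| "lw Phi a = 0"

lemma partial_wt_sub_wt: "partial_wt (sub_wt lam x) a = partial_wt lam a - lw x a"
proof -
 have "(\<Sum>i=1..a. letter_wt x i) = lw x a"
  by (cases x) (auto simp: eps_def sum_negf)
 then show ?thesis by (simp add: partial_wt_def sub_wt_def sum_subtractf)
qed

lemma pr_sub_wt:
 assumes "nonexceptional ty n" "i\<in>{1..n}" "x\<in>letters ty n"
 shows "pr ty n i lam = pr ty n i (sub_wt lam x) + int (lp ty n i x) - int (le ty n i x)"
 using pr_add[of ty n i "sub_wt lam x" "letter_wt x"] pr_letter[OF assms] by (simp add: sub_wt_def)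

text \<open>For letters other than 0, one of \<epsilon> and \<phi> vanishes in each classical
  colour, so the condition reduces to nonnegative pairings before and after. The letter 0 has both
  equal to 1 in colour \<open>n\<close>, which leads to \<open>1 <= lam n\<close>.\<close>

lemma hw_stepI:
 assumes ne: "nonexceptional ty n" and x: "x\<in>letters ty n"
  and "!!i. i\<in>{1..n} ==> 0<=pr ty n i lam" "!!i. i\<in>{1..n} ==> 0<=pr ty n i (sub_wt lam x)"
  and "x = Zero ==> 1<=lam n"
 shows "hw_step ty n x (sub_wt lam x)"
 unfolding hw_step_def
proof
 fix i assume i: "i\<in>{1..n}"
 show "int (le ty n i x)<=pr ty n i (sub_wt lam x)"
 proof (cases "x = Zero")
  case True
  then show ?thesis using assms(4)[OF i] assms(5) x i by (auto simp: pr_def sub_wt_def letters_simps)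
 next
  case False
  then have "le ty n i x = 0 | lp ty n i x = 0" using i x ne by (cases x) (auto simp: letters_simps nonexceptional_def)
  then show ?thesis using pr_sub_wt[OF ne i x, of lam] assms(3,4)[OF i] by auto
 qed
qed

lemma hw_stepD:
 assumes ne: "nonexceptional ty n" and x: "x\<in>letters ty n" and h: "hw_step ty n x (sub_wt lam x)"
 shows "i\<in>{1..n} ==> 0<=pr ty n i lam" "x = Zero ==> 1<=lam n"
proof -
 show "0<=pr ty n i lam" if "i\<in>{1..n}"
 proof -
  have "int (le ty n i x)<=pr ty n i (sub_wt lam x)" using h that unfolding hw_step_def by blast
  then show ?thesis using pr_sub_wt[OF ne that x, of lam] by simp
 qed
 show "1<=lam n" if "x = Zero"
 proof -
  have "n\<in>{1..n}" using rank_pos[OF ne] by simp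
  then have "int (le ty n n x)<=pr ty n n (sub_wt lam x)" using h unfolding hw_step_def by blast
  then show ?thesis using x that by (auto simp: letters_simps pr_def sub_wt_def split: if_splits)
 qed
qed

text \<open>The coordinates decrease from \<open>lam 1 <= 0\<close>. A lower bound comes from the
  last pairing, or in type \<open>A1\<close> from the vanishing total, and squeezes them to
  zero.\<close>

lemma dominant_zero:
 assumes ne: "nonexceptional ty n" and lam: "lam\<in>weights ty n"
  and pr: "!!i. i\<in>{1..n} ==> 0<=pr ty n i lam" and "lam 1<=0"
  and A1: "ty = A1 ==> partial_wt lam (n + 1) = 0"
 shows "lam = (%_. 0)"
proof -
 define m where "m = wt_dim ty n"
 have n: "n>=1" using rank_pos[OF ne] .
 have step: "lam (Suc i)<=lam i" if "1<=i" "i < m" for i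
  using pr[of i] that by (auto simp: pr_def m_def wt_dim_def split: if_splits)
 have desc: "lam j<=lam i" if "1<=i" "i<=j" "j<=m" for i j
  using that(2,3)
 proof (induction j rule: dec_induct)
  case (step j)
  then show ?case using \<open>!!i. 1<=i ==> i < m ==> lam (Suc i)<=lam i\<close>[of j] that(1) by simp
 qed simp
 have le0: "lam i<=0" if "1<=i" "i<=m" for i using desc[of 1 i] that assms(4) by simp
 have z: "lam i = 0" if i: "1<=i" "i<=m" for i
 proof (cases "ty = A1")
  case True
  then have "(\<Sum>i=1..m. - lam i) = 0" using A1 by (simp add: partial_wt_def m_def wt_dim_def sum_negf)
  moreover have "\<forall>i\<in>{1..m}. 0 <= - lam i" using le0 by simp
  ultimately have "\<forall>i\<in>{1..m}. - lam i = 0" using sum_nonneg_eq_0_iff[of "{1..m}" "%i. - lam i"] by blast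
  then show ?thesis using i by simp
 next
  case False
  then have m: "m = n" by (simp add: m_def wt_dim_def)
  have "0<=pr ty n n lam" using pr n by simp
  moreover have "lam (n - 1)<=0" if "ty = D1" using le0[of "n - 1"] that ne m by (auto simp: nonexceptional_def)
  ultimately have "lam n>=0"
   using False le0[of n] n m ne[unfolded nonexceptional_def] by (cases "ty = D1") (auto simp: pr_def split: if_splits)
  then show ?thesis using desc[of i n] le0[of i] i m by simp
 qed
 show ?thesis
 proof
  fix i show "lam i = 0"
   using z[of i] lam by (cases "i\<in>{1..m}") (auto simp: weights_def m_def)
 qed
qed

text \<open>One induction on the number of letters for all types. \<open>K\<close> stands for the
  rigged configurations, \<open>D\<close> removes a letter in the manner of
  \<open>paths_Cons\<close>, and \<open>cnt\<close> has to satisfy the recursion of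
  \<open>ehs\<close>. The predicate \<open>Bd\<close> contains the bound on the sizes that keeps all
  parts shorter than the fixed \<open>T\<close>.\<close>

locale path_system =
 fixes ty :: aff_type and n :: nat
  and K :: "nat => (nat => int) => riggings set" and D :: "riggings => letter \<times> riggings"
  and Bd :: "nat => (nat => int) => bool" and stat cnt :: "riggings => int" and c :: int
 assumes ne: "nonexceptional ty n"
  and K_0: "!!lam J. Bd 0 lam ==> J\<in>K 0 lam \<longleftrightarrow> lam = (%_. 0) & J = (%_ _. {#})"
  and stat_0: "stat (%_ _. {#}) = 0"
  and Bd_step: "!!L lam x. Bd (Suc L) lam ==> x\<in>letters ty n ==> Bd L (sub_wt lam x)"
  and forward: "!!L lam J. Bd (Suc L) lam ==> J\<in>K (Suc L) lam ==>
   \<exists>x J'. D J = (x, J') & x\<in>letters ty n & J'\<in>K L (sub_wt lam x) & hw_step ty n x (sub_wt lam x)"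
  and backward: "!!L lam x J'. Bd (Suc L) lam ==> x\<in>letters ty n ==> J'\<in>K L (sub_wt lam x) ==>
   hw_step ty n x (sub_wt lam x) ==> \<exists>J\<in>K (Suc L) lam. D J = (x, J')"
  and inj: "!!L lam. Bd (Suc L) lam ==> inj_on D (K (Suc L) lam)"
  and stat_step: "!!L lam J x J'. Bd (Suc L) lam ==> J\<in>K (Suc L) lam ==> D J = (x, J') ==> stat J = stat J' + c * cnt J"
  and cnt_1: "!!lam J x J'. Bd 1 lam ==> J\<in>K 1 lam ==> D J = (x, J') ==> cnt J = of_bool (x = Phi)"
  and cnt_2: "!!L lam J x J' y J''. Bd (Suc (Suc L)) lam ==> J\<in>K (Suc (Suc L)) lam ==> D J = (x, J') ==> D J' = (y, J'')
   ==> cnt J = eh ty n x y + cnt J'"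
begin

primrec path :: "nat => riggings => letter list" where
 "path 0 J = []"
| "path (Suc L) J = fst (D J) # path L (snd (D J))"

theorem path_bij:
 assumes "Bd L lam"
 shows "bij_betw (path L) (K L lam) (paths ty n lam L)"
  and "J\<in>K L lam ==> stat J = c * D_bar ty n (path L J) & (L > 0 --> cnt J = ehs ty n (path L J))"
proof -
 have "bij_betw (path L) (K L lam) (paths ty n lam L) &
  (\<forall>J\<in>K L lam. stat J = c * D_bar ty n (path L J) & (L > 0 --> cnt J = ehs ty n (path L J)))"
  using assms
 proof (induction L arbitrary: lam)
  case 0
  have "K 0 lam = (if lam = (%_. 0) then {%_ _. {#}} else {})" using K_0[OF 0] by auto
  then show ?case by (auto simp: paths_0 bij_betw_def stat_0 D_bar_Nil)
 next
  case (Suc L)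
  have IH: "bij_betw (path L) (K L (sub_wt lam x)) (paths ty n (sub_wt lam x) L)"
    "J\<in>K L (sub_wt lam x) ==> stat J = c * D_bar ty n (path L J) & (L > 0 --> cnt J = ehs ty n (path L J))"
   if "x\<in>letters ty n" for x J
   using Suc.IH[OF Bd_step[OF Suc.prems that]] by auto
  have PC: "x # b\<in>paths ty n lam (Suc L) \<longleftrightarrow> x\<in>letters ty n & b\<in>paths ty n (sub_wt lam x) L & hw_step ty n x (sub_wt lam x)" for x b
   unfolding paths_Cons[OF ne] hw_step_def sub_wt_def ..
  have F: "\<exists>x J'. D J = (x, J') & x\<in>letters ty n & J'\<in>K L (sub_wt lam x) & path L J'\<in>paths ty n (sub_wt lam x) L
    & path (Suc L) J = x # path L J' & path (Suc L) J\<in>paths ty n lam (Suc L)" if J: "J\<in>K (Suc L) lam" for J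
  proof -
   obtain x J' where x: "D J = (x, J')" "x\<in>letters ty n" "J'\<in>K L (sub_wt lam x)" "hw_step ty n x (sub_wt lam x)"
    using forward[OF Suc.prems J] by blast
   moreover have "path L J'\<in>paths ty n (sub_wt lam x) L" using IH(1)[OF x(2)] x(3) by (auto simp: bij_betw_def)
   ultimately show ?thesis using PC by auto
  qed
  have "inj_on (path (Suc L)) (K (Suc L) lam)"
  proof (rule inj_onI)
   fix J1 J2 assume J: "J1\<in>K (Suc L) lam" "J2\<in>K (Suc L) lam" and eq: "path (Suc L) J1 = path (Suc L) J2"
   obtain x1 K1 where 1: "D J1 = (x1, K1)" "x1\<in>letters ty n" "K1\<in>K L (sub_wt lam x1)" using F[OF J(1)] by blast
   obtain x2 K2 where 2: "D J2 = (x2, K2)" "K2\<in>K L (sub_wt lam x2)" using F[OF J(2)] by blast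
   have "x1 = x2" "path L K1 = path L K2" using eq 1 2 by auto
   then have "K1 = K2" using IH(1)[OF 1(2)] 1 2 by (auto simp: bij_betw_def dest: inj_onD)
   then show "J1 = J2" using \<open>x1 = x2\<close> 1 2 inj_onD[OF inj[OF Suc.prems] _ J] by simp
  qed
  moreover have "path (Suc L) ` K (Suc L) lam = paths ty n lam (Suc L)"
  proof
   show "path (Suc L) ` K (Suc L) lam \<subseteq> paths ty n lam (Suc L)" using F by blast
   show "paths ty n lam (Suc L) \<subseteq> path (Suc L) ` K (Suc L) lam"
   proof
    fix b assume b: "b\<in>paths ty n lam (Suc L)"
    then obtain x b' where xb: "b = x # b'" using paths_Suc_nonempty by (cases b) auto
    then have p: "x\<in>letters ty n" "b'\<in>paths ty n (sub_wt lam x) L" "hw_step ty n x (sub_wt lam x)" using b PC by auto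
    have "b'\<in>path L ` K L (sub_wt lam x)" using IH(1)[OF p(1)] p(2) unfolding bij_betw_def by simp
    then obtain J' where J': "J'\<in>K L (sub_wt lam x)" "path L J' = b'" by blast
    obtain J where "J\<in>K (Suc L) lam" "D J = (x, J')" using backward[OF Suc.prems p(1) J'(1) p(3)] by blast
    then show "b\<in>path (Suc L) ` K (Suc L) lam" using J' xb by (intro image_eqI[of _ _ J]) auto
   qed
  qed
  moreover have "stat J = c * D_bar ty n (path (Suc L) J) & cnt J = ehs ty n (path (Suc L) J)" if J: "J\<in>K (Suc L) lam" for J
  proof -
   obtain x J' where x: "D J = (x, J')" "x\<in>letters ty n" "J'\<in>K L (sub_wt lam x)"
    "path (Suc L) J = x # path L J'" "path (Suc L) J\<in>paths ty n lam (Suc L)" using F[OF J] by blast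
   have "cnt J = ehs ty n (x # path L J')"
   proof (cases L)
    case 0
    then show ?thesis using cnt_1 J x Suc.prems by simp
   next
    case (Suc M)
    obtain y J'' where y: "D J' = (y, J'')" by (cases "D J'")
    then show ?thesis
     using cnt_2[of M lam J x J' y J''] J x Suc.prems Suc IH(2)[OF x(2,3)] by simp
   qed
   then show ?thesis
    using stat_step[OF Suc.prems J x(1)] IH(2)[OF x(2,3)] D_bar_Cons[OF ne x(5)[unfolded x(4)]] x(4)
    by (simp add: algebra_simps)
  qed
  ultimately show ?case by (auto simp: bij_betw_def simp del: path.simps)
 qed
 then show "bij_betw (path L) (K L lam) (paths ty n lam L)"
  "J\<in>K L lam ==> stat J = c * D_bar ty n (path L J) & (L > 0 --> cnt J = ehs ty n (path L J))" by auto
qed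

theorem Xbar_eq:
 assumes "Bd L lam"
 shows "c ~= 0 ==> Xbar ty n lam L = (\<Sum>J\<in>K L lam. qpow (of_int (stat J) / of_int c))"
proof -
 assume c: "c ~= 0"
 have "Xbar ty n lam L = (\<Sum>J\<in>K L lam. qpow (of_int (D_bar ty n (path L J))))"
  unfolding Xbar_def by (rule sum.reindex_bij_betw[OF path_bij(1)[OF assms], symmetric])
 also have "... = (\<Sum>J\<in>K L lam. qpow (of_int (stat J) / of_int c))"
  using path_bij(2)[OF assms] c by (intro sum.cong) auto
 finally show ?thesis .
qed

end

text \<open>The form in which the walkers deliver these data: a letter is known through its final
  positions \<open>enc x\<close>, and the highest weight condition is split into nonnegative
  pairings and the condition on the letter 0, to be joined by \<open>hw_stepI\<close> and
  \<open>hw_stepD\<close>.\<close>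

locale letter_walks =
 fixes ty :: aff_type and n :: nat and enc :: "letter => 'e"
  and K :: "nat => (nat => int) => riggings set" and M :: "riggings => 'e \<times> riggings"
  and Bd :: "nat => (nat => int) => bool" and stat cnt :: "riggings => int" and c :: int
 assumes ne: "nonexceptional ty n" and enc_inj: "inj_on enc (letters ty n)"
  and K_empty: "(%_ _. {#})\<in>K 0 (%_. 0)" "!!J. J\<in>K 0 (%_. 0) ==> J = (%_ _. {#})"
  and K_le: "!!lam J. Bd 0 lam ==> J\<in>K 0 lam ==>
   lam\<in>weights ty n & lam 1<=0 & (ty = A1 --> partial_wt lam (n + 1) = 0)"
  and stat_0: "stat (%_ _. {#}) = 0"
  and Bd_step: "!!L lam x. Bd (Suc L) lam ==> x\<in>letters ty n ==> Bd L (sub_wt lam x)"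
  and K_pr: "!!L lam J i. J\<in>K L lam ==> i\<in>{1..n} ==> 0<=pr ty n i lam"
  and fwd: "!!L lam J. Bd (Suc L) lam ==> J\<in>K (Suc L) lam ==>
   \<exists>x\<in>letters ty n. \<exists>J'\<in>K L (sub_wt lam x). M J = (enc x, J') & (x = Zero --> 1<=lam n)"
  and bwd: "!!L lam x J'. Bd (Suc L) lam ==> x\<in>letters ty n ==> J'\<in>K L (sub_wt lam x) ==>
   (\<forall>i\<in>{1..n}. 0<=pr ty n i lam) ==> (x = Zero --> 1<=lam n) ==> \<exists>J\<in>K (Suc L) lam. M J = (enc x, J')"
  and inj: "!!L lam. Bd (Suc L) lam ==> inj_on M (K (Suc L) lam)"
  and stat_step: "!!L lam J x J'. Bd (Suc L) lam ==> J\<in>K (Suc L) lam ==> x\<in>letters ty n ==> M J = (enc x, J')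
   ==> stat J = stat J' + c * cnt J"
  and cnt_1: "!!lam J x. Bd 1 lam ==> J\<in>K 1 lam ==> x\<in>letters ty n ==> x = Ltr 1 | x = Phi ==>
   M J = (enc x, %_ _. {#}) ==> cnt J = of_bool (x = Phi)"
  and cnt_2: "!!L lam J x J' y J''. Bd (Suc (Suc L)) lam ==> J\<in>K (Suc (Suc L)) lam ==> J'\<in>K (Suc L) (sub_wt lam x) ==>
   x\<in>letters ty n ==> y\<in>letters ty n ==> M J = (enc x, J') ==> M J' = (enc y, J'')
   ==> cnt J = eh ty n x y + cnt J'"
begin

lemma K_0:
 assumes "Bd 0 lam"
 shows "J\<in>K 0 lam \<longleftrightarrow> lam = (%_. 0) & J = (%_ _. {#})"
proof
 assume J: "J\<in>K 0 lam"
 have "lam = (%_. 0)" using K_le[OF assms J] by (intro dominant_zero[OF ne _ K_pr[OF J]]) auto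
 then show "lam = (%_. 0) & J = (%_ _. {#})" using J K_empty(2) by simp
qed (use K_empty(1) in simp)

definition DM :: "riggings => letter \<times> riggings" where
 "DM J = (THE x. x\<in>letters ty n & enc x = fst (M J), snd (M J))"

lemma DM_eq: "x\<in>letters ty n ==> M J = (enc x, J') ==> DM J = (x, J')"
 using enc_inj by (auto simp: DM_def inj_on_def intro!: the_equality)

lemma fwd_DM:
 assumes "Bd (Suc L) lam" "J\<in>K (Suc L) lam"
 obtains x J' where "x\<in>letters ty n" "J'\<in>K L (sub_wt lam x)" "M J = (enc x, J')" "DM J = (x, J')"
  "hw_step ty n x (sub_wt lam x)"
proof -
 obtain x J' where x: "x\<in>letters ty n" "J'\<in>K L (sub_wt lam x)" "M J = (enc x, J')" "x = Zero --> 1<=lam n"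
  using fwd[OF assms] by blast
 have "hw_step ty n x (sub_wt lam x)"
  using hw_stepI[OF ne x(1) K_pr[OF assms(2)] K_pr[OF x(2)]] x(4) by blast
 then show ?thesis using that x DM_eq by blast
qed

sublocale path_system ty n K DM Bd stat cnt c
proof
 show "nonexceptional ty n" by (rule ne)
 show "J\<in>K 0 lam \<longleftrightarrow> lam = (%_. 0) & J = (%_ _. {#})" if "Bd 0 lam" for lam J using K_0 that .
 show "stat (%_ _. {#}) = 0" by (rule stat_0)
 show "Bd L (sub_wt lam x)" if "Bd (Suc L) lam" "x\<in>letters ty n" for L lam x using Bd_step that .
 show "\<exists>x J'. DM J = (x, J') & x\<in>letters ty n & J'\<in>K L (sub_wt lam x) & hw_step ty n x (sub_wt lam x)"
  if "Bd (Suc L) lam" "J\<in>K (Suc L) lam" for L lam J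
  using fwd_DM[OF that] by blast
 show "\<exists>J\<in>K (Suc L) lam. DM J = (x, J')"
  if B: "Bd (Suc L) lam" and x: "x\<in>letters ty n" and J': "J'\<in>K L (sub_wt lam x)"
   and hw: "hw_step ty n x (sub_wt lam x)" for L lam x J'
  using bwd[OF B x J'] hw_stepD[OF ne x hw] DM_eq[OF x] by blast
 show "inj_on DM (K (Suc L) lam)" if B: "Bd (Suc L) lam" for L lam
 proof (rule inj_onI)
  fix J1 J2 assume J: "J1\<in>K (Suc L) lam" "J2\<in>K (Suc L) lam" and eq: "DM J1 = DM J2"
  then have "M J1 = M J2" using fwd_DM[OF B J(1)] fwd_DM[OF B J(2)] by (metis prod.inject)
  then show "J1 = J2" using inj_onD[OF inj[OF B] _ J] by blast
 qed
 show "stat J = stat J' + c * cnt J" if B: "Bd (Suc L) lam" and J: "J\<in>K (Suc L) lam" and D: "DM J = (x, J')" for L lam J x J'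
  using fwd_DM[OF B J] stat_step[OF B J] D by (metis prod.inject)
 show "cnt J = of_bool (x = Phi)" if B: "Bd 1 lam" and J: "J\<in>K 1 lam" and D: "DM J = (x, J')" for lam J x J'
 proof -
  have B': "Bd (Suc 0) lam" and J1: "J\<in>K (Suc 0) lam" using B J by auto
  obtain x' J2 where "x'\<in>letters ty n" "J2\<in>K 0 (sub_wt lam x')" "M J = (enc x', J2)" "DM J = (x', J2)"
   "hw_step ty n x' (sub_wt lam x')"
   using fwd_DM[OF B' J1] by blast
  then have x: "x\<in>letters ty n" "J'\<in>K 0 (sub_wt lam x)" "M J = (enc x, J')" "hw_step ty n x (sub_wt lam x)" using D by auto
  then have 0: "sub_wt lam x = (%_. 0)" "J' = (%_ _. {#})" using K_0[OF Bd_step[OF B' x(1)]] by auto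
  have "pr ty n i (%_. 0) = 0" for i by (simp add: pr_def)
  then have "\<forall>i\<in>{1..n}. le ty n i x = 0" using x(4) 0(1) by (simp add: hw_step_def)
  then show ?thesis using cnt_1[OF B J x(1) le_0_letter[OF ne x(1)]] x(3) 0(2) by simp
 qed
 show "cnt J = eh ty n x y + cnt J'" if B: "Bd (Suc (Suc L)) lam" and J: "J\<in>K (Suc (Suc L)) lam"
  and D: "DM J = (x, J')" "DM J' = (y, J'')" for L lam J x J' y J''
 proof -
  obtain x' J1 where "x'\<in>letters ty n" "J1\<in>K (Suc L) (sub_wt lam x')" "M J = (enc x', J1)" "DM J = (x', J1)"
   using fwd_DM[OF B J] by blast
  then have x: "x\<in>letters ty n" "J'\<in>K (Suc L) (sub_wt lam x)" "M J = (enc x, J')" using D by auto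
  obtain y' J2 where "y'\<in>letters ty n" "M J' = (enc y', J2)" "DM J' = (y', J2)"
   using fwd_DM[OF Bd_step[OF B x(1)] x(2)] by blast
  then have y: "y\<in>letters ty n" "M J' = (enc y, J'')" using D by auto
  show ?thesis by (rule cnt_2[OF B J x(2,1) y(1) x(3) y(2)])
 qed
qed

end

section \<open>Types with a single walker\<close>

context rc
begin

lemma RC_cong: "(!!a. a\<in>C ==> N a = N' a) ==> RC Z N = RC Z N'"
 by (simp add: RC_def)

lemma RC_N_nonneg:
 assumes "J\<in>RC Z N" "a\<in>C"
 shows "0<=N a"
proof -
 have "0<=Qn T (m_of J a) T" unfolding Qn_at_top by (intro sum_nonneg) (simp add: m_of_def)
 then show ?thesis using RC_D(2)[OF assms] by (metis of_int_0_le_iff)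
qed

lemma RC_empty:
 assumes "J\<in>RC Z N" "!!a. a\<in>C ==> N a = 0"
 shows "J = (%_ _. {#})"
proof (intro ext)
 fix a t
 note sup = RC_D(1)[OF assms(1)]
 show "J a t = {#}"
 proof (cases "a\<in>C & 1<=t & t<=T")
  case True
  then have "(\<Sum>s=1..T. int s * m_of J a s) = 0"
   using RC_D(2)[OF assms(1)] assms(2) unfolding Qn_at_top by (metis of_int_eq_0_iff)
  then have "int t * m_of J a t = 0" using True
   by (subst (asm) sum_nonneg_eq_0_iff) (auto simp: m_of_def)
  then show ?thesis using True by (simp add: m_of_def)
 next
  case False
  then show ?thesis using sup by (auto simp: supported_def)
 qed
qed

lemma RC_0:
 assumes "!!a. a\<in>C ==> N a = 0" "!!a. Z a>=0"
 shows "(%_ _. {#})\<in>RC Z N"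
 using assms by (simp add: RC_def supported_def vac_def m_of_def Qn_def)

lemma st_0: "st (%_ _. {#}) = 0" and np_0: "np (%_ _. {#}) a = 0"
 by (simp_all add: st_def np_def m_of_def)

definition Z1a :: "nat => nat => int" where
 "Z1a L a = int L * of_bool (a = a0)"

lemma Z1a_step: "(Z1a (Suc L))(a0 := Z1a (Suc L) a0 - 1) = Z1a L"
 by (auto simp: Z1a_def fun_eq_iff)

lemma Z1a_nonneg: "Z1a L a>=0" "Z1a (Suc L) a0>=1"
 by (auto simp: Z1a_def)

end

lemma sub_wt_weights: "lam\<in>weights ty n ==> x\<in>letters ty n ==> sub_wt lam x\<in>weights ty n"
 by (cases x) (auto simp: weights_def sub_wt_def letters_simps eps_def wt_dim_def split: if_splits)

text \<open>Here the letters are the elements of \<open>S\<close> themselves, through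
  \<open>vec\<close>. The assumption \<open>energy\<close> is to be supplied by
  \<open>walk_adjoint\<close> or \<open>walk_energy\<close>.\<close>

locale single_walker = rc +
 fixes ty :: aff_type and n :: nat and vec :: "letter => nat => nat"
  and N :: "nat => (nat => int) => nat => rat"
 assumes ne: "nonexceptional ty n" and C_eq: "C = {Suc 0..n}" and a0_eq: "a0 = Suc 0" and d_a0: "d a0 = 1"
  and ty: "ty\<notin>{A2_even, D2, B1, A2_dagger}"
  and vec_bij: "bij_betw vec (letters ty n) S" and vec_1: "vec (Ltr 1) = (%_. 0)"
  and N_step: "!!L lam x a. a\<in>C ==> x\<in>letters ty n ==> N L (sub_wt lam x) a = N (Suc L) lam a - of_nat (vec x a)"
  and N_dm: "!!L lam a. a\<in>C ==> (ty = A1 ==> partial_wt lam (n + 1) = int L) ==>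
   dm (Z1a L) (N L lam) a = of_int (pr ty n a lam)"
  and N_0: "N 0 lam a0 = - of_int (lam 1)" "N 0 (%_. 0) a = 0"
  and energy: "!!J u x y v. fwalk J u ==> u T = vec y ==> rwalk J (vec x) v ==> x\<in>letters ty n ==> y\<in>letters ty n ==>
   int (v 1 a0) = eh ty n x y"
begin

definition KW :: "nat => (nat => int) => riggings set" where
 "KW L lam = {J\<in>RC (Z1a L) (N L lam). ty = A1 --> partial_wt lam (n + 1) = int L}"

definition BW :: "nat => (nat => int) => bool" where
 "BW L lam \<longleftrightarrow> lam\<in>weights ty n & (\<forall>a\<in>C. N L lam a < of_nat T)"

lemma vec_in: "x\<in>letters ty n ==> vec x\<in>S" and vec_ex: "u\<in>S ==> \<exists>x\<in>letters ty n. u = vec x"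
 using vec_bij by (auto simp: bij_betw_def)

lemma KW_pr:
 assumes "J\<in>KW L lam" "i\<in>{1..n}"
 shows "0<=pr ty n i lam"
proof -
 have i: "i\<in>C" using assms(2) C_eq by simp
 have "0<=dm (Z1a L) (N L lam) i" using RC_dm[of J "Z1a L" "N L lam" i] assms(1) i by (simp add: KW_def)
 then show ?thesis using N_dm[OF i] assms(1) by (simp add: KW_def)
qed

lemma partial_wt_sub: "ty = A1 ==> x\<in>letters ty n ==>
 partial_wt (sub_wt lam x) (n + 1) = int L \<longleftrightarrow> partial_wt lam (n + 1) = int (Suc L)"
 by (auto simp: partial_wt_sub_wt letters_def)

lemma RC_step: "x\<in>letters ty n ==> RC (Z1a L) (%a. N (Suc L) lam a - of_nat (vec x a)) = RC (Z1a L) (N L (sub_wt lam x))"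
 by (rule RC_cong) (simp add: N_step)

lemma del_step:
 assumes B: "BW (Suc L) lam" and A1: "ty = A1 --> partial_wt lam (n + 1) = int (Suc L)"
  and pr: "\<forall>i\<in>{1..n}. 0<=pr ty n i lam"
 shows "bij_betw del (RC (Z1a (Suc L)) (N (Suc L) lam)) (SIGMA x:S. RC (Z1a L) (%a. N (Suc L) lam a - of_nat (x a)))"
proof (rule del_bij[of "Z1a (Suc L)", unfolded Z1a_step])
 show "0<=Z1a (Suc L) a" "1<=Z1a (Suc L) a0" for a by (rule Z1a_nonneg)+
 show "N (Suc L) lam a < of_nat T" if "a\<in>C" for a using B that by (simp add: BW_def)
 show "0<=of_int (Z1a (Suc L) a) - (\<Sum>b\<in>C. of_int (A a b) * N (Suc L) lam b)" if "a\<in>C" for a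
 proof -
  have "a\<in>{1..n}" using that C_eq by simp
  then have "0<=pr ty n a lam" using pr by blast
  then show ?thesis using N_dm[OF that, of lam "Suc L"] A1 unfolding dm_def by simp
 qed
qed

sublocale letter_walks ty n vec KW del BW st "%J. np J a0" 2
proof
 show "nonexceptional ty n" by (rule ne)
 show "inj_on vec (letters ty n)" using vec_bij by (simp add: bij_betw_def)
 show "(%_ _. {#})\<in>KW 0 (%_. 0)"
  using RC_0[of "N 0 (%_. 0)" "Z1a 0"] N_0(2) by (simp add: KW_def partial_wt_def Z1a_nonneg)
 show "J = (%_ _. {#})" if "J\<in>KW 0 (%_. 0)" for J
  by (rule RC_empty[of J "Z1a 0" "N 0 (%_. 0)"]) (use that N_0(2) in \<open>auto simp: KW_def\<close>)
 show "lam\<in>weights ty n & lam 1<=0 & (ty = A1 --> partial_wt lam (n + 1) = 0)" if "BW 0 lam" "J\<in>KW 0 lam" for lam J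
  using RC_N_nonneg[of J "Z1a 0" "N 0 lam" a0] that a0_in_C N_0(1) by (simp add: KW_def BW_def)
 show "st (%_ _. {#}) = 0" by (rule st_0)
 show "BW L (sub_wt lam x)" if B: "BW (Suc L) lam" and x: "x\<in>letters ty n" for L lam x
 proof -
  have "N L (sub_wt lam x) a < of_nat T" if a: "a\<in>C" for a
   using B a N_step[OF a x, of L lam] unfolding BW_def by (metis diff_le_eq le_add_same_cancel1 of_nat_0_le_iff order_le_less_trans)
  then show ?thesis using B x sub_wt_weights by (auto simp: BW_def)
 qed
 show "0<=pr ty n i lam" if "J\<in>KW L lam" "i\<in>{1..n}" for L lam J i using KW_pr that .
 show "\<exists>x\<in>letters ty n. \<exists>J'\<in>KW L (sub_wt lam x). del J = (vec x, J') & (x = Zero --> 1<=lam n)"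
  if B: "BW (Suc L) lam" and J: "J\<in>KW (Suc L) lam" for L lam J
 proof -
  have A1: "ty = A1 --> partial_wt lam (n + 1) = int (Suc L)" using J unfolding KW_def by blast
  have "del J\<in>(SIGMA x:S. RC (Z1a L) (%a. N (Suc L) lam a - of_nat (x a)))"
   using bij_betw_apply[OF del_step[OF B A1]] J KW_pr[OF J] by (simp add: KW_def)
  then obtain x J' where x: "x\<in>letters ty n" "del J = (vec x, J')" "J'\<in>RC (Z1a L) (%a. N (Suc L) lam a - of_nat (vec x a))"
   using vec_ex by (cases "del J") auto
  then have "J'\<in>KW L (sub_wt lam x)" using A1 RC_step[OF x(1)] partial_wt_sub[OF _ x(1)] unfolding KW_def by blast
  moreover have "x ~= Zero" using x(1) ty by (auto simp: letters_simps)
  ultimately show ?thesis using x by blast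
 qed
 show "\<exists>J\<in>KW (Suc L) lam. del J = (vec x, J')"
  if B: "BW (Suc L) lam" and x: "x\<in>letters ty n" and J': "J'\<in>KW L (sub_wt lam x)"
   and pr: "\<forall>i\<in>{1..n}. 0<=pr ty n i lam" for L lam x J'
 proof -
  have A1: "ty = A1 --> partial_wt lam (n + 1) = int (Suc L)" using J' partial_wt_sub[OF _ x] unfolding KW_def by blast
  have "(vec x, J')\<in>(SIGMA x:S. RC (Z1a L) (%a. N (Suc L) lam a - of_nat (x a)))"
   using vec_in[OF x] J' RC_step[OF x] by (simp add: KW_def)
  then have "(vec x, J')\<in>del ` RC (Z1a (Suc L)) (N (Suc L) lam)" using del_step[OF B A1 pr] unfolding bij_betw_def by simp
  then obtain J where "J\<in>RC (Z1a (Suc L)) (N (Suc L) lam)" "del J = (vec x, J')" by (metis imageE)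
  then show ?thesis using A1 by (intro bexI[of _ J]) (auto simp: KW_def)
 qed
 show "inj_on del (KW (Suc L) lam)" if B: "BW (Suc L) lam" for L lam
 proof (rule inj_onI)
  fix J J' assume J: "J\<in>KW (Suc L) lam" "J'\<in>KW (Suc L) lam" and eq: "del J = del J'"
  have A1: "ty = A1 --> partial_wt lam (n + 1) = int (Suc L)" using J unfolding KW_def by blast
  have pr: "\<forall>i\<in>{1..n}. 0<=pr ty n i lam" using KW_pr[OF J(1)] by blast
  show "J = J'"
   using bij_betw_imp_inj_on[OF del_step[OF B A1 pr]] eq J unfolding KW_def inj_on_def by blast
 qed
 show "st J = st J' + 2 * np J a0" if J: "J\<in>KW (Suc L) lam" and D: "del J = (vec x, J')" for L lam J x J'
 proof -
  obtain u where u: "fwalk J u" using fwalk_exists by blast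
  then show ?thesis using st_act[OF u] J d_a0 D del_eq[OF u] by (auto simp: KW_def RC_def)
 qed
 have np_step: "u T = vec x & J' = act u J & rwalk J' (vec x) u & np J a0 = np J' a0 + int (u 1 a0)"
  if B: "BW (Suc L) lam" and J: "J\<in>KW (Suc L) lam" and u: "fwalk J u" and D: "del J = (vec x, J')" for L lam J J' u x
 proof -
  have e: "u T = vec x" "J' = act u J" using D del_eq[OF u] by auto
  have JR: "J\<in>RC (Z1a (Suc L)) (N (Suc L) lam)" using J by (simp add: KW_def)
  have NT: "N (Suc L) lam a < of_nat T" if "a\<in>C" for a using B that by (simp add: BW_def)
  show ?thesis
   using act_RC(2)[OF Z1a_nonneg(1) Z1a_nonneg(2) NT JR u] np_act[OF u RC_D(1)[OF JR], of a0] e by simp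
 qed
 show "np J a0 = of_bool (x = Phi)" if B: "BW 1 lam" and J: "J\<in>KW 1 lam" and x: "x\<in>letters ty n" "x = Ltr 1 | x = Phi"
  and D: "del J = (vec x, %_ _. {#})" for lam J x
 proof -
  obtain u where u: "fwalk J u" using fwalk_exists by blast
  have x1: "x = Ltr 1" using x ty by (auto simp: letters_simps)
  have s: "u T = (%_. 0)" "np J a0 = int (u 1 a0)" using np_step[of 0 lam J u x] B J u D x1 vec_1 np_0 by auto
  have "u 1<=u (1 + k)" for k by (induction k) (use fwalk_mono[OF u] order_trans in auto)
  from this[of "T - 1"] have "u 1<=u T" using T_pos by simp
  then show ?thesis using s x1 by (simp add: le_fun_def)
 qed
 show "np J a0 = eh ty n x y + np J' a0" if B: "BW (Suc (Suc L)) lam" and J: "J\<in>KW (Suc (Suc L)) lam"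
  and x: "x\<in>letters ty n" and y: "y\<in>letters ty n" and D: "del J = (vec x, J')" "del J' = (vec y, J'')" for L lam J x J' y J''
 proof -
  obtain u where u: "fwalk J u" using fwalk_exists by blast
  obtain v where v: "fwalk J' v" using fwalk_exists by blast
  have "v T = vec y" using D(2) del_eq[OF v] by simp
  then show ?thesis using np_step[OF B J u D(1)] energy[OF v _ _ x y] by auto
 qed
qed

end

section \<open>Letters, sizes and energies for the types \<open>A1\<close>, \<open>A2_odd\<close>
  and \<open>D1\<close>\<close>

lemma partial_wt_Suc: "partial_wt lam (Suc a) = partial_wt lam a + lam (Suc a)"
 by (simp add: partial_wt_def)

lemma partial_wt_0 [simp]: "partial_wt lam 0 = 0"
 by (simp add: partial_wt_def)

lemma sum_cartan:
 fixes f :: "nat => rat"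
 assumes "a\<in>{Suc 0..n}"
 shows "(\<Sum>b\<in>{Suc 0..n}. of_int (cartan a b) * f b)
  = 2 * f a - of_bool (Suc 0 < a) * f (a - 1) - of_bool (a < n) * f (Suc a)"
proof -
 have "(\<Sum>b\<in>{Suc 0..n}. of_int (cartan a b) * f b)
   = (\<Sum>b\<in>{Suc 0..n}. (if b = a then 2 * f a else 0) - (if b = a - 1 then f (a - 1) else 0) - (if b = Suc a then f (Suc a) else 0))"
  using assms by (intro sum.cong) (auto simp: cartan_def)
 also have "... = 2 * f a - of_bool (Suc 0 < a) * f (a - 1) - of_bool (a < n) * f (Suc a)"
  using assms by (auto simp: sum_subtractf)
 finally show ?thesis .
qed

lemma second_difference_partial_wt:
 "a>=1 ==> 2 * partial_wt lam a - partial_wt lam (a - 1) - partial_wt lam (Suc a) = lam a - lam (Suc a)"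
 using partial_wt_Suc[of lam "a - 1"] partial_wt_Suc[of lam a] by simp

locale type_A =
 fixes n T :: nat
 assumes n_ge_1: "n>=1" and T_ge_1: "T>=1"
begin

sublocale chain_rc "{Suc 0..n}" cartan "%_. 1" lcol n T
 using n_ge_1 T_ge_1 by unfold_locales (auto simp: cartan_def lcol_def)

fun vecA :: "letter => nat => nat" where
 "vecA (Ltr k) = pv lcol (k - 1)"
| "vecA x = (%_. 0)"

sublocale single_walker "{Suc 0..n}" cartan "%_. 1" "lcol 0" S T A1 n vecA "%L lam. config_size A1 n lam L"
proof unfold_locales
 show "nonexceptional A1 n" using n_ge_1 by (simp add: nonexceptional_def)
 show "lcol 0 = Suc 0" by (simp add: lcol_def)
 show "bij_betw vecA (letters A1 n) S"
 proof (rule bij_betwI')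
  show "vecA x = vecA y \<longleftrightarrow> x = y" if "x\<in>letters A1 n" "y\<in>letters A1 n" for x y
   using that by (auto simp: letters_def pv_inject)
  show "vecA x\<in>S" if "x\<in>letters A1 n" for x
   using that by (auto simp: letters_def intro!: pv_in_S)
  show "\<exists>x\<in>letters A1 n. u = vecA x" if uS: "u\<in>S" for u
  proof -
   obtain k where "k<=n" "u = pv lcol k" using S_pv[OF uS] by blast
   then show ?thesis by (intro bexI[of _ "Ltr (Suc k)"]) (auto simp: letters_simps)
  qed
 qed
 show "config_size A1 n (sub_wt lam x) L a = config_size A1 n lam (Suc L) a - of_nat (vecA x a)"
  if "a\<in>{Suc 0..n}" "x\<in>letters A1 n" for L lam x a
  using that by (auto simp: letters_def config_size_def partial_wt_sub_wt pv_lcol)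
 show "dm (Z1a L) (config_size A1 n lam L) a = of_int (pr A1 n a lam)"
  if a: "a\<in>{Suc 0..n}" and A1: "A1 = A1 ==> partial_wt lam (n + 1) = int L" for L lam a
 proof -
  have "of_bool (a < n) * config_size A1 n lam L (Suc a) = (of_int (int L - partial_wt lam (Suc a)) :: rat)"
   using A1 a by (auto simp: config_size_def le_less)
  moreover have "of_int (Z1a L a) + of_bool (Suc 0 < a) * config_size A1 n lam L (a - 1) = (of_int (int L - partial_wt lam (a - 1)) :: rat)"
   unfolding Z1a_def unfolding lcol_def using a by (auto simp: config_size_def not_less le_antisym)
  moreover have "pr A1 n a lam = 2 * partial_wt lam a - partial_wt lam (a - 1) - partial_wt lam (Suc a)"
   using second_difference_partial_wt[of a lam] a by (simp add: pr_def)
  ultimately show ?thesis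
   unfolding dm_def sum_cartan[OF a] by (simp add: config_size_def algebra_simps)
 qed
 show "config_size A1 n lam 0 (lcol 0) = - of_int (lam 1)" "config_size A1 n (%_. 0) 0 a = 0" for lam a
  by (simp_all add: config_size_def lcol_def partial_wt_def)
 show "int (v 1 (lcol 0)) = eh A1 n x y"
  if u: "fwalk J u" "u T = vecA y" and v: "rwalk J (vecA x) v" and xy: "x\<in>letters A1 n" "y\<in>letters A1 n" for J u x y v
 proof -
  obtain j where j: "j<=n" "v 1 = pv lcol j" using S_pv rwalk_in_S[OF v] by blast
  have "vecA x<=vecA y \<longleftrightarrow> j = 0" using walk_adjoint[OF u(1) v] u(2) j pv_inject[of lcol j 0] by simp
  moreover have "vecA x<=vecA y \<longleftrightarrow> ~ descent A1 n x y"
   using xy by (auto simp: letters_def pv_le_iff descent_def)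
  moreover have "eh A1 n x y = of_bool (descent A1 n x y)" using xy by (auto simp: eh_def letters_def)
  ultimately show ?thesis using j pv_lcol[of j "lcol 0"] by (auto simp: lcol_def)
 qed
qed auto

end

lemma sum_cartanC:
 fixes f :: "nat => rat"
 assumes "a\<in>{Suc 0..n}"
 shows "(\<Sum>b\<in>{Suc 0..n}. of_int (cartanC n a b) * f b)
  = 2 * f a - of_bool (Suc 0 < a) * f (a - 1) - of_bool (a < n) * f (Suc a) - of_bool (Suc a = n) * f n"
proof -
 have "(\<Sum>b\<in>{Suc 0..n}. of_int (cartanC n a b) * f b)
   = (\<Sum>b\<in>{Suc 0..n}. of_int (cartan a b) * f b - (if b = n then of_bool (Suc a = n) * f n else 0))"
  by (intro sum.cong) (auto simp: cartanC_def cartan_def algebra_simps)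
 also have "... = (\<Sum>b\<in>{Suc 0..n}. of_int (cartan a b) * f b) - of_bool (Suc a = n) * f n"
  using assms by (simp add: sum_subtractf)
 finally show ?thesis unfolding sum_cartan[OF assms] .
qed

context type_C
begin

fun vecC :: "letter => nat => nat" where
 "vecC (Ltr k) = cv (k - 1)"
| "vecC (Bar k) = cv (2 * n - k)"
| "vecC x = (%_. 0)"

lemma letters_A2_odd: "x\<in>letters A2_odd n \<longleftrightarrow> (\<exists>k. 1<=k & k<=n & (x = Ltr k | x = Bar k))"
 by (auto simp: letters_def)

lemma vecC_le:
 assumes "x\<in>letters A2_odd n" "y\<in>letters A2_odd n"
 shows "vecC x<=vecC y \<longleftrightarrow> ~ descent A2_odd n x y"
 using assms n_ge_2 by (auto simp: letters_A2_odd pv_le_iff descent_def)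

sublocale single_walker "{Suc 0..n}" "cartanC n" "dC n" "ccol n 0" S T A2_odd n vecC "%L lam. config_size A2_odd n lam L"
proof unfold_locales
 show "nonexceptional A2_odd n" using n_ge_2 by (simp add: nonexceptional_def)
 show "ccol n 0 = Suc 0" by (rule ccol_1)
 show "dC n (ccol n 0) = 1" using n_ge_2 by (simp add: ccol_1 dC_def)
 show "bij_betw vecC (letters A2_odd n) S"
 proof (rule bij_betwI')
  show "vecC x = vecC y \<longleftrightarrow> x = y" if "x\<in>letters A2_odd n" "y\<in>letters A2_odd n" for x y
   using that n_ge_2 by (auto simp: letters_A2_odd pv_inject)
  show "vecC x\<in>S" if "x\<in>letters A2_odd n" for x
   using that by (auto simp: letters_A2_odd intro!: pv_in_S)
  show "\<exists>x\<in>letters A2_odd n. u = vecC x" if uS: "u\<in>S" for u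
  proof -
   obtain k where k: "k<=nn" "u = cv k" using S_pv[OF uS] by blast
   show ?thesis
   proof (cases "k < n")
    case True
    then show ?thesis using k by (intro bexI[of _ "Ltr (Suc k)"]) (auto simp: letters_simps)
   next
    case False
    then show ?thesis using k n_ge_2 by (intro bexI[of _ "Bar (2 * n - k)"]) (auto simp: letters_simps)
   qed
  qed
 qed
 show "config_size A2_odd n (sub_wt lam x) L a = config_size A2_odd n lam (Suc L) a - of_nat (vecC x a)"
  if a: "a\<in>{Suc 0..n}" and x: "x\<in>letters A2_odd n" for L lam x a
 proof -
  obtain k where k: "1<=k" "k<=n" "x = Ltr k | x = Bar k" using x by (auto simp: letters_A2_odd)
  from k(3) show ?thesis
  proof
   assume x: "x = Ltr k"
   have "cv (k - 1) a = of_bool (a < k)" using pv_ccol[of "k - 1" a] k a by auto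
   then show ?thesis using k a unfolding x
    by (auto simp: config_size_def partial_wt_sub_wt of_bool_def field_simps)
  next
   assume x: "x = Bar k"
   have "cv (2 * n - k) a = 1 + of_bool (k<=a & a < n)" using pv_ccol'[of "2 * n - k" a] k a by auto
   then show ?thesis using k a unfolding x
    by (auto simp: config_size_def partial_wt_sub_wt of_bool_def field_simps)
  qed
 qed
 show "dm (Z1a L) (config_size A2_odd n lam L) a = of_int (pr A2_odd n a lam)"
  if a: "a\<in>{Suc 0..n}" for L lam a
 proof -
  have m: "of_int (Z1a L a) + of_bool (Suc 0 < a) * config_size A2_odd n lam L (a - 1) = (of_int (int L - partial_wt lam (a - 1)) :: rat)"
   unfolding Z1a_def unfolding ccol_1 using a by (auto simp: config_size_def not_less le_antisym)
  have S: "partial_wt lam a = partial_wt lam (a - 1) + lam a" using partial_wt_Suc[of lam "a - 1"] a by simp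
  consider "a = n" | "Suc a = n" | "Suc a < n" using a by force
  then show ?thesis
  proof cases
   case 1
   then show ?thesis using m S
    unfolding dm_def sum_cartanC[OF a] by (simp add: config_size_def pr_def field_simps)
  next
   case 2
   then have "of_bool (a < n) * config_size A2_odd n lam L (Suc a) + of_bool (Suc a = n) * config_size A2_odd n lam L n
    = (of_int (int L - partial_wt lam (Suc a)) :: rat)" by (simp add: config_size_def)
   then show ?thesis using m S 2 partial_wt_Suc[of lam a]
    unfolding dm_def sum_cartanC[OF a] by (simp add: config_size_def pr_def field_simps)
  next
   case 3
   then show ?thesis using m S partial_wt_Suc[of lam a]
    unfolding dm_def sum_cartanC[OF a] by (simp add: config_size_def pr_def field_simps)
  qed
 qed
 show "config_size A2_odd n lam 0 (ccol n 0) = - of_int (lam 1)" "config_size A2_odd n (%_. 0) 0 a = 0" for lam a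
  using n_ge_2 by (simp_all add: config_size_def ccol_1 partial_wt_def)
 show "int (v 1 (ccol n 0)) = eh A2_odd n x y"
  if u: "fwalk J u" "u T = vecC y" and v: "rwalk J (vecC x) v" and xy: "x\<in>letters A2_odd n" "y\<in>letters A2_odd n" for J u x y v
 proof -
  have t: "vecC x = ptop \<longleftrightarrow> x = Bar 1" "vecC y = (%_. 0) \<longleftrightarrow> y = Ltr 1"
  proof -
   have z: "cv j = (%_. 0) \<longleftrightarrow> j = 0" for j using pv_inject[of "ccol n" j 0] by simp
   obtain j k where "1<=j" "j<=n" "x = Ltr j | x = Bar j" "1<=k" "k<=n" "y = Ltr k | y = Bar k"
    using xy by (auto simp: letters_A2_odd)
   then show "vecC x = ptop \<longleftrightarrow> x = Bar 1" "vecC y = (%_. 0) \<longleftrightarrow> y = Ltr 1"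
    using n_ge_2 by (auto simp: pv_inject z simp del: pv.simps)
  qed
  have "eh A2_odd n x y = (if x = Bar 1 & y = Ltr 1 then 2 else of_bool (descent A2_odd n x y))"
   using xy by (auto simp: eh_def letters_A2_odd)
  moreover have "descent A2_odd n x y" if "x = Bar 1 & y = Ltr 1" using that n_ge_2 by (simp add: descent_def)
  ultimately show ?thesis
   using energy_top[OF u(1) v] unfolding u(2) vecC_le[OF xy] t ccol_1 by auto
 qed
qed auto

end

lemma sum_cartanD:
 fixes f :: "nat => rat"
 assumes "a\<in>{Suc 0..n}" "n>=4"
 shows "(\<Sum>b\<in>{Suc 0..n}. of_int (cartanD n a b) * f b) =
  (if a = n then 2 * f n - f (n - 2) else if Suc a = n then 2 * f a - f (a - 1)
  else if a + 2 = n then 2 * f a - f (a - 1) - f (a + 1) - f n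
  else 2 * f a - of_bool (Suc 0 < a) * f (a - 1) - f (Suc a))"
proof (cases "a = n")
 case True
 have "(\<Sum>b\<in>{Suc 0..n}. of_int (cartanD n a b) * f b)
   = (\<Sum>b\<in>{Suc 0..n}. (if b = n then 2 * f n else 0) - (if b = n - 2 then f (n - 2) else 0))"
  using assms True by (intro sum.cong) (auto simp: cartanD_def)
 also have "... = 2 * f n - f (n - 2)" using assms by (auto simp: sum_subtractf)
 finally show ?thesis using True by simp
next
 case False
 have "(\<Sum>b\<in>{Suc 0..n}. of_int (cartanD n a b) * f b)
   = (\<Sum>b\<in>{Suc 0..n}. (if b = a then 2 * f a else 0) - (if b = a - 1 then f (a - 1) else 0)
     - (if b = Suc a then of_bool (Suc a < n) * f (Suc a) else 0) - (if b = n then of_bool (a + 2 = n) * f n else 0))"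
  using assms False by (intro sum.cong) (auto simp: cartanD_def)
 also have "... = 2 * f a - of_bool (Suc 0 < a) * f (a - 1) - of_bool (Suc a < n) * f (Suc a) - of_bool (a + 2 = n) * f n"
  using assms False by (auto simp: sum_subtractf)
 finally show ?thesis using False assms by auto
qed

context type_D
begin

fun vecD :: "letter => nat => nat" where
 "vecD (Ltr k) = dv (k - 1)"
| "vecD (Bar k) = (if k = n then w else dv (2 * n - Suc k))"
| "vecD x = (%_. 0)"

lemma letters_D1: "x\<in>letters D1 n \<longleftrightarrow> (\<exists>k. 1<=k & k<=n & (x = Ltr k | x = Bar k))"
 by (auto simp: letters_def)

lemma letters_D1_cases:
 assumes "x\<in>letters D1 n"
 obtains k where "1<=k" "k<=n" "x = Ltr k" | "x = Bar n" | k where "1<=k" "k < n" "x = Bar k"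
 using assms by (force simp: letters_D1)

lemma vecD_le:
 assumes "x\<in>letters D1 n" "y\<in>letters D1 n"
 shows "vecD x<=vecD y \<longleftrightarrow> ~ descent D1 n x y"
proof -
 have a: "w<=dv (k - Suc 0) \<longleftrightarrow> False" if "1<=k" "k<=n" for k
  using w_le_pv[of "k - 1"] that n_ge_4 by auto
 have b: "w<=dv (2 * n - Suc k)" "~ dv (2 * n - Suc k)<=w" if "1<=k" "k < n" for k
  using w_le_pv[of "2 * n - Suc k"] pv_le_w[of "2 * n - Suc k"] that n_ge_4 by auto
 have c: "dv (k - Suc 0)<=w \<longleftrightarrow> k < n" if "1<=k" "k<=n" for k
  using pv_le_w[of "k - 1"] that n_ge_4 by auto
 show ?thesis
  using assms(1)
 proof (cases rule: letters_D1_cases)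
  case (1 j)
  note x = this
  show ?thesis using assms(2)
   by (cases rule: letters_D1_cases) (use x n_ge_4 in \<open>auto simp: pv_le_iff c descent_def\<close>)
 next
  case 2
  note x = this
  show ?thesis using assms(2)
   by (cases rule: letters_D1_cases) (use x n_ge_4 in \<open>auto simp: pv_le_iff a b descent_def\<close>)
 next
  case (3 j)
  note x = this
  show ?thesis using assms(2)
   by (cases rule: letters_D1_cases) (use x n_ge_4 in \<open>auto simp: pv_le_iff b descent_def\<close>)
 qed
qed

sublocale single_walker "{Suc 0..n}" "cartanD n" "%_. 1" "Suc 0" SD T D1 n vecD "%L lam. config_size D1 n lam L"
proof unfold_locales
 show "nonexceptional D1 n" using n_ge_4 by (simp add: nonexceptional_def)
 show bij: "bij_betw vecD (letters D1 n) SD"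
 proof (rule bij_betwI')
  show "vecD x = vecD y \<longleftrightarrow> x = y" if xy: "x\<in>letters D1 n" "y\<in>letters D1 n" for x y
  proof
   assume "vecD x = vecD y"
   then have "~ descent D1 n x y" "~ descent D1 n y x" using vecD_le[OF xy] vecD_le[OF xy(2,1)] by auto
   then show "x = y" using xy by (auto simp: descent_def letters_D1)
  qed simp
  show "vecD x\<in>SD" if "x\<in>letters D1 n" for x
   using that n_ge_4 by (auto simp: letters_D1 w_in_SD intro!: pv_in_SD)
  show "\<exists>x\<in>letters D1 n. u = vecD x" if uS: "u\<in>SD" for u
   using uS
  proof (cases rule: SD_cases)
   case 1
   then show ?thesis using n_ge_4 by (intro bexI[of _ "Bar n"]) (auto simp: letters_simps)
  next
   case (2 k)
   show ?thesis
   proof (cases "k < n")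
    case True
    then show ?thesis using 2 by (intro bexI[of _ "Ltr (Suc k)"]) (auto simp: letters_simps)
   next
    case False
    then show ?thesis using 2 n_ge_4 by (intro bexI[of _ "Bar (2 * n - Suc k)"]) (auto simp: letters_simps)
   qed
  qed
 qed
 show "config_size D1 n (sub_wt lam x) L a = config_size D1 n lam (Suc L) a - of_nat (vecD x a)"
  if a: "a\<in>{Suc 0..n}" and x: "x\<in>letters D1 n" for L lam x a
  using x
 proof (cases rule: letters_D1_cases)
  case (1 k)
  have "dv (k - 1) a = of_bool (a < k)" using pv_dcol[of "k - 1" a] 1 a by auto
  moreover have "sub_wt lam x n = lam n - of_bool (k = n)" using 1 by (simp add: sub_wt_def eps_def)
  ultimately show ?thesis using 1 a n_ge_4
   by (cases "k = n") (auto simp: config_size_def partial_wt_sub_wt of_bool_def field_simps)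
 next
  case 2
  have "sub_wt lam x n = lam n + 1" using 2 by (simp add: sub_wt_def eps_def)
  then show ?thesis using 2 a n_ge_4 w_eq[of a]
   by (auto simp: config_size_def partial_wt_sub_wt of_bool_def field_simps)
 next
  case (3 k)
  have "dv (2 * n - Suc k) a = 1 + of_bool (k<=a & a<=n - 2)" using pv_dcol'[of "2 * n - Suc k" a] 3 a by auto
  moreover have "sub_wt lam x n = lam n" using 3 by (simp add: sub_wt_def eps_def)
  ultimately show ?thesis using 3 a n_ge_4
   by (auto simp: config_size_def partial_wt_sub_wt of_bool_def field_simps)
 qed
 show "dm (Z1a L) (config_size D1 n lam L) a = of_int (pr D1 n a lam)"
  if a: "a\<in>{Suc 0..n}" for L lam a
 proof -
  let ?S = "partial_wt lam"
  obtain m where n: "n = Suc (Suc (Suc m))" using n_ge_4 that[of "n - 3"] by simp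
  consider "a = n" | "Suc a = n" | "a + 2 = n" | "a + 2 < n" using a by force
  then show ?thesis
  proof cases
   case 1
   then show ?thesis using n_ge_4
    unfolding dm_def sum_cartanD[OF a n_ge_4] Z1a_def by (simp add: config_size_def pr_def partial_wt_Suc n field_simps)
  next
   case 2
   then have "a = Suc (Suc m)" using n by simp
   then show ?thesis using n_ge_4
    unfolding dm_def sum_cartanD[OF a n_ge_4] Z1a_def by (simp add: config_size_def pr_def partial_wt_Suc n field_simps)
  next
   case 3
   then have "a = Suc m" using n by simp
   then show ?thesis using n_ge_4
    unfolding dm_def sum_cartanD[OF a n_ge_4] Z1a_def by (simp add: config_size_def pr_def partial_wt_Suc n field_simps)
  next
   case 4
   have "of_int (Z1a L a) + of_bool (Suc 0 < a) * config_size D1 n lam L (a - 1) = (of_int (int L - ?S (a - 1)) :: rat)"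
    unfolding Z1a_def using a 4 by (auto simp: config_size_def not_less le_antisym)
   moreover have "?S a = ?S (a - 1) + lam a" using partial_wt_Suc[of lam "a - 1"] a by simp
   moreover have "config_size D1 n lam L (Suc a) = (of_int (int L - ?S (Suc a)) :: rat)" using 4 by (auto simp: config_size_def)
   moreover have "config_size D1 n lam L a = (of_int (int L - ?S a) :: rat)" using 4 by (auto simp: config_size_def)
   ultimately show ?thesis using 4 partial_wt_Suc[of lam a]
    unfolding dm_def sum_cartanD[OF a n_ge_4] by (simp add: pr_def field_simps)
  qed
 qed
 show "config_size D1 n lam 0 (Suc 0) = - of_int (lam 1)" "config_size D1 n (%_. 0) 0 a = 0" for lam a
  using n_ge_4 by (auto simp: config_size_def partial_wt_def)
 show "int (v 1 (Suc 0)) = eh D1 n x y"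
  if u: "fwalk J u" "u T = vecD y" and v: "rwalk J (vecD x) v" and xy: "x\<in>letters D1 n" "y\<in>letters D1 n" for J u x y v
 proof -
  have B1: "Bar 1\<in>letters D1 n" "dtop = vecD (Bar 1)" using n_ge_4 by (auto simp: letters_simps numeral_2_eq_2)
  have L1: "Ltr 1\<in>letters D1 n" "(%_. 0) = vecD (Ltr 1)" using n_ge_4 by (auto simp: letters_simps)
  note eq = inj_on_eq_iff[OF bij_betw_imp_inj_on[OF bij]]
  have t1: "vecD x = dtop \<longleftrightarrow> x = Bar 1" unfolding B1(2) using eq[OF xy(1) B1(1)] .
  have t2: "vecD y = (%_. 0) \<longleftrightarrow> y = Ltr 1" unfolding L1(2) using eq[OF xy(2) L1(1)] .
  have "eh D1 n x y = (if x = Bar 1 & y = Ltr 1 then 2 else of_bool (descent D1 n x y))"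
   using xy by (auto simp: eh_def letters_D1)
  moreover have "descent D1 n x y" if "x = Bar 1 & y = Ltr 1" using that n_ge_4 by (simp add: descent_def)
  ultimately show ?thesis
   using energy_D[OF u(1) v] unfolding u(2) vecD_le[OF xy] t1 t2 by auto
 qed
qed auto

end

section \<open>Types with a pair of walkers\<close>

text \<open>The final positions of the two walkers when the letter is removed.\<close>
fun lpair :: "nat => letter => nat \<times> nat" where
 "lpair n (Ltr k) = (k - 1, k - 1)"
| "lpair n (Bar k) = (2 * n - k, 2 * n - k)"
| "lpair n Zero = (n - 1, n)"
| "lpair n Phi = (2 * n - 1, 0)"

lemma lpair_inj:
 assumes "ty ~= A1" "n>=1" "x\<in>letters ty n" "y\<in>letters ty n" "lpair n x = lpair n y"
 shows "x = y"
 using assms by (cases x; cases y) (auto simp: letters_simps)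

lemma lpair_surj:
 assumes "n>=1" "ty ~= A1"
  and "(x = y & x<=2 * n - Suc 0) | (x = n - 1 & y = n & Zero\<in>letters ty n) | (x = 2 * n - Suc 0 & y = 0 & Phi\<in>letters ty n)"
 shows "\<exists>l\<in>letters ty n. lpair n l = (x, y)"
proof -
 consider "x = y" "x < n" | "x = y" "n<=x" "x<=2 * n - Suc 0" | "x = n - 1" "y = n" "Zero\<in>letters ty n"
  | "x = 2 * n - Suc 0" "y = 0" "Phi\<in>letters ty n" using assms(3) by linarith
 then show ?thesis
 proof cases
  case 1
  then show ?thesis using assms by (intro bexI[of _ "Ltr (Suc x)"]) (auto simp: letters_simps)
 next
  case 2
  then show ?thesis using assms by (intro bexI[of _ "Bar (2 * n - x)"]) (auto simp: letters_simps)
 next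
  case 3
  then show ?thesis by (intro bexI[of _ Zero]) auto
 next
  case 4
  then show ?thesis by (intro bexI[of _ Phi]) auto
 qed
qed

lemma lpair_descent:
 assumes "ty\<notin>{A1, D1}" "x\<in>letters ty n" "y\<in>letters ty n" "x ~= Phi" "y ~= Phi" "n>=1"
 shows "snd (lpair n x)<=fst (lpair n y) \<longleftrightarrow> ~ descent ty n x y"
 using assms by (cases x; cases y) (auto simp: letters_simps descent_def)

locale type_C_family = sym_class +
 fixes ty :: aff_type
 assumes ne: "nonexceptional ty n" and ty_C: "ty\<in>{D2, A2_even, A2_dagger, C1}"
  and zero_ok_iff: "zero_ok \<longleftrightarrow> Zero\<in>letters ty n" and phi_ok_iff: "phi_ok \<longleftrightarrow> Phi\<in>letters ty n"
begin

text \<open>The sizes of the folded diagram, repeated on the mirror colours.\<close>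

definition NC :: "nat => (nat => int) => nat => rat" where
 "NC L lam a = of_int (int L - partial_wt lam (min a (2 * n - a)))"

definition KC :: "nat => (nat => int) => riggings set" where
 "KC L lam = KS L (NC L lam)"

definition BC :: "nat => (nat => int) => bool" where
 "BC L lam \<longleftrightarrow> lam\<in>weights ty n & (\<forall>a\<in>{Suc 0..nn}. NC L lam a < of_nat T)"

definition kC :: int where
 "kC = (if ty\<in>{D2, A2_even} then 2 else 1)"

text \<open>By \<open>pair_stat\<close> a letter changes \<open>st\<close> by \<open>4 * np\<close>,
  less 2 for phi. With phi in the alphabet the common divisor is 2, otherwise 4; \<open>cntC\<close>
  is the quotient, and \<open>4 div kC\<close> the divisor.\<close>

definition cntC :: "riggings => int" where
 "cntC J = kC * L.np J (Suc 0) - of_bool (fst (Dmap J) = (nn, 0))"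

lemma NN_NC:
 assumes a: "a\<in>{Suc 0..nn}" and x: "x\<in>letters ty n"
 shows "NN (NC (Suc L) lam) (fst (lpair n x)) (snd (lpair n x)) a = NC L (sub_wt lam x) a"
proof -
 have r: "rv y a = of_bool (2 * n - y<=a)" if "y<=nn" for y
  using pv_rcol[OF n_pos that, of a] a by simp
 have N: "NC L (sub_wt lam x) a = NC (Suc L) lam a - 1 + of_int (lw x (min a (2 * n - a)))"
  by (simp add: NC_def partial_wt_sub_wt)
 show ?thesis
 proof (cases x)
  case (Ltr k)
  then have k: "1<=k" "k<=n" using x ty_C by (auto simp: letters_simps)
  then show ?thesis using Ltr a r[of "k - 1"] unfolding N NN_def by (auto simp: pv_lcol)
 next
  case (Bar k)
  then have k: "1<=k" "k<=n" using x ty_C by (auto simp: letters_simps)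
  then show ?thesis using Bar a r[of "2 * n - k"] unfolding N NN_def by (auto simp: pv_lcol)
 next
  case Zero
  then show ?thesis using a r[of n] n_pos unfolding N NN_def by (auto simp: pv_lcol)
 next
  case Phi
  then show ?thesis using a r[of 0] n_pos unfolding N NN_def by (auto simp: pv_lcol)
 qed
qed

lemma KS_cong: "(!!a. a\<in>{Suc 0..nn} ==> N a = N' a) ==> KS L N = KS L N'"
 unfolding KS_def using L.RC_cong[of N N' "Zof L"] by simp

lemma KS_step:
 "x\<in>letters ty n ==> KS L (NN (NC (Suc L) lam) (fst (lpair n x)) (snd (lpair n x))) = KC L (sub_wt lam x)"
 unfolding KC_def by (rule KS_cong) (rule NN_NC)

lemma dm_NC:
 assumes a: "1<=a" "a<=n"
 shows "L.dm (Zof L) (NC L lam) a = of_int (if a < n then lam a - lam (Suc a) else 2 * lam n)"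
  and "L.dm (Zof L) (NC L lam) (2 * n - a) = L.dm (Zof L) (NC L lam) a"
proof -
 let ?m = "%b. min b (2 * n - b)"
 have g: "L.dm (Zof L) (NC L lam) b = of_int (2 * partial_wt lam (?m b) - partial_wt lam (?m (b - 1)) - partial_wt lam (?m (Suc b)))"
  if b: "b\<in>{Suc 0..nn}" for b
 proof -
  have "of_int (Zof L b) + of_bool (Suc 0 < b) * NC L lam (b - 1) + of_bool (b < nn) * NC L lam (Suc b)
   = NC L lam (b - 1) + NC L lam (Suc b)"
  proof -
   have 1: "of_int (int L * of_bool (b = Suc 0)) + of_bool (Suc 0 < b) * NC L lam (b - 1) = NC L lam (b - 1)"
    using b by (cases "b = Suc 0") (simp_all add: NC_def)
   have 2: "of_int (int L * of_bool (b = nn)) + of_bool (b < nn) * NC L lam (Suc b) = NC L lam (Suc b)"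
   proof (cases "b = nn")
    case True
    then have "min (Suc b) (2 * n - Suc b) = 0" using b by simp
    then show ?thesis using True by (simp add: NC_def)
   next
    case False
    then show ?thesis using b by simp
   qed
   show ?thesis unfolding Zof_def distrib_left of_int_add using 1 2 by linarith
  qed
  then show ?thesis unfolding L.dm_def sum_cartan[OF b] by (simp add: NC_def algebra_simps)
 qed
 have a': "a\<in>{Suc 0..nn}" "2 * n - a\<in>{Suc 0..nn}" using a by auto
 have m: "?m a = a" "?m (a - 1) = a - 1" "?m (2 * n - a) = a" "?m (2 * n - a - 1) = ?m (Suc a)" "?m (Suc (2 * n - a)) = a - 1"
  using a by (auto simp: min_def)
 show "L.dm (Zof L) (NC L lam) (2 * n - a) = L.dm (Zof L) (NC L lam) a"
  unfolding g[OF a'(1)] g[OF a'(2)] m by simp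
 have S: "partial_wt lam a = partial_wt lam (a - 1) + lam a" using partial_wt_Suc[of lam "a - 1"] a by simp
 show "L.dm (Zof L) (NC L lam) a = of_int (if a < n then lam a - lam (Suc a) else 2 * lam n)"
 proof (cases "a < n")
  case True
  then have "?m (Suc a) = Suc a" by (simp add: min_def)
  then show ?thesis unfolding g[OF a'(1)] m using True S by (simp add: partial_wt_Suc)
 next
  case False
  then have "a = n" "?m (Suc a) = a - 1" using a by (auto simp: min_def)
  then show ?thesis unfolding g[OF a'(1)] m using S by simp
 qed
qed

lemma pr_C: "pr ty n i lam = (if i < n then lam i - lam (Suc i) else if ty\<in>{D2, A2_dagger} then 2 * lam n else lam n)"
 using ty_C by (auto simp: pr_def)

lemma dm_pr:
 "(\<forall>a\<in>{Suc 0..nn}. 0<=L.dm (Zof L) (NC L lam) a) \<longleftrightarrow> (\<forall>i\<in>{1..n}. 0<=pr ty n i lam)"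
proof -
 have e: "0<=L.dm (Zof L) (NC L lam) a \<longleftrightarrow> 0<=pr ty n a lam" if "a\<in>{1..n}" for a
  using dm_NC(1)[of a L lam] that by (auto simp: pr_C)
 have "0<=L.dm (Zof L) (NC L lam) a"
  if "\<forall>i\<in>{1..n}. 0<=L.dm (Zof L) (NC L lam) i" "a\<in>{Suc 0..nn}" for a
 proof (cases "a<=n")
  case False
  then have m: "2 * n - a\<in>{1..n}" "2 * n - (2 * n - a) = a" using that(2) by auto
  then have "L.dm (Zof L) (NC L lam) a = L.dm (Zof L) (NC L lam) (2 * n - a)" using dm_NC(2)[of "2 * n - a" L lam] by simp
  moreover have "0<=L.dm (Zof L) (NC L lam) (2 * n - a)" using that(1) m(1) by blast
  ultimately show ?thesis by simp
 qed (use that in auto)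
 moreover have "{1..n} \<subseteq> {Suc 0..nn}" using n_pos by auto
 ultimately show ?thesis using e by blast
qed

lemma KC_pr: "J\<in>KC L lam ==> i\<in>{1..n} ==> 0<=pr ty n i lam"
 using dm_pr[of L lam] L.RC_dm[of J "Zof L" "NC L lam"] unfolding KC_def KS_def by blast

lemma allowed_letter: "allowed p q ==> \<exists>x\<in>letters ty n. lpair n x = (p, q)"
proof -
 assume "allowed p q"
 moreover have "ty ~= A1" using ty_C by auto
 ultimately show ?thesis
  using lpair_surj[OF n_pos, of ty p q] zero_ok_iff phi_ok_iff unfolding allowed_def by blast
qed

lemma letter_allowed: "x\<in>letters ty n ==> allowed (fst (lpair n x)) (snd (lpair n x))"
proof -
 assume x: "x\<in>letters ty n"
 have "ty ~= A1" using ty_C by auto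
 then show ?thesis
  unfolding allowed_def using x zero_ok_iff phi_ok_iff n_pos by (cases x) (auto simp: letters_simps)
qed

lemma lpair_Zero: "x\<in>letters ty n ==> fst (lpair n x) = n - 1 & snd (lpair n x) = n \<longleftrightarrow> x = Zero"
 using n_pos by (cases x) (auto simp: letters_simps)

lemma lpair_Phi: "x\<in>letters ty n ==> lpair n x = (nn, 0) \<longleftrightarrow> x = Phi"
 using n_pos ty_C by (cases x) (auto simp: letters_simps)

sublocale letter_walks ty n "lpair n" KC Dmap BC L.st cntC "4 div kC"
proof
 show "nonexceptional ty n" by (rule ne)
 show "inj_on (lpair n) (letters ty n)" using lpair_inj[of ty n] ty_C n_pos by (auto simp: inj_on_def)
 have NT: "a\<in>{Suc 0..nn} ==> NC L lam a < of_nat T" if "BC L lam" for L lam a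
  using that by (simp add: BC_def)
 show "L.st (%_ _. {#}) = 0" by (rule L.st_0)
 show "(%_ _. {#})\<in>KC 0 (%_. 0)"
  using L.RC_0[of "NC 0 (%_. 0)" "Zof 0"] by (simp add: Zof_def NC_def partial_wt_def KC_def KS_def sym_def in_cls_def)
 show "J = (%_ _. {#})" if "J\<in>KC 0 (%_. 0)" for J
  by (rule L.RC_empty[of J "Zof 0" "NC 0 (%_. 0)"]) (use that in \<open>auto simp: KC_def KS_def NC_def partial_wt_def\<close>)
 show "lam\<in>weights ty n & lam 1<=0 & (ty = A1 --> partial_wt lam (n + 1) = 0)" if "BC 0 lam" "J\<in>KC 0 lam" for lam J
 proof -
  have "min 1 (2 * n - 1) = 1" using n_pos by auto
  then show ?thesis using L.RC_N_nonneg[of J "Zof 0" "NC 0 lam" 1] that n_pos ty_C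
   by (auto simp: KC_def KS_def BC_def NC_def partial_wt_def)
 qed
 show "BC L (sub_wt lam x)" if B: "BC (Suc L) lam" and x: "x\<in>letters ty n" for L lam x
 proof -
  have "NC L (sub_wt lam x) a < of_nat T" if a: "a\<in>{Suc 0..nn}" for a
  proof -
   have "NC L (sub_wt lam x) a<=NC (Suc L) lam a" unfolding NN_NC[OF a x, symmetric] NN_def by simp
   also have "... < of_nat T" using NT[OF B a] .
   finally show ?thesis .
  qed
  then show ?thesis using B x sub_wt_weights by (auto simp: BC_def)
 qed
 show "0<=pr ty n i lam" if "J\<in>KC L lam" "i\<in>{1..n}" for L lam J i using KC_pr that .
 have z: "1<=L.dm (Zof L) (NC L lam) n \<longleftrightarrow> 1<=lam n" for L lam
  using dm_NC(1)[of n L lam] n_pos by auto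
 show "\<exists>x\<in>letters ty n. \<exists>J'\<in>KC L (sub_wt lam x). Dmap J = (lpair n x, J') & (x = Zero --> 1<=lam n)"
  if B: "BC (Suc L) lam" and J: "J\<in>KC (Suc L) lam" for L lam J
 proof -
  obtain p q K2 where k: "Dmap J = ((p, q), K2)" "allowed p q" "K2\<in>KS L (NN (NC (Suc L) lam) p q)"
   "p = n - 1 & q = n ==> 1<=L.dm (Zof (Suc L)) (NC (Suc L) lam) n"
   using pair_forward[OF J[unfolded KC_def] NT[OF B]] by blast
  obtain x where x: "x\<in>letters ty n" "lpair n x = (p, q)" using allowed_letter[OF k(2)] by blast
  have "K2\<in>KC L (sub_wt lam x)" using KS_step[OF x(1), of L lam] k(3) x(2) by simp
  moreover have "1<=lam n" if "x = Zero" using k(4) z x(2) that by auto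
  ultimately show ?thesis using x k(1) by (intro bexI[of _ x] bexI[of _ K2]) auto
 qed
 show "\<exists>J\<in>KC (Suc L) lam. Dmap J = (lpair n x, J')"
  if B: "BC (Suc L) lam" and x: "x\<in>letters ty n" and J': "J'\<in>KC L (sub_wt lam x)"
   and pr: "\<forall>i\<in>{1..n}. 0<=pr ty n i lam" and Z: "x = Zero --> 1<=lam n" for L lam x J'
 proof -
  have dom: "0<=L.dm (Zof (Suc L)) (NC (Suc L) lam) a" if "a\<in>{Suc 0..nn}" for a
   using dm_pr pr that by blast
  have zero: "1<=L.dm (Zof (Suc L)) (NC (Suc L) lam) n" if "fst (lpair n x) = n - 1 & snd (lpair n x) = n"
   using Z lpair_Zero[OF x] that z by blast
  have J2: "J'\<in>KS L (NN (NC (Suc L) lam) (fst (lpair n x)) (snd (lpair n x)))" using J' KS_step[OF x] by simp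
  show ?thesis
   using pair_backward[OF J2 letter_allowed[OF x] NT[OF B] dom zero] unfolding KC_def by simp
 qed
 show "inj_on Dmap (KC (Suc L) lam)" if B: "BC (Suc L) lam" for L lam
  unfolding KC_def by (rule pair_inj[OF NT[OF B]])
 have k: "kC = 2 & phi_ok | kC = 1 & ~ phi_ok" using phi_ok_iff ty_C by (auto simp: kC_def letters_simps)
 show "L.st J = L.st J' + 4 div kC * cntC J"
  if B: "BC (Suc L) lam" and J: "J\<in>KC (Suc L) lam" and x: "x\<in>letters ty n" and M: "Dmap J = (lpair n x, J')" for L lam J x J'
 proof -
  obtain p q where pq: "lpair n x = (p, q)" by (cases "lpair n x")
  have s: "L.st J = L.st J' + 2 * (2 * L.np J (Suc 0) - of_bool (x = Phi))"
   using pair_stat(1)[OF J[unfolded KC_def] NT[OF B], of p q J'] M lpair_Phi[OF x] unfolding pq by simp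
  have c: "cntC J = kC * L.np J (Suc 0) - of_bool (x = Phi)" using lpair_Phi[OF x] M by (simp add: cntC_def)
  show ?thesis unfolding s c using k x phi_ok_iff by (auto simp: algebra_simps)
 qed
 have np: "L.np J (Suc 0) = L.np J' (Suc 0) + of_bool (x = Phi | ~ snd (lpair n x)<=p')"
  if B: "BC (Suc L) lam" and J: "J\<in>KC (Suc L) lam" and x: "x\<in>letters ty n" and M: "Dmap J = (lpair n x, J')"
   "Dmap J' = ((p', q'), J'')" for L lam J x J' p' q' J''
 proof -
  obtain p q where pq: "lpair n x = (p, q)" by (cases "lpair n x")
  show ?thesis
   using pair_stat(2)[OF J[unfolded KC_def] NT[OF B] _ M(2), of p q] M(1) lpair_Phi[OF x] unfolding pq by simp
 qed
 show "cntC J = of_bool (x = Phi)"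
  if B: "BC 1 lam" and J: "J\<in>KC 1 lam" and x: "x\<in>letters ty n" "x = Ltr 1 | x = Phi"
   and M: "Dmap J = (lpair n x, %_ _. {#})" for lam J x
 proof -
  obtain p' q' J'' where "Dmap (%_ _. {#}) = ((p', q'), J'')" by (metis surj_pair)
  then have "L.np J (Suc 0) = of_bool (x = Phi)"
   using np[of 0 lam J x "%_ _. {#}"] B J x M L.np_0 by auto
  then show ?thesis using lpair_Phi[OF x(1)] M k x(1) phi_ok_iff by (auto simp: cntC_def)
 qed
 show "cntC J = eh ty n x y + cntC J'"
  if B: "BC (Suc (Suc L)) lam" and J: "J\<in>KC (Suc (Suc L)) lam"
   and x: "x\<in>letters ty n" and y: "y\<in>letters ty n" and M: "Dmap J = (lpair n x, J')" "Dmap J' = (lpair n y, J'')"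
  for L lam J x J' y J''
 proof -
  have n': "L.np J (Suc 0) = L.np J' (Suc 0) + of_bool (x = Phi | ~ snd (lpair n x)<=fst (lpair n y))"
   using np[OF B J x M(1), of "fst (lpair n y)" "snd (lpair n y)"] M(2) by simp
  \<comment> \<open>With \<open>y = Phi\<close> no new part appears, and the value 1 of
    \<open>eh\<close> comes from the correction term in \<open>cntC J'\<close>.\<close>
  have le: "snd (lpair n x)<=fst (lpair n y)" if "y = Phi" "x ~= Phi"
   using that x ty_C n_pos by (cases x) (auto simp: letters_simps)
  have c: "cntC J = kC * L.np J (Suc 0) - of_bool (x = Phi)" "cntC J' = kC * L.np J' (Suc 0) - of_bool (y = Phi)"
   using lpair_Phi[OF x] lpair_Phi[OF y] M by (simp_all add: cntC_def)
  have d: "snd (lpair n x)<=fst (lpair n y) \<longleftrightarrow> ~ descent ty n x y" if "x ~= Phi" "y ~= Phi"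
   using lpair_descent[OF _ x y that n_pos] ty_C by auto
  show ?thesis
  proof (cases "x = Phi | y = Phi")
   case True
   then have "kC = 2" using k phi_ok_iff x y by auto
   then show ?thesis using True unfolding c n' using le by (auto simp: eh_def)
  next
   case False
   then have "eh ty n x y = kC * of_bool (descent ty n x y)" using ty_C by (auto simp: eh_def kC_def)
   then show ?thesis using False d unfolding c n' by (simp add: algebra_simps)
  qed
 qed
qed

end

locale type_B = type_C +
 assumes n_ge_3: "n>=3"
begin

text \<open>Twice the sizes prescribed for \<open>B1\<close>, in keeping with the doubled parts; in
  colour \<open>n\<close> this clears the factor 1/2.\<close>

definition NB :: "nat => (nat => int) => nat => rat" where
 "NB L lam a = (if a = n then of_int (int L - partial_wt lam n) else 2 * of_int (int L - partial_wt lam a))"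

definition KB :: "nat => (nat => int) => riggings set" where
 "KB L lam = ES (2 * L) (NB L lam)"

definition BB :: "nat => (nat => int) => bool" where
 "BB L lam \<longleftrightarrow> lam\<in>weights B1 n & (\<forall>a\<in>{Suc 0..n}. NB L lam a < of_nat T)"

lemma letters_B1:
 assumes "x\<in>letters B1 n"
 obtains k where "1<=k" "k<=n" "x = Ltr k" | k where "1<=k" "k<=n" "x = Bar k" | "x = Zero"
 using assms by (cases x) (auto simp: letters_simps)

lemma EN_NB:
 assumes a: "a\<in>{Suc 0..n}" and x: "x\<in>letters B1 n"
 shows "EN (NB (Suc L) lam) (fst (lpair n x)) (snd (lpair n x)) a = NB L (sub_wt lam x) a"
 using x
proof (cases rule: letters_B1)
 case (1 k)
 then have "cv (k - 1) a = of_bool (a < k)" using pv_ccol[of "k - 1" a] a by auto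
 then show ?thesis using 1 a by (auto simp: EN_def NB_def partial_wt_sub_wt)
next
 case (2 k)
 have "cv (2 * n - k) a = 1 + of_bool (k<=a & a < n)" using pv_ccol'[of "2 * n - k" a] 2 a by auto
 then show ?thesis using 2 a by (auto simp: EN_def NB_def partial_wt_sub_wt)
next
 case 3
 have "cv (n - 1) a = of_bool (a < n)" "cv n a = 1" using pv_ccol[of _ a] a by auto
 then show ?thesis using 3 a by (auto simp: EN_def NB_def partial_wt_sub_wt)
qed

lemma ES_step: "x\<in>letters B1 n ==> ES L' (EN (NB (Suc L) lam) (fst (lpair n x)) (snd (lpair n x))) = ES L' (NB L (sub_wt lam x))"
 unfolding ES_def using RC_cong[of "EN (NB (Suc L) lam) (fst (lpair n x)) (snd (lpair n x))" "NB L (sub_wt lam x)" "Zc L'"] EN_NB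
 by simp

lemma dm_NB:
 assumes a: "a\<in>{Suc 0..n}"
 shows "dm (Zc (2 * L)) (NB L lam) a = of_int (if a < n then 2 * (lam a - lam (Suc a)) else 2 * lam n)"
proof -
 have m: "of_int (Zc (2 * L) a) + of_bool (Suc 0 < a) * NB L lam (a - 1) = (of_int (2 * (int L - partial_wt lam (a - 1))) :: rat)"
  unfolding Zc_def using a by (auto simp: NB_def not_less le_antisym)
 have S: "partial_wt lam a = partial_wt lam (a - 1) + lam a" using partial_wt_Suc[of lam "a - 1"] a by simp
 consider "a = n" | "Suc a = n" | "Suc a < n" using a by force
 then show ?thesis
 proof cases
  case 1
  then show ?thesis using m S
   unfolding dm_def sum_cartanC[OF a] by (simp add: NB_def field_simps)
 next
  case 2
  then have "of_bool (a < n) * NB L lam (Suc a) + of_bool (Suc a = n) * NB L lam n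
   = (of_int (2 * (int L - partial_wt lam (Suc a))) :: rat)" by (simp add: NB_def)
  then show ?thesis using m S 2 partial_wt_Suc[of lam a]
   unfolding dm_def sum_cartanC[OF a] by (simp add: NB_def field_simps)
 next
  case 3
  then show ?thesis using m S partial_wt_Suc[of lam a]
   unfolding dm_def sum_cartanC[OF a] by (simp add: NB_def field_simps)
 qed
qed

lemma dm_pr_B: "a\<in>{Suc 0..n} ==> 0<=dm (Zc (2 * L)) (NB L lam) a \<longleftrightarrow> 0<=pr B1 n a lam"
 by (subst dm_NB) (auto simp: pr_def)

lemma KB_pr: "J\<in>KB L lam ==> i\<in>{1..n} ==> 0<=pr B1 n i lam"
 using dm_pr_B[of i L lam] RC_dm[of J "Zc (2 * L)" "NB L lam" i] by (simp add: KB_def ES_def)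

lemma ealw_letter: "ealw p q ==> \<exists>x\<in>letters B1 n. lpair n x = (p, q)"
 using lpair_surj[of n B1 p q] n_ge_3 by (auto simp: ealw_def letters_simps)

lemma letter_ealw: "x\<in>letters B1 n ==> ealw (fst (lpair n x)) (snd (lpair n x))"
 unfolding ealw_def using n_ge_3 by (cases x) (auto simp: letters_simps)

lemma lpair_Zero_B: "x\<in>letters B1 n ==> fst (lpair n x) = n - 1 & snd (lpair n x) = n \<longleftrightarrow> x = Zero"
 using n_ge_3 by (cases x) (auto simp: letters_simps)

sublocale B: letter_walks B1 n "lpair n" KB Emap BB st "%J. np J (Suc 0)" 4
proof
 show ne: "nonexceptional B1 n" using n_ge_3 by (simp add: nonexceptional_def)
 show "inj_on (lpair n) (letters B1 n)" using lpair_inj[of B1 n] n_ge_3 by (auto simp: inj_on_def)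
 have NT: "a\<in>{Suc 0..n} ==> NB L lam a < of_nat T" if "BB L lam" for L lam a
  using that by (simp add: BB_def)
 show "st (%_ _. {#}) = 0" by (rule st_0)
 show "(%_ _. {#})\<in>KB 0 (%_. 0)"
  using RC_0[of "NB 0 (%_. 0)" "Zc 0"] by (simp add: Zc_def NB_def partial_wt_def KB_def ES_def evn_def)
 show "J = (%_ _. {#})" if "J\<in>KB 0 (%_. 0)" for J
  by (rule RC_empty[of J "Zc 0" "NB 0 (%_. 0)"]) (use that in \<open>auto simp: KB_def ES_def NB_def partial_wt_def\<close>)
 show "lam\<in>weights B1 n & lam 1<=0 & (B1 = A1 --> partial_wt lam (n + 1) = 0)" if "BB 0 lam" "J\<in>KB 0 lam" for lam J
  using RC_N_nonneg[of J "Zc 0" "NB 0 lam" 1] that n_ge_3 by (auto simp: KB_def ES_def BB_def NB_def partial_wt_def)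
 show "BB L (sub_wt lam x)" if B: "BB (Suc L) lam" and x: "x\<in>letters B1 n" for L lam x
 proof -
  have "NB L (sub_wt lam x) a < of_nat T" if a: "a\<in>{Suc 0..n}" for a
  proof -
   have "NB L (sub_wt lam x) a<=NB (Suc L) lam a" unfolding EN_NB[OF a x, symmetric] EN_def by simp
   also have "... < of_nat T" using NT[OF B a] .
   finally show ?thesis .
  qed
  then show ?thesis using B x sub_wt_weights by (auto simp: BB_def)
 qed
 show "0<=pr B1 n i lam" if "J\<in>KB L lam" "i\<in>{1..n}" for L lam J i using KB_pr that .
 have z: "1<=dm (Zc (2 * L)) (NB L lam) n \<longleftrightarrow> 1<=lam n" for L lam
  using dm_NB[of n L lam] n_ge_3 by auto
 have L2: "2 * Suc L = Suc (Suc (2 * L))" for L by simp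
 show "\<exists>x\<in>letters B1 n. \<exists>J'\<in>KB L (sub_wt lam x). Emap J = (lpair n x, J') & (x = Zero --> 1<=lam n)"
  if B: "BB (Suc L) lam" and J: "J\<in>KB (Suc L) lam" for L lam J
 proof -
  obtain p q K2 where k: "Emap J = ((p, q), K2)" "ealw p q" "K2\<in>ES (2 * L) (EN (NB (Suc L) lam) p q)"
   "p = n - 1 & q = n ==> 1<=dm (Zc (Suc (Suc (2 * L)))) (NB (Suc L) lam) n"
   using even_forward[OF J[unfolded KB_def L2] NT[OF B]] by blast
  obtain x where x: "x\<in>letters B1 n" "lpair n x = (p, q)" using ealw_letter[OF k(2)] by blast
  have "K2\<in>KB L (sub_wt lam x)" using ES_step[OF x(1), of "2 * L" L lam] k(3) x(2) by (simp add: KB_def)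
  moreover have "1<=lam n" if "x = Zero" using k(4) z[of "Suc L" lam] x(2) that by auto
  ultimately show ?thesis using x k(1) by (intro bexI[of _ x] bexI[of _ K2]) auto
 qed
 show "\<exists>J\<in>KB (Suc L) lam. Emap J = (lpair n x, J')"
  if B: "BB (Suc L) lam" and x: "x\<in>letters B1 n" and J': "J'\<in>KB L (sub_wt lam x)"
   and pr: "\<forall>i\<in>{1..n}. 0<=pr B1 n i lam" and Z: "x = Zero --> 1<=lam n" for L lam x J'
 proof -
  have dom: "0<=dm (Zc (Suc (Suc (2 * L)))) (NB (Suc L) lam) a" if "a\<in>{Suc 0..n}" for a
   using dm_pr_B[OF that, of "Suc L" lam] pr that by simp
  have zero: "1<=dm (Zc (Suc (Suc (2 * L)))) (NB (Suc L) lam) n" if "fst (lpair n x) = n - 1 & snd (lpair n x) = n"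
   using Z lpair_Zero_B[OF x] that z[of "Suc L" lam] by simp
  have J2: "J'\<in>ES (2 * L) (EN (NB (Suc L) lam) (fst (lpair n x)) (snd (lpair n x)))" using J' ES_step[OF x] by (simp add: KB_def)
  show ?thesis
   using even_backward[OF J2 letter_ealw[OF x] NT[OF B] dom zero] unfolding KB_def L2 by simp
 qed
 show "inj_on Emap (KB (Suc L) lam)" if B: "BB (Suc L) lam" for L lam
  unfolding KB_def L2 by (rule even_inj[OF NT[OF B]])
 show "st J = st J' + 4 * np J (Suc 0)"
  if B: "BB (Suc L) lam" and J: "J\<in>KB (Suc L) lam" and M: "Emap J = (lpair n x, J')" for L lam J x J'
  using even_stat(1)[OF J[unfolded KB_def L2] NT[OF B], of "fst (lpair n x)" "snd (lpair n x)" J'] M by simp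
 have np: "np J (Suc 0) = np J' (Suc 0)
   + (if snd (lpair n x)<=p' then 0 else if snd (lpair n x) = nn & p' = 0 then 2 else 1)"
  if B: "BB (Suc L) lam" and J: "J\<in>KB (Suc L) lam" and M: "Emap J = (lpair n x, J')" "Emap J' = ((p', q'), J'')"
  for L lam J x J' p' q' J''
  using even_stat(2)[OF J[unfolded KB_def L2] NT[OF B] _ M(2), of "fst (lpair n x)" "snd (lpair n x)"] M(1) by simp
 show "np J (Suc 0) = of_bool (x = Phi)"
  if B: "BB 1 lam" and J: "J\<in>KB 1 lam" and x: "x\<in>letters B1 n" "x = Ltr 1 | x = Phi"
   and M: "Emap J = (lpair n x, %_ _. {#})" for lam J x
 proof -
  obtain p' q' J'' where "Emap (%_ _. {#}) = ((p', q'), J'')" by (metis surj_pair)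
  moreover have "x = Ltr 1" using x by (auto simp: letters_simps)
  ultimately show ?thesis
   using np[of 0 lam J x "%_ _. {#}"] B J M np_0 by auto
 qed
 show "np J (Suc 0) = eh B1 n x y + np J' (Suc 0)"
  if B: "BB (Suc (Suc L)) lam" and J: "J\<in>KB (Suc (Suc L)) lam"
   and x: "x\<in>letters B1 n" and y: "y\<in>letters B1 n" and M: "Emap J = (lpair n x, J')" "Emap J' = (lpair n y, J'')"
  for L lam J x J' y J''
 proof -
  have xy: "x ~= Phi" "y ~= Phi" using x y by (auto simp: letters_simps)
  have "snd (lpair n x)<=fst (lpair n y) \<longleftrightarrow> ~ descent B1 n x y"
   using lpair_descent[OF _ x y xy] n_ge_3 by auto
  moreover have "snd (lpair n x) = nn \<longleftrightarrow> x = Bar 1" "fst (lpair n y) = 0 \<longleftrightarrow> y = Ltr 1"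
   using x y n_ge_3 by (cases x; cases y; auto simp: letters_simps)+
  moreover have "descent B1 n (Bar 1) (Ltr 1)" using n_ge_3 by (simp add: descent_def)
  moreover have "eh B1 n x y = (if x = Bar 1 & y = Ltr 1 then 2 else of_bool (descent B1 n x y))"
   using xy by (auto simp: eh_def)
  ultimately show ?thesis
   using np[OF B J M(1), of "fst (lpair n y)" "snd (lpair n y)"] M(2) by auto
 qed
qed

end

section \<open>The fermionic formula as a sum over rigged configurations\<close>

text \<open>Partitions in a box with \<open>m\<close> rows and \<open>p\<close> columns, zero rows
  included; the Gaussian binomial is their generating function.\<close>

definition MS :: "nat => nat => nat multiset set" where
 "MS p m = {M. size M = m & (\<forall>x\<in>#M. x<=p)}"

lemma MS_0: "MS p 0 = {{#}}" "MS 0 m = {replicate_mset m 0}"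
proof -
 have "M = replicate_mset (size M) 0" if "\<forall>x\<in>#M. x<=0" for M :: "nat multiset"
  using that by (induction M) auto
 then show "MS 0 m = {replicate_mset m 0}" by (auto simp: MS_def split: if_splits)
qed (auto simp: MS_def)

text \<open>The Pascal rule for these multisets, by whether the largest possible entry
  occurs.\<close>

lemma MS_Suc: "MS (Suc p) (Suc m) = MS p (Suc m) \<union> add_mset (Suc p) ` MS (Suc p) m"
proof (intro equalityI subsetI)
 fix M assume M: "M\<in>MS (Suc p) (Suc m)"
 show "M\<in>MS p (Suc m) \<union> add_mset (Suc p) ` MS (Suc p) m"
 proof (cases "Suc p \<in># M")
  case True
  then obtain N where "M = add_mset (Suc p) N" by (metis mset_add)
  then show ?thesis using M by (auto simp: MS_def)
 next
  case False
  then have "M\<in>MS p (Suc m)" using M by (auto simp: MS_def) (metis le_Suc_eq)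
  then show ?thesis by blast
 qed
qed (auto simp: MS_def)

lemma finite_MS: "finite (MS p m)"
proof (induction p arbitrary: m)
 case (Suc p)
 show ?case by (induction m) (use Suc in \<open>auto simp: MS_0 MS_Suc\<close>)
qed (simp add: MS_0)

lemma qpoch_Suc: "qpoch q (Suc m) = qpoch q m * (1 - q ^ Suc m)"
 by (simp add: qpoch_def)

text \<open>Stated without division, because \<open>qbinom\<close> is specified as an exact
  quotient.\<close>

lemma gaussian_sum:
 "(\<Sum>M\<in>MS p m. q ^ sum_mset M) * (qpoch q p * qpoch q m) = qpoch q (p + m)"
proof (induction p arbitrary: m)
 case 0
 then show ?case by (simp add: MS_0 qpoch_def)
next
 case (Suc p)
 note IHp = this
 show ?case
 proof (induction m)
  case 0
  then show ?case by (simp add: MS_0 qpoch_def)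
 next
  case (Suc m)
  have "MS p (Suc m) \<inter> add_mset (Suc p) ` MS (Suc p) m = {}" by (auto simp: MS_def)
  then have "(\<Sum>M\<in>MS (Suc p) (Suc m). q ^ sum_mset M)
    = (\<Sum>M\<in>MS p (Suc m). q ^ sum_mset M) + (\<Sum>M\<in>add_mset (Suc p) ` MS (Suc p) m. q ^ sum_mset M)"
   unfolding MS_Suc by (intro sum.union_disjoint) (auto simp: finite_MS)
  also have "(\<Sum>M\<in>add_mset (Suc p) ` MS (Suc p) m. q ^ sum_mset M) = q ^ Suc p * (\<Sum>M\<in>MS (Suc p) m. q ^ sum_mset M)"
   by (subst sum.reindex) (auto simp: inj_on_def sum_distrib_left power_add mult.assoc)
  finally have G: "(\<Sum>M\<in>MS (Suc p) (Suc m). q ^ sum_mset M)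
    = (\<Sum>M\<in>MS p (Suc m). q ^ sum_mset M) + q ^ Suc p * (\<Sum>M\<in>MS (Suc p) m. q ^ sum_mset M)" .
  let ?g = "\<Sum>M\<in>MS p (Suc m). q ^ sum_mset M" and ?g' = "\<Sum>M\<in>MS (Suc p) m. q ^ sum_mset M"
  have "(\<Sum>M\<in>MS (Suc p) (Suc m). q ^ sum_mset M) * (qpoch q (Suc p) * qpoch q (Suc m))
    = (?g * (qpoch q p * qpoch q (Suc m))) * (1 - q ^ Suc p)
     + q ^ Suc p * (?g' * (qpoch q (Suc p) * qpoch q m)) * (1 - q ^ Suc m)"
   unfolding G qpoch_Suc by (simp add: algebra_simps)
  also have "... = qpoch q (p + Suc m) * (1 - q ^ Suc p) + q ^ Suc p * qpoch q (Suc p + m) * (1 - q ^ Suc m)"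
   using IHp[of "Suc m"] Suc by simp
  also have "... = qpoch q (p + Suc m) * (1 - q ^ Suc (p + Suc m))"
   by (simp add: algebra_simps power_add)
  finally show ?case by (simp add: qpoch_Suc)
 qed
qed

lemma qpow_0: "qpow 0 = 1" and qpow_add: "qpow (r + s) = qpow r * qpow s"
 by (simp_all add: qpow_def mult_single)

lemma qpow_power: "qpow r ^ k = qpow (r * of_nat k)"
 by (induction k) (simp_all add: qpow_0 qpow_add[symmetric] algebra_simps)

lemma qpow_sum: "finite A ==> (\<Prod>x\<in>A. qpow (f x)) = qpow (\<Sum>x\<in>A. f x)"
 by (induction A rule: finite_induct) (simp_all add: qpow_0 qpow_add)

lemma qpow_eq_1: "qpow r = 1 \<longleftrightarrow> r = 0"
proof
 assume "qpow r = 1"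
 moreover have "Poly_Mapping.lookup (qpow r) r = 1" unfolding qpow_def by (rule lookup_single_eq)
 ultimately have "Poly_Mapping.lookup (1 :: qpoly) r = 1" by simp
 then show "r = 0" by (simp add: lookup_one when_def split: if_splits)
qed (simp add: qpow_0)

text \<open>For \<open>r > 0\<close> no factor \<open>1 - q ^ k\<close> vanishes, and the ring has
  no zero divisors, so the quotient is unique and \<open>gaussian_sum\<close> identifies it.\<close>

lemma qbinom_eq:
 assumes "r > 0"
 shows "qbinom (qpow r) p m = (\<Sum>M\<in>MS p m. qpow (r * of_nat (sum_mset M)))"
proof -
 have "qpoch (qpow r) k ~= 0" for k
  using assms by (auto simp: qpoch_def qpow_power qpow_eq_1)
 then have nz: "qpoch (qpow r) p * qpoch (qpow r) m ~= 0" by simp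
 have "qbinom (qpow r) p m = (\<Sum>M\<in>MS p m. qpow r ^ sum_mset M)"
  unfolding qbinom_def
 proof (rule the_equality)
  show "(\<Sum>M\<in>MS p m. qpow r ^ sum_mset M) * (qpoch (qpow r) p * qpoch (qpow r) m) = qpoch (qpow r) (p + m)"
   by (rule gaussian_sum)
  then show "x = (\<Sum>M\<in>MS p m. qpow r ^ sum_mset M)"
   if "x * (qpoch (qpow r) p * qpoch (qpow r) m) = qpoch (qpow r) (p + m)" for x
   using that nz by (metis mult_cancel_right)
 qed
 then show ?thesis by (simp add: qpow_power)
qed

definition rig_int :: "aff_type => nat => nat => rat => rat => bool" where
 "rig_int ty n a i x \<longleftrightarrow> (if ty = A2_dagger & a = n & odd_rat i then x - 1/2\<in>\<int> else x\<in>\<int>)"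

definition rig_cfgs :: "aff_type => nat => (nat => int) => nat => ((nat => rat multiset) \<times> (nat => rat => rat multiset)) set" where
 "rig_cfgs ty n lam L =
  {(nu, R). nu\<in>admissible_configs ty n lam L &
   (\<forall>a\<in>{1..n}. \<forall>i. size (R a i) = count (nu a) i &
     (\<forall>x\<in>#R a i. 0<=x & x<=vacancy ty n nu a i & rig_int ty n a i x)) &
   (\<forall>a. a\<notin>{1..n} --> (\<forall>i. R a i = {#}))}"

definition rig_stat :: "aff_type => nat => (nat => rat multiset) \<times> (nat => rat => rat multiset) => rat" where
 "rig_stat ty n = (%(nu, R). cocharge ty n nu + (\<Sum>a=1..n. \<Sum>i\<in>set_mset (nu a). tt_vee ty n a * sum_mset (R a i)))"

text \<open>A half-integral rigging between 0 and an integral vacancy number forces this number to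
  be at least 1. This yields the condition on odd parts in
  \<open>dagger_rigged_configs\<close>.\<close>

lemma Mbar_dagger_rigged:
 assumes "n>=1" and "!!nu R a i. (nu, R)\<in>rig_cfgs A2_dagger n lam L ==> a\<in>{1..n} ==> i\<in>part_sizes A2_dagger n a ==> vacancy A2_dagger n nu a i\<in>\<int>"
 shows "Mbar_dagger n lam L = (\<Sum>p\<in>rig_cfgs A2_dagger n lam L. qpow (rig_stat A2_dagger n p))"
proof -
 have "dagger_rigged_configs n lam L = rig_cfgs A2_dagger n lam L"
 proof (intro equalityI subsetI)
  fix p assume "p\<in>dagger_rigged_configs n lam L"
  then show "p\<in>rig_cfgs A2_dagger n lam L"
   by (auto simp: dagger_rigged_configs_def rig_cfgs_def rig_int_def)
 next
  fix p assume p: "p\<in>rig_cfgs A2_dagger n lam L"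
  obtain nu R where nR: "p = (nu, R)" by (cases p)
  have "1<=vacancy A2_dagger n nu n i" if i: "i\<in>part_sizes A2_dagger n n" "odd_rat i" "count (nu n) i > 0" for i
  proof -
   have n: "n\<in>{1..n}" using \<open>n>=1\<close> by simp
   have "size (R n i) > 0" using p nR i n by (auto simp: rig_cfgs_def)
   then obtain x where "x \<in># R n i" by (metis size_eq_0_iff_empty multiset_nonemptyE less_numeral_extra(3))
   moreover have "\<forall>a\<in>{1..n}. \<forall>i. \<forall>x\<in>#R a i. 0<=x & x<=vacancy A2_dagger n nu a i & rig_int A2_dagger n a i x"
    using p nR by (simp add: rig_cfgs_def)
   ultimately have x: "0<=x" "x<=vacancy A2_dagger n nu n i" "rig_int A2_dagger n n i x" using n by blast+
   then have "x - 1/2\<in>\<int>" using i(2) by (simp add: rig_int_def)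
   then obtain k where k: "x - 1/2 = of_int k" by (auto elim: Ints_cases)
   obtain l where l: "vacancy A2_dagger n nu n i = of_int l" using assms(2)[OF p[unfolded nR] n i(1)] by (auto elim: Ints_cases)
   have "(0::rat) < of_int (2 * k + 2)" using k x(1) by simp
   then have "0<=k" by (simp only: of_int_0_less_iff)
   then have "0 < x" using k by simp
   then have "0 < l" using x(2) l by simp
   then show ?thesis using l by simp
  qed
  then show "p\<in>dagger_rigged_configs n lam L"
   using p nR by (auto simp: dagger_rigged_configs_def rig_cfgs_def rig_int_def)
 qed
 moreover have "tt_vee A2_dagger n a = 1" for a by (simp add: tt_vee_def)
 ultimately show ?thesis unfolding Mbar_dagger_def rig_stat_def by (intro sum.cong) auto
qed

lemma config_parts_pos:
 assumes "is_config ty n lam L nu" "a\<in>{1..n}" "i \<in># nu a"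
 shows "i\<in>part_sizes ty n a"
 using assms by (auto simp: is_config_def)

lemma fst_rig_cfgs:
 assumes "ty ~= A2_dagger"
 shows "fst ` rig_cfgs ty n lam L = admissible_configs ty n lam L"
proof (intro equalityI subsetI)
 fix nu assume nu: "nu\<in>admissible_configs ty n lam L"
 define R :: "nat => rat => rat multiset" where "R a i = (if a\<in>{1..n} then replicate_mset (count (nu a) i) 0 else {#})" for a i
 have "(nu, R)\<in>rig_cfgs ty n lam L"
  using nu assms config_parts_pos[of ty n lam L nu]
  by (auto simp: rig_cfgs_def R_def admissible_configs_def rig_int_def split: if_splits)
 then show "nu\<in>fst ` rig_cfgs ty n lam L" by (auto intro: rev_image_eqI)
qed (auto simp: rig_cfgs_def)

lemma Mbar_generic_rigged:
 assumes ty: "ty ~= A2_dagger" and fin: "finite (rig_cfgs ty n lam L)"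
 shows "Mbar_generic ty n lam L = (\<Sum>p\<in>rig_cfgs ty n lam L. qpow (rig_stat ty n p))"
proof -
 have fa: "finite (admissible_configs ty n lam L)" using fin fst_rig_cfgs[OF ty, of n lam L] by (metis finite_imageI)
 have "qpow (cocharge ty n nu) * (\<Prod>a = 1..n. \<Prod>i\<in>set_mset (nu a).
     qbinom (qpow (tt_vee ty n a)) (nat \<lfloor>vacancy ty n nu a i\<rfloor>) (count (nu a) i))
   = (\<Sum>p\<in>{p\<in>rig_cfgs ty n lam L. fst p = nu}. qpow (rig_stat ty n p))"
  if nu: "nu\<in>admissible_configs ty n lam L" for nu
 proof -
  define I where "I = (SIGMA a:{1..n}. set_mset (nu a))"
  define B where "B = (%(a, i). MS (nat \<lfloor>vacancy ty n nu a i\<rfloor>) (count (nu a) i))"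
  have fI: "finite I" by (simp add: I_def)
  have vac: "0<=vacancy ty n nu a i" if "(a, i)\<in>I" for a i
   using nu that config_parts_pos[of ty n lam L nu] by (auto simp: I_def admissible_configs_def)
  have pos: "tt_vee ty n a > 0" for a by (simp add: tt_vee_def)
  have "(\<Prod>a = 1..n. \<Prod>i\<in>set_mset (nu a).
     qbinom (qpow (tt_vee ty n a)) (nat \<lfloor>vacancy ty n nu a i\<rfloor>) (count (nu a) i))
    = (\<Prod>(a, i)\<in>I. qbinom (qpow (tt_vee ty n a)) (nat \<lfloor>vacancy ty n nu a i\<rfloor>) (count (nu a) i))"
   unfolding I_def by (rule prod.Sigma) auto
  also have "... = (\<Prod>x\<in>I. \<Sum>M\<in>B x. qpow (tt_vee ty n (fst x) * of_nat (sum_mset M)))"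
   by (intro prod.cong refl) (auto simp: B_def qbinom_eq[OF pos])
  \<comment> \<open>Expanding the product of sums amounts to choosing one multiset for each colour
    and part size, that is, a family of riggings.\<close>
  also have "... = (\<Sum>g\<in>PiE I B. \<Prod>x\<in>I. qpow (tt_vee ty n (fst x) * of_nat (sum_mset (g x))))"
   by (rule prod_sum_PiE[OF fI]) (auto simp: B_def finite_MS split: prod.splits)
  also have "... = (\<Sum>g\<in>PiE I B. qpow (\<Sum>x\<in>I. tt_vee ty n (fst x) * of_nat (sum_mset (g x))))"
   by (simp add: qpow_sum[OF fI])
  finally have "qpow (cocharge ty n nu) * (\<Prod>a = 1..n. \<Prod>i\<in>set_mset (nu a).
     qbinom (qpow (tt_vee ty n a)) (nat \<lfloor>vacancy ty n nu a i\<rfloor>) (count (nu a) i))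
    = (\<Sum>g\<in>PiE I B. qpow (cocharge ty n nu + (\<Sum>x\<in>I. tt_vee ty n (fst x) * of_nat (sum_mset (g x)))))"
   by (simp add: sum_distrib_left qpow_add)
  also have "... = (\<Sum>p\<in>{p\<in>rig_cfgs ty n lam L. fst p = nu}. qpow (rig_stat ty n p))"
  proof (rule sum.reindex_bij_witness[where
     j = "%g. (nu, %a i. if (a, i)\<in>I then image_mset of_nat (g (a, i)) else {#})"
     and i = "%p. restrict (%(a, i). image_mset (%x. nat \<lfloor>x\<rfloor>) (snd p a i)) I"])
   fix g assume g: "g\<in>PiE I B"
   let ?R = "%a i. if (a, i)\<in>I then image_mset of_nat (g (a, i)) else {#} :: rat multiset"
   show "restrict (%(a, i). image_mset (%x. nat \<lfloor>x\<rfloor>) (snd (nu, ?R) a i)) I = g"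
    using g by (auto simp: PiE_def extensional_def fun_eq_iff multiset.map_comp comp_def)
   have gm: "size (g (a, i)) = count (nu a) i" "x \<in># g (a, i) ==> of_nat x<=vacancy ty n nu a i" if "(a, i)\<in>I" for a i x
   proof -
    have "g (a, i)\<in>B (a, i)" using g that by blast
    then have "g (a, i)\<in>MS (nat \<lfloor>vacancy ty n nu a i\<rfloor>) (count (nu a) i)" by (simp add: B_def)
    then show "size (g (a, i)) = count (nu a) i" "x \<in># g (a, i) ==> of_nat x<=vacancy ty n nu a i"
     using vac[OF that] by (auto simp: MS_def le_nat_iff le_floor_iff)
   qed
   have out: "count (nu a) i = 0" if "(a, i)\<notin>I" "a\<in>{1..n}" for a i
    using that by (auto simp: I_def not_in_iff)
   show "(nu, ?R)\<in>{p\<in>rig_cfgs ty n lam L. fst p = nu}"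
    using nu gm out ty unfolding rig_cfgs_def rig_int_def by (auto simp: I_def)
   have "(\<Sum>a=1..n. \<Sum>i\<in>set_mset (nu a). tt_vee ty n a * sum_mset (?R a i)) = (\<Sum>(a, i)\<in>I. tt_vee ty n a * sum_mset (?R a i))"
    unfolding I_def by (rule sum.Sigma) auto
   also have "... = (\<Sum>x\<in>I. tt_vee ty n (fst x) * of_nat (sum_mset (g x)))"
    by (intro sum.cong) (auto simp: of_nat_sum_mset)
   finally show "qpow (rig_stat ty n (nu, ?R)) = qpow (cocharge ty n nu + (\<Sum>x\<in>I. tt_vee ty n (fst x) * of_nat (sum_mset (g x))))"
    by (simp add: rig_stat_def)
  next
   fix p assume "p\<in>{p\<in>rig_cfgs ty n lam L. fst p = nu}"
   then obtain R where p: "p = (nu, R)" "(nu, R)\<in>rig_cfgs ty n lam L" by (cases p) auto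
   have R: "size (R a i) = count (nu a) i" "x \<in># R a i ==> 0<=x & x<=vacancy ty n nu a i & x\<in>\<int>"
    if "a\<in>{1..n}" for a i x
    using p(2) that ty by (auto simp: rig_cfgs_def rig_int_def)
   have Rout: "R a i = {#}" if "(a, i)\<notin>I" for a i
   proof (cases "a\<in>{1..n}")
    case True
    then show ?thesis using R(1)[OF True, of i] that by (auto simp: I_def not_in_iff)
   next
    case False
    then show ?thesis using p(2) by (auto simp: rig_cfgs_def)
   qed
   have id: "image_mset (%x. of_nat (nat \<lfloor>x\<rfloor>)) (R a i) = R a i" if "(a, i)\<in>I" for a i
   proof -
    have "image_mset (%x. of_nat (nat \<lfloor>x\<rfloor>)) (R a i) = image_mset (%x. x) (R a i)"
     using R(2)[of a _ i] that by (intro image_mset_cong) (auto simp: I_def elim!: Ints_cases)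
    then show ?thesis by simp
   qed
   show "(nu, %a i. if (a, i)\<in>I then image_mset of_nat (restrict (%(a, i). image_mset (%x. nat \<lfloor>x\<rfloor>) (snd p a i)) I (a, i)) else {#}) = p"
    using id Rout by (auto simp: p(1) fun_eq_iff multiset.map_comp comp_def)
   show "restrict (%(a, i). image_mset (%x. nat \<lfloor>x\<rfloor>) (snd p a i)) I\<in>PiE I B"
    using R by (auto simp: p(1) B_def MS_def I_def intro!: nat_mono floor_mono)
  qed
  finally show ?thesis .
 qed
 then have "Mbar_generic ty n lam L = (\<Sum>nu\<in>admissible_configs ty n lam L. \<Sum>p\<in>{p\<in>rig_cfgs ty n lam L. fst p = nu}. qpow (rig_stat ty n p))"
  unfolding Mbar_generic_def by (intro sum.cong) auto
 also have "... = (\<Sum>p\<in>rig_cfgs ty n lam L. qpow (rig_stat ty n p))"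
  by (rule sum.group[OF fin fa]) (simp add: fst_rig_cfgs[OF ty])
 finally show ?thesis .
qed

text \<open>The vacancy number as a linear expression in abstract box counts, so that the comparison
  with \<open>vac\<close> becomes the identity \<open>vac_eq\<close> in an arbitrary
  \<open>Q\<close>.\<close>

definition vacQ :: "aff_type => nat => (nat => rat) => nat => rat" where
 "vacQ ty n Q a =
  (if ty = A1 & a = n then Q (n - 1) - 2 * Q n
  else if ty = D1 & a = n - 2 then Q (n - 3) - 2 * Q (n - 2) + Q (n - 1) + Q n
  else if ty = D1 & a\<in>{n - 1, n} then Q (n - 2) - 2 * Q a
  else if ty = B1 & a = n - 1 then Q (n - 2) - 2 * Q (n - 1) + 2 * Q n
  else if ty = B1 & a = n then 2 * Q (n - 1) - 4 * Q n
  else if ty\<in>{C1, A2_even, A2_dagger} & a = n then Q (n - 1) - Q n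
  else if ty = A2_odd & a = n - 1 then Q (n - 2) - 2 * Q (n - 1) + 2 * Q n
  else if ty = A2_odd & a = n then Q (n - 1) - 2 * Q n
  else if ty = D2 & a = n then 2 * Q (n - 1) - 2 * Q n
  else Q (a - 1) - 2 * Q a + Q (a + 1))"

lemma vacancy_vacQ: "vacancy ty n nu a i = vacQ ty n (%b. Qsum i (nu b)) a"
 by (simp add: vacancy_def vacQ_def Let_def)

text \<open>As \<open>tt b / upsilon a\<close> is symmetric in the two colours
  (\<open>tt_upsilon\<close>), it can be pulled out of the minimum in the cocharge.
  \<open>BF\<close> is the coefficient that then stands before \<open>min x y\<close>.\<close>

definition BF :: "aff_type => nat => nat => nat => rat" where
 "BF ty n a b = wt_form ty n (simple_root ty n a) (simple_root ty n b) * (tt ty n b / upsilon ty n a)"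

lemma tt_upsilon: "tt ty n b / upsilon ty n a = tt ty n a / upsilon ty n b & 0 < tt ty n b / upsilon ty n a"
 if "a<=n" "b<=n" for ty n a b
 using that by (auto simp: tt_def upsilon_def)

text \<open>
 A part \<open>i\<close> becomes a part of size \<open>t = s i\<close>, and a rigging \<open>x\<close> of colour \<open>a\<close> becomes \<open>\<rho> a x\<close>; the colours of
 \<open>C\<close> are folded to \<open>{1..n}\<close> by \<open>fc\<close>. The colours with \<open>ev a\<close> have parts of even size only.
\<close>
locale fermi = rc +
 fixes ty :: aff_type and n :: nat and lam :: "nat => int" and L :: nat
  and Z :: "nat => int" and N :: "nat => rat" and s :: nat and \<rho> fc :: "nat => nat"
  and ev :: "nat => bool" and cl :: "nat => nat => int => bool" and c :: int
 assumes fermi_n: "n>=1" and s_cases: "s = 1 | (s = 2 & (\<forall>a\<in>{1..n}. a ~= n --> ev a))"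
  and rho_pos: "!!a. \<rho> a>=1" and c_pos: "c > 0" and Z_nonneg: "!!a. Z a>=0"
  and fc_C: "!!a. a\<in>C ==> fc a\<in>{1..n}" and fc_id: "!!a. a\<in>{1..n} ==> fc a = a" and sub_C: "{1..n} \<subseteq> C"
  and part_iff: "!!a t. a\<in>{1..n} ==> of_nat t / of_nat s\<in>part_sizes ty n a \<longleftrightarrow> t>=1 & (ev a --> even t)"
  and part_hat: "!!a i. a\<in>{1..n} ==> i\<in>part_sizes ty n a ==> \<exists>t. i = of_nat t / of_nat s"
  and cl_iff: "!!a t x. a\<in>{1..n} ==> t>=1 ==> (ev a --> even t) ==>
    rig_int ty n a (of_nat t / of_nat s) (of_int x / of_nat (\<rho> a)) \<longleftrightarrow> cl a t x"
  and rig_hat: "!!a i r. a\<in>{1..n} ==> rig_int ty n a i r ==> \<exists>x::int. r = of_int x / of_nat (\<rho> a)"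
  and vac_eq: "!!a Q. a\<in>C ==> Q 0 = of_nat L | (s = 2 & fc a = n) ==>
    of_int (Z a) - (\<Sum>b\<in>C. of_int (A a b) * (of_nat s * Q (fc b))) = of_nat (\<rho> (fc a)) * vacQ ty n Q (fc a)"
  and N_eq: "!!a. a\<in>C ==> N a = of_nat s * config_size ty n lam L (fc a)"
  and N_T: "!!a. a\<in>C ==> N a < of_nat T"
  and form_eq: "!!f. 2 * of_nat s * (\<Sum>a\<in>C. \<Sum>b\<in>C. of_int (d a * A a b) * f (fc a) (fc b))
    = of_int c * (\<Sum>a=1..n. \<Sum>b=1..n. BF ty n a b * f a b)"
  and d_eq: "!!g. 2 * (\<Sum>a\<in>C. of_int (d a) * g (fc a)) = of_int c * (\<Sum>a=1..n. tt_vee ty n a / of_nat (\<rho> a) * g a)"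
  and A1_wt: "ty = A1 ==> partial_wt lam (n + 1) = int L"
begin

abbreviation ts :: "nat => rat" where "ts t \<equiv> of_nat t / of_nat s"

definition KF :: "riggings set" where
 "KF = {J\<in>RC Z N. (\<forall>a\<in>C. J a = J (fc a)) &
  (\<forall>a\<in>{1..n}. \<forall>t. (ev a & odd t --> J a t = {#}) & (\<forall>x\<in>#J a t. cl a t x))}"

definition nuJ :: "riggings => nat => rat multiset" where
 "nuJ J a = (if a = 0 then replicate_mset L 1 else if a<=n
  then \<Sum>t=1..T. replicate_mset (size (J a t)) (ts t) else {#})"

definition tix :: "rat => nat" where
 "tix i = (if \<exists>t. i = ts t then THE t. i = ts t else 0)"

definition RJ :: "riggings => nat => rat => rat multiset" where
 "RJ J a i = (if a\<in>{1..n} then image_mset (%x. of_int x / of_nat (\<rho> a)) (J a (tix i)) else {#})"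

text \<open>The rounding is exact: by \<open>rig_hat\<close> every rigging that occurs becomes an
  integer when multiplied by \<open>\<rho>\<close>.\<close>

definition GJ :: "(nat => rat multiset) \<times> (nat => rat => rat multiset) => riggings" where
 "GJ p a t = (if a\<in>C & 1<=t & t<=T
  then image_mset (%r. \<lfloor>of_nat (\<rho> (fc a)) * r\<rfloor>) (snd p (fc a) (ts t)) else {#})"

lemma s_pos: "s>=1"
 using s_cases by auto

lemma s_neq_0 [simp]: "s ~= 0"
 using s_pos by simp

lemma div_s_inject: "ts t = (of_nat t' / of_nat s :: rat) \<longleftrightarrow> t = t'"
 using s_pos by (simp add: field_simps)

lemma tix_eq [simp]: "tix (ts t) = t"
 by (auto simp: tix_def div_s_inject)

lemma tix_other: "\<nexists>t. i = ts t ==> tix i = 0"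
 by (simp add: tix_def)

lemma count_nuJ:
 assumes "a\<in>{1..n}"
 shows "1<=t ==> t<=T ==> count (nuJ J a) (ts t) = size (J a t)"
  and "(!!t. 1<=t ==> t<=T ==> i ~= ts t) ==> count (nuJ J a) i = 0"
proof -
 have e: "count (nuJ J a) i = (\<Sum>t=1..T. if ts t = i then size (J a t) else 0)" for i
  using assms by (auto simp: nuJ_def count_sum intro!: sum.cong)
 show "count (nuJ J a) (ts t) = size (J a t)" if "1<=t" "t<=T"
  unfolding e div_s_inject using that by simp
 show "count (nuJ J a) i = 0" if "!!t. 1<=t ==> t<=T ==> i ~= ts t"
  unfolding e
 proof (intro sum.neutral ballI)
  fix t assume "t\<in>{1..T}"
  then show "(if ts t = i then size (J a t) else 0) = 0" using that[of t] by auto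
 qed
qed

lemma set_nuJ:
 assumes "a\<in>{1..n}"
 shows "set_mset (nuJ J a) = (%t. ts t) ` {t\<in>{1..T}. J a t ~= {#}}"
proof -
 have "set_mset (nuJ J a) = (\<Union>t\<in>{1..T}. set_mset (replicate_mset (size (J a t)) (ts t)))"
  using assms by (simp add: nuJ_def set_mset_sum)
 also have "... = (%t. ts t) ` {t\<in>{1..T}. J a t ~= {#}}"
  by (auto split: if_splits)
 finally show ?thesis .
qed

lemma sum_set_nuJ:
 assumes "a\<in>{1..n}" "!!t. J a t = {#} ==> g (ts t) = 0"
 shows "(\<Sum>i\<in>set_mset (nuJ J a). g i) = (\<Sum>t=1..T. (g (ts t) :: rat))"
proof -
 have "inj_on (%t. ts t :: rat) {t\<in>{1..T}. J a t ~= {#}}" by (auto simp: inj_on_def div_s_inject)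
 then have "(\<Sum>i\<in>set_mset (nuJ J a). g i) = (\<Sum>t\<in>{t\<in>{1..T}. J a t ~= {#}}. g (ts t))"
  unfolding set_nuJ[OF assms(1)] by (simp add: sum.reindex)
 also have "... = (\<Sum>t=1..T. g (ts t))"
  by (rule sum.mono_neutral_left) (use assms(2) in auto)
 finally show ?thesis .
qed

lemma sum_mset_nuJ:
 fixes g :: "rat => rat"
 assumes "a\<in>{1..n}"
 shows "(\<Sum>i\<in>#nuJ J a. g i) = (\<Sum>t=1..T. of_nat (size (J a t)) * g (ts t))"
proof -
 have "(\<Sum>i\<in># (\<Sum>t\<in>F. replicate_mset (size (J a t)) (ts t)). g i)
   = (\<Sum>t\<in>F. of_nat (size (J a t)) * g (ts t))" if "finite F" for F
  using that by (induction F rule: finite_induct) auto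
 then show ?thesis using assms by (simp add: nuJ_def)
qed

lemma Qsum_nuJ:
 assumes "a\<in>{1..n}"
 shows "of_nat s * Qsum (ts t) (nuJ J a) = of_int (Qn T (m_of J a) t)"
proof -
 have m: "min (of_nat t' / of_nat s) (ts t) = (of_nat (min t' t) / of_nat s :: rat)" for t'
  using s_pos by (auto simp: min_def divide_le_cancel)
 show ?thesis
  unfolding Qsum_def sum_mset_nuJ[OF assms] m using s_pos
  by (simp add: Qn_def m_of_def sum_distrib_left mult.commute)
qed

lemma sum_nuJ:
 assumes "a\<in>{1..n}"
 shows "of_nat s * sum_mset (nuJ J a) = of_int (Qn T (m_of J a) T)"
 using sum_mset_nuJ[OF assms, of "%i. i" J] s_pos
 by (simp add: Qn_at_top m_of_def sum_distrib_left mult.commute)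

lemma vac_nuJ:
 assumes a: "a\<in>C" and sym: "\<forall>b\<in>C. J b = J (fc b)" and t: "t>=1" "ev (fc a) --> even t"
 shows "of_int (vac Z J a t) = of_nat (\<rho> (fc a)) * vacancy ty n (nuJ J) (fc a) (ts t)"
proof -
 let ?Q = "%b. Qsum (ts t) (nuJ J b)"
 \<comment> \<open>The parts of \<nu>^(0) have size 1, so they contribute \<open>L\<close> only for
   sizes at least 1. The single smaller size is 1/2, which belongs to colour \<open>n\<close> when
   \<open>s = 2\<close>; \<open>vac_eq\<close> allows for this.\<close>
 have Q0: "?Q 0 = of_nat L | (s = 2 & fc a = n)"
 proof (cases "t>=s")
  case True
  then have "min 1 (ts t) = (1 :: rat)" using s_pos by (auto simp: min_def divide_simps)
  then show ?thesis by (simp add: nuJ_def Qsum_def)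
 next
  case False
  then have "s = 2" "t = 1" using s_cases t(1) by auto
  then show ?thesis using s_cases t(2) fc_C[OF a] by auto
 qed
 have "of_int (vac Z J a t) = (of_int (Z a) - (\<Sum>b\<in>C. of_int (A a b) * of_int (Qn T (m_of J b) t)) :: rat)"
  using t by (simp add: vac_def)
 also have "(\<Sum>b\<in>C. of_int (A a b) * of_int (Qn T (m_of J b) t)) = (\<Sum>b\<in>C. of_int (A a b) * (of_nat s * ?Q (fc b)))"
 proof (rule sum.cong[OF refl])
  fix b assume b: "b\<in>C"
  have "m_of J b = m_of J (fc b)" using sym b by (simp add: m_of_def fun_eq_iff)
  then show "of_int (A a b) * of_int (Qn T (m_of J b) t) = of_int (A a b) * (of_nat s * ?Q (fc b))"
   using Qsum_nuJ[OF fc_C[OF b]] by simp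
 qed
 finally show ?thesis using vac_eq[of a ?Q] a Q0 by (simp add: vacancy_vacQ)
qed

lemma KF_D:
 assumes "J\<in>KF"
 shows "J\<in>RC Z N" "\<forall>b\<in>C. J b = J (fc b)" "a\<in>{1..n} ==> ev a ==> odd t ==> J a t = {#}"
  "a\<in>{1..n} ==> x \<in># J a t ==> cl a t x"
 using assms unfolding KF_def by blast+

lemma KF_rig_cfgs:
 assumes J: "J\<in>KF"
 shows "(nuJ J, RJ J)\<in>rig_cfgs ty n lam L"
proof -
 note D = KF_D[OF J]
 have nC: "a\<in>C" if "a\<in>{1..n}" for a using sub_C that by blast
 have cfg: "is_config ty n lam L (nuJ J)"
 proof -
  have "set_mset (nuJ J a) \<subseteq> part_sizes ty n a" if a: "a\<in>{1..n}" for a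
  proof
   fix i assume "i \<in># nuJ J a"
   then obtain t where t: "i = ts t" "t>=1" "J a t ~= {#}" unfolding set_nuJ[OF a] by auto
   then show "i\<in>part_sizes ty n a" using part_iff[OF a, of t] D(3)[OF a] by auto
  qed
  moreover have "sum_mset (nuJ J a) = config_size ty n lam L a" if a: "a\<in>{1..n}" for a
  proof -
   have "of_nat s * sum_mset (nuJ J a) = of_nat s * config_size ty n lam L a"
    using sum_nuJ[OF a, of J] RC_D(2)[OF D(1) nC[OF a]] N_eq[OF nC[OF a]] fc_id[OF a] by simp
   then show ?thesis using s_pos by simp
  qed
  ultimately show ?thesis using A1_wt by (auto simp: is_config_def nuJ_def)
 qed
 have vac: "of_int (vac Z J a t) = of_nat (\<rho> a) * vacancy ty n (nuJ J) a (ts t)"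
  if "a\<in>{1..n}" "t>=1" "ev a --> even t" for a t
  using vac_nuJ[OF nC[OF that(1)] D(2) that(2)] that fc_id[OF that(1)] by simp
 have adm: "0<=vacancy ty n (nuJ J) a i" if a: "a\<in>{1..n}" and i: "i\<in>part_sizes ty n a" for a i
 proof -
  obtain t where t: "i = ts t" using part_hat[OF a i] by blast
  then have "t>=1" "ev a --> even t" using part_iff[OF a] i by auto
  then have "0<=of_nat (\<rho> a) * vacancy ty n (nuJ J) a i"
   using vac[OF a] t RC_D(3)[OF D(1) nC[OF a], of t] by (metis of_int_0_le_iff)
  then show ?thesis using rho_pos[of a] by (simp add: zero_le_mult_iff)
 qed
 have rig: "size (RJ J a i) = count (nuJ J a) i &
   (\<forall>x\<in>#RJ J a i. 0<=x & x<=vacancy ty n (nuJ J) a i & rig_int ty n a i x)" if a: "a\<in>{1..n}" for a i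
 proof (cases "\<exists>t. 1<=t & t<=T & i = ts t")
  case True
  then obtain t where t: "1<=t" "t<=T" "i = ts t" by blast
  have R: "RJ J a i = image_mset (%x. of_int x / of_nat (\<rho> a)) (J a t)" using a t(3) by (simp add: RJ_def)
  have "0<=y / of_nat (\<rho> a) & y / of_nat (\<rho> a)<=vacancy ty n (nuJ J) a i & rig_int ty n a i (y / of_nat (\<rho> a))"
   if y: "x \<in># J a t" "y = of_int x" for x y
  proof -
   have e: "ev a --> even t" using D(3)[OF a, of t] y(1) by (metis empty_iff set_mset_empty)
   have "0<=x" "x<=vac Z J a t" using RC_D(4,5)[OF D(1) nC[OF a] y(1)] by auto
   then have "0<=y" "y<=of_nat (\<rho> a) * vacancy ty n (nuJ J) a i"
    using vac[OF a t(1) e] y(2) t(3) by (metis of_int_0_le_iff, metis of_int_le_iff)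
   moreover have "rig_int ty n a i (y / of_nat (\<rho> a))" using cl_iff[OF a t(1) e] D(4)[OF a y(1)] t(3) y(2) by simp
   ultimately show ?thesis using rho_pos[of a] by (simp add: pos_divide_le_eq mult.commute)
  qed
  then show ?thesis unfolding R using count_nuJ(1)[OF a t(1,2), of J] t(3) by auto
 next
  case False
  have "J a (tix i) = {#}"
  proof (cases "\<exists>t. i = ts t")
   case True
   then obtain t where t: "i = ts t" by blast
   then have "t < 1 | t > T" using False by auto
   then show ?thesis using RC_D(1)[OF D(1)] t by (auto simp: supported_def)
  next
   case False
   then show ?thesis using tix_other[OF False] RC_D(1)[OF D(1)] by (simp add: supported_def)
  qed
  then have "RJ J a i = {#}" by (simp add: RJ_def)
  moreover have "count (nuJ J a) i = 0" by (rule count_nuJ(2)[OF a]) (use False in blast)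
  ultimately show ?thesis by simp
 qed
 have "RJ J a i = {#}" if "a\<notin>{1..n}" for a i using that by (auto simp: RJ_def)
 then show ?thesis using cfg adm rig by (simp add: rig_cfgs_def admissible_configs_def)
qed

lemma GJ_inverse_left:
 assumes J: "J\<in>KF"
 shows "GJ (nuJ J, RJ J) = J"
proof (intro ext)
 fix a t
 note D = KF_D[OF J]
 show "GJ (nuJ J, RJ J) a t = J a t"
 proof (cases "a\<in>C & 1<=t & t<=T")
  case True
  then have a: "fc a\<in>{1..n}" using fc_C by blast
  have "GJ (nuJ J, RJ J) a t = image_mset (%x. \<lfloor>of_nat (\<rho> (fc a)) * (of_int x / of_nat (\<rho> (fc a)) :: rat)\<rfloor>) (J (fc a) t)"
   using True a by (simp add: GJ_def RJ_def multiset.map_comp comp_def)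
  also have "... = J (fc a) t" using rho_pos[of "fc a"] by simp
  also have "... = J a t" using D(2) True by metis
  finally show ?thesis .
 next
  case False
  then show ?thesis using RC_D(1)[OF D(1)] by (auto simp: GJ_def supported_def)
 qed
qed

lemma rig_cfgs_KF:
 assumes p: "p\<in>rig_cfgs ty n lam L"
 shows "nuJ (GJ p) = fst p" "RJ (GJ p) = snd p" "GJ p\<in>KF"
proof -
 obtain nu R where nR: "p = (nu, R)" by (cases p)
 have cfg: "is_config ty n lam L nu" and vac0: "!!a i. a\<in>{1..n} ==> i\<in>part_sizes ty n a ==> 0<=vacancy ty n nu a i"
  using p by (auto simp: nR rig_cfgs_def admissible_configs_def)
 have R: "size (R a i) = count (nu a) i" "x \<in># R a i ==> 0<=x & x<=vacancy ty n nu a i & rig_int ty n a i x"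
  if "a\<in>{1..n}" for a i x using p that by (auto simp: nR rig_cfgs_def)
 have Rout: "R a i = {#}" if "a\<notin>{1..n}" for a i using p that by (auto simp: nR rig_cfgs_def)
 have nC: "a\<in>C" if "a\<in>{1..n}" for a using sub_C that by blast
 have part: "\<exists>t. i = ts t & 1<=t & t<=T & (ev a --> even t)" if a: "a\<in>{1..n}" and i: "i \<in># nu a" for a i
 proof -
  have ip: "i\<in>part_sizes ty n a" using cfg a i by (auto simp: is_config_def)
  then obtain t where t: "i = ts t" using part_hat[OF a] by blast
  then have t1: "t>=1" "ev a --> even t" using part_iff[OF a] ip by auto
  have pos: "0<=j" if "j \<in># nu a" for j
  proof -
   have "j\<in>part_sizes ty n a" using cfg a that by (auto simp: is_config_def)
   then show ?thesis by (auto simp: part_sizes_def upsilon_def)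
  qed
  obtain M where M: "nu a = add_mset i M" using i by (metis mset_add)
  have "0<=sum_mset M'" if "\<forall>j\<in>#M'. 0<=j" for M' :: "rat multiset"
   using that by (induction M') auto
  then have "0<=sum_mset M" using pos M by auto
  then have "i<=sum_mset (nu a)" using M by simp
  then have "i<=config_size ty n lam L a" using cfg a by (simp add: is_config_def)
  then have "of_nat s * i<=N a" using N_eq[OF nC[OF a]] fc_id[OF a] by (simp add: mult_left_mono)
  also have "... < of_nat T" using N_T[OF nC[OF a]] .
  finally have "of_nat t < (of_nat T :: rat)" using t s_pos by simp
  then have "t<=T" by simp
  then show ?thesis using t t1 by blast
 qed
 have G: "GJ p a t = image_mset (%r. \<lfloor>of_nat (\<rho> (fc a)) * r\<rfloor>) (R (fc a) (ts t))"
  if "a\<in>C" "1<=t" "t<=T" for a t using that by (simp add: GJ_def nR)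
 show nu: "nuJ (GJ p) = fst p"
 proof
  fix a
  consider "a = 0" | "a > n" | "a\<in>{1..n}" by force
  then show "nuJ (GJ p) a = fst p a"
  proof cases
   case 3
   show ?thesis
   proof (rule multiset_eqI)
    fix i
    show "count (nuJ (GJ p) a) i = count (fst p a) i"
    proof (cases "\<exists>t. 1<=t & t<=T & i = ts t")
     case True
     then obtain t where t: "1<=t" "t<=T" "i = ts t" by blast
     then show ?thesis using count_nuJ(1)[OF 3 t(1,2)] G[OF nC[OF 3] t(1,2)] R(1)[OF 3] fc_id[OF 3] by (simp add: nR)
    next
     case False
     then have "i \<notin># nu a" using part[OF 3] by blast
     moreover have "count (nuJ (GJ p) a) i = 0" by (rule count_nuJ(2)[OF 3]) (use False in blast)
     ultimately show ?thesis by (simp add: nR not_in_iff)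
    qed
   qed
  qed (use cfg fermi_n in \<open>auto simp: nuJ_def nR is_config_def\<close>)
 qed
 have hat: "image_mset (%r. of_int \<lfloor>of_nat (\<rho> a) * r\<rfloor> / of_nat (\<rho> a)) (R a i) = R a i" if a: "a\<in>{1..n}" for a i
 proof -
  have "image_mset (%r. of_int \<lfloor>of_nat (\<rho> a) * r\<rfloor> / of_nat (\<rho> a)) (R a i) = image_mset (%r. r) (R a i)"
  proof (rule image_mset_cong)
   fix r assume "r \<in># R a i"
   then obtain x where x: "r = of_int x / of_nat (\<rho> a)" using rig_hat[OF a] R(2)[OF a] by blast
   have "\<lfloor>of_nat (\<rho> a) * r\<rfloor> = x" using rho_pos[of a] by (simp add: x)
   then show "of_int \<lfloor>of_nat (\<rho> a) * r\<rfloor> / of_nat (\<rho> a) = r" by (simp add: x)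
  qed
  then show ?thesis by simp
 qed
 show "RJ (GJ p) = snd p"
 proof (intro ext)
  fix a i
  show "RJ (GJ p) a i = snd p a i"
  proof (cases "a\<in>{1..n}")
   case a: True
   show ?thesis
   proof (cases "\<exists>t. 1<=t & t<=T & i = ts t")
    case True
    then obtain t where t: "1<=t" "t<=T" "i = ts t" by blast
    have "RJ (GJ p) a i = image_mset (%x. of_int x / of_nat (\<rho> a)) (GJ p a t)" using a t(3) by (simp add: RJ_def)
    also have "... = R a i" unfolding G[OF nC[OF a] t(1,2)] fc_id[OF a] multiset.map_comp comp_def t(3)[symmetric] by (rule hat[OF a])
    finally show ?thesis by (simp add: nR)
   next
    case False
    then have "i \<notin># nu a" using part[OF a] by blast
    then have "R a i = {#}" using R(1)[OF a, of i] by (simp add: not_in_iff)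
    moreover have "GJ p a (tix i) = {#}"
    proof (cases "\<exists>t. i = ts t")
     case True
     then obtain t where t: "i = ts t" by blast
     then have "~ (1<=t & t<=T)" using False by auto
     then show ?thesis using t by (auto simp: GJ_def)
    next
     case False
     then show ?thesis using tix_other[OF False] by (simp add: GJ_def)
    qed
    ultimately show ?thesis by (simp add: RJ_def nR)
   qed
  next
   case False
   then show ?thesis using Rout[OF False] unfolding RJ_def nR by (simp only: if_False snd_conv)
  qed
 qed
 have sup: "supported (GJ p)" by (auto simp: supported_def GJ_def)
 have sym: "\<forall>b\<in>C. GJ p b = GJ p (fc b)"
 proof
  fix b assume b: "b\<in>C"
  have "fc b\<in>C" "fc (fc b) = fc b" using fc_C[OF b] nC fc_id by auto
  then show "GJ p b = GJ p (fc b)" using b by (simp add: GJ_def fun_eq_iff)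
 qed
 have elem: "1<=t & t<=T & (ev a --> even t) & of_int x / of_nat (\<rho> a) \<in># R a (ts t)"
  if a: "a\<in>{1..n}" and x: "x \<in># GJ p a t" for a t x
 proof -
  have t: "1<=t" "t<=T" using x by (auto simp: GJ_def split: if_splits)
  obtain r where r: "r \<in># R a (ts t)" "x = \<lfloor>of_nat (\<rho> a) * r\<rfloor>"
   using x unfolding G[OF nC[OF a] t] fc_id[OF a] by auto
  obtain y where y: "r = of_int y / of_nat (\<rho> a)" using rig_hat[OF a] R(2)[OF a r(1)] by blast
  have "x = y" using r(2) y rho_pos[of a] by simp
  moreover have "ts t \<in># nu a"
   using R(1)[OF a, of "ts t"] r(1) by (metis count_greater_zero_iff nonempty_has_size empty_iff set_mset_empty)
  then have "ts t\<in>part_sizes ty n a" using cfg a by (auto simp: is_config_def)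
  then have "ev a --> even t" using part_iff[OF a] by blast
  ultimately show ?thesis using t r(1) y by blast
 qed
 have vac: "of_int (vac Z (GJ p) a t) = of_nat (\<rho> (fc a)) * vacancy ty n nu (fc a) (ts t)"
  if "a\<in>C" "t>=1" "ev (fc a) --> even t" for a t
  using vac_nuJ[OF that(1) sym that(2,3)] unfolding nu by (simp add: nR)
 have vpos: "0<=vac Z (GJ p) a t" if a: "a\<in>C" and e: "ev (fc a) --> even t" for a t
 proof (cases "t = 0")
  case True
  then show ?thesis by (simp add: vac_def)
 next
  case False
  then have "ts t\<in>part_sizes ty n (fc a)" using part_iff[OF fc_C[OF a]] e by auto
  then have "0<=vacancy ty n nu (fc a) (ts t)" using vac0[OF fc_C[OF a]] by blast
  then have "(0::rat)<=of_int (vac Z (GJ p) a t)" using vac[OF a _ e] False by simp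
  then show ?thesis by simp
 qed
 \<comment> \<open>Lengths that are no admissible sizes of this colour are not covered by
   \<open>admissible_configs\<close>. The colour has no part there, so its vacancy number is concave
   and bounded below by the mean of its two even neighbours.\<close>
 have vpos': "0<=vac Z (GJ p) a t" if a: "a\<in>C" for a t
 proof (cases "ev (fc a) --> even t")
  case False
  then have t: "odd t" "t>=1" by (auto intro: Suc_leI odd_pos)
  have "GJ p (fc a) t = {#}" using elem[OF fc_C[OF a], of _ t] False by (metis multiset_nonemptyE)
  then have m0: "m_of (GJ p) a t = 0" using sym a by (simp add: m_of_def)
  have "(\<Sum>b\<in>C. A a b * m_of (GJ p) b t)<=0"
  proof (rule sum_nonpos)
   fix b assume b: "b\<in>C"
   show "A a b * m_of (GJ p) b t<=0"
    using m0 A_off[OF a b] by (cases "a = b") (auto simp: m_of_def mult_le_0_iff)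
  qed
  then have "vac Z (GJ p) a (t + 1) + vac Z (GJ p) a (t - 1) - 2 * vac Z (GJ p) a t<=0"
   unfolding vac_second_difference[OF sup t(2)] using Z_nonneg[of a] by auto
  moreover have "0<=vac Z (GJ p) a (t + 1)" "0<=vac Z (GJ p) a (t - 1)" using vpos[OF a] t by auto
  ultimately show ?thesis by linarith
 qed (use vpos[OF a] in blast)
 have "GJ p\<in>RC Z N"
 proof -
  have "of_int (Qn T (m_of (GJ p) a) T) = N a" if a: "a\<in>C" for a
  proof -
   have "m_of (GJ p) a = m_of (GJ p) (fc a)" using sym a by (simp add: m_of_def fun_eq_iff)
   then have "of_int (Qn T (m_of (GJ p) a) T) = of_nat s * sum_mset (nu (fc a))"
    using sum_nuJ[OF fc_C[OF a], of "GJ p"] unfolding nu by (simp add: nR)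
   also have "... = N a" using cfg fc_C[OF a] N_eq[OF a] by (simp add: is_config_def)
   finally show ?thesis .
  qed
  moreover have "0<=x & x<=vac Z (GJ p) a t" if a: "a\<in>C" and x: "x \<in># GJ p a t" for a t x
  proof -
   have "x \<in># GJ p (fc a) t" using x sym a by metis
   note e = elem[OF fc_C[OF a] this]
   have "0<=of_int x / (of_nat (\<rho> (fc a)) :: rat)" "of_int x / of_nat (\<rho> (fc a))<=vacancy ty n nu (fc a) (ts t)"
    using R(2)[OF fc_C[OF a]] e by blast+
   then have "(0::rat)<=of_int x" "(of_int x :: rat)<=of_nat (\<rho> (fc a)) * vacancy ty n nu (fc a) (ts t)"
    using rho_pos[of "fc a"] by (auto simp: zero_le_divide_iff pos_divide_le_eq mult.commute)
   then have "(0::rat)<=of_int x" "(of_int x :: rat)<=of_int (vac Z (GJ p) a t)" using vac[OF a] e by auto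
   then show ?thesis by simp
  qed
  ultimately show ?thesis using sup vpos' by (simp add: RC_def)
 qed
 moreover have "cl a t x" if a: "a\<in>{1..n}" and x: "x \<in># GJ p a t" for a t x
  using elem[OF a x] R(2)[OF a, of _ "ts t"] cl_iff[OF a, of t x] by blast
 moreover have "GJ p a t = {#}" if "a\<in>{1..n}" "ev a" "odd t" for a t
  using elem[OF that(1), of _ t] that by (metis multiset_nonemptyE)
 ultimately show "GJ p\<in>KF" using sym unfolding KF_def by blast
qed

lemma cocharge_nuJ:
 "of_int c * cocharge ty n (nuJ J) = of_int c * (1 / (2 * of_nat s) * (\<Sum>a=1..n. \<Sum>b=1..n.
  BF ty n a b * of_int (\<Sum>t=1..T. m_of J a t * Qn T (m_of J b) t)))"
proof -
 have "(\<Sum>x\<in>set_mset (nuJ J a). \<Sum>y\<in>set_mset (nuJ J b).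
   wt_form ty n (simple_root ty n a) (simple_root ty n b)
   * min (tt ty n b * (x / upsilon ty n a)) (tt ty n a * (y / upsilon ty n b))
   * of_nat (count (nuJ J a) x) * of_nat (count (nuJ J b) y))
  = 1 / of_nat s * (BF ty n a b * of_int (\<Sum>t=1..T. m_of J a t * Qn T (m_of J b) t))"
  if a: "a\<in>{1..n}" and b: "b\<in>{1..n}" for a b
 proof -
  let ?k = "tt ty n b / upsilon ty n a"
  have k: "tt ty n a / upsilon ty n b = ?k" "?k > 0" using tt_upsilon[of a n b ty] a b by auto
  have m: "min (tt ty n b * (x / upsilon ty n a)) (tt ty n a * (y / upsilon ty n b)) = ?k * min x y" for x y
  proof -
   have "tt ty n b * (x / upsilon ty n a) = ?k * x" "tt ty n a * (y / upsilon ty n b) = ?k * y" using k(1) by (simp, metis (no_types, lifting) mult.commute times_divide_eq_left)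
   moreover have "min (?k * x) (?k * y) = ?k * min x y" using k(2) min_mult_distrib_left[of ?k x y] by (simp only: less_imp_le if_True)
   ultimately show ?thesis by (simp only:)
  qed
  have ms: "min (ts t) (of_nat t' / of_nat s) = (of_nat (min t' t) / of_nat s :: rat)" for t t'
   using s_pos by (auto simp: min_def divide_le_cancel)
  let ?F = "wt_form ty n (simple_root ty n a) (simple_root ty n b)"
  have in1: "(\<Sum>y\<in>set_mset (nuJ J b). ?F * (?k * min x y) * of_nat (count (nuJ J a) x) * of_nat (count (nuJ J b) y))
    = (\<Sum>t' = 1..T. ?F * (?k * min x (of_nat t' / of_nat s)) * of_nat (count (nuJ J a) x) * of_int (m_of J b t'))" for x
  proof -
   have "(\<Sum>y\<in>set_mset (nuJ J b). ?F * (?k * min x y) * of_nat (count (nuJ J a) x) * of_nat (count (nuJ J b) y))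
    = (\<Sum>t' = 1..T. ?F * (?k * min x (of_nat t' / of_nat s)) * of_nat (count (nuJ J a) x) * of_nat (if t'\<in>{1..T} then count (nuJ J b) (of_nat t' / of_nat s) else 0))"
    unfolding set_nuJ[OF b]
    by (subst sum.reindex) (auto simp: inj_on_def div_s_inject count_nuJ(1)[OF b] intro!: sum.mono_neutral_cong_left)
   also have "... = (\<Sum>t' = 1..T. ?F * (?k * min x (of_nat t' / of_nat s)) * of_nat (count (nuJ J a) x) * of_int (m_of J b t'))"
    by (intro sum.cong) (auto simp: count_nuJ(1)[OF b] m_of_def)
   finally show ?thesis .
  qed
  have "(\<Sum>x\<in>set_mset (nuJ J a). (\<Sum>t' = 1..T. ?F * (?k * min x (of_nat t' / of_nat s)) * of_nat (count (nuJ J a) x) * of_int (m_of J b t')))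
   = (\<Sum>t=1..T. \<Sum>t' = 1..T. ?F * (?k * min (ts t) (of_nat t' / of_nat s)) * of_int (m_of J a t) * of_int (m_of J b t'))"
   unfolding set_nuJ[OF a]
   by (subst sum.reindex) (auto simp: inj_on_def div_s_inject count_nuJ(1)[OF a] m_of_def intro!: sum.mono_neutral_cong_left)
  also have "... = 1 / of_nat s * (BF ty n a b * of_int (\<Sum>t=1..T. m_of J a t * Qn T (m_of J b) t))"
   unfolding ms Qn_def BF_def by (simp add: sum_distrib_left mult.assoc mult.left_commute mult.commute)
  finally show ?thesis unfolding m in1 .
 qed
 then have "cocharge ty n (nuJ J) = 1/2 * (\<Sum>a=1..n. \<Sum>b=1..n. 1 / of_nat s * (BF ty n a b * of_int (\<Sum>t=1..T. m_of J a t * Qn T (m_of J b) t)))"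
  unfolding cocharge_def by (intro arg_cong[where f = "%x. 1/2 * x"] sum.cong refl)
 then show ?thesis by (simp add: sum_distrib_left mult.assoc)
qed

lemma rig_sum_nuJ:
 assumes a: "a\<in>{1..n}"
 shows "(\<Sum>i\<in>set_mset (nuJ J a). tt_vee ty n a * sum_mset (RJ J a i))
  = tt_vee ty n a / of_nat (\<rho> a) * of_int (\<Sum>t=1..T. sum_mset (J a t))"
proof -
 have m: "sum_mset (image_mset (%x. of_int x / of_nat (\<rho> a)) M) = (of_int (sum_mset M) / of_nat (\<rho> a) :: rat)" for M
  by (induction M) (auto simp: add_divide_distrib)
 have "(\<Sum>i\<in>set_mset (nuJ J a). tt_vee ty n a * sum_mset (RJ J a i))
   = (\<Sum>t=1..T. tt_vee ty n a * sum_mset (RJ J a (ts t)))"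
  by (rule sum_set_nuJ[OF a]) (use a in \<open>simp add: RJ_def\<close>)
 also have "... = (\<Sum>t=1..T. tt_vee ty n a / of_nat (\<rho> a) * of_int (sum_mset (J a t)))"
  using a by (intro sum.cong) (simp_all add: RJ_def m)
 also have "... = tt_vee ty n a / of_nat (\<rho> a) * of_int (\<Sum>t=1..T. sum_mset (J a t))"
  by (simp add: sum_distrib_left)
 finally show ?thesis .
qed

lemma rig_stat_nuJ:
 assumes J: "J\<in>KF"
 shows "rig_stat ty n (nuJ J, RJ J) = of_int (st J) / of_int c"
proof -
 let ?f = "%a b. of_int (\<Sum>t=1..T. m_of J a t * Qn T (m_of J b) t) :: rat"
 let ?g = "%a. of_int (\<Sum>t=1..T. sum_mset (J a t)) :: rat"
 have sym: "J a = J (fc a)" if "a\<in>C" for a using KF_D(2)[OF J] that by blast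
 have f: "?f (fc a) (fc b) = ?f a b" if "a\<in>C" "b\<in>C" for a b
  unfolding m_of_def sym[OF that(1), symmetric] sym[OF that(2), symmetric] ..
 have g: "?g (fc a) = ?g a" if "a\<in>C" for a
  unfolding sym[OF that, symmetric] ..
 have "2 * of_nat s * (\<Sum>a\<in>C. \<Sum>b\<in>C. of_int (d a * A a b) * ?f a b) = 2 * of_nat s * (of_int c * cocharge ty n (nuJ J))"
  using form_eq[of ?f] f unfolding cocharge_nuJ by simp
 then have "(\<Sum>a\<in>C. \<Sum>b\<in>C. of_int (d a * A a b) * ?f a b) = of_int c * cocharge ty n (nuJ J)"
  by simp
 moreover have "2 * (\<Sum>a\<in>C. of_int (d a) * ?g a) = of_int c * (\<Sum>a=1..n. \<Sum>i\<in>set_mset (nuJ J a). tt_vee ty n a * sum_mset (RJ J a i))"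
  using d_eq[of ?g] g rig_sum_nuJ by simp
 moreover have "of_int (st J) = (\<Sum>a\<in>C. \<Sum>b\<in>C. of_int (d a * A a b) * ?f a b) + 2 * (\<Sum>a\<in>C. of_int (d a) * ?g a)"
  by (simp add: st_def)
 ultimately have "of_int (st J) = of_int c * rig_stat ty n (nuJ J, RJ J)"
  by (simp add: rig_stat_def distrib_left)
 then show ?thesis using c_pos by simp
qed

theorem rig_cfgs_bij: "bij_betw (%J. (nuJ J, RJ J)) KF (rig_cfgs ty n lam L)"
proof (rule bij_betw_byWitness[where f' = GJ])
 show "\<forall>J\<in>KF. GJ (nuJ J, RJ J) = J" using GJ_inverse_left by blast
 show "\<forall>p\<in>rig_cfgs ty n lam L. (nuJ (GJ p), RJ (GJ p)) = p" using rig_cfgs_KF by simp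
 show "(%J. (nuJ J, RJ J)) ` KF \<subseteq> rig_cfgs ty n lam L" using KF_rig_cfgs by blast
 show "GJ ` rig_cfgs ty n lam L \<subseteq> KF" using rig_cfgs_KF(3) by blast
qed

theorem rig_cfgs_sum:
 "(\<Sum>p\<in>rig_cfgs ty n lam L. qpow (rig_stat ty n p)) = (\<Sum>J\<in>KF. qpow (of_int (st J) / of_int c))"
 unfolding sum.reindex_bij_betw[OF rig_cfgs_bij, symmetric] by (intro sum.cong refl) (simp add: rig_stat_nuJ)

end

section \<open>Comparison with the fermionic formula, type by type\<close>

lemma finite_paths: "finite (paths ty n lam L)"
proof -
 have "finite (letters ty n)" by (simp add: letters_def)
 then have "finite {b. set b \<subseteq> letters ty n & length b = L}" by (rule finite_lists_length_eq)
 moreover have "paths ty n lam L \<subseteq> {b. set b \<subseteq> letters ty n & length b = L}"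
  by (auto simp: paths_def elts_tensor_power B11_def)
 ultimately show ?thesis by (rule finite_subset[rotated])
qed

lemma vacancy_dagger_Ints:
 assumes "(nu, R)\<in>rig_cfgs A2_dagger n lam L" "a\<in>{1..n}" "i\<in>part_sizes A2_dagger n a"
 shows "vacancy A2_dagger n nu a i\<in>\<int>"
proof -
 have cfg: "is_config A2_dagger n lam L nu" using assms(1) by (simp add: rig_cfgs_def admissible_configs_def)
 have i: "i\<in>\<int>" using assms(3) by (auto simp: part_sizes_def upsilon_def)
 have parts: "x\<in>\<int>" if "x \<in># nu b" for x b
 proof -
  consider "b = 0" | "b > n" | "b\<in>{1..n}" by force
  then show ?thesis
  proof cases
   case 3
   then have "x\<in>part_sizes A2_dagger n b" using cfg that by (auto simp: is_config_def)
   then show ?thesis by (auto simp: part_sizes_def upsilon_def)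
  qed (use cfg that in \<open>auto simp: is_config_def split: if_splits\<close>)
 qed
 have "Qsum i M\<in>\<int>" if "\<forall>x\<in>#M. x\<in>\<int>" for M
  using that by (induction M) (auto simp: Qsum_def min_def i)
 then have Q: "Qsum i (nu b)\<in>\<int>" for b using parts by blast
 show ?thesis by (simp add: vacancy_vacQ vacQ_def Q)
qed

definition ip :: "nat => (nat => rat) => (nat => rat) => rat" where
 "ip N u v = (\<Sum>i=1..N. u i * v i)"

lemma ip_eps: "ip N (eps a) (eps b) = of_bool (a = b & 1<=a & a<=N)"
proof -
 have "(\<Sum>i=1..N. eps a i * eps b i) = (\<Sum>i=1..N. if i = a then of_bool (a = b) else (0::rat))"
  by (intro sum.cong) (auto simp: eps_def)
 then show ?thesis by (auto simp: ip_def)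
qed

lemma ip_linear:
 "ip N (%i. u i - v i) w = ip N u w - ip N v w" "ip N w (%i. u i - v i) = ip N w u - ip N w v"
 "ip N (%i. u i + v i) w = ip N u w + ip N v w" "ip N w (%i. u i + v i) = ip N w u + ip N w v"
 "ip N (%i. 2 * u i) w = 2 * ip N u w" "ip N w (%i. 2 * u i) = 2 * ip N w u"
 by (simp_all add: ip_def algebra_simps sum.distrib sum_subtractf sum_distrib_left)

lemma wt_form_ip: "wt_form ty n u v = (if ty = C1 then 1/2 else if ty\<in>{A2_even, D2} then 2 else 1) * ip (wt_dim ty n) u v"
 by (simp add: wt_form_def ip_def)

lemmas BF_simps = BF_def wt_form_ip simple_root_def wt_dim_def tt_def upsilon_def ip_linear ip_eps

lemma Mbar_rigged:
 assumes "nonexceptional ty n" "finite (rig_cfgs ty n lam L)"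
 shows "Mbar ty n lam L = (\<Sum>p\<in>rig_cfgs ty n lam L. qpow (rig_stat ty n p))"
 using assms Mbar_generic_rigged Mbar_dagger_rigged[OF _ vacancy_dagger_Ints] rank_pos[OF assms(1)]
 by (auto simp: Mbar_def)

lemma (in path_system) finite_K: "Bd L lam ==> finite (K L lam)"
 using path_bij(1) finite_paths bij_betw_finite by blast

lemma (in fermi) Mbar_KF:
 assumes "nonexceptional ty n" "finite KF"
 shows "Mbar ty n lam L = (\<Sum>J\<in>KF. qpow (of_int (st J) / of_int c))"
proof -
 have "finite (rig_cfgs ty n lam L)" using bij_betw_finite[OF rig_cfgs_bij] assms(2) by blast
 then show ?thesis using Mbar_rigged[OF assms(1)] rig_cfgs_sum by simp
qed

context single_walker
begin

lemma X_eq_M: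
 assumes B: "BW L lam" and Nc: "!!L lam a. N L lam a = config_size ty n lam L a"
  and vac: "!!L a Q. a\<in>C ==> Q 0 = of_nat L ==> of_int (Z1a L a) - (\<Sum>b\<in>C. of_int (A a b) * Q b) = vacQ ty n Q a"
  and form: "!!a b. a\<in>C ==> b\<in>C ==> of_int (d a * A a b) = BF ty n a b"
  and d: "!!a. a\<in>C ==> of_int (d a) = tt_vee ty n a" and C1: "ty ~= C1"
 shows "Xbar ty n lam L = Mbar ty n lam L"
proof (cases "ty = A1 --> partial_wt lam (n + 1) = int L")
 case True
 have C': "C = {1..n}" using C_eq by simp
 have up: "upsilon ty n a = 1" for a using ty C1 by (auto simp: upsilon_def)
 interpret F: fermi C A d a0 S T ty n lam L "Z1a L" "N L lam" 1 "%_. 1" "%a. a" "%_. False" "%_ _ _. True" 2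
 proof unfold_locales
  show "n>=1" using rank_pos[OF ne] .
  show "0<=Z1a L a" for a by (rule Z1a_nonneg)
  show "of_nat t / of_nat 1\<in>part_sizes ty n a \<longleftrightarrow> 1<=t & (False --> even t)" for a t
   by (auto simp: part_sizes_def up)
  show "\<exists>t. i = of_nat t / of_nat 1" if "i\<in>part_sizes ty n a" for a i
   using that by (auto simp: part_sizes_def up)
  show "rig_int ty n a (of_nat t / of_nat 1) (of_int x / of_nat 1) \<longleftrightarrow> True" for a t x
   using ty by (auto simp: rig_int_def)
  show "\<exists>x::int. r = of_int x / of_nat 1" if "rig_int ty n a i r" for a i r
   using that ty by (auto simp: rig_int_def elim!: Ints_cases)
  show "of_int (Z1a L a) - (\<Sum>b\<in>C. of_int (A a b) * (of_nat 1 * Q b)) = of_nat 1 * vacQ ty n Q a"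
   if "a\<in>C" "Q 0 = of_nat L | (1::nat) = 2 & a = n" for a Q
   using vac[OF that(1), of Q L] that(2) by simp
  show "N L lam a < of_nat T" if "a\<in>C" for a using B that by (simp add: BW_def)
  show "2 * of_nat 1 * (\<Sum>a\<in>C. \<Sum>b\<in>C. of_int (d a * A a b) * f a b) = of_int 2 * (\<Sum>a=1..n. \<Sum>b=1..n. BF ty n a b * f a b)" for f
   using form unfolding C' by simp
  show "2 * (\<Sum>a\<in>C. of_int (d a) * g a) = of_int 2 * (\<Sum>a=1..n. tt_vee ty n a / of_nat 1 * g a)" for g
   using d unfolding C' by simp
 qed (use C' True Nc in auto)
 have "KW L lam = F.KF" using True by (auto simp: KW_def F.KF_def)
 then show ?thesis using Xbar_eq[OF B] F.Mbar_KF[OF ne] finite_K[OF B] by simp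
next
 \<comment> \<open>In type \<open>A1\<close> with the wrong total weight there is neither a path nor
   a configuration, and both sides are empty sums.\<close>
 case False
 then have "KW L lam = {}" "admissible_configs ty n lam L = {}"
  unfolding KW_def admissible_configs_def is_config_def by blast+
 moreover have "ty ~= A2_dagger" using False by auto
 ultimately show ?thesis using Xbar_eq[OF B] by (simp add: Mbar_def Mbar_generic_def)
qed

end

theorem (in type_A) X_eq_M_A1: "BW L lam ==> Xbar A1 n lam L = Mbar A1 n lam L"
proof (rule X_eq_M)
 show "of_int (Z1a L a) - (\<Sum>b\<in>{Suc 0..n}. of_int (cartan a b) * Q b) = vacQ A1 n Q a"
  if a: "a\<in>{Suc 0..n}" and Q: "Q 0 = of_nat L" for L a Q
 proof -
  have "of_int (Z1a L a) + of_bool (Suc 0 < a) * Q (a - 1) = Q (a - 1)"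
   unfolding Z1a_def unfolding lcol_def using a Q by (cases "a = Suc 0") auto
  then show ?thesis unfolding sum_cartan[OF a] using a by (cases "a = n") (auto simp: vacQ_def)
 qed
 show "of_int (1 * cartan a b) = BF A1 n a b" if "a\<in>{Suc 0..n}" "b\<in>{Suc 0..n}" for a b
  using that by (auto simp: BF_simps cartan_def)
 show "of_int 1 = tt_vee A1 n a" for a by (simp add: tt_vee_def)
qed simp_all

theorem (in type_C) X_eq_M_A2_odd: "BW L lam ==> Xbar A2_odd n lam L = Mbar A2_odd n lam L"
proof (rule X_eq_M)
 show "of_int (Z1a L a) - (\<Sum>b\<in>{Suc 0..n}. of_int (cartanC n a b) * Q b) = vacQ A2_odd n Q a"
  if a: "a\<in>{Suc 0..n}" and Q: "Q 0 = of_nat L" for L a Q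
 proof -
  have "of_int (Z1a L a) + of_bool (Suc 0 < a) * Q (a - 1) = Q (a - 1)"
   unfolding Z1a_def unfolding ccol_1 using a Q by (cases "a = Suc 0") auto
  moreover have "Q (a - 1) = Q (n - 2)" if "a = n - 1" using that by (simp add: numeral_2_eq_2)
  ultimately show ?thesis unfolding sum_cartanC[OF a] using a n_ge_2 by (auto simp: vacQ_def)
 qed
 show "of_int (dC n a * cartanC n a b) = BF A2_odd n a b" if "a\<in>{Suc 0..n}" "b\<in>{Suc 0..n}" for a b
  using that n_ge_2 by (cases "a = n"; cases "b = n") (auto simp: BF_simps dC_def cartanC_def cartan_def)
 show "of_int (dC n a) = tt_vee A2_odd n a" for a by (simp add: tt_vee_def dC_def)
qed simp_all

theorem (in type_D) X_eq_M_D1: "BW L lam ==> Xbar D1 n lam L = Mbar D1 n lam L"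
proof (rule X_eq_M)
 obtain m where n: "n = Suc (Suc (Suc (Suc m)))" using n_ge_4 that[of "n - 4"] by simp
 show "of_int (Z1a L a) - (\<Sum>b\<in>{Suc 0..n}. of_int (cartanD n a b) * Q b) = vacQ D1 n Q a"
  if a: "a\<in>{Suc 0..n}" and Q: "Q 0 = of_nat L" for L a Q
 proof -
  have "of_int (Z1a L a) + of_bool (Suc 0 < a) * Q (a - 1) = Q (a - 1)"
   unfolding Z1a_def using a Q by (cases "a = Suc 0") auto
  moreover have "of_int (Z1a L a) = (0::rat)" if "Suc 0 < a" using that by (simp add: Z1a_def)
  moreover consider "a = n" | "Suc a = n" | "a + 2 = n" | "a + 2 < n" using a by force
  ultimately show ?thesis unfolding sum_cartanD[OF a n_ge_4]
   by cases (auto simp: vacQ_def n)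
 qed
 show "of_int (1 * cartanD n a b) = BF D1 n a b" if "a\<in>{Suc 0..n}" "b\<in>{Suc 0..n}" for a b
  using that n_ge_4
  by (cases "a = n"; cases "b = n")
   (auto simp: BF_simps cartanD_def)
 show "of_int 1 = tt_vee D1 n a" for a by (simp add: tt_vee_def)
qed simp_all

theorem (in type_B) X_eq_M_B1:
 assumes B: "BB L lam"
 shows "Xbar B1 n lam L = Mbar B1 n lam L"
proof -
 have ne: "nonexceptional B1 n" using n_ge_3 by (simp add: nonexceptional_def)
 \<comment> \<open>All lengths are doubled, which makes the half-integral parts of colour
   \<open>n\<close> integral and those of the other colours even. The constant is 4 since doubling
   the lengths doubles the cocharge and \<open>st\<close> has a factor 2 of its own.\<close>
 interpret F: fermi "{Suc 0..n}" "cartanC n" "dC n" "ccol n 0" S T B1 n lam L "Zc (2 * L)" "NB L lam" 2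
  "%a. if a < n then 2 else 1" "%a. a" "%a. a < n" "%a t x. a < n --> even x" 4
 proof unfold_locales
  show "0<=Zc (2 * L) a" for a by (simp add: Zc_def)
  show "of_nat t / of_nat 2\<in>part_sizes B1 n a \<longleftrightarrow> 1<=t & (a < n --> even t)" if a: "a\<in>{1..n}" for a t
  proof (cases "a < n")
   case True
   have "of_nat t / of_nat 2 = (of_nat k :: rat) \<longleftrightarrow> t = 2 * k" for k
    by (simp add: field_simps) (metis of_nat_eq_iff of_nat_mult of_nat_numeral)
   then show ?thesis using True by (auto simp: part_sizes_def upsilon_def elim!: evenE)
  next
   case False
   then show ?thesis using a by (auto simp: part_sizes_def upsilon_def)
  qed
  show "\<exists>t. i = of_nat t / of_nat 2" if i: "i\<in>part_sizes B1 n a" for a i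
  proof -
   obtain k where "i = upsilon B1 n a * of_nat k" using i by (auto simp: part_sizes_def)
   then show ?thesis by (cases "a = n") (auto simp: upsilon_def intro: exI[of _ k] exI[of _ "2 * k"])
  qed
  show "rig_int B1 n a (of_nat t / of_nat 2) (of_int x / of_nat (if a < n then 2 else 1)) \<longleftrightarrow> (a < n --> even x)" for a t x
  proof -
   have "(of_int x / 2 :: rat)\<in>\<int> \<longleftrightarrow> even x"
    by (auto simp: Ints_def field_simps elim!: evenE) (metis dvd_triv_right of_int_eq_iff of_int_mult of_int_numeral)
   then show ?thesis by (auto simp: rig_int_def)
  qed
  show "\<exists>x::int. r = of_int x / of_nat (if a < n then 2 else 1)" if r: "rig_int B1 n a i r" for a i r
  proof -
   obtain k where "r = of_int k" using r by (auto simp: rig_int_def elim!: Ints_cases)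
   then show ?thesis by (intro exI[of _ "if a < n then 2 * k else k"]) auto
  qed
  show "of_int (Zc (2 * L) a) - (\<Sum>b\<in>{Suc 0..n}. of_int (cartanC n a b) * (of_nat 2 * Q b))
    = of_nat (if a < n then 2 else 1) * vacQ B1 n Q a"
   if a: "a\<in>{Suc 0..n}" and Q: "Q 0 = of_nat L | (2::nat) = 2 & a = n" for a Q
  proof -
   have "of_int (Zc (2 * L) a) + of_bool (Suc 0 < a) * (of_nat 2 * Q (a - 1)) = 2 * Q (a - 1)"
    unfolding Zc_def using a Q n_ge_3 by (cases "a = Suc 0") auto
   moreover have "Q (a - 1) = Q (n - 2)" if "a = n - 1" using that by (simp add: numeral_2_eq_2)
   ultimately show ?thesis unfolding sum_cartanC[OF a] using a n_ge_3 by (auto simp: vacQ_def)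
  qed
  show "NB L lam a < of_nat T" if "a\<in>{Suc 0..n}" for a using B that by (simp add: BB_def)
  show "2 * of_nat 2 * (\<Sum>a\<in>{Suc 0..n}. \<Sum>b\<in>{Suc 0..n}. of_int (dC n a * cartanC n a b) * f a b)
    = of_int 4 * (\<Sum>a=1..n. \<Sum>b=1..n. BF B1 n a b * f a b)" for f
  proof -
   have "of_int (dC n a * cartanC n a b) = BF B1 n a b" if "a\<in>{1..n}" "b\<in>{1..n}" for a b
    using that n_ge_3 by (cases "a = n"; cases "b = n") (auto simp: BF_simps dC_def cartanC_def cartan_def)
   then show ?thesis by simp
  qed
  show "2 * (\<Sum>a\<in>{Suc 0..n}. of_int (dC n a) * g a) = of_int 4 * (\<Sum>a=1..n. tt_vee B1 n a / of_nat (if a < n then 2 else 1) * g a)" for g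
   unfolding sum_distrib_left by (intro sum.cong) (auto simp: tt_vee_def dC_def)
  show "NB L lam a = of_nat 2 * config_size B1 n lam L a" for a by (simp add: NB_def config_size_def)
 qed (use n_ge_3 in auto)
 have "{1..n} = insert n {Suc 0..<n}" using n_ge_3 by auto
 then have "evn J \<longleftrightarrow> (\<forall>a\<in>{1..n}. \<forall>t. (a < n & odd t --> J a t = {#}) & (\<forall>x\<in>#J a t. a < n --> even x))" for J
  by (simp add: evn_def)
 then have "KB L lam = F.KF" by (simp add: KB_def F.KF_def ES_def)
 then show ?thesis using B.Xbar_eq[OF B] F.Mbar_KF[OF ne] B.finite_K[OF B] by simp
qed

text \<open>Except in \<open>D2\<close> the riggings of the middle colour are doubled, so integral
  ones become even. The half-integral riggings at odd sizes in \<open>A2_dagger\<close> become odd,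
  and in \<open>C1\<close> the parts of this colour are even as well.\<close>

fun cls_of :: "aff_type => nat => int => bool" where
 "cls_of A2_even t x = even x"
| "cls_of A2_dagger t x = even (x - int t)"
| "cls_of C1 t x = (even x & even t)"
| "cls_of ty t x = True"

lemma half_Ints: "(of_int x / 2 :: rat)\<in>\<int> \<longleftrightarrow> even x" "(of_int x / 2 - 1 / 2 :: rat)\<in>\<int> \<longleftrightarrow> odd x"
proof -
 show e: "(of_int x / 2 :: rat)\<in>\<int> \<longleftrightarrow> even x" for x
  by (auto simp: Ints_def field_simps elim!: evenE) (metis dvd_triv_right of_int_eq_iff of_int_mult of_int_numeral)
 show "(of_int x / 2 - 1 / 2 :: rat)\<in>\<int> \<longleftrightarrow> odd x"
  using e[of "x - 1"] by (simp add: diff_divide_distrib)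
qed

lemma (in sym_pair) sum_fold:
 fixes g :: "nat => rat"
 shows "(\<Sum>a\<in>{Suc 0..2 * n - Suc 0}. g a) = (\<Sum>a=1..n. g a + of_bool (a < n) * g (2 * n - a))"
proof -
 have "{Suc 0..2 * n - Suc 0} = {1..n} \<union> (%a. 2 * n - a) ` {1..<n}"
 proof (intro equalityI subsetI)
  fix a assume "a\<in>{Suc 0..2 * n - Suc 0}"
  then show "a\<in>{1..n} \<union> (%a. 2 * n - a) ` {1..<n}"
   by (cases "a<=n") (auto intro!: image_eqI[of _ _ "2 * n - a"])
 qed auto
 moreover have "{1..n} \<inter> (%a. 2 * n - a) ` {1..<n} = {}" by auto
 ultimately have "(\<Sum>a\<in>{Suc 0..2 * n - Suc 0}. g a) = (\<Sum>a=1..n. g a) + (\<Sum>a\<in>(%a. 2 * n - a) ` {1..<n}. g a)"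
  by (simp add: sum.union_disjoint)
 also have "(\<Sum>a\<in>(%a. 2 * n - a) ` {1..<n}. g a) = (\<Sum>a\<in>{1..<n}. g (2 * n - a))"
  by (subst sum.reindex) (auto simp: inj_on_def)
 also have "... = (\<Sum>a=1..n. of_bool (a < n) * g (2 * n - a))"
  by (intro sum.mono_neutral_cong_left) auto
 finally show ?thesis by (simp add: sum.distrib)
qed

theorem (in type_C_family) X_eq_M_C:
 assumes B: "BC L lam" and cls: "cls = cls_of ty"
 shows "Xbar ty n lam L = Mbar ty n lam L"
proof -
 \<comment> \<open>In the middle colour the unfolded diagram gives
   \<open>2 * Q (n - 1) - 2 * Q n\<close>. This is the vacancy number of \<open>D2\<close> and twice
   that of the other three types.\<close>
 define \<rho> :: "nat => nat" where "\<rho> a = (if a = n & ty ~= D2 then 2 else 1)" for a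
 define fc :: "nat => nat" where "fc a = min a (2 * n - a)" for a
 define c :: int where "c = 4 div kC"
 have c: "c = (if ty\<in>{D2, A2_even} then 2 else 4)" by (simp add: c_def kC_def)
 interpret F: fermi "{Suc 0..2 * n - Suc 0}" cartan "%_. 1" "lcol 0" L.S T ty n lam L "Zof L" "NC L lam" 1
  \<rho> fc "%a. a = n & ty = C1" "%a t x. a = n --> cls t x" c
 proof unfold_locales
  show "n>=1" by (rule n_pos)
  show "0 < c" using c by simp
  show "1<=\<rho> a" for a by (simp add: \<rho>_def)
  show "0<=Zof L a" for a by (simp add: Zof_def)
  show fcC: "fc a\<in>{1..n}" if "a\<in>{Suc 0..2 * n - Suc 0}" for a using that by (auto simp: fc_def)
  show "fc a = a" if "a\<in>{1..n}" for a using that by (auto simp: fc_def)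
  show "{1..n} \<subseteq> {Suc 0..2 * n - Suc 0}" using n_pos by auto
  show "of_nat t / of_nat 1\<in>part_sizes ty n a \<longleftrightarrow> 1<=t & (a = n & ty = C1 --> even t)" for a t
  proof (cases "a = n & ty = C1")
   case True
   have "(of_nat t :: rat) = 2 * of_nat k \<longleftrightarrow> t = 2 * k" for k
    by (metis of_nat_eq_iff of_nat_mult of_nat_numeral)
   then show ?thesis using True by (auto simp: part_sizes_def upsilon_def elim!: evenE)
  next
   case False
   then show ?thesis using ty_C by (auto simp: part_sizes_def upsilon_def)
  qed
  show "\<exists>t. i = of_nat t / of_nat 1" if i: "i\<in>part_sizes ty n a" for a i
  proof -
   obtain k where "i = upsilon ty n a * of_nat k" using i by (auto simp: part_sizes_def)
   then show ?thesis using ty_C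
    by (cases "a = n & ty = C1") (auto simp: upsilon_def intro: exI[of _ k] exI[of _ "2 * k"])
  qed
  have odd: "odd_rat (of_nat t) \<longleftrightarrow> odd t" for t
   by (auto simp: odd_rat_def) (metis even_of_nat of_int_eq_iff of_int_of_nat_eq, metis even_of_nat of_int_of_nat_eq)
  show "rig_int ty n a (of_nat t / of_nat 1) (of_int x / of_nat (\<rho> a)) \<longleftrightarrow> (a = n --> cls t x)"
   if "a = n & ty = C1 --> even t" for a t x
   using ty_C that half_Ints[of x] by (auto simp: rig_int_def \<rho>_def cls odd)
  show "\<exists>x::int. r = of_int x / of_nat (\<rho> a)" if r: "rig_int ty n a i r" for a i r
  proof (cases "ty = A2_dagger & a = n & odd_rat i")
   case True
   then obtain k where k: "r - 1 / 2 = of_int k" using r by (auto simp: rig_int_def elim!: Ints_cases)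
   have "r = (r - 1 / 2) + 1 / 2" by simp
   then show ?thesis unfolding k using True by (intro exI[of _ "2 * k + 1"]) (simp add: \<rho>_def field_simps)
  next
   case False
   then obtain k where "r = of_int k" using r by (auto simp: rig_int_def elim!: Ints_cases)
   then show ?thesis by (intro exI[of _ "if a = n & ty ~= D2 then 2 * k else k"]) (auto simp: \<rho>_def)
  qed
  show "of_int (Zof L a) - (\<Sum>b\<in>{Suc 0..2 * n - Suc 0}. of_int (cartan a b) * (of_nat 1 * Q (fc b)))
    = of_nat (\<rho> (fc a)) * vacQ ty n Q (fc a)"
   if a: "a\<in>{Suc 0..2 * n - Suc 0}" and Q: "Q 0 = of_nat L | (1::nat) = 2 & fc a = n" for a Q
  proof -
   have 1: "of_int (int L * of_bool (a = Suc 0)) + of_bool (Suc 0 < a) * Q (fc (a - 1)) = Q (fc (a - 1))"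
    using a Q by (cases "a = Suc 0") (simp_all add: fc_def)
   have 2: "of_int (int L * of_bool (a = 2 * n - Suc 0)) + of_bool (a < 2 * n - Suc 0) * Q (fc (Suc a)) = Q (fc (Suc a))"
   proof (cases "a = 2 * n - Suc 0")
    case True
    then have "fc (Suc a) = 0" using a by (simp add: fc_def)
    then show ?thesis using True Q by simp
   next
    case False
    then show ?thesis using a by simp
   qed
   have "of_int (Zof L a) - (\<Sum>b\<in>{Suc 0..2 * n - Suc 0}. of_int (cartan a b) * (of_nat 1 * Q (fc b)))
     = Q (fc (a - 1)) + Q (fc (Suc a)) - 2 * Q (fc a)"
    using 1 2 sum_cartan[OF a, of "%b. Q (fc b)"] unfolding Zof_def distrib_left of_int_add by simp
   also have "... = of_nat (\<rho> (fc a)) * vacQ ty n Q (fc a)"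
   proof -
    consider "a < n" | "a = n" | "n < a" by linarith
    then show ?thesis
    proof cases
     case 1
     then have "fc (a - 1) = a - 1" "fc a = a" "fc (Suc a) = Suc a" by (auto simp: fc_def)
     then show ?thesis using 1 ty_C by (auto simp: \<rho>_def vacQ_def)
    next
     case 2
     then have "fc (a - 1) = n - 1" "fc a = n" "fc (Suc a) = n - 1" by (auto simp: fc_def)
     then show ?thesis using ty_C by (auto simp: \<rho>_def vacQ_def)
    next
     case 3
     then have "fc (a - 1) = Suc (fc a)" "fc (Suc a) = fc a - 1" "fc a < n" using a by (auto simp: fc_def)
     then show ?thesis using ty_C by (auto simp: \<rho>_def vacQ_def)
    qed
   qed
   finally show ?thesis .
  qed
  show "NC L lam a = of_nat 1 * config_size ty n lam L (fc a)" if "a\<in>{Suc 0..2 * n - Suc 0}" for a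
   using ty_C by (auto simp: NC_def config_size_def fc_def)
  show "NC L lam a < of_nat T" if "a\<in>{Suc 0..2 * n - Suc 0}" for a using B that by (simp add: BC_def)
  show "2 * of_nat 1 * (\<Sum>a\<in>{Suc 0..2 * n - Suc 0}. \<Sum>b\<in>{Suc 0..2 * n - Suc 0}. of_int (1 * cartan a b) * f (fc a) (fc b))
    = of_int c * (\<Sum>a=1..n. \<Sum>b=1..n. BF ty n a b * f a b)" for f
  proof -
   \<comment> \<open>The sum of the entries of the unfolded Cartan matrix over the colours that fold
     to \<open>a\<close> and to \<open>b\<close>.\<close>
   let ?w = "%a b. of_int (cartan a b) + of_bool (b < n) * of_int (cartan a (2 * n - b))
    + of_bool (a < n) * (of_int (cartan (2 * n - a) b) + of_bool (b < n) * of_int (cartan (2 * n - a) (2 * n - b))) :: rat"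
   have f1: "fc b = b" "fc (2 * n - b) = b" if "b\<in>{1..n}" for b using that by (auto simp: fc_def)
   define h where "h a = (\<Sum>b=1..n. (of_int (cartan a b) + of_bool (b < n) * of_int (cartan a (2 * n - b))) * f (fc a) b)" for a
   have "(\<Sum>b\<in>{Suc 0..2 * n - Suc 0}. of_int (1 * cartan a b) * f (fc a) (fc b)) = h a" for a
    unfolding sum_fold h_def using f1 by (intro sum.cong) (auto simp: algebra_simps)
   then have "(\<Sum>a\<in>{Suc 0..2 * n - Suc 0}. \<Sum>b\<in>{Suc 0..2 * n - Suc 0}. of_int (1 * cartan a b) * f (fc a) (fc b))
     = (\<Sum>a=1..n. h a + of_bool (a < n) * h (2 * n - a))"
    unfolding sum_fold[symmetric] by simp
   also have "... = (\<Sum>a=1..n. \<Sum>b=1..n. ?w a b * f a b)"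
   proof (rule sum.cong[OF refl])
    fix a assume a: "a\<in>{1..n}"
    show "h a + of_bool (a < n) * h (2 * n - a) = (\<Sum>b=1..n. ?w a b * f a b)"
     unfolding h_def f1[OF a] sum_distrib_left sum.distrib[symmetric]
     by (intro sum.cong refl) (simp only: algebra_simps)
   qed
   finally have "(\<Sum>a\<in>{Suc 0..2 * n - Suc 0}. \<Sum>b\<in>{Suc 0..2 * n - Suc 0}. of_int (1 * cartan a b) * f (fc a) (fc b))
     = (\<Sum>a=1..n. \<Sum>b=1..n. ?w a b * f a b)" .
   moreover have "2 * ?w a b = of_int c * BF ty n a b" if "a\<in>{1..n}" "b\<in>{1..n}" for a b
   proof -
    consider "a < n" "b < n" | "a = n" "b < n" | "a < n" "b = n" | "a = n" "b = n" using \<open>a\<in>{1..n}\<close> \<open>b\<in>{1..n}\<close> by force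
    then show ?thesis
    proof cases
     case 1
     have "Suc n<=2 * n - b" "Suc n<=2 * n - a" using 1 by linarith+
     then have "cartan a (2 * n - b) = 0" "cartan (2 * n - a) b = 0" using 1 by (auto simp: cartan_def)
     moreover have "2 * n - a = 2 * n - b \<longleftrightarrow> a = b" "2 * n - a = Suc (2 * n - b) \<longleftrightarrow> b = Suc a"
      "2 * n - b = Suc (2 * n - a) \<longleftrightarrow> a = Suc b" using 1 by linarith+
     then have "cartan (2 * n - a) (2 * n - b) = cartan a b" by (simp add: cartan_def disj_commute)
     moreover have "BF ty n a b = (2 / of_int c) * (2 * of_int (cartan a b))"
      using 1 that ty_C by (auto simp: BF_simps c cartan_def)
     ultimately show ?thesis using 1 c by simp
    next
     case 2
     have "cartan n (2 * n - b) = cartan n b" using 2 by (auto simp: cartan_def)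
     then show ?thesis using 2 that ty_C by (auto simp: BF_simps c cartan_def)
    next
     case 3
     have "cartan (2 * n - a) n = cartan a n" using 3 by (auto simp: cartan_def)
     then show ?thesis using 3 that ty_C by (auto simp: BF_simps c cartan_def)
    next
     case 4
     then show ?thesis using that ty_C by (auto simp: BF_simps c cartan_def)
    qed
   qed
   ultimately show ?thesis by (simp add: sum_distrib_left mult.assoc[symmetric])
  qed
  show "2 * (\<Sum>a\<in>{Suc 0..2 * n - Suc 0}. of_int 1 * g (fc a)) = of_int c * (\<Sum>a=1..n. tt_vee ty n a / of_nat (\<rho> a) * g a)" for g
   unfolding sum_fold sum_distrib_left
   by (intro sum.cong) (use ty_C in \<open>auto simp: tt_vee_def \<rho>_def c fc_def\<close>)
 qed (use ty_C in auto)
 have "sym J \<longleftrightarrow> (\<forall>a\<in>{Suc 0..2 * n - Suc 0}. J a = J (fc a))" for J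
 proof
  assume s: "sym J"
  show "\<forall>a\<in>{Suc 0..2 * n - Suc 0}. J a = J (fc a)"
  proof
   fix a assume "a\<in>{Suc 0..2 * n - Suc 0}"
   then have "J (2 * n - a) t = J a t" for t using s by (simp add: sym_def)
   then show "J a = J (fc a)" by (auto simp: fc_def min_def fun_eq_iff)
  qed
 next
  assume *: "\<forall>a\<in>{Suc 0..2 * n - Suc 0}. J a = J (fc a)"
  show "sym J" unfolding sym_def
  proof (intro ballI allI)
   fix a t assume a: "a\<in>{Suc 0..2 * n - Suc 0}"
   then have "2 * n - a\<in>{Suc 0..2 * n - Suc 0}" "fc (2 * n - a) = fc a" by (auto simp: fc_def)
   then show "J (2 * n - a) t = J a t" using * a by metis
  qed
 qed
 moreover have "in_cls J \<longleftrightarrow> (\<forall>a\<in>{1..n}. \<forall>t. (a = n & ty = C1 & odd t --> J a t = {#}) & (\<forall>x\<in>#J a t. a = n --> cls t x))" for J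
 proof -
  have "J n t = {#}" if "\<forall>x\<in>#J n t. cls t x" "ty = C1" "odd t" for t
  proof (rule ccontr)
   assume "J n t ~= {#}"
   then obtain x where "x \<in># J n t" by (metis multiset_nonemptyE)
   then have "cls_of C1 t x" using that(1,2) cls by auto
   then show False using that(3) by simp
  qed
  moreover have "{1..n} = insert n {1..<n}" using n_pos by auto
  ultimately show ?thesis by (auto simp: in_cls_def)
 qed
 ultimately have "KC L lam = F.KF" unfolding KC_def F.KF_def KS_def by auto
 moreover have "4 div kC ~= 0" by (simp add: kC_def)
 ultimately show ?thesis using Xbar_eq[OF B] F.Mbar_KF[OF ne] finite_K[OF B] by (simp add: c_def)
qed

lemma bound_exists: "\<exists>T\<ge>1. \<forall>a\<in>A. (g a :: rat) < of_nat T" if "finite A" for A :: "nat set"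
 using that
proof (induction A rule: finite_induct)
 case (insert a A)
 then obtain T where T: "T>=1" "\<forall>a\<in>A. g a < of_nat T" by blast
 obtain k where k: "g a < of_nat k" using reals_Archimedean2 by blast
 have "\<forall>b\<in>insert a A. g b < of_nat (max T k)"
  using T(2) k by (auto simp: less_max_iff_disj)
 then show ?case using T(1) by (intro exI[of _ "max T k"]) auto
qed auto

theorem mainTheorem2:
 fixes ty :: aff_type and n L :: nat and lam :: "nat \<Rightarrow> int"
 assumes "nonexceptional ty n"
  and "dominant ty n lam"
 shows "Xbar ty n lam L = Mbar ty n lam L"
proof -
 have lam: "lam\<in>weights ty n" using assms(2) by (simp add: dominant_def)
 obtain T where T: "T>=1" "\<forall>a\<in>{Suc 0..n}. config_size ty n lam L a < of_nat T"
  using bound_exists[of "{Suc 0..n}"] by blast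
 consider "ty = A1" | "ty = A2_odd" | "ty = D1" | "ty = B1" | "ty\<in>{D2, A2_even, A2_dagger, C1}" by (cases ty) auto
 then show ?thesis
 proof cases
  case 1
  interpret type_A n T using assms(1) 1 T(1) by unfold_locales (auto simp: nonexceptional_def)
  show ?thesis using X_eq_M_A1[of L lam] lam T 1 by (simp add: BW_def)
 next
  case 2
  interpret type_C n T using assms(1) 2 T(1) by unfold_locales (auto simp: nonexceptional_def)
  show ?thesis using X_eq_M_A2_odd[of L lam] lam T 2 by (simp add: BW_def)
 next
  case 3
  interpret type_D n T using assms(1) 3 T(1) by unfold_locales (auto simp: nonexceptional_def)
  show ?thesis using X_eq_M_D1[of L lam] lam T 3 by (simp add: BW_def)
 next
  case 4
  \<comment> \<open>The bound is doubled because \<open>NB\<close> is twice the configuration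
    size.\<close>
  interpret type_B n "2 * T" using assms(1) 4 T(1) by unfold_locales (auto simp: nonexceptional_def)
  have "NB L lam a = 2 * config_size B1 n lam L a" for a by (simp add: NB_def config_size_def)
  then show ?thesis using X_eq_M_B1[of L lam] lam T 4 by (simp add: BB_def)
 next
  case 5
  have z: "Zero\<in>letters ty n \<longleftrightarrow> ty\<in>{D2, A2_dagger}" "Phi\<in>letters ty n \<longleftrightarrow> ty\<in>{D2, A2_even}"
   using 5 by (auto simp: letters_simps)
  interpret type_C_family n T "cls_of ty" "Zero\<in>letters ty n" "Phi\<in>letters ty n" ty
   using assms(1) 5 T(1) rank_pos[OF assms(1)] by unfold_locales (auto simp: letters_simps)
  have "NC L lam a < of_nat T" if a: "a\<in>{Suc 0..2 * n - Suc 0}" for a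
  proof -
   have "min a (2 * n - a)\<in>{Suc 0..n}" using a by auto
   moreover have "NC L lam a = config_size ty n lam L (min a (2 * n - a))" using 5 by (auto simp: NC_def config_size_def)
   ultimately show ?thesis using T(2) by simp
  qed
  then show ?thesis using X_eq_M_C[of L lam] lam by (simp add: BC_def)
 qed
qed

end
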